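(* Let $\varepsilon>0$, $\alpha_o\ge 0$ and $\beta>0$ be constants, and let $(f_0,f_1)\in H^{4.5}(\mathbb{R})\times H^{3}(\mathbb{R})$. Consider the initial value problem on $\mathbb{R}$ for the unknown $f=f(x_1,t)$ $$f_{tt}=-\Lambda f-\beta\Lambda^3 f+\alpha_o\Lambda f_{tx_1}+\varepsilon\Big[-\mathcal{H}\big((\mathcal{H}f_t)^2\big)+[\![\mathcal{H},f]\!]\Lambda f\Big]_{x_1},$$ with initial data $f(x_1,0)=f_0(x_1)$ and $f_t(x_1,0)=f_1(x_1)$. Then there exist $T^*>0$ and a unique solution $f$ of this problem on $[0,T^*]$ with $$(f,f_t)\in L^\infty(0,T^*;H^{4.5}(\mathbb{R}))\times L^\infty(0,T^*;H^{3}(\mathbb{R})).$$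
   Context: Subscripts $t$ and $x_1$ denote partial derivatives in time and in the space variable $x_1\in\mathbb{R}$. The unknown is real-valued. The Fourier transform is $\hat f(k)=\frac{1}{\sqrt{2\pi}}\int_{\mathbb{R}}f(x_1)e^{-ikx_1}\,dx_1$. The Hilbert transform $\mathcal{H}$ and the operator $\Lambda$ (and its powers $\Lambda^s$) are the Fourier multipliers $\widehat{\mathcal{H}f}(k)=-i\,\mathrm{sgn}(k)\hat f(k)$, $\widehat{\Lambda f}(k)=|k|\hat f(k)$, $\widehat{\Lambda^s f}(k)=|k|^s\hat f(k)$. For an operator $\mathcal{T}$ and functions $f,g$, the commutator is $[\![\mathcal{T},f]\!]g=\mathcal{T}(fg)-f\,\mathcal{T}(g)$. The Sobolev spaces are $$H^s(\mathbb{R})=\Big\{h\in L^2(\mathbb{R}):\ \|h\|_{H^s}^2=\int_{\mathbb{R}}(1+|n|^{2s})|\hat h(n)|^2\,dn<\infty\Big\}.$$ The constants are the steepness parameter $\varepsilon$, the odd Reynolds number $\alpha_o$ and the Bond number $\beta$. *)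

theory Defs
  imports "HOL-Analysis.Analysis"
begin

text \<open>Elements of \<open>L\<^sup>2(\<real>)\<close> are represented by Borel functions; every notion below depends on such a
  function only up to equality almost everywhere.\<close>

definition square_integrable :: "(real \<Rightarrow> 'a::{real_normed_vector, second_countable_topology}) \<Rightarrow> bool"
  where "square_integrable f \<longleftrightarrow>
    f \<in> borel_measurable lborel \<and> integrable lborel (\<lambda>x. (norm (f x))\<^sup>2)"

definition L2_norm :: "(real \<Rightarrow> real) \<Rightarrow> real"
  where "L2_norm f = sqrt (LINT x|lborel. (f x)\<^sup>2)"

definition fourier_trunc :: "real \<Rightarrow> (real \<Rightarrow> real) \<Rightarrow> real \<Rightarrow> complex"
  where "fourier_trunc R f k =
    complex_of_real (1 / sqrt (2 * pi)) *
      (LINT x:{-R..R}|lborel. complex_of_real (f x) * exp (- \<i> * complex_of_real (k * x)))"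

text \<open>For \<open>f\<close> in \<open>L\<^sup>2\<close> the Fourier integral need not converge absolutely; as usual, the transform is
  the \<open>L\<^sup>2\<close>-limit of the truncated integrals. It agrees a.e. with the absolutely convergent
  integral if \<open>f\<close> is also in \<open>L\<^sup>1\<close>. The nonnegative integral makes sure that the limit is not
  met by a default value of the Bochner integral.\<close>

definition has_fourier :: "(real \<Rightarrow> real) \<Rightarrow> (real \<Rightarrow> complex) \<Rightarrow> bool"
  where "has_fourier f F \<longleftrightarrow> square_integrable F \<and>
    ((\<lambda>R. \<integral>\<^sup>+k. ennreal ((norm (F k - fourier_trunc R f k))\<^sup>2) \<partial>lborel) \<longlongrightarrow> 0) at_top"

definition fourier :: "(real \<Rightarrow> real) \<Rightarrow> real \<Rightarrow> complex"
  where "fourier f = (SOME F. has_fourier f F)"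

text \<open>A representative of the (a.e. unique) real function in \<open>L\<^sup>2\<close> with Fourier transform
  \<open>m k * fourier f k\<close>. It exists if \<open>m * fourier f\<close> is in \<open>L\<^sup>2\<close> and \<open>m (- k) = cnj (m k)\<close>,
  and is unspecified otherwise.\<close>

definition fourier_multiplier :: "(real \<Rightarrow> complex) \<Rightarrow> (real \<Rightarrow> real) \<Rightarrow> real \<Rightarrow> real"
  where "fourier_multiplier m f =
    (SOME g. square_integrable g \<and> (AE k in lborel. fourier g k = m k * fourier f k))"

definition hilbert :: "(real \<Rightarrow> real) \<Rightarrow> real \<Rightarrow> real"
  where "hilbert = fourier_multiplier (\<lambda>k. - \<i> * complex_of_real (sgn k))"

definition Lambda :: "(real \<Rightarrow> real) \<Rightarrow> real \<Rightarrow> real"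
  where "Lambda = fourier_multiplier (\<lambda>k. complex_of_real \<bar>k\<bar>)"

definition Lambda_pow :: "real \<Rightarrow> (real \<Rightarrow> real) \<Rightarrow> real \<Rightarrow> real"
  where "Lambda_pow s = fourier_multiplier (\<lambda>k. complex_of_real (\<bar>k\<bar> powr s))"

definition commutator ::
    "((real \<Rightarrow> real) \<Rightarrow> real \<Rightarrow> real) \<Rightarrow> (real \<Rightarrow> real) \<Rightarrow> (real \<Rightarrow> real) \<Rightarrow> real \<Rightarrow> real"
  where "commutator T f g = (\<lambda>x. T (\<lambda>y. f y * g y) x - f x * T g x)"

definition test_function_on :: "real set \<Rightarrow> (real \<Rightarrow> real) \<Rightarrow> bool"
  where "test_function_on S \<phi> \<longleftrightarrow>
    (\<forall>n x. ((deriv ^^ n) \<phi>) field_differentiable (at x)) \<and>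
    (\<exists>K. compact K \<and> K \<subseteq> S \<and> (\<forall>x. x \<notin> K \<longrightarrow> \<phi> x = 0))"

definition has_weak_deriv :: "(real \<Rightarrow> real) \<Rightarrow> (real \<Rightarrow> real) \<Rightarrow> bool"
  where "has_weak_deriv u v \<longleftrightarrow> square_integrable u \<and> square_integrable v \<and>
    (\<forall>\<phi>. test_function_on UNIV \<phi> \<longrightarrow>
      (LINT x|lborel. u x * deriv \<phi> x) = - (LINT x|lborel. v x * \<phi> x))"

definition dx :: "(real \<Rightarrow> real) \<Rightarrow> real \<Rightarrow> real"
  where "dx u = (SOME v. has_weak_deriv u v)"

definition Hs :: "real \<Rightarrow> (real \<Rightarrow> real) set"
  where "Hs s = {h. square_integrable h \<and>
    integrable lborel (\<lambda>n. (1 + \<bar>n\<bar> powr (2 * s)) * (norm (fourier h n))\<^sup>2)}"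

definition Hs_norm :: "real \<Rightarrow> (real \<Rightarrow> real) \<Rightarrow> real"
  where "Hs_norm s h = sqrt (LINT n|lborel. (1 + \<bar>n\<bar> powr (2 * s)) * (norm (fourier h n))\<^sup>2)"

text \<open>A function \<open>u\<close> of time and space is written \<open>u t x\<close>. For functions with values in the
  separable spaces \<open>L\<^sup>2\<close> and \<open>H\<^sup>s\<close>, strong measurability in time amounts to the existence of a
  jointly measurable representative.\<close>

definition jointly_measurable :: "real \<Rightarrow> (real \<Rightarrow> real \<Rightarrow> real) \<Rightarrow> bool"
  where "jointly_measurable T u \<longleftrightarrow>
    case_prod u \<in> borel_measurable (restrict_space borel {0..T} \<Otimes>\<^sub>M borel)"

definition Linf_Hs :: "real \<Rightarrow> real \<Rightarrow> (real \<Rightarrow> real \<Rightarrow> real) set"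
  where "Linf_Hs T s = {u. jointly_measurable T u \<and>
    (\<exists>C. AE t in lborel. t \<in> {0<..<T} \<longrightarrow> u t \<in> Hs s \<and> Hs_norm s (u t) \<le> C)}"

definition L1_L2 :: "real \<Rightarrow> (real \<Rightarrow> real \<Rightarrow> real) set"
  where "L1_L2 T = {u. jointly_measurable T u \<and>
    (AE t in lborel. t \<in> {0<..<T} \<longrightarrow> square_integrable (u t)) \<and>
    (\<integral>\<^sup>+t\<in>{0<..<T}. ennreal (L2_norm (u t)) \<partial>lborel) < \<infinity>}"

definition C_L2 :: "real \<Rightarrow> (real \<Rightarrow> real \<Rightarrow> real) set"
  where "C_L2 T = {u. (\<forall>t\<in>{0..T}. square_integrable (u t)) \<and>
    (\<forall>t\<in>{0..T}. ((\<lambda>s. L2_norm (\<lambda>x. u s x - u t x)) \<longlongrightarrow> 0) (at t within {0..T}))}"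

text \<open>The weak time derivative of an \<open>L\<^sup>2\<close>-valued function on \<open>(0,T)\<close>. Members of
  \<open>L\<^sup>1(0,T;L\<^sup>2)\<close> are integrable in \<open>t\<close> for almost every \<open>x\<close>, and the two integrals below
  represent the \<open>L\<^sup>2\<close>-valued Bochner integrals.\<close>

definition has_weak_time_deriv ::
    "real \<Rightarrow> (real \<Rightarrow> real \<Rightarrow> real) \<Rightarrow> (real \<Rightarrow> real \<Rightarrow> real) \<Rightarrow> bool"
  where "has_weak_time_deriv T u v \<longleftrightarrow> u \<in> L1_L2 T \<and> v \<in> L1_L2 T \<and>
    (\<forall>\<phi>. test_function_on {0<..<T} \<phi> \<longrightarrow>
      (AE x in lborel. (LINT t:{0<..<T}|lborel. deriv \<phi> t * u t x)
                     = - (LINT t:{0<..<T}|lborel. \<phi> t * v t x)))"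

definition wave_rhs ::
    "real \<Rightarrow> real \<Rightarrow> real \<Rightarrow> (real \<Rightarrow> real) \<Rightarrow> (real \<Rightarrow> real) \<Rightarrow> real \<Rightarrow> real"
  where "wave_rhs \<epsilon> \<alpha>\<^sub>o \<beta> u u\<^sub>t = (\<lambda>x.
    - Lambda u x - \<beta> * Lambda_pow 3 u x + \<alpha>\<^sub>o * Lambda (dx u\<^sub>t) x
    + \<epsilon> * dx (\<lambda>y. - hilbert (\<lambda>z. (hilbert u\<^sub>t z)\<^sup>2) y + commutator hilbert u (Lambda u) y) x)"

text \<open>\<open>f\<close> solves the problem on \<open>[0,T]\<close> with time derivative \<open>f\<^sub>t\<close>. The equation holds almost
  everywhere. Continuity into \<open>L\<^sup>2\<close> selects the representatives (in time) for which the initial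
  values make sense; a function with a weak time derivative in \<open>L\<^sup>1(0,T;L\<^sup>2)\<close> always has one.\<close>

definition ivp_solution ::
    "real \<Rightarrow> real \<Rightarrow> real \<Rightarrow> (real \<Rightarrow> real) \<Rightarrow> (real \<Rightarrow> real) \<Rightarrow> real
      \<Rightarrow> (real \<Rightarrow> real \<Rightarrow> real) \<Rightarrow> (real \<Rightarrow> real \<Rightarrow> real) \<Rightarrow> bool"
  where "ivp_solution \<epsilon> \<alpha>\<^sub>o \<beta> f\<^sub>0 f\<^sub>1 T f f\<^sub>t \<longleftrightarrow>
    f \<in> C_L2 T \<and> f\<^sub>t \<in> C_L2 T \<and>
    has_weak_time_deriv T f f\<^sub>t \<and>
    (\<exists>f\<^sub>t\<^sub>t. has_weak_time_deriv T f\<^sub>t f\<^sub>t\<^sub>t \<and>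
      (AE t in lborel. t \<in> {0<..<T} \<longrightarrow>
        (AE x in lborel. f\<^sub>t\<^sub>t t x = wave_rhs \<epsilon> \<alpha>\<^sub>o \<beta> (f t) (f\<^sub>t t) x))) \<and>
    (AE x in lborel. f 0 x = f\<^sub>0 x) \<and>
    (AE x in lborel. f\<^sub>t 0 x = f\<^sub>1 x)"

end

theory Submission
  imports Defs "HOL-Probability.Probability"
begin

text \<open>Taking the Fourier transform in space turns the problem into the system \<open>F' = V\<close>, \<open>V' = R(F,V)\<close> for the
  transforms \<open>F\<close> of \<open>f\<close> and \<open>V\<close> of \<open>f\<^sub>t\<close>. Here \<open>R\<close> consists of \<open>- lam F\<close> with \<open>lam k = |k| + \<beta> |k|^3\<close>, of the
  term \<open>i \<alpha> k |k| V\<close>, which does not contribute to the energy, and of a quadratic term.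
  The energy \<open>\<integral> (1 + k^6) (|V|^2 + lam |F|^2) + |F|^2\<close> controls exactly the norms of \<open>H^3\<close> and \<open>H^4.5\<close>. It has an a priori
  bound because the quadratic term loses no derivative: in the pairing with \<open>V\<close> the kernel of the part quadratic
  in \<open>V\<close> can be symmetrised over the three frequencies, and the kernel of the part quadratic in \<open>F\<close>,
  a commutator, vanishes unless \<open>k\<close> and \<open>l\<close> have opposite signs, so that \<open>|k|\<close> and \<open>|l|\<close> are at most \<open>|k - l|\<close>.
  The same cancellation, one level lower, bounds the difference of two solutions in the norm
  \<open>\<integral> (lam + 1) |F|^2 + |V|^2\<close>.

  An explicit Euler step of the system truncated to \<open>|k| \<le> N\<close> raises the energy by at most a constant times
  the step length, uniformly in \<open>N\<close>. Hence the Euler polygons are uniformly bounded on a common interval, and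
  by the difference estimate they form a Cauchy sequence. Conversely the transform of any solution
  satisfies the integrated system for almost all frequencies, and the difference estimate gives uniqueness.\<close>

text \<open>On the frequency side the linear part is a multiplication, and the system cut to
  \<open>|k| \<le> N\<close> has a locally Lipschitz right-hand side in L^2. Euler polygons
  therefore replace an existence theorem for ODEs, and they are jointly measurable by construction.
  The price is that the operators of the problem are choices of representatives; the relation
  \<open>rep\<close> transports them, and it asks for transforms that are integrable, square
  integrable and hermitian.

  The exponents fit together: \<open>lam\<close> times \<open>1 + k^6\<close> grows like |k|^9, the
  squared weight of H^4.5, and the factor |k| of the kernel raises 6 to 7, an odd power sum
  divisible by the product of three frequencies of sum zero. A difference of two solutions is
  treated lower because V' is controlled only in H^1, too little for the energy identity with weight
  \<open>1 + k^6\<close>, and because a difference of squares keeps only one of the symmetries; the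
  derivative then falls on the sum of the two solutions, which can afford it. A given solution obeys
  its bounds only at almost every time; lower semicontinuity of the energy extends them to all
  times.\<close>

abbreviation (input) nn_lborel :: "(real \<Rightarrow> ennreal) \<Rightarrow> ennreal" (binder "NN " 10)
 where "nn_lborel f \<equiv> integral\<^sup>N lborel f"

abbreviation (input) int_lborel :: "(real \<Rightarrow> 'a::{banach, second_countable_topology}) \<Rightarrow> 'a" (binder "LI " 10)
 where "int_lborel f \<equiv> integral\<^sup>L lborel f"

abbreviation (input) bm :: "('a::topological_space \<Rightarrow> 'b::topological_space) set" where "bm \<equiv> borel_measurable borel"

abbreviation (input) bm2 :: "(real \<times> real \<Rightarrow> 'b::topological_space) set" where "bm2 \<equiv> borel_measurable (borel \<Otimes>\<^sub>M borel)"

abbreviation (input) cr :: "real \<Rightarrow> complex" where "cr \<equiv> complex_of_real"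

abbreviation (input) AE_lborel :: "(real \<Rightarrow> bool) \<Rightarrow> bool" (binder "AEL " 10) where "AE_lborel P \<equiv> (AE x in lborel. P x)"

abbreviation (input) intL :: "(real \<Rightarrow> 'a::{banach, second_countable_topology}) \<Rightarrow> bool" where "intL \<equiv> integrable lborel"

type_synonym cfun = "real \<Rightarrow> complex"

lemmas LI_cong = Bochner_Integration.integral_cong and LI_add = Bochner_Integration.integral_add
 and LI_diff = Bochner_Integration.integral_diff and LI_nonneg = Bochner_Integration.integral_nonneg
 and LI_cnj = Bochner_Integration.integral_cnj and LI_int_add = Bochner_Integration.integrable_add
 and LI_int_diff = Bochner_Integration.integrable_diff and LI_int_bound = Bochner_Integration.integrable_bound

section \<open>Squared L^2 norms and limits in L^2 depending on a parameter\<close>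

definition nsq :: "(real \<Rightarrow> 'a::{real_normed_vector, second_countable_topology}) \<Rightarrow> ennreal"
 where "nsq f = (NN x. ennreal ((norm (f x))\<^sup>2))"

text \<open>With values in \<open>ennreal\<close> every estimate makes sense without integrability
  conditions; finiteness is drawn at the end, and this equivalence returns to the notion of the
  statement.\<close>

lemma square_integrable_iff_nsq:
 "square_integrable f \<longleftrightarrow> f \<in> bm \<and> nsq f < \<infinity>"
proof -
 have "intL (%x. (norm (f x))\<^sup>2) \<longleftrightarrow> nsq f < \<infinity>" if [measurable]: "f \<in> bm"
  by (simp add: integrable_iff_bounded nsq_def)
 then show ?thesis by (auto simp: square_integrable_def)
qed

lemma nsq_cong_AE: "(AEL x. norm (f x) = norm (g x)) ==> nsq f = nsq g"
 unfolding nsq_def by (rule nn_integral_cong_AE) auto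

lemma nsq_mono_AE: "(AEL x. norm (f x) \<le> norm (g x)) ==> nsq f \<le> nsq g"
 unfolding nsq_def by (rule nn_integral_mono_AE) (auto elim!: eventually_mono intro!: ennreal_leI power_mono)

lemma nsq_minus_commute:
 fixes f :: "real \<Rightarrow> 'a::{real_normed_vector, second_countable_topology}"
 shows "nsq (%x. f x - g x) = nsq (%x. g x - f x)"
 unfolding nsq_def by (simp add: norm_minus_commute)

lemma ennreal_lin2:
 "0 \<le> a ==> 0 \<le> b ==> 0 \<le> x ==> 0 \<le> y ==> ennreal a * ennreal x + ennreal b * ennreal y = ennreal (a * x + b * y)"
 by (simp add: ennreal_mult ennreal_plus)

lemma ennreal_2_times: "2 * ennreal x = ennreal (2 * x)"
 by (metis ennreal_mult' ennreal_numeral zero_le_numeral)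

lemma ennreal_2_sum: "0 \<le> x ==> 0 \<le> y ==> 2 * ennreal x + 2 * ennreal y = ennreal (2 * x + 2 * y)"
 using ennreal_lin2[of 2 2 x y] by simp

lemma ennreal_finite_ex: "(x::ennreal) \<noteq> \<infinity> ==> \<exists>K. x = ennreal K \<and> 0 \<le> K"
 by (cases x) auto

lemma ennreal_term_le_suminf: "f n \<le> (\<Sum>n. f n :: ennreal)"
 using sum_le_suminf[of f "{n}"] by simp

lemma power2_sum_le: "(x + y)\<^sup>2 \<le> 2 * x\<^sup>2 + 2 * (y::real)\<^sup>2"
 using sum_squares_bound[of x y] by (simp add: power2_sum)

lemma nsq_add_le:
 fixes f :: "real \<Rightarrow> 'a::{real_normed_vector, second_countable_topology}"
 assumes [measurable]: "f \<in> bm" "g \<in> bm"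
 shows "nsq (%x. f x + g x) \<le> 2 * nsq f + 2 * nsq g"
proof -
 have "nsq (%x. f x + g x) \<le> (NN x. 2 * ennreal ((norm (f x))\<^sup>2) + 2 * ennreal ((norm (g x))\<^sup>2))"
  unfolding nsq_def
 proof (rule nn_integral_mono)
  fix x
  have "(norm (f x + g x))\<^sup>2 \<le> (norm (f x) + norm (g x))\<^sup>2"
   by (intro power_mono norm_triangle_ineq) auto
  also have "\<dots> \<le> 2 * (norm (f x))\<^sup>2 + 2 * (norm (g x))\<^sup>2" by (rule power2_sum_le)
  finally have "ennreal ((norm (f x + g x))\<^sup>2) \<le> ennreal (2 * (norm (f x))\<^sup>2 + 2 * (norm (g x))\<^sup>2)"
   by (rule ennreal_leI)
  then show "ennreal ((norm (f x + g x))\<^sup>2) \<le> 2 * ennreal ((norm (f x))\<^sup>2) + 2 * ennreal ((norm (g x))\<^sup>2)"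
   by (simp add: ennreal_plus ennreal_mult'')
 qed
 also have "\<dots> = 2 * nsq f + 2 * nsq g"
  unfolding nsq_def by (simp add: nn_integral_add nn_integral_cmult)
 finally show ?thesis .
qed

lemma nsq_uminus: "nsq (%x. - f x) = nsq f"
 unfolding nsq_def by simp

lemma nsq_diff_le:
 fixes f :: "real \<Rightarrow> 'a::{real_normed_vector, second_countable_topology}"
 assumes [measurable]: "f \<in> bm" "g \<in> bm"
 shows "nsq (%x. f x - g x) \<le> 2 * nsq f + 2 * nsq g"
 using nsq_add_le[of f "%x. - g x"] nsq_uminus[of g] by simp

lemma nsq_triangle:
 fixes f :: "real \<Rightarrow> 'a::{real_normed_vector, second_countable_topology}"
 assumes [measurable]: "f \<in> bm" "g \<in> bm" "h \<in> bm"
 shows "nsq (%x. f x - h x) \<le> 2 * nsq (%x. f x - g x) + 2 * nsq (%x. g x - h x)"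
 using nsq_add_le[of "%x. f x - g x" "%x. g x - h x"] by simp

lemma nsq_cmult:
 fixes f :: "real \<Rightarrow> 'a::{real_normed_algebra_1, second_countable_topology}"
 assumes [measurable]: "f \<in> bm" and "!!x y::'a. norm (x * y) = norm x * norm y"
 shows "nsq (%x. c * f x) = ennreal ((norm c)\<^sup>2) * nsq f"
 unfolding nsq_def by (simp add: assms(2) power_mult_distrib ennreal_mult nn_integral_cmult)

lemma nsq_scale:
 fixes f :: cfun
 assumes [measurable]: "f \<in> bm"
 shows "nsq (%x. c * f x) = ennreal ((norm c)\<^sup>2) * nsq f"
 by (rule nsq_cmult) (auto simp: norm_mult)

lemma nsq_0_AE:
 assumes [measurable]: "f \<in> bm" and "nsq f = 0"
 shows "AEL x. f x = 0"
 using assms(2) unfolding nsq_def by (subst (asm) nn_integral_0_iff_AE) (auto simp: power2_le_iff_abs_le)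

lemma nsq_reflect:
 assumes [measurable]: "f \<in> bm"
 shows "nsq (%x. f (- x)) = nsq f"
 unfolding nsq_def using nn_integral_real_affine[of "%x. ennreal ((norm (f x))\<^sup>2)" "-1" 0] by simp

text \<open>Integrating 2|fg| \<le> s f^2 + g^2 / s and optimising over s > 0 works in
  \<open>ennreal\<close>, where the usual division by the norms would meet 0 and infinity.\<close>

lemma nn_cauchy_schwarz:
 fixes f g :: "'a \<Rightarrow> real"
 assumes [measurable]: "f \<in> borel_measurable M" "g \<in> borel_measurable M"
 shows "(\<integral>\<^sup>+x. ennreal \<bar>f x * g x\<bar> \<partial>M)\<^sup>2 \<le> (\<integral>\<^sup>+x. ennreal ((f x)\<^sup>2) \<partial>M) * (\<integral>\<^sup>+x. ennreal ((g x)\<^sup>2) \<partial>M)"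
  (is "?P\<^sup>2 \<le> ?A * ?B")
proof -
 have *: "2 * ?P \<le> ennreal s * ?A + ennreal (1/s) * ?B" if s: "s > 0" for s
 proof -
  have "2 * ?P = (\<integral>\<^sup>+x. 2 * ennreal \<bar>f x * g x\<bar> \<partial>M)" by (simp add: nn_integral_cmult)
  also have "\<dots> \<le> (\<integral>\<^sup>+x. ennreal s * ennreal ((f x)\<^sup>2) + ennreal (1/s) * ennreal ((g x)\<^sup>2) \<partial>M)"
  proof (rule nn_integral_mono)
   fix x
   have "0 \<le> (s * \<bar>f x\<bar> - \<bar>g x\<bar>)\<^sup>2 / s" using s by simp
   also have "\<dots> = s * (f x)\<^sup>2 + 1/s * (g x)\<^sup>2 - 2 * \<bar>f x * g x\<bar>"
    using s by (simp add: power2_diff field_simps abs_mult power2_eq_square)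
   finally have "2 * \<bar>f x * g x\<bar> \<le> s * (f x)\<^sup>2 + 1/s * (g x)\<^sup>2" by simp
   then have "ennreal (2 * \<bar>f x * g x\<bar>) \<le> ennreal (s * (f x)\<^sup>2 + 1/s * (g x)\<^sup>2)" by (rule ennreal_leI)
   then show "2 * ennreal \<bar>f x * g x\<bar> \<le> ennreal s * ennreal ((f x)\<^sup>2) + ennreal (1/s) * ennreal ((g x)\<^sup>2)"
    using s by (subst ennreal_lin2) (auto simp: ennreal_2_times)
  qed
  also have "\<dots> = ennreal s * ?A + ennreal (1/s) * ?B" by (simp add: nn_integral_add nn_integral_cmult)
  finally show ?thesis .
 qed
 \<comment> \<open>A product of the form 0 times infinity on the right is 0, so the left side must
   be shown to vanish even if the other factor is infinite.\<close>
 have z: "?P = 0" if "?A = 0 \<or> ?B = 0"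
 proof -
  have "AE x in M. f x * g x = 0"
  proof (cases "?A = 0")
   case True
   then have "AE x in M. ennreal ((f x)\<^sup>2) = 0" by (subst (asm) nn_integral_0_iff_AE) auto
   then show ?thesis by (auto elim!: eventually_mono)
  next
   case False
   then have "?B = 0" using that by simp
   then have "AE x in M. ennreal ((g x)\<^sup>2) = 0" by (subst (asm) nn_integral_0_iff_AE) auto
   then show ?thesis by (auto elim!: eventually_mono)
  qed
  then have "?P = (\<integral>\<^sup>+x. 0 \<partial>M)" by (intro nn_integral_cong_AE) (auto elim!: eventually_mono)
  then show ?thesis by simp
 qed
 show ?thesis
 proof (cases "?A = 0 \<or> ?B = 0")
  case True
  then show ?thesis using z by simp
 next
  case ne: False
  show ?thesis
  proof (cases "?A = \<infinity> \<or> ?B = \<infinity>")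
   case True
   then have "?A * ?B = \<infinity>" using ne by (auto simp: ennreal_mult_eq_top_iff)
   then show ?thesis by simp
  next
   case False
   then obtain a b where ab: "?A = ennreal a" "?B = ennreal b" "a > 0" "b > 0"
    using ne by (cases ?A; cases ?B) (auto simp: less_le)
   \<comment> \<open>This s makes the two terms s a and b / s equal.\<close>
   define s where "s = sqrt (b/a)"
   have s: "s > 0" unfolding s_def using ab by simp
   have "s * a = sqrt (a * b)" "b / s = sqrt (a * b)"
    unfolding s_def using ab by (auto simp: real_sqrt_mult real_sqrt_divide field_simps)
   then have "2 * ?P \<le> ennreal (2 * sqrt (a*b))"
    using *[OF s] ab s ennreal_lin2[of s "1/s" a b] by simp
   then have "?P \<le> ennreal (sqrt (a * b))"
    using ab by (cases ?P) (auto simp: ennreal_2_times ennreal_mult_eq_top_iff top_unique)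
   then have "?P\<^sup>2 \<le> (ennreal (sqrt (a*b)))\<^sup>2" by (rule power_mono) simp
   also have "\<dots> = ?A * ?B" using ab by (simp add: ennreal_power ennreal_mult[symmetric])
   finally show ?thesis .
  qed
 qed
qed

lemma nsq_pair:
 fixes f g :: cfun
 assumes [measurable]: "f \<in> bm" "g \<in> bm"
 shows "(NN x. ennreal (norm (f x * g x)))\<^sup>2 \<le> nsq f * nsq g"
 using nn_cauchy_schwarz[of "%x. norm (f x)" lborel "%x. norm (g x)"] by (simp add: nsq_def norm_mult abs_mult)

lemma integrable_L2_mult:
 fixes f g :: cfun
 assumes [measurable]: "f \<in> bm" "g \<in> bm" and "nsq f < \<infinity>" "nsq g < \<infinity>"
 shows "intL (%x. f x * g x)"
proof (rule integrableI_bounded)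
 have "(NN x. ennreal (norm (f x * g x)))\<^sup>2 \<le> nsq f * nsq g" by (rule nsq_pair) fact+
 also have "\<dots> < \<infinity>" using assms(3,4) by (simp add: ennreal_mult_less_top)
 finally show "(NN x. ennreal (norm (f x * g x))) < \<infinity>" by (rule_tac ccontr) (auto simp: not_less top_unique power2_eq_square)
qed simp

text \<open>Continuity of the L^2 pairing in its first argument. The filter is arbitrary because the
  truncation radius of a transform runs through the reals.\<close>

lemma nsq_pair_tendsto:
 fixes f :: "'i \<Rightarrow> real \<Rightarrow> complex"
 assumes fm[measurable]: "!!i. f i \<in> bm" "g \<in> bm" "h \<in> bm"
  and g: "nsq g < \<infinity>" and h: "nsq h < \<infinity>" and lim: "((%i. nsq (%x. g x - f i x)) \<longlongrightarrow> 0) A"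
 shows "((%i. LI x. f i x * h x) \<longlongrightarrow> (LI x. g x * h x)) A"
proof -
 have ev: "\<forall>\<^sub>F i in A. nsq (%x. g x - f i x) < 1"
  using lim by (rule order_tendstoD) simp
 have "((%i. nsq h * nsq (%x. g x - f i x)) \<longlongrightarrow> nsq h * 0) A"
  using lim h by (intro ennreal_tendsto_cmult) (auto simp: less_top)
 then have *: "((%i. sqrt (enn2real (nsq (%x. g x - f i x) * nsq h))) \<longlongrightarrow> sqrt (enn2real 0)) A"
  by (intro tendsto_intros tendsto_enn2real) (auto simp: mult.commute)
 have "((%i. (LI x. f i x * h x) - (LI x. g x * h x)) \<longlongrightarrow> 0) A"
 proof (rule Lim_null_comparison[where g="%i. sqrt (enn2real (nsq (%x. g x - f i x) * nsq h))"])
  show "\<forall>\<^sub>F i in A. norm ((LI x. f i x * h x) - (LI x. g x * h x)) \<le> sqrt (enn2real (nsq (%x. g x - f i x) * nsq h))"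
   using ev
  proof eventually_elim
   case (elim i)
   have d: "nsq (%x. f i x - g x) < \<infinity>" using elim nsq_minus_commute[of "f i" g] by (auto intro: less_trans)
   have "nsq (f i) \<le> 2 * nsq (%x. f i x - g x) + 2 * nsq g"
    using nsq_add_le[of "%x. f i x - g x" g] by simp
   also have "\<dots> < \<infinity>" using d g by (simp add: ennreal_mult_less_top)
   finally have fi: "nsq (f i) < \<infinity>" .
   have eq: "(LI x. f i x * h x) - (LI x. g x * h x) = (LI x. (f i x - g x) * h x)"
    using integrable_L2_mult[of "f i" h] integrable_L2_mult[of g h] fi g h by (simp add: left_diff_distrib)
   have int: "intL (%x. (f i x - g x) * h x)" using d h by (intro integrable_L2_mult) auto
   let ?n = "norm (LI x. (f i x - g x) * h x)"
   have "ennreal ?n \<le> (NN x. ennreal (norm ((f i x - g x) * h x)))"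
    by (rule integral_norm_bound_ennreal[OF int])
   then have "(ennreal ?n)\<^sup>2 \<le> (NN x. ennreal (norm ((f i x - g x) * h x)))\<^sup>2" by (rule power_mono) simp
   also have "\<dots> \<le> nsq (%x. f i x - g x) * nsq h" by (rule nsq_pair) auto
   finally have "ennreal (?n\<^sup>2) \<le> nsq (%x. g x - f i x) * nsq h"
    by (simp add: ennreal_power nsq_minus_commute)
   moreover have "nsq (%x. g x - f i x) * nsq h < \<infinity>" using d h by (simp add: ennreal_mult_less_top nsq_minus_commute)
   ultimately have "?n\<^sup>2 \<le> enn2real (nsq (%x. g x - f i x) * nsq h)"
    by (cases "nsq (%x. g x - f i x) * nsq h") (auto simp: ennreal_le_iff2)
   then show ?case unfolding eq by (rule real_le_rsqrt)
  qed
  show "((%i. sqrt (enn2real (nsq (%x. g x - f i x) * nsq h))) \<longlongrightarrow> 0) A" using * by simp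
 qed
 then show ?thesis by (rule iffD2[OF Lim_null])
qed

text \<open>Riesz-Fischer with a parameter. Choosing an L^2 limit separately for every t would
  destroy measurability in t; a geometric rate gives a pointwise limit instead, which is measurable
  in (t, k) together and inherits the hermitian symmetry.\<close>

lemma L2_limit_joint:
 fixes u :: "nat \<Rightarrow> real \<Rightarrow> real \<Rightarrow> complex"
 assumes m[measurable]: "!!n. case_prod (u n) \<in> bm2"
  and C: "C \<ge> 0"
  and step: "!!n t. t \<in> S ==> nsq (%k. u (Suc n) t k - u n t k) \<le> ennreal (C * (1/4)^n)"
 obtains U where "case_prod U \<in> bm2"
  "!!n t. t \<in> S ==> nsq (%k. u n t k - U t k) \<le> ennreal (4 * C * (1/4)^n)"
  "!!t. t \<in> S ==> AEL k. (%n. u n t k) \<longlonglongrightarrow> U t k"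
  "(!!n t k. u n t (-k) = cnj (u n t k)) ==> (!!t k. U t (-k) = cnj (U t k))"
proof -
 \<comment> \<open>The value 0 where the sequence is not Cauchy keeps U measurable; the set of such
   k is symmetric for hermitian sequences, so the symmetry of U holds everywhere.\<close>
 define U where "U t k = (if Cauchy (%n. u n t k) then lim (%n. u n t k) else 0)" for t k
 have m1[measurable]: "(%k. u n t k) \<in> bm" for n t
  using measurable_compose[OF measurable_Pair1' m[of n], of t] by simp
 have mU[measurable]: "case_prod U \<in> bm2"
 proof -
  have "(%p. if Cauchy (%n. (case_prod (u n)) p) then lim (%n. case_prod (u n) p) else 0) \<in> bm2"
   by (intro measurable_If borel_measurable_lim_metric sets_Collect_Cauchy m borel_measurable_const)
  moreover have "(%p. if Cauchy (%n. (case_prod (u n)) p) then lim (%n. case_prod (u n) p) else 0) = case_prod U"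
   by (auto simp: U_def fun_eq_iff)
  ultimately show ?thesis by simp
 qed
 have mU1[measurable]: "U t \<in> bm" for t
  using measurable_compose[OF measurable_Pair1' mU, of t] by simp
 have conv: "AEL k. (%n. u n t k) \<longlonglongrightarrow> U t k" if t: "t \<in> S" for t
 proof -
  \<comment> \<open>The weights 2^n still leave a convergent series since the squared norms decay
    like 4^-n. Finiteness almost everywhere then forces increments of order 2^(-n/2), which are
    summable.\<close>
  have "(NN k. (\<Sum>n. ennreal (2^n * (norm (u (Suc n) t k - u n t k))\<^sup>2)))
    = (\<Sum>n. ennreal (2^n) * nsq (%k. u (Suc n) t k - u n t k))"
   unfolding nsq_def by (subst nn_integral_suminf) (auto simp: ennreal_mult nn_integral_cmult)
  also have "\<dots> \<le> (\<Sum>n. ennreal (2^n) * ennreal (C * (1/4)^n))"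
   by (intro suminf_le mult_left_mono step t) auto
  also have "\<dots> = (\<Sum>n. ennreal (C * (1/2)^n))"
  proof -
   have "ennreal (2^n) * ennreal (C * (1/4)^n) = ennreal (C * (1/2)^n)" for n
   proof -
    have "(2::real)^n * (C * (1/4)^n) = C * (2 * (1/4))^n" by (subst power_mult_distrib) simp
    then show ?thesis using C by (subst ennreal_mult[symmetric]) auto
   qed
   then show ?thesis by simp
  qed
  also have "\<dots> < \<infinity>"
   using C by (subst suminf_ennreal2) (auto intro!: summable_mult summable_geometric)
  finally have fin: "(NN k. (\<Sum>n. ennreal (2^n * (norm (u (Suc n) t k - u n t k))\<^sup>2))) < \<infinity>" .
  have "AEL k. (\<Sum>n. ennreal (2^n * (norm (u (Suc n) t k - u n t k))\<^sup>2)) \<noteq> \<infinity>"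
  proof (rule nn_integral_PInf_AE)
   show "(%k. \<Sum>n. ennreal (2^n * (norm (u (Suc n) t k - u n t k))\<^sup>2)) \<in> borel_measurable lborel"
    by measurable
   show "(NN k. (\<Sum>n. ennreal (2^n * (norm (u (Suc n) t k - u n t k))\<^sup>2))) \<noteq> \<infinity>"
    using fin by (metis less_irrefl)
  qed
  then show ?thesis
  proof eventually_elim
   case (elim k)
   let ?a = "%n. norm (u (Suc n) t k - u n t k)"
   obtain K where K: "(\<Sum>n. ennreal (2^n * (?a n)\<^sup>2)) = ennreal K" "K \<ge> 0"
    using ennreal_finite_ex[OF elim] by (elim exE conjE)
   have b: "?a n \<le> sqrt K * (1 / sqrt 2)^n" for n
   proof -
    have "ennreal (2^n * (?a n)\<^sup>2) \<le> (\<Sum>n. ennreal (2^n * (?a n)\<^sup>2))"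
     by (rule ennreal_term_le_suminf[of "%n. ennreal (2^n * (?a n)\<^sup>2)"])
    then have "2^n * (?a n)\<^sup>2 \<le> K" unfolding K(1) using K(2) by (simp add: ennreal_le_iff)
    then have "(?a n)\<^sup>2 \<le> K * (1/2)^n" by (simp add: field_simps power_divide)
    then have "?a n \<le> sqrt (K * (1/2)^n)" by (rule real_le_rsqrt)
    then show ?thesis by (simp add: real_sqrt_mult real_sqrt_power real_sqrt_divide)
   qed
   have "summable (%n. sqrt K * (1 / sqrt 2)^n)"
    by (intro summable_mult summable_geometric) auto
   then have "summable (%n. u (Suc n) t k - u n t k)"
    by (rule summable_comparison_test') (use b in auto)
   then have "convergent (%n. \<Sum>i<n. u (Suc i) t k - u i t k)" by (simp add: summable_iff_convergent)
   then have "convergent (%n. (u n t k - u 0 t k) + u 0 t k)"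
    by (subst (asm) sum_lessThan_telescope) (rule convergent_add[OF _ convergent_const])
   then have c: "convergent (%n. u n t k)" by simp
   then show ?case using convergent_Cauchy[OF c] by (simp add: U_def convergent_LIMSEQ_iff)
  qed
 qed
 \<comment> \<open>The constant 4 reproduces itself: 2 * (4 C / 4) + 2 C = 4 C.\<close>
 have bnd: "nsq (%k. u (n + p) t k - u n t k) \<le> ennreal (4 * C * (1/4)^n)" if t: "t \<in> S" for n p t
 proof (induction p arbitrary: n)
  case 0 then show ?case by (simp add: nsq_def)
 next
  case (Suc p)
  have "nsq (%k. u (n + Suc p) t k - u n t k) \<le> 2 * nsq (%k. u (Suc n + p) t k - u (Suc n) t k) + 2 * nsq (%k. u (Suc n) t k - u n t k)"
   using nsq_triangle[of "u (Suc n + p) t" "u (Suc n) t" "u n t"] by simp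
  also have "\<dots> \<le> 2 * ennreal (4 * C * (1/4)^Suc n) + 2 * ennreal (C * (1/4)^n)"
   by (intro add_mono mult_left_mono Suc.IH step t) auto
  also have "\<dots> = ennreal (4 * C * (1/4)^n)"
   using C by (subst ennreal_2_sum) (auto simp: field_simps)
  finally show ?case .
 qed
 have lim: "nsq (%k. u n t k - U t k) \<le> ennreal (4 * C * (1/4)^n)" if t: "t \<in> S" for n t
 proof -
  have "nsq (%k. u n t k - U t k) \<le> (NN k. liminf (%p. ennreal ((norm (u (n + p) t k - u n t k))\<^sup>2)))"
   unfolding nsq_def
  proof (rule nn_integral_mono_AE)
   show "AEL k. ennreal ((norm (u n t k - U t k))\<^sup>2) \<le> liminf (%p. ennreal ((norm (u (n + p) t k - u n t k))\<^sup>2))"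
    using conv[OF t]
   proof eventually_elim
    case (elim k)
    have "(%p. u (n + p) t k) \<longlonglongrightarrow> U t k" using LIMSEQ_ignore_initial_segment[OF elim, of n] by (simp add: add.commute)
    then have "(%p. ennreal ((norm (u (n + p) t k - u n t k))\<^sup>2)) \<longlonglongrightarrow> ennreal ((norm (U t k - u n t k))\<^sup>2)"
     by (intro tendsto_intros)
    then have "liminf (%p. ennreal ((norm (u (n + p) t k - u n t k))\<^sup>2)) = ennreal ((norm (U t k - u n t k))\<^sup>2)"
     by (rule lim_imp_Liminf[rotated]) simp
    then show ?case by (simp add: norm_minus_commute)
   qed
  qed
  also have "\<dots> \<le> liminf (%p. nsq (%k. u (n + p) t k - u n t k))"
   unfolding nsq_def by (rule nn_integral_liminf) simp
  also have "\<dots> \<le> ennreal (4 * C * (1/4)^n)"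
   by (rule Liminf_le) (auto intro!: always_eventually bnd t)
  finally show ?thesis .
 qed
 have herm: "U t (-k) = cnj (U t k)" if h: "!!n t k. u n t (-k) = cnj (u n t k)" for t k
 proof -
  have "Cauchy (%n. u n t (-k)) \<longleftrightarrow> Cauchy (%n. u n t k)"
   unfolding h Cauchy_def dist_norm by (simp flip: complex_cnj_diff)
  moreover have "lim (%n. u n t (-k)) = cnj (lim (%n. u n t k))" if "Cauchy (%n. u n t k)"
  proof -
   have "(%n. u n t k) \<longlonglongrightarrow> lim (%n. u n t k)" using that by (simp add: Cauchy_convergent convergent_LIMSEQ_iff[symmetric])
   then have "(%n. cnj (u n t k)) \<longlonglongrightarrow> cnj (lim (%n. u n t k))" by (rule tendsto_cnj)
   then show ?thesis unfolding h by (rule limI)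
  qed
  ultimately show ?thesis by (auto simp: U_def)
 qed
 show thesis by (rule that[OF mU lim conv herm])
qed

section \<open>Convolutions\<close>

lemma measurable_section2:
 assumes "case_prod u \<in> bm2" "f \<in> borel_measurable M" "g \<in> borel_measurable M"
 shows "(%x. u (f x) (g x)) \<in> borel_measurable M"
 using measurable_compose[OF measurable_Pair[OF assms(2,3)] assms(1)] by simp

lemma measurable_pair_lborel:
 "f \<in> borel_measurable (lborel \<Otimes>\<^sub>M lborel) \<longleftrightarrow> f \<in> bm2"
 by (intro arg_cong[of _ _ "%S. f \<in> S"] measurable_cong_sets sets_pair_measure_cong) auto

lemma Fubini_nn:
 assumes "case_prod f \<in> bm2"
 shows "(NN x y. f x y) = (NN y x. f x y)"
 using lborel_pair.Fubini'[of f] assms by (simp add: measurable_pair_lborel)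

lemma integrable_pairI:
 fixes f :: "real \<Rightarrow> real \<Rightarrow> 'a::{banach, second_countable_topology}"
 assumes m: "case_prod f \<in> bm2"
  and b: "(NN x y. ennreal (norm (f x y))) < \<infinity>"
 shows "integrable (lborel \<Otimes>\<^sub>M lborel) (case_prod f)"
proof (rule integrableI_bounded)
 show m': "case_prod f \<in> borel_measurable (lborel \<Otimes>\<^sub>M lborel)" using m by (simp add: measurable_pair_lborel)
 have "(\<integral>\<^sup>+p. ennreal (norm (case_prod f p)) \<partial>(lborel \<Otimes>\<^sub>M lborel)) = (NN x y. ennreal (norm (f x y)))"
  using lborel.nn_integral_fst[of "%p. ennreal (norm (case_prod f p))" lborel] m' by simp
 then show "(\<integral>\<^sup>+p. ennreal (norm (case_prod f p)) \<partial>(lborel \<Otimes>\<^sub>M lborel)) < \<infinity>" using b by simp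
qed

lemma Fubini_bochner:
 fixes f :: "real \<Rightarrow> real \<Rightarrow> 'a::{banach, second_countable_topology}"
 assumes "case_prod f \<in> bm2"
  and "(NN x y. ennreal (norm (f x y))) < \<infinity>"
 shows "(LI x y. f x y) = (LI y x. f x y)"
 using lborel_pair.Fubini_integral[OF integrable_pairI[OF assms]] by simp

text \<open>After localisation to [-n, n] the integrals of g over half-lines vanish. Half-lines form
  a generator of the Borel sets stable under intersection, so the integral of g over every Borel set
  vanishes. This is how functions on the line are identified throughout.\<close>

lemma AE_zero_intervals:
 fixes f :: "real \<Rightarrow> 'a::{banach, second_countable_topology}"
 assumes int: "!!a b. set_integrable lborel {a..b} f"
  and zero: "!!a b. a \<le> b ==> (LINT x:{a..b}|lborel. f x) = 0"
 shows "AEL x. f x = 0"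
proof -
 have sb: "sets borel = sigma_sets UNIV (range (%a. {..a::real}))"
  by (subst borel_eq_atMost) simp
 have Pow_top': "range (%a. {..a::real}) \<subseteq> Pow UNIV" by auto
 have st: "Int_stable (range (%a. {..a::real}))" by (auto simp: Int_stable_def)
 have "AEL x. x \<in> {- real n..real n} \<longrightarrow> f x = 0" for n
 proof -
  define g where "g x = indicator {- real n..real n} x *\<^sub>R f x" for x
  have g: "intL g" using int[of "- real n" "real n"] unfolding g_def set_integrable_def .
  have "set_lebesgue_integral lborel A g = 0" if "A \<in> sets lborel" for A
  proof -
   have "A \<in> sigma_sets UNIV (range (%a. {..a::real}))"
    using that sb by simp
   from st Pow_top' this show ?thesis
   proof (induction A rule: sigma_sets_induct_disjoint)
    case (basic A)
    then obtain a where A: "A = {..a}" by auto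
    have "set_lebesgue_integral lborel A g = (LINT x:{- real n..min a (real n)}|lborel. f x)"
     unfolding A set_lebesgue_integral_def g_def by (rule LI_cong) (auto split: split_indicator)
    also have "\<dots> = 0" 
    proof (cases "- real n \<le> min a (real n)")
     case True then show ?thesis by (rule zero)
    next
     case False
     then have "{- real n..min a (real n)} = {}" by auto
     then show ?thesis by (simp only: set_lebesgue_integral_def) simp
    qed
    finally show ?case .
   next
    case empty then show ?case by (simp add: set_lebesgue_integral_def)
   next
    case (compl A)
    then have A: "A \<in> sets lborel" using sb by simp
    have "(LINT x|lborel. g x) = (LINT x:{- real n..real n}|lborel. f x)" by (simp add: g_def set_lebesgue_integral_def)
    then have 0: "(LINT x|lborel. g x) = 0" by (simp add: zero)
    have sA: "set_integrable lborel A g" unfolding set_integrable_def using A g by (intro integrable_mult_indicator) auto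
    have "set_lebesgue_integral lborel (UNIV - A) g = (LINT x|lborel. g x - indicator A x *\<^sub>R g x)"
     unfolding set_lebesgue_integral_def by (rule LI_cong) (auto split: split_indicator)
    also have "\<dots> = (LINT x|lborel. g x) - set_lebesgue_integral lborel A g"
     unfolding set_lebesgue_integral_def using sA g by (subst LI_diff) (auto simp: set_integrable_def)
    finally show ?case using 0 compl by simp
   next
    case (union A)
    have A: "A i \<in> sets lborel" for i using union(2) sb by auto
    have "set_integrable lborel (\<Union>i. A i) g"
     unfolding set_integrable_def using A g by (intro integrable_mult_indicator) auto
    then have "set_lebesgue_integral lborel (\<Union>i. A i) g = (\<Sum>i. set_lebesgue_integral lborel (A i) g)"
     using A union(1) by (intro lebesgue_integral_countable_add) (auto simp: disjoint_family_on_def)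
    then show ?case using union by simp
   qed
  qed
  then have "AEL x. g x = 0" by (intro sigma_finite_measure.density_zero[OF lborel.sigma_finite_measure_axioms g]) auto
  then show ?thesis by eventually_elim (auto simp: g_def)
 qed
 then have "AEL x. \<forall>n. x \<in> {- real n..real n} \<longrightarrow> f x = 0" by (simp only: AE_all_countable) blast
 then show ?thesis
 proof eventually_elim
  case (elim x)
  obtain n where "\<bar>x\<bar> \<le> real n" using real_arch_simple by blast
  then show ?case using elim[rule_format, of n] by (simp add: abs_le_iff)
 qed
qed

lemma nn_integral_reflect_shift:
 fixes p :: "real \<Rightarrow> ennreal"
 assumes [measurable]: "p \<in> bm"
 shows "(NN l. p (k - l)) = (NN l. p l)"
 using nn_integral_real_affine[of p "-1" k] by simp

lemma nn_integral_shift: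
 fixes p :: "real \<Rightarrow> ennreal"
 assumes [measurable]: "p \<in> bm"
 shows "(NN l. p (k + l)) = (NN l. p l)" "(NN l. p (l + k)) = (NN l. p l)"
  "(NN l. p (l - k)) = (NN l. p l)"
 using nn_integral_real_affine[of p 1 k] nn_integral_real_affine[of p 1 "-k"] by (simp_all add: add.commute)

lemma nn_convolution:
 fixes p q :: "real \<Rightarrow> ennreal"
 assumes [measurable]: "p \<in> bm" "q \<in> bm"
 shows "(NN k l. p (k - l) * q l) = (NN x. p x) * (NN x. q x)"
proof -
 have "(NN k l. p (k - l) * q l) = (NN l k. p (k - l) * q l)"
  by (rule Fubini_nn) measurable
 also have "\<dots> = (NN l. (NN x. p x) * q l)"
  by (intro nn_integral_cong) (simp add: nn_integral_multc nn_integral_shift(3))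
 finally show ?thesis by (simp add: nn_integral_cmult)
qed

text \<open>Cauchy-Schwarz after splitting |p| into sqrt |p| times sqrt |p|: one half carries the
  total mass of p, the other stays with q^2 and is integrated by
  \<open>nn_convolution\<close>.\<close>

lemma nn_young:
 fixes p q :: "real \<Rightarrow> real"
 assumes [measurable]: "p \<in> bm" "q \<in> bm"
 shows "(NN k. (NN l. ennreal \<bar>p (k - l) * q l\<bar>)\<^sup>2)
  \<le> (NN x. ennreal \<bar>p x\<bar>)\<^sup>2 * (NN x. ennreal ((q x)\<^sup>2))"
proof -
 let ?P = "NN x. ennreal \<bar>p x\<bar>"
 have "(NN l. ennreal \<bar>p (k - l) * q l\<bar>)\<^sup>2 \<le> ?P * (NN l. ennreal \<bar>p (k - l)\<bar> * ennreal ((q l)\<^sup>2))" for k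
 proof -
  have "(NN l. ennreal \<bar>p (k - l) * q l\<bar>)\<^sup>2
    = (NN l. ennreal \<bar>sqrt \<bar>p (k - l)\<bar> * (sqrt \<bar>p (k - l)\<bar> * q l)\<bar>)\<^sup>2"
   by (simp add: abs_mult mult.assoc[symmetric])
  also have "\<dots> \<le> (NN l. ennreal ((sqrt \<bar>p (k - l)\<bar>)\<^sup>2)) * (NN l. ennreal ((sqrt \<bar>p (k - l)\<bar> * q l)\<^sup>2))"
   by (rule nn_cauchy_schwarz) measurable
  also have "\<dots> = ?P * (NN l. ennreal \<bar>p (k - l)\<bar> * ennreal ((q l)\<^sup>2))"
   using nn_integral_reflect_shift[of "%x. ennreal \<bar>p x\<bar>" k] by (simp add: power_mult_distrib ennreal_mult)
  finally show ?thesis .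
 qed
 then have "(NN k. (NN l. ennreal \<bar>p (k - l) * q l\<bar>)\<^sup>2)
   \<le> (NN k. ?P * (NN l. ennreal \<bar>p (k - l)\<bar> * ennreal ((q l)\<^sup>2)))"
  by (intro nn_integral_mono) auto
 also have "\<dots> = ?P * (NN k l. ennreal \<bar>p (k - l)\<bar> * ennreal ((q l)\<^sup>2))"
  by (rule nn_integral_cmult) measurable
 also have "\<dots> = ?P * (?P * (NN x. ennreal ((q x)\<^sup>2)))"
  by (subst nn_convolution[of "%x. ennreal \<bar>p x\<bar>" "%x. ennreal ((q x)\<^sup>2)"]) auto
 finally show ?thesis by (simp add: power2_eq_square mult.assoc)
qed

lemma nn_convolution_bound:
 fixes p q :: "real \<Rightarrow> real"
 assumes [measurable]: "p \<in> bm" "q \<in> bm"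
 shows "(NN l. ennreal \<bar>p (k - l) * q l\<bar>)\<^sup>2 \<le> (NN x. ennreal ((p x)\<^sup>2)) * (NN x. ennreal ((q x)\<^sup>2))"
 using nn_cauchy_schwarz[of "%l. p (k - l)" lborel q] nn_integral_reflect_shift[of "%x. ennreal ((p x)\<^sup>2)" k] by simp

text \<open>The workhorse of all estimates: one factor in L^1, two in L^2. The product of the L^2
  norms is replaced by half the sum of their squares, which is the form in which energies
  occur.\<close>

lemma nn_trilinear:
 fixes p q r :: "real \<Rightarrow> real"
 assumes [measurable]: "p \<in> bm" "q \<in> bm" "r \<in> bm"
 shows "2 * (NN a b. ennreal \<bar>p a * q b * r (a + b)\<bar>)
  \<le> (NN x. ennreal \<bar>p x\<bar>) * ((NN x. ennreal ((q x)\<^sup>2)) + (NN x. ennreal ((r x)\<^sup>2)))"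
proof -
 let ?S = "(NN x. ennreal ((q x)\<^sup>2)) + (NN x. ennreal ((r x)\<^sup>2))"
 have *: "2 * (NN b. ennreal \<bar>p a * q b * r (a + b)\<bar>) \<le> ennreal \<bar>p a\<bar> * ?S" for a
 proof -
  have "2 * (NN b. ennreal \<bar>p a * q b * r (a + b)\<bar>) = (NN b. 2 * ennreal \<bar>p a * q b * r (a + b)\<bar>)"
   by (simp add: nn_integral_cmult)
  also have "\<dots> \<le> (NN b. ennreal \<bar>p a\<bar> * (ennreal ((q b)\<^sup>2) + ennreal ((r (a + b))\<^sup>2)))"
  proof (rule nn_integral_mono)
   fix b
   have "2 * \<bar>q b * r (a + b)\<bar> \<le> (q b)\<^sup>2 + (r (a + b))\<^sup>2"
    using sum_squares_bound[of "\<bar>q b\<bar>" "\<bar>r (a + b)\<bar>"] by (simp add: abs_mult)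
   then have "\<bar>p a\<bar> * (2 * \<bar>q b * r (a + b)\<bar>) \<le> \<bar>p a\<bar> * ((q b)\<^sup>2 + (r (a + b))\<^sup>2)"
    by (intro mult_left_mono) auto
   then have "2 * \<bar>p a * q b * r (a + b)\<bar> \<le> \<bar>p a\<bar> * ((q b)\<^sup>2 + (r (a + b))\<^sup>2)"
    by (simp add: abs_mult ac_simps)
   then have "ennreal (2 * \<bar>p a * q b * r (a + b)\<bar>) \<le> ennreal (\<bar>p a\<bar> * ((q b)\<^sup>2 + (r (a + b))\<^sup>2))" by (rule ennreal_leI)
   then show "2 * ennreal \<bar>p a * q b * r (a + b)\<bar> \<le> ennreal \<bar>p a\<bar> * (ennreal ((q b)\<^sup>2) + ennreal ((r (a + b))\<^sup>2))"
    by (simp add: ennreal_mult)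
  qed
  also have "\<dots> = ennreal \<bar>p a\<bar> * ((NN x. ennreal ((q x)\<^sup>2)) + (NN b. ennreal ((r (a + b))\<^sup>2)))"
   by (simp add: nn_integral_cmult nn_integral_add)
  also have "\<dots> = ennreal \<bar>p a\<bar> * ?S"
   using nn_integral_shift(1)[of "%x. ennreal ((r x)\<^sup>2)" a] by simp
  finally show ?thesis .
 qed
 have "2 * (NN a b. ennreal \<bar>p a * q b * r (a + b)\<bar>)
   = (NN a. 2 * (NN b. ennreal \<bar>p a * q b * r (a + b)\<bar>))"
  by (rule nn_integral_cmult[symmetric]) measurable
 also have "\<dots> \<le> (NN a. ennreal \<bar>p a\<bar> * ?S)" by (intro nn_integral_mono *)
 also have "\<dots> = (NN x. ennreal \<bar>p x\<bar>) * ?S" by (rule nn_integral_multc) measurable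
 finally show ?thesis .
qed

definition conv :: "cfun \<Rightarrow> cfun \<Rightarrow> real \<Rightarrow> complex"
 where "conv F G k = (LI l. F (k - l) * G l)"

lemma conv_measurable[measurable]:
 assumes [measurable]: "F \<in> bm" "G \<in> bm"
 shows "conv F G \<in> bm"
 unfolding conv_def by measurable

text \<open>Where the convolution integral does not converge, \<open>conv\<close> has the default
  value 0, so the bound holds for every k.\<close>

lemma norm_conv_le:
 assumes [measurable]: "F \<in> bm" "G \<in> bm"
 shows "ennreal (norm (conv F G k)) \<le> (NN l. ennreal \<bar>norm (F (k - l)) * norm (G l)\<bar>)"
proof (cases "intL (%l. F (k - l) * G l)")
 case True
 then show ?thesis unfolding conv_def using integral_norm_bound_ennreal[OF True] by (simp add: norm_mult abs_mult)
next
 case False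
 then show ?thesis unfolding conv_def by (simp add: not_integrable_integral_eq)
qed

lemma conv_integrable:
 assumes F: "intL F" and G: "intL G"
 shows "intL (conv F G)"
proof (rule integrableI_bounded)
 have [measurable]: "F \<in> bm" "G \<in> bm" using F G by auto
 show "conv F G \<in> borel_measurable lborel" by simp
 have "(NN k. ennreal (norm (conv F G k))) \<le> (NN k l. ennreal (norm (F (k - l))) * ennreal (norm (G l)))"
  using norm_conv_le[of F G] by (intro nn_integral_mono) (simp add: ennreal_mult)
 also have "\<dots> = (NN x. ennreal (norm (F x))) * (NN x. ennreal (norm (G x)))"
  by (rule nn_convolution) auto
 also have "\<dots> < \<infinity>" using F G by (simp add: integrable_iff_bounded ennreal_mult_less_top)
 finally show "(NN k. ennreal (norm (conv F G k))) < \<infinity>" .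
qed

lemma nsq_conv:
 assumes [measurable]: "F \<in> bm" "G \<in> bm"
 shows "nsq (conv F G) \<le> (NN x. ennreal (norm (F x)))\<^sup>2 * nsq G"
proof -
 have "nsq (conv F G) \<le> (NN k. (NN l. ennreal \<bar>norm (F (k - l)) * norm (G l)\<bar>)\<^sup>2)"
  unfolding nsq_def by (intro nn_integral_mono) (simp only: ennreal_power[OF norm_ge_zero, symmetric] power_mono[OF norm_conv_le] assms zero_le)
 also have "\<dots> \<le> (NN x. ennreal (norm (F x)))\<^sup>2 * nsq G"
  using nn_young[of "%x. norm (F x)" "%x. norm (G x)"] by (simp add: nsq_def)
 finally show ?thesis .
qed

lemma integral_reflect_real:
 fixes f :: "real \<Rightarrow> 'a::{banach, second_countable_topology}"
 shows "(LI x. f (- x)) = (LI x. f x)"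
 using lborel_integral_real_affine[of "-1" f 0] by simp

lemma conv_hermitian:
 assumes "!!k. F (- k) = cnj (F k)" "!!k. G (- k) = cnj (G k)"
 shows "conv F G (- k) = cnj (conv F G k)"
proof -
 have "conv F G (- k) = (LI l. F (- k - (- l)) * G (- l))"
  unfolding conv_def by (rule integral_reflect_real[symmetric])
 also have "\<dots> = (LI l. cnj (F (k - l) * G l))"
  using assms(1)[of "k - l" for l] assms(2) by simp
 also have "\<dots> = cnj (conv F G k)" unfolding conv_def by (rule LI_cnj)
 finally show ?thesis .
qed

section \<open>The Fourier transform on $L^2$\<close>

lemma borel_measurable_cnj[measurable]:
 assumes "f \<in> borel_measurable M"
 shows "(%x. cnj (f x)) \<in> borel_measurable M"
 using measurable_compose[OF assms borel_measurable_continuous_onI[OF continuous_on_cnj[OF continuous_on_id]]] .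

definition ft :: "cfun \<Rightarrow> real \<Rightarrow> complex"
 where "ft g k = cr (1 / sqrt (2 * pi)) * (LI x. g x * exp (- \<i> * cr (k * x)))"

lemma norm_exp_mi[simp]: "norm (exp (- \<i> * cr r)) = 1" "norm (exp (- (\<i> * cr r))) = 1"
 using norm_exp_i_times[of "- r"] by simp_all

lemma ft_measurable[measurable]:
 assumes [measurable]: "g \<in> bm"
 shows "ft g \<in> bm"
 unfolding ft_def by measurable

lemma integrable_times_bounded:
 fixes g h :: cfun
 assumes g: "intL g" and [measurable]: "h \<in> bm" and h: "!!x. norm (h x) \<le> B"
 shows "intL (%x. g x * h x)"
proof (rule LI_int_bound[of lborel "%x. B * norm (g x)"])
 show "intL (%x. B * norm (g x))" using g by simp
 have [measurable]: "g \<in> bm" using g by auto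
 show "(%x. g x * h x) \<in> borel_measurable lborel" by measurable
 have "0 \<le> B" using h[of 0] norm_ge_zero order_trans by blast
 then show "AEL x. norm (g x * h x) \<le> norm (B * norm (g x))"
  using h by (intro AE_I2) (auto simp: norm_mult mult.commute[of B] intro!: mult_left_mono)
qed

lemma ft_integrand: "intL g ==> intL (%x. g x * exp (- \<i> * cr (k * x)))"
 by (rule integrable_times_bounded[where B=1]) auto

lemma norm_ft_le:
 assumes "intL g"
 shows "norm (ft g k) \<le> (LI x. norm (g x))"
proof -
 have "norm (ft g k) = 1 / sqrt (2 * pi) * norm (LI x. g x * exp (- \<i> * cr (k * x)))"
  by (simp add: ft_def norm_mult norm_divide)
 also have "\<dots> \<le> 1 * norm (LI x. g x * exp (- \<i> * cr (k * x)))"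
  using pi_ge_two by (intro mult_right_mono) (auto simp: divide_le_eq_1 real_le_rsqrt)
 also have "\<dots> \<le> (LI x. norm (g x * exp (- \<i> * cr (k * x))))"
  by (simp del: norm_mult)
 also have "\<dots> = (LI x. norm (g x))" by (simp add: norm_mult)
 finally show ?thesis .
qed

text \<open>Fubini for an absolutely convergent double integral. From this identity Plancherel,
  Parseval and inversion are derived by inserting Gaussians.\<close>

lemma ft_multiplication:
 assumes g: "intL g" and m: "intL m"
 shows "(LI k. ft g k * m k) = (LI x. g x * ft m x)"
proof -
 have [measurable]: "g \<in> bm" "m \<in> bm" using g m by auto
 define \<phi> where "\<phi> k x = m k * (g x * exp (- \<i> * cr (k * x)))" for k x
 have "(NN k x. ennreal (norm (\<phi> k x)))
   = (NN k. ennreal (norm (m k)) * (NN x. ennreal (norm (g x))))"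
  by (intro nn_integral_cong) (simp add: \<phi>_def norm_mult ennreal_mult nn_integral_cmult)
 also have "\<dots> = (NN k. ennreal (norm (m k))) * (NN x. ennreal (norm (g x)))"
  by (rule nn_integral_multc) simp
 also have "\<dots> < \<infinity>" using g m by (simp add: integrable_iff_bounded ennreal_mult_less_top)
 finally have fub: "(LI k x. \<phi> k x) = (LI x k. \<phi> k x)"
  by (intro Fubini_bochner) (auto simp: \<phi>_def)
 have 1: "ft g k * m k = cr (1 / sqrt (2 * pi)) * (LI x. \<phi> k x)" for k
  unfolding ft_def \<phi>_def by simp
 have 2: "g x * ft m x = cr (1 / sqrt (2 * pi)) * (LI k. \<phi> k x)" for x
 proof -
  have "(LI k. \<phi> k x) = (LI k. g x * (m k * exp (- \<i> * cr (x * k))))"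
   unfolding \<phi>_def by (intro LI_cong) (auto simp: ac_simps)
  then show ?thesis unfolding ft_def by simp
 qed
 show ?thesis unfolding 1 2 using fub by simp
qed

lemma cnj_ft: "cnj (ft h k) = ft (%x. cnj (h x)) (- k)"
proof -
 have "cnj (LI x. h x * exp (- \<i> * cr (k * x))) = (LI x. cnj (h x * exp (- \<i> * cr (k * x))))"
  by (rule LI_cnj[symmetric])
 also have "\<dots> = (LI x. cnj (h x) * exp (- \<i> * cr (- k * x)))"
  by (simp add: exp_cnj)
 finally show ?thesis by (simp add: ft_def)
qed

abbreviation gauss :: "real \<Rightarrow> real \<Rightarrow> real"
 where "gauss d k \<equiv> exp (- ((d * k)\<^sup>2 / 2))"

lemma gauss_integrable: "d > 0 ==> intL (gauss d)"
proof -
 assume d: "d > 0"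
 have "intL (%x. sqrt (2 * pi * (1/d)\<^sup>2) * normal_density 0 (1/d) x)" using d by simp
 moreover have "sqrt (2 * pi * (1/d)\<^sup>2) * normal_density 0 (1/d) x = gauss d x" for x
  using d by (simp add: normal_density_def power_divide power_mult_distrib)
 ultimately show ?thesis by simp
qed

text \<open>A rescaling of the characteristic function of the standard normal distribution.\<close>

lemma ft_gauss:
 assumes d: "d > 0"
 shows "cr (1 / sqrt (2 * pi)) * ft (%k. cr (gauss d k)) x = cr (normal_density 0 d x)"
proof -
 have "(LI y. std_normal_density y *\<^sub>R iexp (- x / d * y)) = cr (exp (- ((- x / d)^2) / 2))"
  using fun_cong[OF char_std_normal_distribution, of "- x / d"]
  unfolding char_def by (subst (asm) integral_density) (auto simp: normal_density_nonneg)
 then have *: "(LI y. cr (std_normal_density y) * iexp (- x / d * y)) = cr (exp (- ((x / d)^2) / 2))"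
  by (simp add: scaleR_conv_of_real)
 have "(LI k. cr (gauss d k) * exp (- \<i> * cr (x * k)))
  = (1/d) *\<^sub>R (LI y. cr (gauss d (y/d)) * exp (- \<i> * cr (x * (y/d))))"
  using lborel_integral_real_affine[of "1/d" "%k. cr (gauss d k) * exp (- \<i> * cr (x * k))" 0] d by simp
 also have "(%y. cr (gauss d (y/d)) * exp (- \<i> * cr (x * (y/d))))
  = (%y. cr (sqrt (2*pi)) * (cr (std_normal_density y) * iexp (- x / d * y)))"
  using d by (auto simp: fun_eq_iff std_normal_density_def)
 also have "(LI y. cr (sqrt (2*pi)) * (cr (std_normal_density y) * iexp (- x / d * y)))
   = cr (sqrt (2*pi)) * cr (exp (- ((x / d)^2) / 2))"
  unfolding *[symmetric] by (rule integral_mult_right_zero)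
 finally have "ft (%k. cr (gauss d k)) x = cr (1 / d * exp (- ((x / d)^2) / 2))"
  unfolding ft_def by (simp add: scaleR_conv_of_real)
 then show ?thesis using d by (simp add: normal_density_def real_sqrt_mult power_divide field_simps)
qed

text \<open>The product of two transforms of integrable functions need not be integrable. The
  Gaussian factor makes it so, and the multiplication formula moves it to the other side, where it
  becomes convolution with a narrow normal density.\<close>

lemma ft_pairing_gauss:
 assumes g: "intL g" and h: "intL h" and d: "d > 0"
 shows "(LI k. ft g k * (cnj (ft h k) * cr (gauss d k)))
  = (LI x. g x * (LI y. cnj (h y) * cr (normal_density 0 d (y - x))))"
proof -
 have [measurable]: "g \<in> bm" "h \<in> bm" using g h by auto
 have gi: "intL (%k. cr (gauss d k))" using gauss_integrable[OF d] by simp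
 have "intL (%k. cr (gauss d k) * cnj (ft h k))"
  by (rule integrable_times_bounded[OF gi, where B="LI x. norm (h x)"]) (auto simp: norm_ft_le[OF h])
 then have mi: "intL (%k. cnj (ft h k) * cr (gauss d k))" by (simp add: mult.commute)
 have hc: "intL (%x. cnj (h x))" using h by simp
 have "ft (%k. cnj (ft h k) * cr (gauss d k)) x = (LI y. cnj (h y) * cr (normal_density 0 d (y - x)))" for x
 proof -
  let ?m = "%k. cr (gauss d k) * exp (\<i> * cr (x * k))"
  have m: "intL ?m" by (rule integrable_times_bounded[OF gi, where B=1]) auto
  have "ft (%k. cnj (ft h k) * cr (gauss d k)) x
    = cr (1 / sqrt (2 * pi)) * (LI k. cnj (ft h k) * cr (gauss d k) * exp (- \<i> * cr (x * k)))"
   by (simp add: ft_def)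
  also have "(LI k. cnj (ft h k) * cr (gauss d k) * exp (- \<i> * cr (x * k)))
    = (LI k. cnj (ft h (-k)) * cr (gauss d (-k)) * exp (- \<i> * cr (x * (-k))))"
   by (rule integral_reflect_real[symmetric])
  also have "\<dots> = (LI k. ft (%x. cnj (h x)) k * ?m k)"
   by (intro LI_cong) (auto simp: cnj_ft)
  also have "\<dots> = (LI y. cnj (h y) * ft ?m y)" by (rule ft_multiplication[OF hc m])
  also have "cr (1 / sqrt (2 * pi)) * \<dots> = (LI y. cnj (h y) * (cr (1 / sqrt (2 * pi)) * ft ?m y))"
   by (subst integral_mult_right_zero[symmetric]) (simp add: ac_simps)
  also have "\<dots> = (LI y. cnj (h y) * cr (normal_density 0 d (y - x)))"
  proof -
   have "ft ?m y = ft (%k. cr (gauss d k)) (y - x)" for y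
    unfolding ft_def by (simp add: mult.assoc flip: exp_add) (simp add: algebra_simps)
   then show ?thesis using ft_gauss[OF d] by simp
  qed
  finally show ?thesis .
 qed
 then show ?thesis using ft_multiplication[OF g mi] by simp
qed

text \<open>The inequality of Plancherel, which gives the Cauchy property of truncated transforms.
  With a Gaussian factor the pairing of g with its mollification is bounded by
  \<open>nn_trilinear\<close>, whose L^1 factor is a probability density; Fatou removes the
  Gaussian.\<close>

lemma nsq_ft_le:
 assumes g: "intL g"
 shows "nsq (ft g) \<le> nsq g"
proof -
 have [measurable]: "g \<in> bm" using g by auto
 have *: "(NN k. ennreal ((norm (ft g k))\<^sup>2 * gauss d k)) \<le> nsq g" if d: "d > 0" for d
 proof -
  let ?\<Phi> = "%x. LI y. cnj (g y) * cr (normal_density 0 d (y - x))"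
  have gi: "intL (%k. cr (gauss d k))" using gauss_integrable[OF d] by simp
  have eq: "cr ((norm (ft g k))\<^sup>2 * gauss d k) = cr (gauss d k) * (ft g k * cnj (ft g k))" for k
   using complex_norm_square[of "ft g k"] by (simp add: mult.commute)
  have "intL (%k. cr (gauss d k) * (ft g k * cnj (ft g k)))"
   by (rule integrable_times_bounded[OF gi, where B="(LI x. norm (g x)) * (LI x. norm (g x))"])
    (auto simp: norm_mult intro!: mult_mono norm_ft_le[OF g])
  then have int: "intL (%k. (norm (ft g k))\<^sup>2 * gauss d k)"
   unfolding eq[symmetric] by (simp only: complex_of_real_integrable_eq)
  have A: "(NN k. ennreal ((norm (ft g k))\<^sup>2 * gauss d k)) = ennreal (LI k. (norm (ft g k))\<^sup>2 * gauss d k)"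
   by (rule nn_integral_eq_integral[OF int]) simp
  have B: "(LI k. (norm (ft g k))\<^sup>2 * gauss d k) \<le> norm (LI k. cr ((norm (ft g k))\<^sup>2 * gauss d k))"
   by (simp only: integral_complex_of_real norm_of_real abs_ge_self)
  have C: "(LI k. cr ((norm (ft g k))\<^sup>2 * gauss d k)) = (LI x. g x * ?\<Phi> x)"
   unfolding eq using ft_pairing_gauss[OF g g d] by (simp add: ac_simps)
  have "(NN k. ennreal ((norm (ft g k))\<^sup>2 * gauss d k)) \<le> ennreal (norm (LI x. g x * ?\<Phi> x))"
   unfolding A using B unfolding C by (rule ennreal_leI)
  also have "ennreal (norm (LI x. g x * ?\<Phi> x)) \<le> (NN x. ennreal (norm (g x * ?\<Phi> x)))"
   by (cases "intL (%x. g x * ?\<Phi> x)") (auto intro: integral_norm_bound_ennreal simp: not_integrable_integral_eq simp del: norm_mult)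
  also have "\<dots> \<le> (NN x z. ennreal \<bar>normal_density 0 d z * norm (g x) * norm (g (z + x))\<bar>)"
  proof (rule nn_integral_mono)
   fix x
   have "ennreal (norm (?\<Phi> x)) \<le> (NN y. ennreal (norm (cnj (g y) * cr (normal_density 0 d (y - x)))))"
    by (cases "intL (%y. cnj (g y) * cr (normal_density 0 d (y - x)))")
     (auto intro: integral_norm_bound_ennreal simp: not_integrable_integral_eq simp del: norm_mult)
   then have "ennreal (norm (g x)) * ennreal (norm (?\<Phi> x)) \<le> ennreal (norm (g x)) * (NN y. ennreal (norm (cnj (g y) * cr (normal_density 0 d (y - x)))))"
    by (rule mult_left_mono) simp
   also have "\<dots> = (NN y. ennreal \<bar>normal_density 0 d (y - x) * norm (g x) * norm (g y)\<bar>)"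
    by (subst nn_integral_cmult[symmetric]) (auto simp: norm_mult abs_mult ac_simps normal_density_nonneg simp flip: ennreal_mult intro!: nn_integral_cong)
   also have "\<dots> = (NN z. ennreal \<bar>normal_density 0 d z * norm (g x) * norm (g (z + x))\<bar>)"
    using nn_integral_shift(2)[of "%y. ennreal \<bar>normal_density 0 d (y - x) * norm (g x) * norm (g y)\<bar>" x] by simp
   finally show "ennreal (norm (g x * ?\<Phi> x)) \<le> \<dots>" by (simp add: norm_mult ennreal_mult)
  qed
  also have "\<dots> = (NN z x. ennreal \<bar>normal_density 0 d z * norm (g x) * norm (g (z + x))\<bar>)"
   by (rule Fubini_nn) measurable
  finally have le: "(NN k. ennreal ((norm (ft g k))\<^sup>2 * gauss d k)) \<le> (NN z x. ennreal \<bar>normal_density 0 d z * norm (g x) * norm (g (z + x))\<bar>)" .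
  \<comment> \<open>Total mass 1, independently of d: this makes the bound uniform.\<close>
  have "(NN x. ennreal (normal_density 0 d x)) = ennreal (LI x. normal_density 0 d x)"
   using d by (intro nn_integral_eq_integral) (auto simp: normal_density_nonneg)
  also have "\<dots> = 1" using d by simp
  finally have one: "(NN x. ennreal \<bar>normal_density 0 d x\<bar>) = 1" by (simp add: normal_density_nonneg)
  have "2 * (NN k. ennreal ((norm (ft g k))\<^sup>2 * gauss d k)) \<le> 2 * (NN z x. ennreal \<bar>normal_density 0 d z * norm (g x) * norm (g (z + x))\<bar>)"
   by (intro mult_left_mono le) simp
  also have "\<dots> \<le> 1 * (nsq g + nsq g)"
   using nn_trilinear[of "normal_density 0 d" "%x. norm (g x)" "%x. norm (g x)"] unfolding one nsq_def by simp
  finally show ?thesis by (simp add: ennreal_mult_le_mult_iff flip: mult_2)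
 qed
 have "nsq (ft g) = (NN k. liminf (%n. ennreal ((norm (ft g k))\<^sup>2 * gauss (1 / real (Suc n)) k)))"
  unfolding nsq_def
 proof (rule nn_integral_cong)
  fix k
  have "(%n. (norm (ft g k))\<^sup>2 * gauss (1 / real (Suc n)) k) \<longlonglongrightarrow> (norm (ft g k))\<^sup>2 * exp (- ((0 * k)\<^sup>2 / 2))"
   by (intro tendsto_intros LIMSEQ_Suc[OF lim_1_over_n] ) auto
  then have "(%n. ennreal ((norm (ft g k))\<^sup>2 * gauss (1 / real (Suc n)) k)) \<longlonglongrightarrow> ennreal ((norm (ft g k))\<^sup>2)"
   by (intro tendsto_ennrealI) simp
  then show "ennreal ((norm (ft g k))\<^sup>2) = liminf (%n. ennreal ((norm (ft g k))\<^sup>2 * gauss (1 / real (Suc n)) k))"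
   by (subst lim_imp_Liminf) auto
 qed
 also have "\<dots> \<le> liminf (%n. NN k. ennreal ((norm (ft g k))\<^sup>2 * gauss (1 / real (Suc n)) k))"
  by (rule nn_integral_liminf) measurable
 also have "\<dots> \<le> nsq g" 
 proof (rule Liminf_le)
  show "\<forall>\<^sub>F n in sequentially. (NN k. ennreal ((norm (ft g k))\<^sup>2 * gauss (1 / real (Suc n)) k)) \<le> nsq g"
   by (intro always_eventually allI * ) simp
 qed simp
 finally show ?thesis .
qed

abbreviation interval_fun :: "real \<Rightarrow> real \<Rightarrow> real \<Rightarrow> complex"
 where "interval_fun a b \<equiv> (%x. indicator {a..b} x)"

lemma interval_fun_integrable[simp]: "intL (interval_fun a b)"
proof -
 have "intL (%x. cr (indicator {a..b} x))"
  by (intro integrable_of_real integrable_real_indicator) (auto simp: emeasure_lborel_Icc_eq)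
 then show ?thesis by (rule Bochner_Integration.integrable_cong[THEN iffD1, rotated 2]) (auto split: split_indicator)
qed

lemma nsq_interval_fun: "nsq (interval_fun a b) < \<infinity>"
proof -
 have "nsq (interval_fun a b) = (NN x. indicator {a..b} x)"
  unfolding nsq_def by (intro nn_integral_cong) (auto split: split_indicator)
 then show ?thesis by (simp add: emeasure_lborel_Icc_eq)
qed

lemma nsq_ft_interval_fun: "nsq (ft (interval_fun a b)) < \<infinity>"
 using nsq_ft_le[OF interval_fun_integrable] nsq_interval_fun le_less_trans by blast

text \<open>Parseval against the indicator of an interval: the limit d -> 0 in
  \<open>ft_pairing_gauss\<close>, by dominated convergence on both sides. Indicators suffice
  because they determine an L^2 function almost everywhere.\<close>

lemma ft_pairing:
 assumes g: "intL g" and g2: "nsq g < \<infinity>"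
 shows "(LI k. ft g k * cnj (ft (interval_fun a b) k)) = (LI x. g x * interval_fun a b x)"
proof -
 have [measurable]: "g \<in> bm" using g by auto
 let ?h = "interval_fun a b"
 define d where "d n = 1 / real (Suc n)" for n
 have d: "d n > 0" for n by (simp add: d_def)
 have d0: "d \<longlonglongrightarrow> 0" unfolding d_def by (rule LIMSEQ_Suc[OF lim_1_over_n])
 \<comment> \<open>The mollified indicator after the substitution y = x + d z. The density is now
   fixed, and only the indicator depends on n, so the density itself is a majorant.\<close>
 define \<theta> where "\<theta> n x = (LI z. indicator {a..b} (x + d n * z) * std_normal_density z)" for n x
 have \<theta>_eq: "(LI y. cnj (?h y) * cr (normal_density 0 (d n) (y - x))) = cr (\<theta> n x)" for n x
 proof -
  have "(LI y. cnj (?h y) * cr (normal_density 0 (d n) (y - x))) = (LI y. cr (indicator {a..b} y * normal_density 0 (d n) (y - x)))"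
   by (intro LI_cong) (auto split: split_indicator)
  also have "\<dots> = cr (LI y. indicator {a..b} y * normal_density 0 (d n) (y - x))"
   by (rule integral_complex_of_real)
  also have "(LI y. indicator {a..b} y * normal_density 0 (d n) (y - x)) = d n * (LI z. indicator {a..b} (x + d n * z) * normal_density 0 (d n) (d n * z))"
   using lborel_integral_real_affine[of "d n" "%y. indicator {a..b} y * normal_density 0 (d n) (y - x)" x] d[of n] by simp
  also have "\<dots> = (LI z. d n * (indicator {a..b} (x + d n * z) * normal_density 0 (d n) (d n * z)))"
   by (rule integral_mult_right_zero[symmetric])
  also have "\<dots> = \<theta> n x"
   unfolding \<theta>_def using d[of n]
   by (intro LI_cong) (auto simp: normal_density_def real_sqrt_mult power_mult_distrib)
  finally show ?thesis .
 qed
 have \<theta>_meas[measurable]: "\<theta> n \<in> bm" for n unfolding \<theta>_def by measurable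
 have \<theta>_int: "intL (%z. indicator {a..b} (x + d n * z) * std_normal_density z)" for n x
  by (rule LI_int_bound[of lborel std_normal_density]) (auto split: split_indicator)
 have \<theta>_bd: "norm (\<theta> n x) \<le> 1" for n x
 proof -
  have "norm (\<theta> n x) \<le> (LI z. norm (indicator {a..b} (x + d n * z) * std_normal_density z))" unfolding \<theta>_def by simp
  also have "\<dots> \<le> (LI z. std_normal_density z)"
   by (intro integral_mono integrable_norm \<theta>_int) (auto split: split_indicator simp: normal_density_nonneg)
  finally show ?thesis by simp
 qed
 \<comment> \<open>At the two endpoints the indicator is discontinuous; they form a null
   set.\<close>
 have \<theta>_lim: "(%n. \<theta> n x) \<longlonglongrightarrow> indicator {a..b} x" if x: "x \<noteq> a" "x \<noteq> b" for x
 proof -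
  have "(%n. \<theta> n x) \<longlonglongrightarrow> (LI z. indicator {a..b} x * std_normal_density z)"
   unfolding \<theta>_def
  proof (rule integral_dominated_convergence[where w=std_normal_density])
   show "AEL z. (%n. indicator {a..b} (x + d n * z) * std_normal_density z) \<longlonglongrightarrow> indicator {a..b} x * std_normal_density z"
   proof (intro AE_I2 tendsto_mult tendsto_const)
    fix z
    have "x \<notin> frontier {a..b}" using x by (auto simp: frontier_def interior_atLeastAtMost_real split: if_splits)
    then have "isCont (indicator {a..b} :: real \<Rightarrow> real) x" by (simp add: isCont_indicator)
    moreover have "(%n. x + d n * z) \<longlonglongrightarrow> x + 0 * z" by (intro tendsto_intros d0)
    ultimately show "(%n. indicator {a..b} (x + d n * z)) \<longlonglongrightarrow> (indicator {a..b} x :: real)"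
     by (intro isCont_tendsto_compose[of x "indicator {a..b}"]) auto
   qed
  qed (auto split: split_indicator simp: normal_density_nonneg)
  then show ?thesis by simp
 qed
 have R: "(%n. LI x. g x * cr (\<theta> n x)) \<longlonglongrightarrow> (LI x. g x * ?h x)"
 proof (rule integral_dominated_convergence[where w="%x. norm (g x)"])
  show "AEL x. (%n. g x * cr (\<theta> n x)) \<longlonglongrightarrow> g x * ?h x"
   using AE_lborel_singleton[of a] AE_lborel_singleton[of b]
  proof eventually_elim
   case (elim x)
   have "(%n. g x * cr (\<theta> n x)) \<longlonglongrightarrow> g x * cr (indicator {a..b} x)"
    by (intro tendsto_intros \<theta>_lim elim)
   then show ?case by (auto split: split_indicator_asm split_indicator)
  qed
  show "AEL x. norm (g x * cr (\<theta> n x)) \<le> norm (g x)" for n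
   using \<theta>_bd[of n] by (intro AE_I2) (simp add: norm_mult mult_left_le)
  show "(%x. g x * ?h x) \<in> borel_measurable lborel" by measurable
 qed (use g in auto)
 have L: "(%n. LI k. ft g k * (cnj (ft ?h k) * cr (gauss (d n) k))) \<longlonglongrightarrow> (LI k. ft g k * cnj (ft ?h k))"
 proof (rule integral_dominated_convergence[where w="%k. norm (ft g k * cnj (ft ?h k))"])
  have "nsq (ft g) < \<infinity>" using nsq_ft_le[OF g] g2 by (rule le_less_trans)
  moreover have "nsq (%k. cnj (ft ?h k)) < \<infinity>" using nsq_ft_interval_fun unfolding nsq_def by simp
  ultimately show "intL (%k. norm (ft g k * cnj (ft ?h k)))"
   by (intro integrable_norm integrable_L2_mult) auto
  show "AEL k. (%n. ft g k * (cnj (ft ?h k) * cr (gauss (d n) k))) \<longlonglongrightarrow> ft g k * cnj (ft ?h k)"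
  proof (rule AE_I2)
   fix k
   have "(%n. ft g k * (cnj (ft ?h k) * cr (gauss (d n) k))) \<longlonglongrightarrow> ft g k * (cnj (ft ?h k) * cr (gauss 0 k))"
    by (intro tendsto_intros d0) auto
   then show "(%n. ft g k * (cnj (ft ?h k) * cr (gauss (d n) k))) \<longlonglongrightarrow> ft g k * cnj (ft ?h k)" by simp
  qed
  show "AEL k. norm (ft g k * (cnj (ft ?h k) * cr (gauss (d n) k))) \<le> norm (ft g k * cnj (ft ?h k))" for n
   by (intro AE_I2) (simp add: norm_mult mult_left_le mult.assoc[symmetric])
  show "(%k. ft g k * cnj (ft ?h k)) \<in> borel_measurable lborel" by measurable
  show "(%k. ft g k * (cnj (ft ?h k) * cr (gauss (d n) k))) \<in> borel_measurable lborel" for n by measurable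
 qed
 have "(LI k. ft g k * (cnj (ft ?h k) * cr (gauss (d n) k))) = (LI x. g x * cr (\<theta> n x))" for n
  unfolding \<theta>_eq[symmetric] by (rule ft_pairing_gauss[OF g interval_fun_integrable d])
 then show ?thesis using LIMSEQ_unique[OF L] R by simp
qed

definition trunc_fun :: "(real \<Rightarrow> real) \<Rightarrow> real \<Rightarrow> real \<Rightarrow> complex"
 where "trunc_fun f R x = indicator {-R..R} x *\<^sub>R cr (f x)"

lemma fourier_trunc_eq: "fourier_trunc R f = ft (trunc_fun f R)"
 by (simp add: fun_eq_iff fourier_trunc_def ft_def trunc_fun_def set_lebesgue_integral_def)

lemma trunc_fun_measurable[measurable]:
 assumes [measurable]: "f \<in> bm"
 shows "trunc_fun f R \<in> bm"
 unfolding trunc_fun_def by measurable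

lemma trunc_fun_integrable:
 assumes "square_integrable f"
 shows "intL (trunc_fun f R)"
proof -
 have [measurable]: "f \<in> bm" and f: "nsq f < \<infinity>" using assms by (auto simp: square_integrable_iff_nsq)
 have "nsq (%x. cr (f x)) < \<infinity>" using f by (simp add: nsq_def)
 then have "intL (%x. cr (f x) * interval_fun (-R) R x)"
  by (intro integrable_L2_mult nsq_interval_fun) auto
 then show ?thesis by (rule Bochner_Integration.integrable_cong[THEN iffD1, rotated 2]) (auto simp: trunc_fun_def split: split_indicator)
qed

lemma nsq_trunc_fun_le: "nsq (trunc_fun f R) \<le> nsq f"
 by (rule nsq_mono_AE[of _ "f", unfolded ]) (auto simp: trunc_fun_def split: split_indicator)

lemma nsq_trunc_fun_tail:
 assumes "square_integrable f"
 shows "((%R. nsq (%x. cr (f x) - trunc_fun f R x)) \<longlongrightarrow> 0) at_top"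
proof -
 have [measurable]: "f \<in> bm" and f: "intL (%x. (f x)\<^sup>2)"
  using assms by (auto simp: square_integrable_def)
 let ?g = "%R x. (norm (cr (f x) - trunc_fun f R x))\<^sup>2"
 have int: "intL (?g R)" for R
  by (rule LI_int_bound[OF f]) (auto simp: trunc_fun_def split: split_indicator)
 have "((%R. LI x. ?g R x) \<longlongrightarrow> (\<integral>x. (0::real) \<partial>(lborel::real measure))) at_top"
 proof (rule tendsto_at_topI_sequentially)
  fix X :: "nat \<Rightarrow> real" assume X: "filterlim X at_top sequentially"
  show "(%n. LI x. ?g (X n) x) \<longlonglongrightarrow> (\<integral>x. 0 \<partial>(lborel::real measure))"
  proof (rule integral_dominated_convergence[where w="%x. (f x)\<^sup>2"])
   show "AEL x. (%n. ?g (X n) x) \<longlonglongrightarrow> 0"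
   proof (rule AE_I2)
    fix x
    have "\<forall>\<^sub>F R in at_top. ?g R x = 0"
     using eventually_ge_at_top[of "\<bar>x\<bar>"] by eventually_elim (auto simp: trunc_fun_def split: split_indicator)
    then have "((%R. ?g R x) \<longlongrightarrow> 0) at_top" by (rule tendsto_eventually)
    then show "(%n. ?g (X n) x) \<longlonglongrightarrow> 0" by (rule filterlim_compose[OF _ X])
   qed
   show "AEL x. norm (?g (X n) x) \<le> (f x)\<^sup>2" for n
    by (intro AE_I2) (auto simp: trunc_fun_def split: split_indicator)
  qed (use f in auto)
 qed
 then have "((%R. ennreal (LI x. ?g R x)) \<longlongrightarrow> ennreal 0) at_top" by (intro tendsto_ennrealI) simp
 then show ?thesis unfolding nsq_def using int by (simp add: nn_integral_eq_integral)
qed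

lemma ft_diff: "intL f ==> intL g ==> ft (%x. f x - g x) k = ft f k - ft g k"
 unfolding ft_def by (subst right_diff_distrib[symmetric], subst LI_diff[symmetric]) (auto simp: left_diff_distrib intro: ft_integrand[simplified])

lemma nsq_tail_eventually:
 assumes "square_integrable f"
 shows "\<exists>R. \<forall>r\<ge>R. nsq (%x. cr (f x) - trunc_fun f r x) \<le> ennreal ((1/4)^n)"
 using order_tendstoD(2)[OF nsq_trunc_fun_tail[OF assms], of "ennreal ((1/4)^n)"]
 by (auto simp: eventually_at_top_linorder intro: less_imp_le)

text \<open>By \<open>nsq_ft_le\<close> the transforms of the truncations are as close as the
  truncations themselves. Completeness comes from \<open>L2_limit_joint\<close> with a dummy
  parameter.\<close>

lemma has_fourier_exists:
 assumes sq: "square_integrable f"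
 shows "\<exists>F. has_fourier f F"
proof -
 have [measurable]: "f \<in> bm" using sq by (auto simp: square_integrable_iff_nsq)
 let ?t = "%r x. cr (f x) - trunc_fun f r x"
 obtain R where R: "!!n r. r \<ge> R n ==> nsq (?t r) \<le> ennreal ((1/4)^n)"
  using nsq_tail_eventually[OF sq] by metis
 define S where "S n = max (R n) (R (Suc n))" for n
 have diff: "nsq (%k. ft (trunc_fun f r) k - ft (trunc_fun f s) k) \<le> ennreal (4 * (1/4)^n)" if "r \<ge> R n" "s \<ge> R n" for r s n
 proof -
  have "(%k. ft (trunc_fun f r) k - ft (trunc_fun f s) k) = ft (%x. trunc_fun f r x - trunc_fun f s x)"
   using ft_diff[OF trunc_fun_integrable[OF sq] trunc_fun_integrable[OF sq]] by (simp add: fun_eq_iff)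
  then have "nsq (%k. ft (trunc_fun f r) k - ft (trunc_fun f s) k) \<le> nsq (%x. trunc_fun f r x - trunc_fun f s x)"
   using nsq_ft_le[of "%x. trunc_fun f r x - trunc_fun f s x"] trunc_fun_integrable[OF sq] by simp
  also have "\<dots> \<le> 2 * nsq (%x. trunc_fun f r x - cr (f x)) + 2 * nsq (?t s)"
   by (rule nsq_triangle) auto
  also have "nsq (%x. trunc_fun f r x - cr (f x)) = nsq (?t r)" by (rule nsq_minus_commute)
  also have "2 * nsq (?t r) + 2 * nsq (?t s) \<le> 2 * ennreal ((1/4)^n) + 2 * ennreal ((1/4)^n)"
   by (intro add_mono mult_left_mono R that) auto
  finally show ?thesis by (subst (asm) ennreal_2_sum) auto
 qed
 \<comment> \<open>Running maxima, so that M n and M (n + 1) both lie beyond the threshold for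
   accuracy 4^-n.\<close>
 define M where "M n = Max (R ` {..n})" for n
 have M: "M n \<ge> R n" "M (Suc n) \<ge> R n" for n by (auto simp: M_def)
 define u where "u n (t::real) = ft (trunc_fun f (M n))" for n t
 obtain U where U: "case_prod U \<in> bm2"
  "!!n t. t \<in> UNIV ==> nsq (%k. u n t k - U t k) \<le> ennreal (4 * 4 * (1/4)^n)"
 proof (rule L2_limit_joint[of u 4 UNIV])
  show "case_prod (u n) \<in> bm2" for n unfolding u_def by measurable
  show "nsq (%k. u (Suc n) t k - u n t k) \<le> ennreal (4 * (1/4)^n)" for n t
   unfolding u_def by (rule diff) (use M in auto)
 qed auto
 define F where "F = U 0"
 have [measurable]: "F \<in> bm" unfolding F_def using measurable_compose[OF measurable_Pair1' U(1)] by simp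
 have near: "nsq (%k. F k - ft (trunc_fun f r) k) \<le> ennreal (40 * (1/4)^n)" if "r \<ge> R n" for r n
 proof -
  have "nsq (%k. F k - ft (trunc_fun f r) k) \<le> 2 * nsq (%k. F k - ft (trunc_fun f (M n)) k) + 2 * nsq (%k. ft (trunc_fun f (M n)) k - ft (trunc_fun f r) k)"
   by (rule nsq_triangle) auto
  also have "\<dots> \<le> 2 * ennreal (4 * 4 * (1/4)^n) + 2 * ennreal (4 * (1/4)^n)"
   using U(2)[of 0 n] M that by (intro add_mono mult_left_mono diff) (auto simp: F_def u_def nsq_minus_commute[of "U 0"])
  also have "\<dots> = ennreal (40 * (1/4)^n)" by (subst ennreal_2_sum) auto
  finally show ?thesis .
 qed
 have "nsq F \<le> 2 * nsq (%k. F k - ft (trunc_fun f (R 0)) k) + 2 * nsq (ft (trunc_fun f (R 0)))"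
  using nsq_add_le[of "%k. F k - ft (trunc_fun f (R 0)) k" "ft (trunc_fun f (R 0))"] by simp
 also have "\<dots> \<le> 2 * ennreal (40 * (1/4)^0) + 2 * nsq f"
  using near[of 0 "R 0"] nsq_ft_le[OF trunc_fun_integrable[OF sq]] nsq_trunc_fun_le[of f]
  by (intro add_mono mult_left_mono) (auto intro: order_trans)
 also have "\<dots> < \<infinity>" using sq by (simp add: square_integrable_iff_nsq ennreal_mult_less_top)
 finally have sF: "square_integrable F" by (simp add: square_integrable_iff_nsq)
 have "((%r. nsq (%k. F k - ft (trunc_fun f r) k)) \<longlongrightarrow> 0) at_top"
 proof (rule order_tendstoI)
  fix e :: ennreal assume e: "0 < e"
  have "(%n. ennreal (40 * (1/4)^n)) \<longlonglongrightarrow> ennreal (40 * 0)"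
   by (intro tendsto_ennrealI tendsto_intros LIMSEQ_power_zero) auto
  then have "\<forall>\<^sub>F n in sequentially. ennreal (40 * (1/4)^n) < e" by (rule order_tendstoD) (use e in auto)
  then obtain n where "ennreal (40 * (1/4)^n) < e" by (auto simp: eventually_sequentially)
  then show "\<forall>\<^sub>F r in at_top. nsq (%k. F k - ft (trunc_fun f r) k) < e"
   using near[of n] unfolding eventually_at_top_linorder by (meson le_less_trans)
 qed auto
 then have "has_fourier f F" using sF unfolding has_fourier_def fourier_trunc_eq nsq_def by simp
 then show ?thesis by (rule exI[of _ F])
qed

lemma has_fourier_fourier: "square_integrable f ==> has_fourier f (fourier f)"
 unfolding fourier_def by (rule someI_ex[of "has_fourier f"]) (rule has_fourier_exists)

lemma has_fourier_limit: "has_fourier f F ==> ((%r. nsq (%k. F k - ft (trunc_fun f r) k)) \<longlongrightarrow> 0) at_top"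
 unfolding has_fourier_def fourier_trunc_eq nsq_def by simp

lemma has_fourier_L2: "has_fourier f F ==> F \<in> bm \<and> nsq F < \<infinity>"
 by (simp add: has_fourier_def square_integrable_iff_nsq)

text \<open>The integrals of f over intervals can be read off from any transform of f: this is the
  injectivity of the transform.\<close>

lemma has_fourier_pair:
 assumes sq: "square_integrable f" and F: "has_fourier f F"
 shows "(LI k. F k * cnj (ft (interval_fun a b) k)) = (LI x. cr (f x) * interval_fun a b x)"
proof -
 have [measurable]: "f \<in> bm" "F \<in> bm"
  using sq has_fourier_L2[OF F] by (auto simp: square_integrable_iff_nsq)
 have f: "nsq f < \<infinity>" using sq by (simp add: square_integrable_iff_nsq)
 let ?h = "interval_fun a b"
 have "((%r. LI k. ft (trunc_fun f r) k * cnj (ft ?h k)) \<longlongrightarrow> (LI k. F k * cnj (ft ?h k))) at_top"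
 proof (rule nsq_pair_tendsto[OF _ _ _ _ _ has_fourier_limit[OF F]])
  show "nsq (%k. cnj (ft ?h k)) < \<infinity>" using nsq_ft_interval_fun unfolding nsq_def by simp
  show "nsq F < \<infinity>" using has_fourier_L2[OF F] by simp
 qed auto
 moreover have "\<forall>\<^sub>F r in at_top. (LI k. ft (trunc_fun f r) k * cnj (ft ?h k)) = (LI x. cr (f x) * ?h x)"
  using eventually_ge_at_top[of "max \<bar>a\<bar> \<bar>b\<bar>"]
 proof eventually_elim
  case (elim r)
  have "(LI k. ft (trunc_fun f r) k * cnj (ft ?h k)) = (LI x. trunc_fun f r x * ?h x)"
   using nsq_trunc_fun_le[of f r] f by (intro ft_pairing trunc_fun_integrable sq) (rule le_less_trans)
  also have "\<dots> = (LI x. cr (f x) * ?h x)"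
   using elim by (intro LI_cong) (auto simp: trunc_fun_def split: split_indicator)
  finally show ?case .
 qed
 then have "((%r. LI k. ft (trunc_fun f r) k * cnj (ft ?h k)) \<longlongrightarrow> (LI x. cr (f x) * ?h x)) at_top"
  by (rule tendsto_eventually)
 ultimately show ?thesis by (rule tendsto_unique[rotated]) simp
qed

text \<open>The dual reading: the integrals of the transform over intervals are determined by f, by
  which a candidate for the transform is verified.\<close>

lemma has_fourier_dual_pair:
 assumes sq: "square_integrable f" and F: "has_fourier f F"
 shows "(LI k. F k * interval_fun a b k) = (LI x. cr (f x) * ft (interval_fun a b) x)"
proof -
 have [measurable]: "f \<in> bm" "F \<in> bm"
  using sq has_fourier_L2[OF F] by (auto simp: square_integrable_iff_nsq)
 have f: "nsq f < \<infinity>" using sq by (simp add: square_integrable_iff_nsq)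
 let ?h = "interval_fun a b"
 have "((%r. LI k. ft (trunc_fun f r) k * ?h k) \<longlongrightarrow> (LI k. F k * ?h k)) at_top"
 proof (rule nsq_pair_tendsto[OF _ _ _ _ _ has_fourier_limit[OF F]])
  show "nsq F < \<infinity>" using has_fourier_L2[OF F] by simp
  show "nsq ?h < \<infinity>" by (rule nsq_interval_fun)
 qed auto
 moreover have "((%r. LI x. trunc_fun f r x * ft ?h x) \<longlongrightarrow> (LI x. cr (f x) * ft ?h x)) at_top"
 proof (rule nsq_pair_tendsto[OF _ _ _ _ _ nsq_trunc_fun_tail[OF sq]])
  show "nsq (%x. cr (f x)) < \<infinity>" using f unfolding nsq_def by simp
  show "nsq (ft ?h) < \<infinity>" by (rule nsq_ft_interval_fun)
 qed auto
 moreover have "(LI k. ft (trunc_fun f r) k * ?h k) = (LI x. trunc_fun f r x * ft ?h x)" for r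
  by (intro ft_multiplication trunc_fun_integrable sq) simp
 ultimately show ?thesis by (intro tendsto_unique[of at_top]) auto
qed

lemma AE_eq_of_interval_integrals:
 fixes F G :: cfun
 assumes "F \<in> bm" "G \<in> bm" "nsq F < \<infinity>" "nsq G < \<infinity>"
  and eq: "!!a b. (LI k. F k * interval_fun a b k) = (LI k. G k * interval_fun a b k)"
 shows "AEL k. F k = G k"
proof -
 have [measurable]: "F \<in> bm" "G \<in> bm" by fact+
 have iF: "intL (%k. F k * interval_fun a b k)" for a b by (intro integrable_L2_mult nsq_interval_fun assms) auto
 have iG: "intL (%k. G k * interval_fun a b k)" for a b by (intro integrable_L2_mult nsq_interval_fun assms) auto
 have *: "indicator {a..b} k *\<^sub>R (F k - G k) = F k * interval_fun a b k - G k * interval_fun a b k" for a b k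
  by (auto split: split_indicator)
 have "AEL k. F k - G k = 0"
 proof (rule AE_zero_intervals)
  show "set_integrable lborel {a..b} (%k. F k - G k)" for a b
   unfolding set_integrable_def * using iF iG by simp
  show "(LINT k:{a..b}|lborel. F k - G k) = 0" if "a \<le> b" for a b
   unfolding set_lebesgue_integral_def * using iF iG eq by simp
 qed
 then show ?thesis by simp
qed

section \<open>Real functions represented by integrable hermitian transforms\<close>

definition nice :: "cfun \<Rightarrow> bool"
 where "nice F \<longleftrightarrow> intL F \<and> nsq F < \<infinity> \<and> (\<forall>k. F (- k) = cnj (F k))"

lemma nice_measurable: "nice F ==> F \<in> bm"
 by (auto simp: nice_def)

text \<open>The inverse transform. Taking the real part only fixes the type: for hermitian F the
  integral is real by \<open>of_real_ir\<close>.\<close>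

definition ir :: "cfun \<Rightarrow> real \<Rightarrow> real"
 where "ir F x = Re (ft F (- x))"

lemma ft_reflect: "ft (%x. g (- x)) k = ft g (- k)"
 unfolding ft_def using integral_reflect_real[of "%x. g x * exp (- \<i> * cr (- k * x))"] by simp

lemma of_real_ir:
 assumes "nice F"
 shows "cr (ir F x) = ft F (- x)"
proof -
 have "cnj (ft F (- x)) = ft (%k. F (- k)) x" using assms by (simp add: cnj_ft nice_def)
 also have "\<dots> = ft F (- x)" by (rule ft_reflect)
 finally show ?thesis unfolding ir_def by (simp add: complex_eq_iff)
qed

lemma ir_measurable[measurable]: "F \<in> bm ==> ir F \<in> bm"
proof -
 assume [measurable]: "F \<in> bm"
 have [measurable]: "(uminus :: real \<Rightarrow> real) \<in> bm"
  by (intro borel_measurable_continuous_onI continuous_intros)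
 show ?thesis unfolding ir_def by measurable
qed

lemma nsq_ir_le:
 assumes "nice F"
 shows "nsq (ir F) \<le> nsq F"
proof -
 have [measurable]: "F \<in> bm" using assms by (rule nice_measurable)
 have "nsq (ir F) = nsq (%x. cr (ir F x))" by (simp add: nsq_def)
 also have "\<dots> = nsq (ft F)" unfolding of_real_ir[OF assms] by (rule nsq_reflect) simp
 also have "\<dots> \<le> nsq F" using assms by (intro nsq_ft_le) (simp add: nice_def)
 finally show ?thesis .
qed

lemma square_integrable_ir: "nice F ==> square_integrable (ir F)"
 unfolding square_integrable_iff_nsq using nsq_ir_le[of F] nice_measurable[of F] by (auto simp: nice_def intro: le_less_trans)

text \<open>Inversion, tested on intervals: the dual pairing turns the left side into a pairing of
  two transforms, and Parseval turns that back into the integral of F.\<close>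

lemma fourier_ir:
 assumes nF: "nice F"
 shows "AEL k. fourier (ir F) k = F k"
proof -
 note sq = square_integrable_ir[OF nF]
 note hf = has_fourier_fourier[OF sq]
 have F: "F \<in> bm" "nsq F < \<infinity>" "intL F" using nF by (auto simp: nice_def)
 show ?thesis
 proof (rule AE_eq_of_interval_integrals)
  fix a b
  let ?h = "interval_fun a b"
  have "(%x. cnj (?h x)) = ?h" by (auto split: split_indicator)
  then have c: "cnj (ft ?h (- x)) = ft ?h x" for x by (simp only: cnj_ft minus_minus)
  have "(LI k. fourier (ir F) k * ?h k) = (LI x. cr (ir F x) * ft ?h x)"
   by (rule has_fourier_dual_pair[OF sq hf])
  also have "\<dots> = (LI x. ft F (- x) * cnj (ft ?h (- x)))" unfolding of_real_ir[OF nF] c ..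
  also have "\<dots> = (LI k. ft F k * cnj (ft ?h k))" by (rule integral_reflect_real)
  also have "\<dots> = (LI k. F k * ?h k)" by (rule ft_pairing) (use F in auto)
  finally show "(LI k. fourier (ir F) k * ?h k) = (LI k. F k * ?h k)" .
 qed (use has_fourier_L2[OF hf] F in auto)
qed

lemma AE_eq_of_fourier_eq:
 assumes f: "square_integrable f" and g: "square_integrable g" and eq: "AEL k. fourier f k = fourier g k"
 shows "AEL x. f x = g x"
proof -
 note hf = has_fourier_fourier[OF f] and hg = has_fourier_fourier[OF g]
 have [measurable]: "f \<in> bm" "g \<in> bm"
  "fourier f \<in> bm" "fourier g \<in> bm"
  using f g has_fourier_L2[OF hf] has_fourier_L2[OF hg] by (auto simp: square_integrable_iff_nsq)
 have "AEL x. cr (f x) = cr (g x)"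
 proof (rule AE_eq_of_interval_integrals)
  show "nsq (%x. cr (f x)) < \<infinity>" "nsq (%x. cr (g x)) < \<infinity>"
   using f g by (auto simp: square_integrable_iff_nsq nsq_def)
  fix a b
  show "(LI x. cr (f x) * interval_fun a b x) = (LI x. cr (g x) * interval_fun a b x)"
   unfolding has_fourier_pair[OF f hf, symmetric] has_fourier_pair[OF g hg, symmetric]
   by (intro integral_cong_AE) (use eq in \<open>auto elim!: eventually_mono\<close>)
 qed auto
 then show ?thesis by simp
qed

text \<open>Equality of functions and not only almost everywhere: the truncated integrals agree for
  every k, hence the predicates \<open>has_fourier f\<close> and \<open>has_fourier g\<close>
  coincide and the choice operator returns the same function.\<close>

lemma fourier_cong_AE:
 assumes "f \<in> bm" "g \<in> bm" "AEL x. f x = g x"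
 shows "fourier f = fourier g"
proof -
 have [measurable]: "f \<in> bm" "g \<in> bm" by fact+
 have "fourier_trunc R f k = fourier_trunc R g k" for R k
  unfolding fourier_trunc_def set_lebesgue_integral_def
  by (intro arg_cong2[where f="(*)"] refl integral_cong_AE) (use assms(3) in \<open>auto elim!: eventually_mono\<close>)
 then have "has_fourier f = has_fourier g" by (simp add: fun_eq_iff has_fourier_def)
 then show ?thesis by (simp add: fourier_def)
qed

text \<open>A relation rather than a map, since the operators of the statement return unspecified
  representatives. Any two functions representing the same F agree almost everywhere.\<close>

definition rep :: "(real \<Rightarrow> real) \<Rightarrow> cfun \<Rightarrow> bool"
 where "rep u F \<longleftrightarrow> u \<in> bm \<and> nice F \<and> (AEL x. u x = ir F x)"

lemma rep_ir: "nice F ==> rep (ir F) F"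
 by (simp add: rep_def nice_measurable ir_measurable)

lemma rep_nice: "rep u F ==> nice F"
 by (simp add: rep_def)

lemma rep_fourier: "rep u F ==> AEL k. fourier u k = F k"
 using fourier_cong_AE[of u "ir F"] fourier_ir[of F] nice_measurable[of F] by (auto simp: rep_def ir_measurable)

lemma nsq_rep: "rep u F ==> nsq u \<le> nsq F"
proof -
 assume r: "rep u F"
 have "nsq u = nsq (ir F)" by (rule nsq_cong_AE) (use r in \<open>auto simp: rep_def elim!: eventually_mono\<close>)
 then show ?thesis using nsq_ir_le[of F] r by (simp add: rep_def)
qed

lemma rep_square_integrable: "rep u F ==> square_integrable u"
 using nsq_rep[of u F] unfolding square_integrable_iff_nsq by (auto simp: rep_def nice_def intro: le_less_trans)

lemma repI:
 assumes "square_integrable u" "nice F" "AEL k. fourier u k = F k"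
 shows "rep u F"
proof -
 have "AEL k. fourier u k = fourier (ir F) k"
  using assms(3) fourier_ir[OF assms(2)] by eventually_elim simp
 then have "AEL x. u x = ir F x" by (rule AE_eq_of_fourier_eq[OF assms(1) square_integrable_ir[OF assms(2)]])
 then show ?thesis using assms by (auto simp: rep_def square_integrable_iff_nsq)
qed

lemma ft_cong_AE:
 assumes "F \<in> bm" "G \<in> bm" "AEL k. F k = G k"
 shows "ft F = ft G"
proof
 fix k
 have [measurable]: "F \<in> bm" "G \<in> bm" by fact+
 show "ft F k = ft G k" unfolding ft_def
  by (intro arg_cong2[where f="(*)"] refl integral_cong_AE) (use assms(3) in \<open>auto elim!: eventually_mono\<close>)
qed

lemma rep_cong:
 assumes "rep u F" "AEL k. F k = G k" "nice G"
 shows "rep u G"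
 using assms ft_cong_AE[of F G] nice_measurable[of F] nice_measurable[of G] by (auto simp: rep_def ir_def)

lemma rep_cong_fun:
 assumes "rep u F" "AEL x. v x = u x" "v \<in> bm"
 shows "rep v F"
 using assms by (auto simp: rep_def elim!: eventually_elim2)

lemma rep_AE_eq: "rep u F ==> rep v F ==> AEL x. u x = v x"
 by (auto simp: rep_def elim!: eventually_elim2)

lemma ft_add: "intL f ==> intL g ==> ft (%x. f x + g x) k = ft f k + ft g k"
 unfolding ft_def by (subst distrib_left[symmetric], subst LI_add[symmetric]) (auto simp: distrib_right intro: ft_integrand[simplified])

lemma ft_cmult: "ft (%x. c * f x) k = c * ft f k"
 unfolding ft_def by (simp add: mult.assoc mult.left_commute)

lemma nice_add: "nice F ==> nice G ==> nice (%k. F k + G k)"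
 using nsq_add_le[of F G] by (auto simp: nice_def ennreal_mult_less_top intro: le_less_trans)

lemma nice_scale: "nice F ==> nice (%k. cr c * F k)"
 using nsq_scale[of F "cr c"] by (auto simp: nice_def ennreal_mult_less_top)

lemma rep_add:
 assumes "rep u F" "rep v G"
 shows "rep (%x. u x + v x) (%k. F k + G k)"
proof -
 have "AEL x. u x + v x = ir (%k. F k + G k) x"
 proof -
  have "ir (%k. F k + G k) x = ir F x + ir G x" for x
   using assms by (simp add: ir_def rep_def nice_def ft_add)
  moreover have "AEL x. u x = ir F x" "AEL x. v x = ir G x" using assms by (auto simp: rep_def)
  ultimately show ?thesis by (auto elim!: eventually_elim2)
 qed
 then show ?thesis using assms by (auto simp: rep_def nice_add intro!: borel_measurable_add)
qed

lemma rep_scale: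
 assumes "rep u F"
 shows "rep (%x. c * u x) (%k. cr c * F k)"
proof -
 have "ir (%k. cr c * F k) x = c * ir F x" for x by (simp add: ir_def ft_cmult)
 then show ?thesis using assms by (auto simp: rep_def nice_scale elim!: eventually_mono)
qed

lemma rep_uminus: "rep u F ==> rep (%x. - u x) (%k. - F k)"
 using rep_scale[of u F "-1"] by simp

lemma rep_diff: "rep u F ==> rep v G ==> rep (%x. u x - v x) (%k. F k - G k)"
 using rep_add[OF _ rep_uminus, of u F v G] by simp

text \<open>The choice in \<open>fourier_multiplier\<close> has a witness, namely the inverse
  transform of m F; whichever function is chosen then has the transform m F and is represented by
  it.\<close>

lemma rep_multiplier:
 assumes u: "rep u F" and m: "nice (%k. m k * F k)"
 shows "rep (fourier_multiplier m u) (%k. m k * F k)"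
proof -
 let ?P = "%g. square_integrable g \<and> (AEL k. fourier g k = m k * fourier u k)"
 have uF: "AEL k. fourier u k = F k" by (rule rep_fourier[OF u])
 have "?P (ir (%k. m k * F k))"
  using square_integrable_ir[OF m] fourier_ir[OF m] uF by (auto elim!: eventually_elim2)
 then have "?P (fourier_multiplier m u)" unfolding fourier_multiplier_def by (rule someI[of ?P])
 then show ?thesis
  using uF by (intro repI m) (auto elim!: eventually_elim2)
qed

text \<open>The product of two transforms carries the normalising factor twice, a single transform
  once; this is the origin of the constant \<open>c\<^sub>F\<close> in the quadratic terms.\<close>

lemma ft_conv:
 assumes F: "intL F" and G: "intL G"
 shows "cr (1 / sqrt (2 * pi)) * ft (conv F G) x = ft F x * ft G x"
proof -
 have [measurable]: "F \<in> bm" "G \<in> bm" using F G by auto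
 define e where "e y = exp (- \<i> * cr (x * y))" for y
 have e[measurable]: "e \<in> bm" unfolding e_def by measurable
 have e1: "norm (e y) = 1" for y unfolding e_def by simp
 have e2: "e (y + z) = e y * e z" for y z unfolding e_def by (simp add: distrib_left exp_add[symmetric])
 have fin: "(NN k l. ennreal (norm (F (k - l) * G l * e k))) < \<infinity>"
 proof -
  have "(NN k l. ennreal (norm (F (k - l) * G l * e k)))
   = (NN k l. ennreal (norm (F (k - l))) * ennreal (norm (G l)))"
   by (simp add: norm_mult e1 ennreal_mult)
  also have "\<dots> = (NN x. ennreal (norm (F x))) * (NN x. ennreal (norm (G x)))"
   by (rule nn_convolution) auto
  also have "\<dots> < \<infinity>" using F G by (simp add: integrable_iff_bounded ennreal_mult_less_top)
  finally show ?thesis .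
 qed
 have "(LI k. conv F G k * e k) = (LI k l. F (k - l) * G l * e k)"
  by (simp add: conv_def)
 also have "\<dots> = (LI l k. F (k - l) * G l * e k)"
  by (rule Fubini_bochner[OF _ fin]) measurable
 also have "\<dots> = (LI l. G l * e l * (LI k. F k * e k))"
 proof (rule LI_cong[OF refl])
  fix l
  have "(LI k. F (k - l) * G l * e k) = (LI k. F (l + k - l) * G l * e (l + k))"
   using lborel_integral_real_affine[of 1 "%k. F (k - l) * G l * e k" l] by simp
  also have "\<dots> = (LI k. (G l * e l) * (F k * e k))" by (simp add: e2 ac_simps)
  finally show "(LI k. F (k - l) * G l * e k) = G l * e l * (LI k. F k * e k)" by simp
 qed
 also have "\<dots> = (LI k. F k * e k) * (LI l. G l * e l)" by simp
 finally show ?thesis unfolding ft_def e_def[symmetric] by simp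
qed

abbreviation conv_const :: complex ("c\<^sub>F") where "c\<^sub>F \<equiv> cr (1 / sqrt (2 * pi))"

lemma nice_conv:
 assumes F: "nice F" and G: "nice G"
 shows "nice (conv F G)"
proof -
 have "nsq (conv F G) \<le> (NN x. ennreal (norm (F x)))\<^sup>2 * nsq G"
  using F G by (intro nsq_conv) (auto simp: nice_def)
 also have "\<dots> < \<infinity>" using F G by (auto simp: nice_def integrable_iff_bounded ennreal_mult_less_top power_less_top_ennreal)
 finally show ?thesis using F G conv_integrable[of F G] conv_hermitian[of F G] by (auto simp: nice_def)
qed

lemma rep_mult:
 assumes u: "rep u F" and v: "rep v G"
 shows "rep (%x. u x * v x) (%k. c\<^sub>F * conv F G k)"
proof -
 have n: "nice (%k. c\<^sub>F * conv F G k)" using u v by (intro nice_scale nice_conv) (auto simp: rep_def)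
 have F: "nice F" and G: "nice G" using u v by (auto simp: rep_def)
 have "cr (ir (%k. c\<^sub>F * conv F G k) x) = cr (ir F x * ir G x)" for x
 proof -
  have "cr (ir (%k. c\<^sub>F * conv F G k) x) = ft F (-x) * ft G (-x)"
   unfolding of_real_ir[OF n] ft_cmult using F G by (intro ft_conv) (auto simp: nice_def)
  then show ?thesis by (simp add: of_real_ir[OF F] of_real_ir[OF G])
 qed
 then have eq: "ir (%k. c\<^sub>F * conv F G k) x = ir F x * ir G x" for x by (simp only: of_real_eq_iff)
 have "AEL x. u x = ir F x" "AEL x. v x = ir G x" using u v by (auto simp: rep_def)
 then have "AEL x. u x * v x = ir (%k. c\<^sub>F * conv F G k) x"
  by eventually_elim (simp only: eq)
 then show ?thesis using n u v by (auto simp: rep_def)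
qed

section \<open>Test functions and weak derivatives\<close>

text \<open>The flat function exp(-1/x) together with its multiples by powers of 1/x: derivatives of
  members are linear combinations of members, so smoothness needs no separate induction on the order
  of the derivative.\<close>

definition expinv :: "nat \<Rightarrow> real \<Rightarrow> real"
 where "expinv n x = (if x > 0 then exp (- inverse x) * inverse x ^ n else 0)"

lemma expinv_lim: "(expinv n \<longlongrightarrow> 0) (at 0)"
proof -
 have "((%x. (inverse x) ^ n / exp (inverse x)) \<longlongrightarrow> 0) (at_right (0::real))"
  by (rule filterlim_compose[OF tendsto_power_div_exp_0 filterlim_inverse_at_top_right])
 then have r: "(expinv n \<longlongrightarrow> 0) (at_right 0)"
  by (rule Lim_transform_eventually) (auto simp: expinv_def exp_minus field_simps eventually_at_right_field intro!: exI[of _ 1])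
 have "\<forall>\<^sub>F x in at_left 0. expinv n x = 0"
  by (auto simp: eventually_at_left_field expinv_def intro!: exI[of _ "-1"])
 then have l: "(expinv n \<longlongrightarrow> 0) (at_left 0)" by (rule tendsto_eventually)
 show ?thesis using l r by (simp add: filterlim_at_split)
qed

lemma expinv_has_derivative:
 "(expinv n has_field_derivative (expinv (n + 2) x - real n * expinv (n + 1) x)) (at x)"
proof -
 consider "x > 0" | "x < 0" | "x = 0" by linarith
 then show ?thesis
 proof cases
  case 1
  have "((%x. exp (- inverse x) * inverse x ^ n) has_field_derivative (exp (- inverse x) * inverse x ^ (n + 2) - real n * (exp (- inverse x) * inverse x ^ (n + 1)))) (at x)"
  proof -
   have "((%x. inverse x ^ n) has_field_derivative (- real n * inverse x ^ (n + 1))) (at x)"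
   proof (induction n)
    case (Suc n)
    have "((%x. inverse x * inverse x ^ n) has_field_derivative (inverse x * (- real n * inverse x ^ (n + 1)) + (- inverse x * inverse x) * inverse x ^ n)) (at x)"
     using 1 by (intro DERIV_mult' Suc.IH) (auto intro!: derivative_eq_intros simp: power2_eq_square)
    then show ?case by (simp add: algebra_simps)
   qed simp
   moreover have "((%x. exp (- inverse x)) has_field_derivative (exp (- inverse x) * (inverse x * inverse x))) (at x)"
    using 1 by (auto intro!: derivative_eq_intros simp: power2_eq_square)
   ultimately have "((%x. exp (- inverse x) * inverse x ^ n) has_field_derivative (exp (- inverse x) * (- real n * inverse x ^ (n + 1)) + exp (- inverse x) * (inverse x * inverse x) * inverse x ^ n)) (at x)"
    by (intro DERIV_mult')
   then show ?thesis by (simp add: algebra_simps power2_eq_square)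
  qed
  then have "((%x. exp (- inverse x) * inverse x ^ n) has_field_derivative (expinv (n + 2) x - real n * expinv (n + 1) x)) (at x)"
   using 1 by (simp add: expinv_def)
  then show ?thesis
   by (rule has_field_derivative_transform_within_open[where S="{0<..}"]) (use 1 in \<open>auto simp: expinv_def\<close>)
 next
  case 2
  have "((%x. 0) has_field_derivative 0) (at x)" by simp
  then have "(expinv n has_field_derivative 0) (at x)"
   by (rule has_field_derivative_transform_within_open[where S="{..<0}"]) (use 2 in \<open>auto simp: expinv_def\<close>)
  then show ?thesis using 2 by (simp add: expinv_def)
 next
  case 3
  \<comment> \<open>At the origin the difference quotient of a member is the next member, which
    tends to 0.\<close>
  have "(%h. (expinv n (0 + h) - expinv n 0) / h) = expinv (Suc n)"
   by (auto simp: fun_eq_iff expinv_def field_simps)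
  then have "(expinv n has_field_derivative 0) (at 0)"
   unfolding DERIV_def using expinv_lim[of "Suc n"] by simp
  then show ?thesis using 3 by (simp add: expinv_def)
 qed
qed

text \<open>A class of functions closed under differentiation, hence of smooth functions.\<close>

inductive smooth_fun :: "(real \<Rightarrow> real) \<Rightarrow> bool" where
 const: "smooth_fun (%x. c)"
| expinv: "smooth_fun (%x. expinv n (a * x + b))"
| add: "smooth_fun f ==> smooth_fun g ==> smooth_fun (%x. f x + g x)"
| mult: "smooth_fun f ==> smooth_fun g ==> smooth_fun (%x. f x * g x)"

lemma smooth_fun_has_derivative:
 "smooth_fun f ==> \<exists>f'. smooth_fun f' \<and> (\<forall>x. (f has_field_derivative f' x) (at x))"
proof (induction rule: smooth_fun.induct)
 case (const c)
 then show ?case by (intro exI[of _ "%x. 0"]) (auto intro: smooth_fun.const)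
next
 case (expinv n a b)
 let ?f' = "%x. a * (expinv (n + 2) (a * x + b) + (- real n) * expinv (n + 1) (a * x + b))"
 have "smooth_fun ?f'" by (intro smooth_fun.intros)
 moreover have "((%x. expinv n (a * x + b)) has_field_derivative ?f' x) (at x)" for x
 proof -
  have "((%x. a * x + b) has_field_derivative a) (at x)" by (auto intro!: derivative_eq_intros)
  from DERIV_chain2[OF expinv_has_derivative this, of n] show ?thesis by (simp add: algebra_simps)
 qed
 ultimately show ?case by blast
next
 case (add f g)
 then obtain f' g' where "smooth_fun f'" "smooth_fun g'" "!!x. (f has_field_derivative f' x) (at x)" "!!x. (g has_field_derivative g' x) (at x)"
  by blast
 then show ?case by (intro exI[of _ "%x. f' x + g' x"]) (auto intro!: smooth_fun.intros derivative_eq_intros)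
next
 case (mult f g)
 then obtain f' g' where *: "smooth_fun f'" "smooth_fun g'" "!!x. (f has_field_derivative f' x) (at x)" "!!x. (g has_field_derivative g' x) (at x)"
  by blast
 then show ?case using mult
  by (intro exI[of _ "%x. f' x * g x + g' x * f x"]) (auto intro!: smooth_fun.intros derivative_eq_intros)
qed

lemma smooth_fun_deriv:
 assumes "smooth_fun f"
 shows "smooth_fun (deriv f)" "(f has_field_derivative deriv f x) (at x)"
proof -
 obtain f' where f': "smooth_fun f'" "!!x. (f has_field_derivative f' x) (at x)"
  using smooth_fun_has_derivative[OF assms] by blast
 then have "deriv f = f'" by (auto intro: DERIV_imp_deriv)
 then show "smooth_fun (deriv f)" "(f has_field_derivative deriv f x) (at x)" using f' by auto
qed

lemma smooth_fun_funpow_deriv: "smooth_fun f ==> smooth_fun ((deriv ^^ n) f)"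
 by (induction n) (auto intro: smooth_fun_deriv)

lemma smooth_fun_differentiable: "smooth_fun f ==> ((deriv ^^ n) f) field_differentiable (at x)"
 using smooth_fun_deriv(2)[OF smooth_fun_funpow_deriv] field_differentiable_def by blast

text \<open>The parameter s steepens the flanks: for s -> \<infinity> the bump tends to 1 inside (a,
  b) and stays 0 outside, so integrals against bumps converge to integrals over the
  interval.\<close>

definition bump :: "real \<Rightarrow> real \<Rightarrow> real \<Rightarrow> real \<Rightarrow> real"
 where "bump s a b x = expinv 0 (s * (x - a)) * expinv 0 (s * (b - x))"

lemma smooth_bump: "smooth_fun (bump s a b)"
proof -
 have "smooth_fun (%x. expinv 0 (s * x + (- s * a)) * expinv 0 ((- s) * x + s * b))" by (intro smooth_fun.intros)
 then show ?thesis unfolding bump_def by (simp add: algebra_simps)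
qed

lemma bump_bounds: "0 \<le> bump s a b x" "bump s a b x \<le> 1"
proof -
 have "0 \<le> expinv 0 z" "expinv 0 z \<le> 1" for z by (auto simp: expinv_def)
 then show "0 \<le> bump s a b x" "bump s a b x \<le> 1" by (auto simp: bump_def intro!: mult_le_one)
qed

lemma bump_zero: "s > 0 ==> x \<notin> {a<..<b} ==> bump s a b x = 0"
 by (auto simp: bump_def expinv_def zero_less_mult_iff)

lemma bump_pos: "s > 0 ==> x \<in> {a<..<b} ==> bump s a b x > 0"
 by (auto simp: bump_def expinv_def)

lemma bump_tendsto: "x \<in> {a<..<b} ==> (%n. bump (real (Suc n)) a b x) \<longlonglongrightarrow> 1"
proof -
 assume x: "x \<in> {a<..<b}"
 have "(%n. exp (- (inverse (real (Suc n)) * inverse (x - a))) * exp (- (inverse (real (Suc n)) * inverse (b - x)))) \<longlonglongrightarrow> exp (- (0 * inverse (x - a))) * exp (- (0 * inverse (b - x)))"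
  by (intro tendsto_intros LIMSEQ_Suc[OF lim_inverse_n])
 moreover have "bump (real (Suc n)) a b x = exp (- (inverse (real (Suc n)) * inverse (x - a))) * exp (- (inverse (real (Suc n)) * inverse (b - x)))" for n
  using x by (simp add: bump_def expinv_def zero_less_mult_iff del: of_nat_Suc)
 ultimately show ?thesis by simp
qed

lemma test_bump: "s > 0 ==> {a..b} \<subseteq> S ==> test_function_on S (bump s a b)"
 unfolding test_function_on_def using bump_zero[of s _ a b]
 by (auto intro!: smooth_fun_differentiable smooth_bump exI[of _ "{a..b}"])

lemma test_function_facts:
 assumes "test_function_on S \<phi>"
 shows "(\<phi> has_field_derivative deriv \<phi> x) (at x)" "continuous_on UNIV \<phi>" "continuous_on UNIV (deriv \<phi>)"
proof -
 have d: "\<phi> field_differentiable (at x)" for x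
  using assms unfolding test_function_on_def by (metis funpow_0)
 have d2: "deriv \<phi> field_differentiable (at x)" for x
  using assms[unfolded test_function_on_def, THEN conjunct1, rule_format, of 1 x] by simp
 show "(\<phi> has_field_derivative deriv \<phi> x) (at x)" using d by (simp add: DERIV_deriv_iff_field_differentiable)
 show "continuous_on UNIV \<phi>" "continuous_on UNIV (deriv \<phi>)"
  using d d2 by (auto simp: continuous_on_eq_continuous_at intro: field_differentiable_imp_continuous_at)
qed

lemma test_function_support:
 assumes "test_function_on S \<phi>"
 obtains A where "A > 0" "!!x. x \<notin> {-A<..<A} ==> \<phi> x = 0" "!!x. x \<notin> {-A<..<A} ==> deriv \<phi> x = 0"
proof -
 obtain K where K: "compact K" "!!x. x \<notin> K ==> \<phi> x = 0" using assms by (auto simp: test_function_on_def)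
 obtain B where B: "B > 0" "!!x. x \<in> K ==> \<bar>x\<bar> < B"
  using compact_imp_bounded[OF K(1)] unfolding bounded_pos_less by auto
 have z: "\<phi> x = 0" if "\<bar>x\<bar> \<ge> B" for x using K(2) B(2)[of x] that by force
 \<comment> \<open>The derivative at x needs the function to vanish near x; a radius larger by 1
   puts x into the open complement of [-B, B].\<close>
 have dz: "deriv \<phi> x = 0" if "x \<notin> {-(B+1)<..<B+1}" for x
 proof -
  have "((%x. 0) has_field_derivative 0) (at x)" by simp
  then have "(\<phi> has_field_derivative 0) (at x)"
  proof (rule has_field_derivative_transform_within_open[where S="- {-B..B}"])
   show "0 = \<phi> y" if "y \<in> - {-B..B}" for y using z[of y] that by auto
  qed (use that B in auto)
  then show ?thesis by (rule DERIV_imp_deriv)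
 qed
 show thesis by (rule that[of "B+1"]) (use B z dz in auto)
qed

lemma integrable_continuous_compact_support:
 fixes f :: "real \<Rightarrow> 'a::euclidean_space"
 assumes "continuous_on UNIV f" "!!x. x \<notin> {-A<..<A} ==> f x = 0"
 shows "intL f"
proof -
 have "set_integrable lborel {-A..A} f" by (rule borel_integrable_atLeastAtMost') (use assms in \<open>auto intro: continuous_on_subset\<close>)
 then show ?thesis unfolding set_integrable_def
  by (rule Bochner_Integration.integrable_cong[THEN iffD1, rotated 2]) (use assms(2) in \<open>auto split: split_indicator\<close>)
qed

lemma test_function_integrable:
 assumes "test_function_on S \<phi>"
 shows "intL \<phi>" "intL (deriv \<phi>)"
proof -
 obtain A where "A > 0" and A: "!!x. x \<notin> {-A<..<A} ==> \<phi> x = 0" "!!x. x \<notin> {-A<..<A} ==> deriv \<phi> x = 0"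
  by (rule test_function_support[OF assms]) auto
 show "intL \<phi>"
  by (rule integrable_continuous_compact_support[OF test_function_facts(2)[OF assms] A(1)])
 show "intL (deriv \<phi>)"
  by (rule integrable_continuous_compact_support[OF test_function_facts(3)[OF assms] A(2)])
qed

text \<open>The derivative of \<phi>(x) exp(-i k x) has integral 0 over an interval containing the
  support.\<close>

lemma ft_deriv_test:
 assumes t: "test_function_on S \<phi>"
 shows "ft (%x. cr (deriv \<phi> x)) k = \<i> * cr k * ft (%x. cr (\<phi> x)) k"
proof -
 obtain A where A: "A > 0" "!!x. x \<notin> {-A<..<A} ==> \<phi> x = 0" "!!x. x \<notin> {-A<..<A} ==> deriv \<phi> x = 0"
  by (rule test_function_support[OF t]) auto
 define e where "e x = exp (- \<i> * cr (k * x))" for x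
 let ?G = "%x. cr (\<phi> x) * e x"
 let ?g = "%x. cr (deriv \<phi> x) * e x - \<i> * cr k * (cr (\<phi> x) * e x)"
 have e': "(e has_vector_derivative (- \<i> * cr k * e x)) (at x within X)" for x X
 proof -
  have e_eq: "e = (%x. exp (x *\<^sub>R (- \<i> * cr k)))" by (auto simp: fun_eq_iff e_def scaleR_conv_of_real mult.commute mult.left_commute)
  show ?thesis
   using exp_scaleR_has_vector_derivative_right[of "- \<i> * cr k" x X] by (simp add: e_eq mult.commute)
 qed
 have p': "((%x. cr (\<phi> x)) has_vector_derivative cr (deriv \<phi> x)) (at x within X)" for x X
  using test_function_facts(1)[OF t, of x] by (intro has_vector_derivative_of_real) (auto simp: has_real_derivative_iff_has_vector_derivative intro: has_vector_derivative_at_within)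
 have d: "(?G has_vector_derivative ?g x) (at x within {-A..A})" for x
  using has_vector_derivative_mult[OF p' e', of x "{-A..A}"] by (simp add: algebra_simps)
 have ce: "continuous_on X e" for X unfolding e_def by (intro continuous_intros)
 have c\<phi>: "continuous_on X (%x. cr (\<phi> x))" "continuous_on X (%x. cr (deriv \<phi> x))" for X
  using test_function_facts(2,3)[OF t] by (auto intro!: continuous_intros intro: continuous_on_subset)
 have cg: "continuous_on {-A..A} ?g" by (intro continuous_intros ce c\<phi>)
 have "(LI x. indicator {-A..A} x *\<^sub>R ?g x) = ?G A - ?G (-A)"
  using integral_FTC_Icc(1)[of "-A" A ?G ?g] d cg A(1) by simp
 also have "\<dots> = 0" using A by simp
 also have "(LI x. indicator {-A..A} x *\<^sub>R ?g x) = (LI x. ?g x)"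
  using A(2,3) by (intro LI_cong) (auto split: split_indicator)
 finally have z: "(LI x. ?g x) = 0" .
 have i: "intL (%x. cr (\<phi> x))" "intL (%x. cr (deriv \<phi> x))"
  using test_function_integrable[OF t] by auto
 have "(LI x. cr (deriv \<phi> x) * e x) - \<i> * cr k * (LI x. cr (\<phi> x) * e x) = 0"
  unfolding z[symmetric] using ft_integrand[OF i(1), of k] ft_integrand[OF i(2), of k] unfolding e_def[symmetric]
  by (subst LI_diff) auto
 then show ?thesis unfolding ft_def e_def[symmetric] by (simp add: algebra_simps)
qed

text \<open>Moves a spatial pairing to the frequency side, where the weak derivative becomes the
  factor i k by \<open>ft_deriv_test\<close>.\<close>

lemma integral_ir_test:
 assumes F: "nice F" and m: "intL m"
 shows "cr (LI x. ir F x * m x) = (LI k. F k * ft (%x. cr (m x)) (- k))"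
proof -
 have Fi: "intL F" using F by (simp add: nice_def)
 have mi: "intL (%x. cr (m (- x)))"
  using lborel_integrable_real_affine[OF m, of "-1" 0] by simp
 have "cr (LI x. ir F x * m x) = (LI x. cr (ir F x * m x))" by (rule integral_complex_of_real[symmetric])
 also have "\<dots> = (LI x. ft F (- x) * cr (m x))" by (simp add: of_real_ir[OF F])
 also have "\<dots> = (LI x. ft F x * cr (m (- x)))"
  using integral_reflect_real[of "%x. ft F (- x) * cr (m x)"] by simp
 also have "\<dots> = (LI k. F k * ft (%x. cr (m (- x))) k)" by (rule ft_multiplication[OF Fi mi])
 finally show ?thesis using ft_reflect[of "%x. cr (m x)"] by simp
qed

lemma has_weak_deriv_rep:
 assumes u: "rep u F" and v: "rep v (%k. \<i> * cr k * F k)"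
 shows "has_weak_deriv u v"
 unfolding has_weak_deriv_def
proof (intro conjI allI impI)
 show "square_integrable u" "square_integrable v" using u v by (auto intro: rep_square_integrable)
 fix \<phi> assume t: "test_function_on UNIV \<phi>"
 have [measurable]: "u \<in> bm" "v \<in> bm" "\<phi> \<in> bm" "deriv \<phi> \<in> bm"
  using u v test_function_facts[OF t] by (auto simp: rep_def intro: borel_measurable_continuous_onI)
 let ?G = "%k. \<i> * cr k * F k"
 have nF: "nice F" and nG: "nice ?G" using u v by (auto simp: rep_def)
 have [measurable]: "ir F \<in> bm" "ir ?G \<in> bm" using nF nG by (auto intro!: ir_measurable nice_measurable)
 have "(LI x. u x * deriv \<phi> x) = (LI x. ir F x * deriv \<phi> x)"
  by (intro integral_cong_AE) (use u in \<open>auto simp: rep_def elim!: eventually_mono\<close>)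
 moreover have "(LI x. v x * \<phi> x) = (LI x. ir ?G x * \<phi> x)"
  by (intro integral_cong_AE) (use v in \<open>auto simp: rep_def elim!: eventually_mono\<close>)
 moreover have "cr (LI x. ir F x * deriv \<phi> x) = cr (- (LI x. ir ?G x * \<phi> x))"
  unfolding of_real_minus integral_ir_test[OF nF test_function_integrable(2)[OF t]] integral_ir_test[OF nG test_function_integrable(1)[OF t]]
  by (subst Bochner_Integration.integral_minus[symmetric], rule LI_cong) (auto simp: ft_deriv_test[OF t])
 ultimately show "(LI x. u x * deriv \<phi> x) = - (LI x. v x * \<phi> x)" by (simp only: of_real_eq_iff)
qed

lemma L2_set_integrable:
 assumes "square_integrable (v :: real \<Rightarrow> real)"
 shows "set_integrable lborel {a..b} v"
proof -
 have [measurable]: "v \<in> bm" and f: "nsq v < \<infinity>" using assms by (auto simp: square_integrable_iff_nsq)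
 have "nsq (%x. cr (v x)) < \<infinity>" using f by (simp add: nsq_def)
 then have "intL (%x. cr (v x) * interval_fun a b x)"
  by (intro integrable_L2_mult nsq_interval_fun) auto
 also have "(%x. cr (v x) * interval_fun a b x) = (%x. cr (indicator {a..b} x *\<^sub>R v x))"
  by (auto split: split_indicator)
 finally show ?thesis unfolding set_integrable_def by (simp only: complex_of_real_integrable_eq)
qed

text \<open>The operator \<open>dx\<close> is a choice, so uniqueness is what makes its value known
  almost everywhere. Two weak derivatives have equal integrals against bumps, and steeper and
  steeper bumps give equal integrals over intervals.\<close>

lemma has_weak_deriv_unique:
 assumes v: "has_weak_deriv u v" and w: "has_weak_deriv u w"
 shows "AEL x. v x = w x"
proof -
 have sv: "square_integrable v" and sw: "square_integrable w" using v w by (auto simp: has_weak_deriv_def)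
 have [measurable]: "v \<in> bm" "w \<in> bm" using sv sw by (auto simp: square_integrable_iff_nsq)
 have iv: "intL (%x. indicator {a..b} x *\<^sub>R (v x - w x))" for a b
  using L2_set_integrable[OF sv, of a b] L2_set_integrable[OF sw, of a b] unfolding set_integrable_def by (simp add: right_diff_distrib)
 have "AEL x. v x - w x = 0"
 proof (rule AE_zero_intervals)
  show "set_integrable lborel {a..b} (%x. v x - w x)" for a b using iv unfolding set_integrable_def .
  fix a b :: real assume "a \<le> b"
  have [measurable]: "bump s a b \<in> bm" for s
   by (intro borel_measurable_continuous_onI) (auto simp: continuous_on_eq_continuous_at intro: DERIV_isCont[OF smooth_fun_deriv(2)[OF smooth_bump]])
  have bi: "intL (%x. z x * bump (real (Suc n)) a b x)" if "square_integrable z" for z n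
  proof (rule LI_int_bound[of lborel "%x. indicator {a..b} x *\<^sub>R z x"])
   show "intL (%x. indicator {a..b} x *\<^sub>R z x)" using L2_set_integrable[OF that] unfolding set_integrable_def .
   show "(%x. z x * bump (real (Suc n)) a b x) \<in> borel_measurable lborel" using that by (auto simp: square_integrable_iff_nsq)
   show "AEL x. norm (z x * bump (real (Suc n)) a b x) \<le> norm (indicator {a..b} x *\<^sub>R z x)"
    using bump_bounds[of "real (Suc n)" a b] bump_zero[of "real (Suc n)" _ a b]
    by (intro AE_I2) (auto simp: abs_mult mult_left_le split: split_indicator)
  qed
  have zero: "(LI x. (v x - w x) * bump (real (Suc n)) a b x) = 0" for n
  proof -
   have t: "test_function_on UNIV (bump (real (Suc n)) a b)" by (rule test_bump) auto
   note vw = v[unfolded has_weak_deriv_def, THEN conjunct2, THEN conjunct2, rule_format, OF t]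
    w[unfolded has_weak_deriv_def, THEN conjunct2, THEN conjunct2, rule_format, OF t]
   have "(LI x. v x * bump (real (Suc n)) a b x) = (LI x. w x * bump (real (Suc n)) a b x)"
    using vw by linarith
   then show ?thesis using bi[OF sv] bi[OF sw] by (simp add: left_diff_distrib)
  qed
  have "(%n. LI x. (v x - w x) * bump (real (Suc n)) a b x) \<longlonglongrightarrow> (LI x. indicator {a..b} x *\<^sub>R (v x - w x))"
  proof (rule integral_dominated_convergence[where w="%x. norm (indicator {a..b} x *\<^sub>R (v x - w x))"])
   show "intL (%x. norm (indicator {a..b} x *\<^sub>R (v x - w x)))" using iv by (rule integrable_norm)
   show "AEL x. (%n. (v x - w x) * bump (real (Suc n)) a b x) \<longlonglongrightarrow> indicator {a..b} x *\<^sub>R (v x - w x)"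
    using AE_lborel_singleton[of a] AE_lborel_singleton[of b]
   proof eventually_elim
    case (elim x)
    show ?case
    proof (cases "x \<in> {a<..<b}")
     case True
     have "(%n. (v x - w x) * bump (real (Suc n)) a b x) \<longlonglongrightarrow> (v x - w x) * 1" by (intro tendsto_intros bump_tendsto True)
     then show ?thesis using True by auto
    next
     case False
     then show ?thesis using elim bump_zero[OF _ False] by (auto split: split_indicator)
    qed
   qed
   show "AEL x. norm ((v x - w x) * bump (real (Suc n)) a b x) \<le> norm (indicator {a..b} x *\<^sub>R (v x - w x))" for n
    using bump_bounds[of "real (Suc n)" a b] bump_zero[of "real (Suc n)" _ a b]
    by (intro AE_I2) (auto simp: abs_mult mult_left_le split: split_indicator)
  qed auto
  then show "(LINT x:{a..b}|lborel. v x - w x) = 0"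
   unfolding zero set_lebesgue_integral_def by (simp add: LIMSEQ_const_iff)
 qed
 then show ?thesis by simp
qed

lemma rep_dx:
 assumes u: "rep u F" and m: "nice (%k. \<i> * cr k * F k)"
 shows "rep (dx u) (%k. \<i> * cr k * F k)"
proof -
 let ?v = "ir (%k. \<i> * cr k * F k)"
 have v: "has_weak_deriv u ?v" by (rule has_weak_deriv_rep[OF u rep_ir[OF m]])
 then have d: "has_weak_deriv u (dx u)" unfolding dx_def by (rule someI[of "has_weak_deriv u"])
 show ?thesis
 proof (rule rep_cong_fun[OF rep_ir[OF m]])
  show "AEL x. dx u x = ?v x" by (rule has_weak_deriv_unique[OF d v])
  show "dx u \<in> bm" using d by (auto simp: has_weak_deriv_def square_integrable_iff_nsq)
 qed
qed

section \<open>The system on the Fourier side\<close>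

definition lam :: "real \<Rightarrow> real \<Rightarrow> real" where "lam \<beta> k = \<bar>k\<bar> + \<beta> * \<bar>k\<bar> ^ 3"

text \<open>The transform of the bracket: products become convolutions (with the factor \<open>c\<^sub>F\<close>), the multiplier of
 \<open>- \<partial>\<^sub>x \<H>\<close> is \<open>- |k|\<close>, and the two factors \<open>- i sgn\<close> of \<open>(\<H> f\<^sub>t)^2\<close> contribute another sign.\<close>

definition Qf :: "cfun \<Rightarrow> cfun \<Rightarrow> real \<Rightarrow> complex"
 where "Qf F V k = c\<^sub>F * (cr \<bar>k\<bar> * conv (%l. cr (sgn l) * V l) (%l. cr (sgn l) * V l) k
  + cr \<bar>k\<bar> * conv F (%l. cr \<bar>l\<bar> * F l) k
  - cr k * conv F (%l. cr l * F l) k)"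

definition Rf :: "real \<Rightarrow> real \<Rightarrow> real \<Rightarrow> cfun \<Rightarrow> cfun \<Rightarrow> real \<Rightarrow> complex"
 where "Rf \<epsilon> \<alpha> \<beta> F V k = - cr (lam \<beta> k) * F k + \<i> * cr (\<alpha> * k * \<bar>k\<bar>) * V k
  + cr \<epsilon> * Qf F V k"

lemma nice_multiplier_bounded:
 assumes F: "nice F" and m: "m \<in> bm" "!!k. norm (m k) \<le> 1" "!!k. m (- k) = cnj (m k)"
 shows "nice (%k. m k * F k)"
proof -
 have [measurable]: "F \<in> bm" "m \<in> bm" using nice_measurable[OF F] m by auto
 have "intL (%k. F k * m k)" using F m by (intro integrable_times_bounded[where B=1]) (auto simp: nice_def)
 moreover have "nsq (%k. m k * F k) \<le> nsq F"
  using m(2) by (intro nsq_mono_AE AE_I2) (simp add: norm_mult mult_left_le_one_le)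
 ultimately show ?thesis using F m(3) by (auto simp: nice_def mult.commute intro: le_less_trans)
qed

lemma conv_scale: "conv (%k. c * F k) (%k. d * G k) = (%k. c * d * conv F G k)"
 unfolding conv_def fun_eq_iff
proof
 fix k
 have "(LI l. c * F (k - l) * (d * G l)) = (LI l. (c * d) * (F (k - l) * G l))" by (simp add: ac_simps)
 then show "(LI l. c * F (k - l) * (d * G l)) = c * d * (LI l. F (k - l) * G l)" by simp
qed

lemma rep_eq: "rep u F ==> (!!k. F k = G k) ==> rep u G"
 by (metis ext)

text \<open>\<open>fourier_multiplier\<close> and \<open>dx\<close> have specified values only where
  the resulting transform belongs to a suitable function. The hypotheses therefore ask each
  intermediate transform to be \<open>nice\<close>; inside the bracket this follows from products
  and bounded multipliers.\<close>

lemma rep_wave_rhs: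
 assumes u: "rep u F" and v: "rep v V"
  and n1: "nice (%k. cr \<bar>k\<bar> * F k)" and n3: "nice (%k. cr (\<bar>k\<bar> ^ 3) * F k)"
  and m1: "nice (%k. \<i> * cr k * V k)" and m2: "nice (%k. cr \<bar>k\<bar> * (\<i> * cr k * V k))"
  and nQ: "nice (Qf F V)"
 shows "rep (wave_rhs \<epsilon> \<alpha> \<beta> u v) (Rf \<epsilon> \<alpha> \<beta> F V)"
proof -
 let ?h = "%k. - \<i> * cr (sgn k)"
 let ?sV = "%l. cr (sgn l) * V l"
 let ?aF = "%l. cr \<bar>l\<bar> * F l"
 let ?lF = "%l. cr l * F l"
 have [measurable]: "(%k. - \<i> * cr (sgn k)) \<in> bm" by measurable
 have hn: "nice (%k. ?h k * G k)" if "nice G" for G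
  by (rule nice_multiplier_bounded[OF that]) (auto simp: norm_mult abs_sgn_eq sgn_minus)
 have hil: "rep (hilbert w) (%k. ?h k * G k)" if "rep w G" for w G
  unfolding hilbert_def by (rule rep_multiplier[OF that hn[OF rep_nice[OF that]]])
 have r1: "rep (Lambda u) ?aF" unfolding Lambda_def by (rule rep_multiplier[OF u n1])
 have r2: "rep (Lambda_pow 3 u) (%k. cr (\<bar>k\<bar> ^ 3) * F k)"
  using rep_multiplier[OF u, of "%k. cr (\<bar>k\<bar> powr 3)"] n3 unfolding Lambda_pow_def by simp
 have r3: "rep (Lambda (dx v)) (%k. cr \<bar>k\<bar> * (\<i> * cr k * V k))"
  unfolding Lambda_def by (rule rep_multiplier[OF rep_dx[OF v m1] m2])
 have "rep (%z. (hilbert v z)\<^sup>2) (%k. c\<^sub>F * conv (%k. ?h k * V k) (%k. ?h k * V k) k)"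
  using rep_mult[OF hil[OF v] hil[OF v]] by (simp add: power2_eq_square)
 then have w1: "rep (%y. - hilbert (%z. (hilbert v z)\<^sup>2) y) (%k. - (?h k * (c\<^sub>F * conv (%k. ?h k * V k) (%k. ?h k * V k) k)))"
  by (intro rep_uminus hil)
 have w2: "rep (commutator hilbert u (Lambda u)) (%k. ?h k * (c\<^sub>F * conv F ?aF k) - c\<^sub>F * conv F (%k. ?h k * ?aF k) k)"
  unfolding commutator_def by (intro rep_diff hil rep_mult u r1)
 let ?W = "%k. - (?h k * (c\<^sub>F * conv (%k. ?h k * V k) (%k. ?h k * V k) k)) + (?h k * (c\<^sub>F * conv F ?aF k) - c\<^sub>F * conv F (%k. ?h k * ?aF k) k)"
 have w: "rep (%y. - hilbert (%z. (hilbert v z)\<^sup>2) y + commutator hilbert u (Lambda u) y) ?W" by (rule rep_add[OF w1 w2])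
 \<comment> \<open>The two factors -i multiply to -1, the two signs stay inside the
   convolution.\<close>
 have c1: "conv (%k. ?h k * V k) (%k. ?h k * V k) k = - conv ?sV ?sV k" for k
  using conv_scale[of "-\<i>" ?sV "-\<i>" ?sV] by (simp add: fun_eq_iff mult.assoc)
 have "?h l * ?aF l = - \<i> * ?lF l" for l by (simp add: mult.assoc[symmetric] flip: of_real_mult) (simp add: mult.commute[of "\<bar>l\<bar>"] mult_sgn_abs)
 then have fe: "(%k. ?h k * ?aF k) = (%l. - \<i> * ?lF l)" by (rule ext)
 have c2: "conv F (%k. ?h k * ?aF k) k = - \<i> * conv F ?lF k" for k
  unfolding fe using conv_scale[of 1 F "-\<i>" ?lF] by (simp add: fun_eq_iff)
 \<comment> \<open>The outer derivative i k meets the multiplier -i sgn k of the Hilbert transform,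
   and together they give |k|.\<close>
 have sk: "cr k * cr (sgn k) = cr \<bar>k\<bar>" for k by (simp flip: of_real_mult add: abs_sgn)
 have W: "\<i> * cr k * ?W k = Qf F V k" for k
  unfolding c1 c2 Qf_def sk[symmetric, of k] by (simp add: algebra_simps)
 have d: "rep (dx (%y. - hilbert (%z. (hilbert v z)\<^sup>2) y + commutator hilbert u (Lambda u) y)) (Qf F V)"
  using rep_dx[OF w] nQ unfolding W by simp
 have "rep (wave_rhs \<epsilon> \<alpha> \<beta> u v) (%k. - ?aF k - cr \<beta> * (cr (\<bar>k\<bar> ^ 3) * F k)
   + cr \<alpha> * (cr \<bar>k\<bar> * (\<i> * cr k * V k)) + cr \<epsilon> * Qf F V k)"
  unfolding wave_rhs_def by (intro rep_add rep_diff rep_uminus rep_scale r1 r2 r3 d)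
 then show ?thesis by (rule rep_eq) (simp add: Rf_def lam_def algebra_simps)
qed

section \<open>Weighted L^2 norms and the energy\<close>

abbreviation wint :: "(real \<Rightarrow> real) \<Rightarrow> cfun \<Rightarrow> ennreal"
 where "wint w F \<equiv> (NN k. ennreal (w k * (norm (F k))\<^sup>2))"

lemma nn_inverse_1_plus_square: "(NN k. ennreal (1 / (1 + k\<^sup>2))) < \<infinity>"
proof -
 have "intL (%k::real. inverse (1 + k\<^sup>2))"
  using integrable_inverse_1_plus_square by (simp add: set_integrable_def)
 then show ?thesis by (simp add: integrable_iff_bounded inverse_eq_divide)
qed

definition cI :: real where "cI = enn2real (NN k. ennreal (1 / (1 + k\<^sup>2)))"

lemma cI: "cI \<ge> 0" "(NN k. ennreal (1 / (1 + k\<^sup>2))) = ennreal cI"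
 using nn_inverse_1_plus_square by (auto simp: cI_def less_top)

text \<open>A weight 1 + k^2 turns L^2 into L^1 at the cost of the constant \<open>cI\<close>. The
  inequality 2 x \<le> 1/s + s x^2 with s = 1 + k^2 gives a form linear in the squared norm, without
  square roots.\<close>

lemma L1_of_weight:
 fixes F :: cfun
 assumes [measurable]: "F \<in> bm" "p \<in> bm" and p: "!!k. p k \<ge> 0"
 shows "2 * (NN k. ennreal (p k * norm (F k))) \<le> ennreal cI + wint (%k. (1 + k\<^sup>2) * (p k)\<^sup>2) F"
proof -
 have "2 * (NN k. ennreal (p k * norm (F k))) = (NN k. 2 * ennreal (p k * norm (F k)))"
  by (simp add: nn_integral_cmult)
 also have "\<dots> \<le> (NN k. ennreal (1 / (1 + k\<^sup>2)) + ennreal ((1 + k\<^sup>2) * (p k)\<^sup>2 * (norm (F k))\<^sup>2))"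
 proof (rule nn_integral_mono)
  fix k :: real
  let ?s = "1 + k\<^sup>2" and ?x = "p k * norm (F k)"
  have s: "?s > 0" by (simp add: add_pos_nonneg)
  have "0 \<le> (1 - ?s * ?x)\<^sup>2 / ?s" using s by simp
  also have "\<dots> = 1 / ?s + ?s * ?x\<^sup>2 - 2 * ?x" using s by (simp add: power2_diff field_simps power2_eq_square)
  finally have "2 * ?x \<le> 1 / ?s + ?s * (p k)\<^sup>2 * (norm (F k))\<^sup>2" by (simp add: power_mult_distrib mult.assoc)
  then have "ennreal (2 * ?x) \<le> ennreal (1 / ?s + ?s * (p k)\<^sup>2 * (norm (F k))\<^sup>2)" by (rule ennreal_leI)
  also have "\<dots> = ennreal (1 / ?s) + ennreal (?s * (p k)\<^sup>2 * (norm (F k))\<^sup>2)" using s by (intro ennreal_plus) auto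
  finally show "2 * ennreal ?x \<le> ennreal (1 / ?s) + ennreal (?s * (p k)\<^sup>2 * (norm (F k))\<^sup>2)"
   by (simp only: ennreal_2_times)
 qed
 also have "\<dots> = ennreal cI + wint (%k. (1 + k\<^sup>2) * (p k)\<^sup>2) F" by (simp add: nn_integral_add cI(2))
 finally show ?thesis .
qed

lemma wint_mono: "(!!k. 0 \<le> w k) ==> (!!k. w k \<le> w' k) ==> wint w F \<le> wint w' F"
 by (intro nn_integral_mono ennreal_leI mult_right_mono) auto

lemma wint_cmult: "0 \<le> c ==> F \<in> bm ==> w \<in> bm ==> wint (%k. c * w k) F = ennreal c * wint w F"
 by (subst nn_integral_cmult[symmetric]) (auto simp: ennreal_mult' mult.assoc)

lemma nsq_le_wint: "(!!k. 1 \<le> w k) ==> nsq F \<le> wint w F"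
 unfolding nsq_def
proof (intro nn_integral_mono ennreal_leI)
 fix k assume "!!k. 1 \<le> w k"
 then show "(norm (F k))\<^sup>2 \<le> w k * (norm (F k))\<^sup>2" using mult_right_mono[of 1 "w k" "(norm (F k))\<^sup>2"] by simp
qed

text \<open>In one dimension H^1 lies in the functions with integrable transform; this is the level
  that every transform in the equation has to reach.\<close>

lemma niceI:
 assumes [measurable]: "F \<in> bm" and h: "!!k. F (- k) = cnj (F k)" and fin: "wint (%k. 1 + k\<^sup>2) F < \<infinity>"
 shows "nice F"
proof -
 have "2 * (NN k. ennreal (1 * norm (F k))) \<le> ennreal cI + wint (%k. (1 + k\<^sup>2) * 1\<^sup>2) F"
  by (rule L1_of_weight) auto
 also have "\<dots> < \<infinity>" using fin by (simp add: ennreal_add_less_top)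
 finally have "(NN k. ennreal (norm (F k))) < \<infinity>" by (auto simp: ennreal_mult_less_top)
 moreover have "nsq F < \<infinity>" using nsq_le_wint[of "%k. 1 + k\<^sup>2" F] fin by (auto intro: le_less_trans)
 ultimately show ?thesis using h by (simp add: nice_def integrable_iff_bounded)
qed

lemma niceI_weight:
 assumes [measurable]: "F \<in> bm" "m \<in> bm" and h: "!!k. F (- k) = cnj (F k)" "!!k. m (- k) = cnj (m k)"
  and fin: "wint w F < \<infinity>" and le: "!!k. (1 + k\<^sup>2) * (norm (m k))\<^sup>2 \<le> C * w k"
  and w: "w \<in> bm" and C: "C \<ge> 0"
 shows "nice (%k. m k * F k)"
proof (rule niceI)
 have "wint (%k. 1 + k\<^sup>2) (%k. m k * F k) = wint (%k. (1 + k\<^sup>2) * (norm (m k))\<^sup>2) F"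
  by (simp add: norm_mult power_mult_distrib mult.assoc)
 also have "\<dots> \<le> wint (%k. C * w k) F" by (rule wint_mono) (auto simp: le)
 also have "\<dots> = ennreal C * wint w F" using w C by (intro wint_cmult) auto
 also have "\<dots> < \<infinity>" using fin by (simp add: ennreal_mult_less_top)
 finally show "wint (%k. 1 + k\<^sup>2) (%k. m k * F k) < \<infinity>" .
qed (use h in auto)

definition wt :: "real \<Rightarrow> real" where "wt k = 1 + k ^ 6"

text \<open>Equivalent to the H^3 weight \<open>wt\<close>, but it splits as (1 + k^2) (1 + k^2)^2,
  so that by \<open>L1_of_weight\<close> even (1 + k^2) F is integrable.\<close>

definition S3 :: "cfun \<Rightarrow> ennreal" where "S3 F = wint (%k. (1 + k\<^sup>2) ^ 3) F"

text \<open>The term with \<open>lam\<close> makes the linear exchange between F and V cancel in the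
  energy. Since \<open>lam\<close> vanishes at k = 0, the last summand is added to control F at low
  frequencies.\<close>

definition edens :: "real \<Rightarrow> cfun \<Rightarrow> cfun \<Rightarrow> real \<Rightarrow> real"
 where "edens \<beta> F V k = wt k * ((norm (V k))\<^sup>2 + lam \<beta> k * (norm (F k))\<^sup>2) + (norm (F k))\<^sup>2"

text \<open>The balls of the energy space. The hermitian symmetry is required at every k, so that
  reflected frequencies can be rewritten under integrals.\<close>

definition hi :: "real \<Rightarrow> real \<Rightarrow> cfun \<Rightarrow> cfun \<Rightarrow> bool"
 where "hi \<beta> M F V \<longleftrightarrow> F \<in> bm \<and> V \<in> bm
  \<and> (\<forall>k. F (- k) = cnj (F k)) \<and> (\<forall>k. V (- k) = cnj (V k)) \<and> (NN k. ennreal (edens \<beta> F V k)) \<le> ennreal M"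

lemma lam_nonneg[simp]: "\<beta> > 0 ==> 0 \<le> lam \<beta> k" by (simp add: lam_def)
lemma lam_minus[simp]: "lam \<beta> (- k) = lam \<beta> k" by (simp add: lam_def)
lemma wt_ge_1[simp]: "1 \<le> wt k" by (simp add: wt_def)
lemma wt_nonneg[simp]: "0 \<le> wt k" using wt_ge_1[of k] by linarith
lemma wt_minus[simp]: "wt (- k) = wt k" by (simp add: wt_def)
lemma lam_measurable[measurable]: "lam \<beta> \<in> bm" unfolding lam_def[abs_def] by measurable
lemma wt_measurable[measurable]: "wt \<in> bm" unfolding wt_def[abs_def] by measurable
lemma edens_measurable[measurable]: "F \<in> bm ==> V \<in> bm ==> edens \<beta> F V \<in> bm"
proof -
 assume [measurable]: "F \<in> bm" "V \<in> bm"
 show ?thesis unfolding edens_def[abs_def] by measurable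
qed
lemma edens_nonneg: "\<beta> > 0 ==> 0 \<le> edens \<beta> F V k"
 unfolding edens_def by (intro add_nonneg_nonneg mult_nonneg_nonneg) auto

lemma hi_mono: "hi \<beta> M F V ==> M \<le> M' ==> hi \<beta> M' F V"
 unfolding hi_def by (meson ennreal_leI order_trans)

lemma hi_weightV:
 assumes h: "hi \<beta> M F V" and b: "\<beta> > 0" and w: "!!k. 0 \<le> w k" "!!k. w k \<le> C * wt k" and C: "C \<ge> 0"
 shows "wint w V \<le> ennreal (C * M)"
proof -
 have [measurable]: "F \<in> bm" "V \<in> bm" using h by (auto simp: hi_def)
 have "wint w V \<le> (NN k. ennreal C * ennreal (edens \<beta> F V k))"
 proof (rule nn_integral_mono)
  fix k
  have "w k * (norm (V k))\<^sup>2 \<le> (C * wt k) * (norm (V k))\<^sup>2" by (intro mult_right_mono w) auto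
  also have "\<dots> \<le> C * edens \<beta> F V k"
   unfolding edens_def mult.assoc using b C by (intro mult_left_mono) (auto simp: distrib_left)
  finally show "ennreal (w k * (norm (V k))\<^sup>2) \<le> ennreal C * ennreal (edens \<beta> F V k)"
   using C by (subst ennreal_mult'[symmetric]) (auto intro: ennreal_leI)
 qed
 also have "\<dots> = ennreal C * (NN k. ennreal (edens \<beta> F V k))" by (simp add: nn_integral_cmult)
 also have "\<dots> \<le> ennreal C * ennreal M" using h by (intro mult_left_mono) (auto simp: hi_def)
 finally show ?thesis using C by (simp add: ennreal_mult')
qed

lemma hi_weightF:
 assumes h: "hi \<beta> M F V" and b: "\<beta> > 0" and w: "!!k. 0 \<le> w k" "!!k. w k \<le> C * (wt k * lam \<beta> k + 1)" and C: "C \<ge> 0"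
 shows "wint w F \<le> ennreal (C * M)"
proof -
 have [measurable]: "F \<in> bm" "V \<in> bm" using h by (auto simp: hi_def)
 have "wint w F \<le> (NN k. ennreal C * ennreal (edens \<beta> F V k))"
 proof (rule nn_integral_mono)
  fix k
  have "w k * (norm (F k))\<^sup>2 \<le> (C * (wt k * lam \<beta> k + 1)) * (norm (F k))\<^sup>2" by (intro mult_right_mono w) auto
  also have "\<dots> \<le> C * edens \<beta> F V k"
   unfolding edens_def mult.assoc using b C by (intro mult_left_mono) (auto simp: distrib_left distrib_right)
  finally show "ennreal (w k * (norm (F k))\<^sup>2) \<le> ennreal C * ennreal (edens \<beta> F V k)"
   using C by (subst ennreal_mult'[symmetric]) (auto intro: ennreal_leI)
 qed
 also have "\<dots> = ennreal C * (NN k. ennreal (edens \<beta> F V k))" by (simp add: nn_integral_cmult)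
 also have "\<dots> \<le> ennreal C * ennreal M" using h by (intro mult_left_mono) (auto simp: hi_def)
 finally show ?thesis using C by (simp add: ennreal_mult')
qed

lemma cube_le: "(1 + k\<^sup>2) ^ 3 \<le> 4 * wt k" for k :: real
proof -
 define y where "y = k\<^sup>2"
 have y: "y \<ge> 0" by (simp add: y_def)
 have "0 \<le> 3 * ((y + 1) * (y - 1)\<^sup>2)" using y by simp
 also have "\<dots> = 4 * (1 + y ^ 3) - (1 + y) ^ 3" by (simp add: power2_eq_square power3_eq_cube algebra_simps)
 finally show ?thesis by (simp add: wt_def y_def power_mult[symmetric])
qed

lemma abs_pow_le: "\<bar>k\<bar> ^ m \<le> 1 + \<bar>k\<bar> ^ n" if "m \<le> n" for k :: real
proof (cases "\<bar>k\<bar> \<le> 1")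
 case True
 then have "\<bar>k\<bar> ^ m \<le> 1" by (simp add: power_le_one)
 then show ?thesis by (simp add: add_increasing2)
next
 case False
 then have "\<bar>k\<bar> ^ m \<le> \<bar>k\<bar> ^ n" using that by (intro power_increasing) auto
 then show ?thesis by simp
qed

lemma wt_lam_ge: "\<beta> > 0 ==> \<bar>k\<bar> ^ 7 \<le> wt k * lam \<beta> k" "\<beta> > 0 ==> \<beta> * \<bar>k\<bar> ^ 9 \<le> wt k * lam \<beta> k"
proof -
 assume b: "\<beta> > 0"
 have k6: "k ^ 6 = \<bar>k\<bar> ^ 6" by simp
 have e: "wt k * lam \<beta> k = \<bar>k\<bar> + \<beta> * \<bar>k\<bar> ^ 3 + \<bar>k\<bar> ^ 7 + \<beta> * \<bar>k\<bar> ^ 9"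
  unfolding wt_def lam_def k6 by (simp add: algebra_simps eval_nat_numeral)
 have "0 \<le> \<bar>k\<bar> ^ 7" "0 \<le> \<beta> * \<bar>k\<bar> ^ 3" "0 \<le> \<beta> * \<bar>k\<bar> ^ 9" using b by auto
 then show "\<bar>k\<bar> ^ 7 \<le> wt k * lam \<beta> k" "\<beta> * \<bar>k\<bar> ^ 9 \<le> wt k * lam \<beta> k" unfolding e by linarith+
qed

lemma cube_le_F: "\<beta> > 0 ==> (1 + k\<^sup>2) ^ 3 \<le> 8 * (wt k * lam \<beta> k + 1)"
proof -
 assume b: "\<beta> > 0"
 have "(1 + k\<^sup>2) ^ 3 \<le> 4 * (1 + \<bar>k\<bar> ^ 6)" using cube_le[of k] by (simp add: wt_def)
 also have "\<dots> \<le> 4 * (2 + wt k * lam \<beta> k)" using abs_pow_le[of 6 7 k] wt_lam_ge(1)[OF b, of k] by simp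
 also have "\<dots> \<le> 8 * (wt k * lam \<beta> k + 1)" using b by simp
 finally show ?thesis .
qed

lemma hi_S3: "hi \<beta> M F V ==> \<beta> > 0 ==> S3 V \<le> ennreal (4 * M)" "hi \<beta> M F V ==> \<beta> > 0 ==> S3 F \<le> ennreal (8 * M)"
proof -
 assume h: "hi \<beta> M F V" and b: "\<beta> > 0"
 show "S3 V \<le> ennreal (4 * M)" unfolding S3_def by (rule hi_weightV[OF h b _ cube_le]) auto
 show "S3 F \<le> ennreal (8 * M)" unfolding S3_def by (rule hi_weightF[OF h b _ cube_le_F[OF b]]) auto
qed

lemma S3_weight:
 assumes [measurable]: "F \<in> bm" "w \<in> bm" and S: "S3 F \<le> ennreal M" and w: "!!k. 0 \<le> w k" "!!k. w k \<le> (1 + k\<^sup>2) ^ 3"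
 shows "wint w F \<le> ennreal M"
 using wint_mono[of w "%k. (1 + k\<^sup>2) ^ 3" F] w S by (auto simp: S3_def intro: order_trans)

text \<open>If f is not integrable the Bochner integral is 0 and the bound is trivial; norms of
  iterated integrals can thus be bounded before their convergence is known.\<close>

lemma norm_integral_le_nn:
 fixes f :: "'a \<Rightarrow> 'b::{banach, second_countable_topology}"
 shows "ennreal (norm (integral\<^sup>L M f)) \<le> (\<integral>\<^sup>+x. ennreal (norm (f x)) \<partial>M)"
 by (cases "integrable M f") (auto intro: integral_norm_bound_ennreal simp: not_integrable_integral_eq)

section \<open>Kernels of the quadratic terms\<close>

definition q1 :: "real \<Rightarrow> real \<Rightarrow> real" where "q1 k l = \<bar>k\<bar> * sgn (k - l) * sgn l"
text \<open>Here k is the frequency of the output, l that of the second factor and k - l that of the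
  first. The difference is the commutator structure: it is 0 for frequencies k and l of equal
  sign.\<close>

definition q2 :: "real \<Rightarrow> real \<Rightarrow> real" where "q2 k l = \<bar>k\<bar> * \<bar>l\<bar> - k * l"

lemma q1_measurable[measurable]: "f \<in> borel_measurable M ==> g \<in> borel_measurable M ==> (%x. q1 (f x) (g x)) \<in> borel_measurable M"
proof -
 assume [measurable]: "f \<in> borel_measurable M" "g \<in> borel_measurable M"
 have s: "(sgn :: real \<Rightarrow> real) \<in> bm" unfolding sgn_if[abs_def] by measurable
 show ?thesis unfolding q1_def
  by (intro borel_measurable_times borel_measurable_abs measurable_compose[OF _ s]) measurable
qed
lemma q2_measurable[measurable]: "f \<in> borel_measurable M ==> g \<in> borel_measurable M ==> (%x. q2 (f x) (g x)) \<in> borel_measurable M"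
 unfolding q2_def by (intro borel_measurable_times borel_measurable_diff borel_measurable_abs borel_measurable_sgn)

lemma q1_le: "\<bar>q1 k l\<bar> \<le> \<bar>k\<bar>"
 unfolding q1_def by (auto simp: abs_mult abs_sgn_eq)

lemma q2_le: "\<bar>q2 k l\<bar> \<le> 2 * \<bar>k\<bar> * \<bar>l\<bar>"
proof -
 have "\<bar>k * l\<bar> = \<bar>k\<bar> * \<bar>l\<bar>" by (rule abs_mult)
 then show ?thesis unfolding q2_def by linarith
qed

text \<open>For opposite signs |k - l| = |k| + |l|.\<close>

lemma q2_support: "q2 k l \<noteq> 0 ==> \<bar>k\<bar> \<le> \<bar>k - l\<bar> \<and> \<bar>l\<bar> \<le> \<bar>k - l\<bar>"
 unfolding q2_def by (auto simp: abs_if split: if_splits)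

text \<open>A derivative at the output k or at the inner frequency l may be shifted to k - l. Which
  of the three bounds on \<open>q2\<close> is applied depends on the factor that can afford a
  derivative.\<close>

lemma q2_le2: "\<bar>q2 k l\<bar> \<le> 2 * \<bar>k\<bar> * \<bar>k - l\<bar>" "\<bar>q2 k l\<bar> \<le> 2 * \<bar>k - l\<bar> * \<bar>l\<bar>"
proof -
 have "\<bar>q2 k l\<bar> \<le> 2 * \<bar>k\<bar> * \<bar>k - l\<bar> \<and> \<bar>q2 k l\<bar> \<le> 2 * \<bar>k - l\<bar> * \<bar>l\<bar>"
 proof (cases "q2 k l = 0")
  case False
  then have s: "\<bar>k\<bar> \<le> \<bar>k - l\<bar>" "\<bar>l\<bar> \<le> \<bar>k - l\<bar>" using q2_support by auto
  have "2 * \<bar>k\<bar> * \<bar>l\<bar> \<le> 2 * \<bar>k\<bar> * \<bar>k - l\<bar>" "2 * \<bar>k\<bar> * \<bar>l\<bar> \<le> 2 * \<bar>k - l\<bar> * \<bar>l\<bar>"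
   using s by (auto intro!: mult_left_mono mult_right_mono)
  then show ?thesis using q2_le[of k l] by linarith
 qed auto
 then show "\<bar>q2 k l\<bar> \<le> 2 * \<bar>k\<bar> * \<bar>k - l\<bar>" "\<bar>q2 k l\<bar> \<le> 2 * \<bar>k - l\<bar> * \<bar>l\<bar>" by auto
qed

definition Tq :: "(real \<Rightarrow> real \<Rightarrow> real) \<Rightarrow> cfun \<Rightarrow> cfun \<Rightarrow> real \<Rightarrow> complex"
 where "Tq q U W k = (LI l. cr (q k l) * (U (k - l) * W l))"

lemma nsq_shift_reflect:
 assumes [measurable]: "U \<in> bm"
 shows "nsq (%l. U (k - l)) = nsq U"
 unfolding nsq_def by (rule nn_integral_reflect_shift[of "%x. ennreal ((norm (U x))\<^sup>2)"]) measurable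

lemma integrable_conv:
 fixes U W :: cfun
 assumes [measurable]: "U \<in> bm" "W \<in> bm" and "nsq U < \<infinity>" "nsq W < \<infinity>"
 shows "intL (%l. U (k - l) * W l)"
 using assms nsq_shift_reflect[of U k] by (intro integrable_L2_mult) auto

abbreviation xF :: "cfun \<Rightarrow> real \<Rightarrow> complex" where "xF F \<equiv> (%l. cr l * F l)"

lemma integrable_q1:
 assumes [measurable]: "U \<in> bm" "W \<in> bm" and "nsq U < \<infinity>" "nsq W < \<infinity>"
 shows "intL (%l. cr (q1 k l) * (U (k - l) * W l))"
proof -
 have "intL (%l. U (k - l) * W l * cr (q1 k l))"
  by (rule integrable_times_bounded[where B="\<bar>k\<bar>"]) (auto intro!: integrable_conv assms simp: q1_le)
 then show ?thesis by (simp add: mult.commute)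
qed

lemma nsq_abs_xF: "nsq (%l. cr \<bar>l\<bar> * F l) = nsq (xF F)"
 by (intro nsq_cong_AE AE_I2) (simp add: norm_mult)

text \<open>The derivative at l may be paid by either factor, through \<open>q2_le\<close> by the
  one at l and through \<open>q2_le2\<close> by the one at k - l.\<close>

lemma integrable_q2:
 assumes [measurable]: "U \<in> bm" "W \<in> bm"
  and "(nsq U < \<infinity> \<and> nsq (xF W) < \<infinity>) \<or> (nsq (xF U) < \<infinity> \<and> nsq W < \<infinity>)"
 shows "intL (%l. cr (q2 k l) * (U (k - l) * W l))"
 using assms(3)
proof
 assume a: "nsq U < \<infinity> \<and> nsq (xF W) < \<infinity>"
 have i: "intL (%l. U (k - l) * xF W l)" using a by (intro integrable_conv) auto
 show ?thesis
 proof (rule LI_int_bound[OF integrable_norm[OF integrable_mult_right[OF i, of "2 * cr k"]]])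
  show "AEL l. norm (cr (q2 k l) * (U (k - l) * W l)) \<le> norm (norm (2 * cr k * (U (k - l) * xF W l)))"
  proof (rule AE_I2)
   fix l
   have "\<bar>q2 k l\<bar> * norm (U (k - l) * W l) \<le> (2 * \<bar>k\<bar> * \<bar>l\<bar>) * norm (U (k - l) * W l)" by (intro mult_right_mono q2_le) auto
   then show "norm (cr (q2 k l) * (U (k - l) * W l)) \<le> norm (norm (2 * cr k * (U (k - l) * xF W l)))"
    by (simp add: norm_mult ac_simps)
  qed
 qed measurable
next
 assume a: "nsq (xF U) < \<infinity> \<and> nsq W < \<infinity>"
 have i: "intL (%l. xF U (k - l) * W l)" using a by (intro integrable_conv) auto
 show ?thesis
 proof (rule LI_int_bound[OF integrable_norm[OF integrable_mult_right[OF i, of "2 * cr k"]]])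
  show "AEL l. norm (cr (q2 k l) * (U (k - l) * W l)) \<le> norm (norm (2 * cr k * (xF U (k - l) * W l)))"
  proof (rule AE_I2)
   fix l
   have "\<bar>q2 k l\<bar> * norm (U (k - l) * W l) \<le> (2 * \<bar>k\<bar> * \<bar>k - l\<bar>) * norm (U (k - l) * W l)" by (intro mult_right_mono q2_le2) auto
   then show "norm (cr (q2 k l) * (U (k - l) * W l)) \<le> norm (norm (2 * cr k * (xF U (k - l) * W l)))"
    by (simp add: norm_mult ac_simps flip: of_real_diff)
  qed
 qed measurable
qed

lemma Qf_eq:
 assumes [measurable]: "F \<in> bm" "V \<in> bm"
  and V: "nsq V < \<infinity>" and F: "nsq F < \<infinity>" and xF: "nsq (xF F) < \<infinity>"
 shows "Qf F V k = c\<^sub>F * (Tq q1 V V k + Tq q2 F F k)"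
proof -
 have 1: "cr \<bar>k\<bar> * conv (%l. cr (sgn l) * V l) (%l. cr (sgn l) * V l) k = Tq q1 V V k"
  unfolding Tq_def conv_def by (subst integral_mult_right_zero[symmetric]) (simp add: q1_def ac_simps)
 have i1: "intL (%l. cr \<bar>k\<bar> * (F (k - l) * (cr \<bar>l\<bar> * F l)))"
  by (intro integrable_mult_right integrable_conv) (use F xF in \<open>auto simp: nsq_abs_xF\<close>)
 have i2: "intL (%l. cr k * (F (k - l) * (cr l * F l)))"
  by (intro integrable_mult_right integrable_conv) (use F xF in auto)
 have "cr \<bar>k\<bar> * conv F (%l. cr \<bar>l\<bar> * F l) k - cr k * conv F (%l. cr l * F l) k
  = (LI l. cr \<bar>k\<bar> * (F (k - l) * (cr \<bar>l\<bar> * F l)) - cr k * (F (k - l) * (cr l * F l)))"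
  unfolding conv_def using i1 i2 by (subst LI_diff) auto
 also have "\<dots> = Tq q2 F F k" unfolding Tq_def by (simp add: q2_def algebra_simps)
 finally have 2: "cr \<bar>k\<bar> * conv F (%l. cr \<bar>l\<bar> * F l) k - cr k * conv F (%l. cr l * F l) k = Tq q2 F F k" .
 show ?thesis unfolding Qf_def 1 2[symmetric] by (simp add: add_diff_eq)
qed

lemma Qf_measurable[measurable]:
 assumes [measurable]: "F \<in> bm" "V \<in> bm"
 shows "Qf F V \<in> bm"
 unfolding Qf_def[abs_def] by measurable

text \<open>Since sgn l and l are odd, sgn l V and l F are hermitian only after multiplication by i.
  The factor i is inserted, \<open>conv_hermitian\<close> applied, and i divided out again: twice in
  the first convolution, once in the last.\<close>

lemma Qf_hermitian:
 assumes F: "!!k. F (- k) = cnj (F k)" and V: "!!k. V (- k) = cnj (V k)"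
 shows "Qf F V (- k) = cnj (Qf F V k)"
proof -
 have 1: "conv (%l. cr (sgn l) * V l) (%l. cr (sgn l) * V l) (-k) = - (- cnj (conv (%l. cr (sgn l) * V l) (%l. cr (sgn l) * V l) k))"
 proof -
  have "conv (%l. \<i> * (cr (sgn l) * V l)) (%l. \<i> * (cr (sgn l) * V l)) (-k) = cnj (conv (%l. \<i> * (cr (sgn l) * V l)) (%l. \<i> * (cr (sgn l) * V l)) k)"
   by (rule conv_hermitian) (auto simp: V sgn_minus)
  then show ?thesis unfolding conv_scale by simp
 qed
 have 2: "conv F (%l. cr \<bar>l\<bar> * F l) (-k) = cnj (conv F (%l. cr \<bar>l\<bar> * F l) k)"
  by (rule conv_hermitian) (auto simp: F)
 have 3: "conv F (%l. cr l * F l) (-k) = - cnj (conv F (%l. cr l * F l) k)"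
 proof -
  have "conv (%l. 1 * F l) (%l. \<i> * (cr l * F l)) (-k) = cnj (conv (%l. 1 * F l) (%l. \<i> * (cr l * F l)) k)"
   by (rule conv_hermitian) (auto simp: F)
  then show ?thesis unfolding conv_scale by (simp add: complex_eq_iff)
 qed
 show ?thesis unfolding Qf_def 1 2 3 by simp
qed

lemma Tq_norm:
 "ennreal (norm (Tq q U W k)) \<le> (NN l. ennreal (\<bar>q k l\<bar> * (norm (U (k - l)) * norm (W l))))"
 unfolding Tq_def using norm_integral_le_nn[of lborel "%l. cr (q k l) * (U (k - l) * W l)"] by (simp add: norm_mult)

lemma norm_cF: "norm c\<^sub>F \<le> 1"
 using pi_ge_two by (simp add: norm_divide divide_le_eq_1 real_le_rsqrt)

text \<open>For bounded \<open>S3\<close> this majorant is both in L^1 and in L^2, as Young's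
  inequality for the convolution of \<open>pw F\<close> with itself requires.\<close>

definition pw :: "cfun \<Rightarrow> real \<Rightarrow> real" where "pw F a = (1 + a\<^sup>2) * norm (F a)"

lemma pw_measurable[measurable]: "F \<in> bm ==> pw F \<in> bm"
 unfolding pw_def[abs_def] by simp

lemma pw_nonneg[simp]: "0 \<le> pw F a" by (simp add: pw_def)

lemma pw_L1:
 assumes [measurable]: "F \<in> bm" and S: "S3 F \<le> ennreal M" and M: "0 \<le> M"
 shows "(NN a. ennreal (pw F a)) \<le> ennreal ((cI + M) / 2)"
proof -
 have "2 * (NN a. ennreal ((1 + a\<^sup>2) * norm (F a))) \<le> ennreal cI + wint (%k. (1 + k\<^sup>2) * (1 + k\<^sup>2)\<^sup>2) F"
  by (rule L1_of_weight) auto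
 also have "wint (%k. (1 + k\<^sup>2) * (1 + k\<^sup>2)\<^sup>2) F = S3 F" unfolding S3_def by (simp add: power3_eq_cube power2_eq_square mult.assoc)
 also have "ennreal cI + S3 F \<le> ennreal cI + ennreal M" using S by (intro add_left_mono)
 also have "\<dots> = 2 * ennreal ((cI + M) / 2)" using cI(1) M by (simp add: ennreal_2_times flip: ennreal_plus)
 finally show ?thesis unfolding pw_def by (simp add: ennreal_mult_le_mult_iff)
qed

lemma pw_L2:
 assumes [measurable]: "F \<in> bm" and S: "S3 F \<le> ennreal M"
 shows "(NN a. ennreal ((pw F a)\<^sup>2)) \<le> ennreal M"
proof -
 have "(NN a. ennreal ((pw F a)\<^sup>2)) = wint (%k. (1 + k\<^sup>2)\<^sup>2) F" by (simp add: pw_def power_mult_distrib)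
 also have "\<dots> \<le> ennreal M" by (rule S3_weight) (auto simp: S power_increasing)
 finally show ?thesis .
qed

lemma S3_nsq:
 assumes "F \<in> bm" "S3 F \<le> ennreal M"
 shows "nsq F \<le> ennreal M" "nsq (xF F) \<le> ennreal M"
proof -
 have 1: "1 \<le> (1 + k\<^sup>2) ^ 3" "k\<^sup>2 \<le> (1 + k\<^sup>2) ^ 3" for k :: real
  using one_le_power[of "1 + k\<^sup>2" 3] power_increasing[of 1 3 "1 + k\<^sup>2"] by auto
 show "nsq F \<le> ennreal M" using S3_weight[OF assms(1) _ assms(2), of "%_. 1"] 1 by (simp add: nsq_def)
 show "nsq (xF F) \<le> ennreal M" using S3_weight[OF assms(1) _ assms(2), of "%k. k\<^sup>2"] 1 by (simp add: nsq_def norm_mult power_mult_distrib)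
qed

text \<open>The weight sqrt (1 + k^2) and the |k| of the kernel together cost at most 1 + k^2, which
  is distributed over the two inner frequencies.\<close>

lemma Qf_weight_pointwise:
 assumes [measurable]: "F \<in> bm" "V \<in> bm"
  and V: "nsq V < \<infinity>" and F: "nsq F < \<infinity>" and xF: "nsq (xF F) < \<infinity>"
 shows "ennreal (sqrt (1 + k\<^sup>2) * norm (Qf F V k))
  \<le> 2 * (NN l. ennreal \<bar>pw V (k - l) * pw V l\<bar>) + 2 * (NN l. ennreal \<bar>pw F (k - l) * pw F l\<bar>)"
proof -
 let ?s = "sqrt (1 + k\<^sup>2)"
 have s: "?s \<ge> 0" by simp
 have ss: "?s \<le> 1 + k\<^sup>2" "\<bar>k\<bar> * ?s \<le> 1 + k\<^sup>2"
 proof -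
  have "\<bar>k\<bar> \<le> ?s" by (rule real_le_rsqrt) simp
  then have "\<bar>k\<bar> * ?s \<le> ?s * ?s" by (intro mult_right_mono) auto
  then show "\<bar>k\<bar> * ?s \<le> 1 + k\<^sup>2" by simp
  show "?s \<le> 1 + k\<^sup>2" using power_increasing[of 1 2 "1 + k\<^sup>2"] by (intro real_le_lsqrt) auto
 qed
 have b1: "?s * \<bar>q1 k l\<bar> \<le> 2 * ((1 + (k - l)\<^sup>2) * (1 + l\<^sup>2))" for l
 proof -
  have "?s * \<bar>q1 k l\<bar> \<le> ?s * \<bar>k\<bar>" by (intro mult_left_mono q1_le s)
  also have "\<dots> \<le> 1 + k\<^sup>2" using ss(2) by (simp add: mult.commute)
  also have "\<dots> \<le> 2 * ((1 + (k - l)\<^sup>2) * (1 + l\<^sup>2))"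
  proof -
   have "k\<^sup>2 \<le> 2 * (k - l)\<^sup>2 + 2 * l\<^sup>2" using power2_sum_le[of "k - l" l] by simp
   moreover have "(1 + (k - l)\<^sup>2) * (1 + l\<^sup>2) = 1 + (k - l)\<^sup>2 + l\<^sup>2 + (k - l)\<^sup>2 * l\<^sup>2" by (simp add: distrib_left distrib_right)
   moreover have "0 \<le> (k - l)\<^sup>2 * l\<^sup>2" by (intro mult_nonneg_nonneg zero_le_power2)
   ultimately show ?thesis by linarith
  qed
  finally show ?thesis .
 qed
 \<comment> \<open>Here l carries a derivative of its own. The weight in k is therefore charged
   entirely to k - l, which is possible because |k| \<le> |k - l| on the support of
   \<open>q2\<close>.\<close>
 have b2: "?s * \<bar>q2 k l\<bar> \<le> 2 * ((1 + (k - l)\<^sup>2) * (1 + l\<^sup>2))" for l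
 proof (cases "q2 k l = 0")
  case False
  have "?s * \<bar>q2 k l\<bar> \<le> ?s * (2 * \<bar>k\<bar> * \<bar>l\<bar>)" by (intro mult_left_mono q2_le s)
  also have "\<dots> = 2 * ((\<bar>k\<bar> * ?s) * \<bar>l\<bar>)" by simp
  also have "\<dots> \<le> 2 * ((1 + (k - l)\<^sup>2) * (1 + l\<^sup>2))"
  proof (intro mult_left_mono mult_mono)
   have "k\<^sup>2 \<le> (k - l)\<^sup>2" using q2_support[OF False] by (simp add: abs_le_square_iff)
   then show "\<bar>k\<bar> * ?s \<le> 1 + (k - l)\<^sup>2" using ss(2) by linarith
   show "\<bar>l\<bar> \<le> 1 + l\<^sup>2" using abs_pow_le[of 1 2 l] by simp
  qed auto
  finally show ?thesis .
 qed auto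
 have T: "ennreal (?s * norm (Tq q U U k)) \<le> 2 * (NN l. ennreal \<bar>pw U (k - l) * pw U l\<bar>)"
  if b: "!!l. ?s * \<bar>q k l\<bar> \<le> 2 * ((1 + (k - l)\<^sup>2) * (1 + l\<^sup>2))" and [measurable]: "(%l. q k l) \<in> bm" "U \<in> bm" for q U
 proof -
  have "ennreal (?s * norm (Tq q U U k)) = ennreal ?s * ennreal (norm (Tq q U U k))" using s by (rule ennreal_mult) simp
  also have "\<dots> \<le> ennreal ?s * (NN l. ennreal (\<bar>q k l\<bar> * (norm (U (k - l)) * norm (U l))))" by (intro mult_left_mono Tq_norm) simp
  also have "\<dots> = (NN l. ennreal ?s * ennreal (\<bar>q k l\<bar> * (norm (U (k - l)) * norm (U l))))"
   by (rule nn_integral_cmult[symmetric]) measurable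
  also have "\<dots> \<le> (NN l. 2 * ennreal \<bar>pw U (k - l) * pw U l\<bar>)"
  proof (rule nn_integral_mono)
   fix l
   have "?s * \<bar>q k l\<bar> * (norm (U (k - l)) * norm (U l)) \<le> 2 * ((1 + (k - l)\<^sup>2) * (1 + l\<^sup>2)) * (norm (U (k - l)) * norm (U l))"
    by (intro mult_right_mono b) auto
   also have "\<dots> = 2 * \<bar>pw U (k - l) * pw U l\<bar>" by (simp add: pw_def abs_mult ac_simps)
   finally have "ennreal (?s * (\<bar>q k l\<bar> * (norm (U (k - l)) * norm (U l)))) \<le> ennreal (2 * \<bar>pw U (k - l) * pw U l\<bar>)"
    by (intro ennreal_leI) (simp add: mult.assoc)
   then show "ennreal ?s * ennreal (\<bar>q k l\<bar> * (norm (U (k - l)) * norm (U l))) \<le> 2 * ennreal \<bar>pw U (k - l) * pw U l\<bar>"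
    using s by (simp only: ennreal_2_times ennreal_mult'[symmetric])
  qed
  also have "\<dots> = 2 * (NN l. ennreal \<bar>pw U (k - l) * pw U l\<bar>)" by (rule nn_integral_cmult) measurable
  finally show ?thesis .
 qed
 have "norm (Qf F V k) \<le> norm (Tq q1 V V k) + norm (Tq q2 F F k)"
 proof -
  have "norm (Qf F V k) \<le> 1 * norm (Tq q1 V V k + Tq q2 F F k)"
   unfolding Qf_eq[OF assms] norm_mult by (intro mult_right_mono norm_cF) auto
  then show ?thesis using norm_triangle_ineq[of "Tq q1 V V k" "Tq q2 F F k"] by linarith
 qed
 then have "ennreal (?s * norm (Qf F V k)) \<le> ennreal (?s * norm (Tq q1 V V k) + ?s * norm (Tq q2 F F k))"
  using s by (intro ennreal_leI) (simp add: distrib_left[symmetric] mult_left_mono)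
 also have "\<dots> = ennreal (?s * norm (Tq q1 V V k)) + ennreal (?s * norm (Tq q2 F F k))" using s by (intro ennreal_plus) auto
 also have "\<dots> \<le> 2 * (NN l. ennreal \<bar>pw V (k - l) * pw V l\<bar>) + 2 * (NN l. ennreal \<bar>pw F (k - l) * pw F l\<bar>)"
  by (intro add_mono T b1 b2) measurable
 finally show ?thesis .
qed

lemma ennreal_power2_sum_le: "(a + b)\<^sup>2 \<le> 2 * a\<^sup>2 + 2 * (b\<^sup>2 :: ennreal)"
proof (cases a; cases b)
 fix x y :: real assume xy: "a = ennreal x" "b = ennreal y" "0 \<le> x" "0 \<le> y"
 have "(a + b)\<^sup>2 = ennreal ((x + y)\<^sup>2)" using xy by (simp add: ennreal_power flip: ennreal_plus)
 also have "\<dots> \<le> ennreal (2 * x\<^sup>2 + 2 * y\<^sup>2)" by (rule ennreal_leI[OF power2_sum_le])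
 also have "\<dots> = 2 * a\<^sup>2 + 2 * b\<^sup>2" using xy by (simp add: ennreal_power ennreal_2_sum)
 finally show ?thesis .
qed (auto simp: power2_eq_square ennreal_mult_top ennreal_top_mult)

text \<open>The quadratic term maps bounded sets of H^3 into bounded sets of H^1. The level H^1
  makes it \<open>nice\<close> and provides the decay by which its part beyond a cutoff N becomes
  small.\<close>

lemma Qf_weight:
 assumes [measurable]: "F \<in> bm" "V \<in> bm"
  and SF: "S3 F \<le> ennreal M" and SV: "S3 V \<le> ennreal M" and M: "0 \<le> M"
 shows "wint (%k. 1 + k\<^sup>2) (Qf F V) \<le> ennreal (4 * (cI + M)\<^sup>2 * M)"
proof -
 have fin: "nsq V < \<infinity>" "nsq F < \<infinity>" "nsq (xF F) < \<infinity>"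
  using S3_nsq[OF _ SF] S3_nsq[OF _ SV] by (auto intro: le_less_trans)
 let ?Y = "%U k. NN l. ennreal \<bar>pw U (k - l) * pw U l\<bar>"
 have Y: "(NN k. (?Y U k)\<^sup>2) \<le> ennreal ((cI + M)\<^sup>2 / 4 * M)" if [measurable]: "U \<in> bm" and S: "S3 U \<le> ennreal M" for U
 proof -
  have "(NN k. (?Y U k)\<^sup>2) \<le> (NN x. ennreal \<bar>pw U x\<bar>)\<^sup>2 * (NN x. ennreal ((pw U x)\<^sup>2))"
   by (rule nn_young) measurable
  also have "\<dots> \<le> (ennreal ((cI + M) / 2))\<^sup>2 * ennreal M"
   using pw_L1[OF _ S M] pw_L2[OF _ S] by (intro mult_mono power_mono) auto
  also have "\<dots> = ennreal ((cI + M)\<^sup>2 / 4 * M)" using cI(1) M by (simp add: ennreal_power power_divide flip: ennreal_mult)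
  finally show ?thesis .
 qed
 have "wint (%k. 1 + k\<^sup>2) (Qf F V) \<le> (NN k. 8 * (?Y V k)\<^sup>2 + 8 * (?Y F k)\<^sup>2)"
 proof (rule nn_integral_mono)
  fix k
  have "ennreal ((1 + k\<^sup>2) * (norm (Qf F V k))\<^sup>2) = (ennreal (sqrt (1 + k\<^sup>2) * norm (Qf F V k)))\<^sup>2"
   by (simp add: ennreal_power power_mult_distrib)
  also have "\<dots> \<le> (2 * ?Y V k + 2 * ?Y F k)\<^sup>2"
   by (intro power_mono Qf_weight_pointwise fin) auto
  also have "\<dots> \<le> 2 * (2 * ?Y V k)\<^sup>2 + 2 * (2 * ?Y F k)\<^sup>2" by (rule ennreal_power2_sum_le)
  finally show "ennreal ((1 + k\<^sup>2) * (norm (Qf F V k))\<^sup>2) \<le> 8 * (?Y V k)\<^sup>2 + 8 * (?Y F k)\<^sup>2"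
   by (simp add: power_mult_distrib mult.assoc[symmetric])
 qed
 also have "\<dots> = 8 * (NN k. (?Y V k)\<^sup>2) + 8 * (NN k. (?Y F k)\<^sup>2)"
  by (simp add: nn_integral_add nn_integral_cmult)
 also have "\<dots> \<le> 8 * ennreal ((cI + M)\<^sup>2 / 4 * M) + 8 * ennreal ((cI + M)\<^sup>2 / 4 * M)"
  by (intro add_mono mult_left_mono Y SF SV) auto
 also have "\<dots> = ennreal (4 * (cI + M)\<^sup>2 * M)"
  using M ennreal_lin2[of 8 8 "(cI + M)\<^sup>2 / 4 * M" "(cI + M)\<^sup>2 / 4 * M"] by simp
 finally show ?thesis .
qed

section \<open>Energy estimates\<close>

text \<open>The factor in L^1 may stand at either inner frequency; the substitutions exchange the
  roles of l and k - l.\<close>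

lemma nn_tri_conv:
 fixes p q r :: "real \<Rightarrow> real"
 assumes [measurable]: "p \<in> bm" "q \<in> bm" "r \<in> bm"
 shows "2 * (NN k l. ennreal \<bar>p (k - l) * q l * r k\<bar>)
  \<le> (NN x. ennreal \<bar>p x\<bar>) * ((NN x. ennreal ((q x)\<^sup>2)) + (NN x. ennreal ((r x)\<^sup>2)))" (is ?A)
  and "2 * (NN k l. ennreal \<bar>q (k - l) * p l * r k\<bar>)
  \<le> (NN x. ennreal \<bar>p x\<bar>) * ((NN x. ennreal ((q x)\<^sup>2)) + (NN x. ennreal ((r x)\<^sup>2)))" (is ?B)
proof -
 have "(NN k l. ennreal \<bar>q (k - l) * p l * r k\<bar>) = (NN l k. ennreal \<bar>q (k - l) * p l * r k\<bar>)"
  by (rule Fubini_nn) measurable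
 also have "\<dots> = (NN l k. ennreal \<bar>p l * q k * r (l + k)\<bar>)"
 proof (rule nn_integral_cong)
  fix l
  have "(NN k. ennreal \<bar>q (k - l) * p l * r k\<bar>) = (NN k. ennreal \<bar>q (l + k - l) * p l * r (l + k)\<bar>)"
   by (rule nn_integral_shift(1)[symmetric]) measurable
  then show "(NN k. ennreal \<bar>q (k - l) * p l * r k\<bar>) = (NN k. ennreal \<bar>p l * q k * r (l + k)\<bar>)"
   by (simp add: ac_simps)
 qed
 finally have 1: "(NN k l. ennreal \<bar>q (k - l) * p l * r k\<bar>) = (NN l k. ennreal \<bar>p l * q k * r (l + k)\<bar>)" .
 show ?B unfolding 1 by (rule nn_trilinear) measurable
 have "(NN l. ennreal \<bar>p (k - l) * q l * r k\<bar>) = (NN l. ennreal \<bar>q (k - l) * p l * r k\<bar>)" for k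
 proof -
  have "(NN l. ennreal \<bar>p (k - (k - l)) * q (k - l) * r k\<bar>) = (NN l. ennreal \<bar>p (k - l) * q l * r k\<bar>)"
   by (rule nn_integral_reflect_shift[of "%l. ennreal \<bar>p (k - l) * q l * r k\<bar>"]) measurable
  then show ?thesis by (simp add: mult.commute[of "p _"])
 qed
 then show ?A using \<open>?B\<close> by simp
qed

text \<open>In terms of the triple (k - l, l, -k) of sum zero, the first substitution exchanges l
  and -k, and the second one rotates the triple cyclically.\<close>

lemma nn_reflect2:
 fixes \<Theta> :: "real \<Rightarrow> real \<Rightarrow> ennreal"
 assumes [measurable]: "case_prod \<Theta> \<in> bm2"
 shows "(NN k l. \<Theta> (- l) (- k)) = (NN k l. \<Theta> k l)"
  and "(NN k l. \<Theta> (l - k) (- k)) = (NN k l. \<Theta> k l)"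
proof -
 note [measurable (raw)] = measurable_section2[OF assms]
 have r: "(NN x. f (- x)) = (NN x. f x)" if "f \<in> bm" for f :: "real \<Rightarrow> ennreal"
  using nn_integral_reflect_shift[OF that, of 0] by simp
 have 1: "(NN k l. \<Theta> l (- k)) = (NN k l. \<Theta> k l)"
 proof -
  have "(NN k l. \<Theta> l (- k)) = (NN k l. \<Theta> l k)"
   by (rule r[of "%k. NN l. \<Theta> l k"]) measurable
  also have "\<dots> = (NN k l. \<Theta> k l)" by (rule Fubini_nn) measurable
  finally show ?thesis .
 qed
 have "(NN l. \<Theta> (- l) (- k)) = (NN l. \<Theta> l (- k))" for k by (rule r[of "%l. \<Theta> l (- k)"]) measurable
 then show "(NN k l. \<Theta> (- l) (- k)) = (NN k l. \<Theta> k l)" using 1 by simp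
 have "(NN l. \<Theta> (l - k) (- k)) = (NN l. \<Theta> l (- k))" for k
  by (rule nn_integral_shift(3)[of "%l. \<Theta> l (- k)"]) measurable
 then show "(NN k l. \<Theta> (l - k) (- k)) = (NN k l. \<Theta> k l)" using 1 by simp
qed

text \<open>Absolute convergence over the plane. It is established qualitatively first, so that the
  iterated integral \<open>dbl\<close> may be symmetrised by the substitutions above; quantitative
  bounds come only afterwards.\<close>

definition good2 :: "(real \<Rightarrow> real \<Rightarrow> complex) \<Rightarrow> bool"
 where "good2 \<Theta> \<longleftrightarrow> case_prod \<Theta> \<in> bm2
  \<and> (NN k l. ennreal (norm (\<Theta> k l))) < \<infinity>"

definition dbl :: "(real \<Rightarrow> real \<Rightarrow> complex) \<Rightarrow> complex"
 where "dbl \<Theta> = (LI k l. \<Theta> k l)"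

lemma good2_product: "good2 \<Theta> ==> integrable (lborel \<Otimes>\<^sub>M lborel) (case_prod \<Theta>)"
 unfolding good2_def by (intro integrable_pairI) auto

lemma dbl_product: "good2 \<Theta> ==> dbl \<Theta> = integral\<^sup>L (lborel \<Otimes>\<^sub>M lborel) (case_prod \<Theta>)"
 unfolding dbl_def using lborel_pair.integral_fst'[OF good2_product] by simp

lemma good2_integrable: "good2 \<Theta> ==> intL (%k. LI l. \<Theta> k l)"
 using lborel_pair.integrable_fst'[OF good2_product] by simp

lemma good2_transform:
 assumes "good2 \<Theta>"
 shows "good2 (%k l. \<Theta> (- l) (- k))" "good2 (%k l. \<Theta> (l - k) (- k))"
  "dbl (%k l. \<Theta> (- l) (- k)) = dbl \<Theta>" "dbl (%k l. \<Theta> (l - k) (- k)) = dbl \<Theta>"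
proof -
 have m[measurable]: "case_prod \<Theta> \<in> bm2" using assms by (simp add: good2_def)
 note [measurable (raw)] = measurable_section2[OF m]
 show "good2 (%k l. \<Theta> (- l) (- k))"
  using nn_reflect2(1)[of "%k l. ennreal (norm (\<Theta> k l))"] assms by (simp add: good2_def)
 show "good2 (%k l. \<Theta> (l - k) (- k))"
  using nn_reflect2(2)[of "%k l. ennreal (norm (\<Theta> k l))"] assms by (simp add: good2_def)
 have fin: "(NN k l. ennreal (norm (\<Theta> k l))) < \<infinity>" using assms by (simp add: good2_def)
 have 1: "(LI k l. \<Theta> l (- k)) = dbl \<Theta>"
 proof -
  have "(LI k l. \<Theta> l (- k)) = (LI k l. \<Theta> l k)"
   by (rule integral_reflect_real[of "%k. LI l. \<Theta> l k"])
  also have "\<dots> = dbl \<Theta>" unfolding dbl_def by (rule Fubini_bochner[symmetric, OF m fin])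
  finally show ?thesis .
 qed
 have "(LI l. \<Theta> (- l) (- k)) = (LI l. \<Theta> l (- k))" for k by (rule integral_reflect_real[of "%l. \<Theta> l (- k)"])
 then show "dbl (%k l. \<Theta> (- l) (- k)) = dbl \<Theta>" using 1 by (simp add: dbl_def)
 have "(LI l. \<Theta> (l - k) (- k)) = (LI l. \<Theta> l (- k))" for k
  using lborel_integral_real_affine[of 1 "%l. \<Theta> (l - k) (- k)" k] by simp
 then show "dbl (%k l. \<Theta> (l - k) (- k)) = dbl \<Theta>" using 1 by (simp add: dbl_def)
qed

lemma good2_add:
 assumes "good2 \<Theta>" "good2 \<Phi>"
 shows "good2 (%k l. \<Theta> k l + \<Phi> k l)" "dbl (%k l. \<Theta> k l + \<Phi> k l) = dbl \<Theta> + dbl \<Phi>"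
proof -
 have m[measurable]: "case_prod \<Theta> \<in> bm2" "case_prod \<Phi> \<in> bm2"
  using assms by (simp_all add: good2_def)
 note [measurable (raw)] = measurable_section2[OF m(1)] measurable_section2[OF m(2)]
 have "(NN k l. ennreal (norm (\<Theta> k l + \<Phi> k l)))
  \<le> (NN k l. ennreal (norm (\<Theta> k l)) + ennreal (norm (\<Phi> k l)))"
  by (intro nn_integral_mono) (simp add: norm_triangle_ineq flip: ennreal_plus)
 also have "\<dots> = (NN k. (NN l. ennreal (norm (\<Theta> k l))) + (NN l. ennreal (norm (\<Phi> k l))))"
  by (intro nn_integral_cong nn_integral_add) measurable
 also have "\<dots> = (NN k l. ennreal (norm (\<Theta> k l))) + (NN k l. ennreal (norm (\<Phi> k l)))"
  by (rule nn_integral_add) measurable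
 also have "\<dots> < \<infinity>" using assms by (simp add: good2_def)
 finally show g: "good2 (%k l. \<Theta> k l + \<Phi> k l)" by (simp add: good2_def)
 show "dbl (%k l. \<Theta> k l + \<Phi> k l) = dbl \<Theta> + dbl \<Phi>"
  unfolding dbl_product[OF g] dbl_product[OF assms(1)] dbl_product[OF assms(2)]
  using good2_product[OF assms(1)] good2_product[OF assms(2)]
  by (subst LI_add[symmetric]) (auto simp: split_beta')
qed

lemma dbl_norm_le:
 assumes "!!k l. norm (\<Theta> k l) \<le> b k l"
 shows "ennreal (norm (dbl \<Theta>)) \<le> (NN k l. ennreal (b k l))"
proof -
 have "ennreal (norm (dbl \<Theta>)) \<le> (NN k. ennreal (norm (LI l. \<Theta> k l)))" unfolding dbl_def by (rule norm_integral_le_nn)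
 also have "\<dots> \<le> (NN k l. ennreal (norm (\<Theta> k l)))" by (intro nn_integral_mono norm_integral_le_nn)
 also have "\<dots> \<le> (NN k l. ennreal (b k l))" by (intro nn_integral_mono ennreal_leI assms)
 finally show ?thesis .
qed

lemma Tq_measurable:
 assumes [measurable]: "case_prod q \<in> bm2" "U \<in> bm" "W \<in> bm"
 shows "Tq q U W \<in> bm"
proof -
 note [measurable (raw)] = measurable_section2[OF assms(1)]
 show ?thesis unfolding Tq_def[abs_def] by measurable
qed

lemma q_measurable2: "case_prod q1 \<in> bm2" "case_prod q2 \<in> bm2"
 unfolding split_beta' by measurable

lemma xF_L1:
 assumes [measurable]: "F \<in> bm" and S: "S3 F \<le> ennreal M" and M: "0 \<le> M"
 shows "(NN a. ennreal \<bar>\<bar>a\<bar> * norm (F a)\<bar>) \<le> ennreal ((cI + M) / 2)" "(NN a. ennreal (norm (F a))) \<le> ennreal ((cI + M) / 2)"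
proof -
 have "\<bar>a\<bar> \<le> 1 + a\<^sup>2" for a :: real using abs_pow_le[of 1 2 a] by simp
 then have "\<bar>\<bar>a\<bar> * norm (F a)\<bar> \<le> pw F a" "norm (F a) \<le> pw F a" for a
  unfolding pw_def using mult_right_mono[of 1 "1 + a\<^sup>2" "norm (F a)"] by (auto simp: abs_mult mult_right_mono)
 then have "(NN a. ennreal \<bar>\<bar>a\<bar> * norm (F a)\<bar>) \<le> (NN a. ennreal (pw F a))"
  "(NN a. ennreal (norm (F a))) \<le> (NN a. ennreal (pw F a))"
  by (auto intro!: nn_integral_mono ennreal_leI)
 then show "(NN a. ennreal \<bar>\<bar>a\<bar> * norm (F a)\<bar>) \<le> ennreal ((cI + M) / 2)" "(NN a. ennreal (norm (F a))) \<le> ennreal ((cI + M) / 2)"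
  using pw_L1[OF assms] by (auto intro: order_trans)
qed

lemma Tq_q1_symmetric: "Tq q1 U W k = Tq q1 W U k"
proof -
 have "Tq q1 U W k = (LI l. cr (q1 k (k - l)) * (U (k - (k - l)) * W (k - l)))"
  unfolding Tq_def using lborel_integral_real_affine[of "-1" "%l. cr (q1 k l) * (U (k - l) * W l)" k] by simp
 also have "\<dots> = Tq q1 W U k" unfolding Tq_def by (simp add: q1_def ac_simps)
 finally show ?thesis .
qed

text \<open>The kernel \<open>q1\<close> is symmetric under l -> k - l, hence the form factorises
  like x^2 - y^2 = (x + y)(x - y). The sum, which has derivatives to spare, stands at k - l.\<close>

lemma Tq_q1_diff:
 assumes [measurable]: "V \<in> bm" "V' \<in> bm" and "nsq V < \<infinity>" "nsq V' < \<infinity>"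
 shows "Tq q1 V V k - Tq q1 V' V' k = Tq q1 (%k. V k + V' k) (%k. V k - V' k) k"
proof -
 note i = integrable_q1[OF assms(1,1,3,3), of k] integrable_q1[OF assms(2,2,4,4), of k] integrable_q1[OF assms(1,2,3,4), of k] integrable_q1[OF assms(2,1,4,3), of k]
 have "Tq q1 (%k. V k + V' k) (%k. V k - V' k) k = Tq q1 V V k - Tq q1 V V' k + (Tq q1 V' V k - Tq q1 V' V' k)"
  unfolding Tq_def using i
  by (simp add: algebra_simps flip: LI_diff LI_add)
 then show ?thesis using Tq_q1_symmetric[of V V' k] by simp
qed

lemma nsq_xF_diff:
 assumes [measurable]: "F \<in> bm" "F' \<in> bm" and "nsq (xF F) < \<infinity>" "nsq (xF F') < \<infinity>"
 shows "nsq (xF (%k. F k - F' k)) < \<infinity>"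
proof -
 have "nsq (xF (%k. F k - F' k)) = nsq (%k. xF F k - xF F' k)" by (simp add: algebra_simps)
 also have "\<dots> \<le> 2 * nsq (xF F) + 2 * nsq (xF F')" by (rule nsq_diff_le) measurable
 also have "\<dots> < \<infinity>" using assms by (simp add: ennreal_mult_less_top)
 finally show ?thesis .
qed

lemma nsq_diff_finite:
 fixes F F' :: cfun
 assumes "F \<in> bm" "F' \<in> bm" and "nsq F < \<infinity>" "nsq F' < \<infinity>"
 shows "nsq (%k. F k - F' k) < \<infinity>"
 using nsq_diff_le[OF assms(1,2)] assms(3,4) by (auto simp: ennreal_mult_less_top intro: le_less_trans)

text \<open>This kernel has no such symmetry, so the difference is split in the usual asymmetric
  way; it loses no derivative in the difference anyway.\<close>

lemma Tq_q2_diff: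
 assumes [measurable]: "F \<in> bm" "F' \<in> bm"
  and n: "nsq F < \<infinity>" "nsq F' < \<infinity>" "nsq (xF F) < \<infinity>" "nsq (xF F') < \<infinity>"
 shows "Tq q2 F F k - Tq q2 F' F' k = Tq q2 (%k. F k - F' k) F k + Tq q2 F' (%k. F k - F' k) k"
proof -
 have i: "intL (%l. cr (q2 k l) * (F (k - l) * F l))"
  "intL (%l. cr (q2 k l) * (F' (k - l) * F' l))"
  "intL (%l. cr (q2 k l) * (F' (k - l) * F l))"
  by (intro integrable_q2 disjI1 conjI n assms)+
 then show ?thesis
  unfolding Tq_def by (simp add: algebra_simps flip: LI_diff LI_add)
qed

text \<open>The derivative loss of the quadratic term cancels in the pairing with the difference, because
 the kernel is antisymmetrised by the substitution \<open>(k, l) \<mapsto> (- l, - k)\<close>.\<close>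

lemma low_energy_estimate:
 assumes m[measurable]: "F \<in> bm" "V \<in> bm" "F' \<in> bm" "V' \<in> bm"
  and hV: "!!k. V (- k) = cnj (V k)" "!!k. V' (- k) = cnj (V' k)"
  and S: "S3 F \<le> ennreal M" "S3 V \<le> ennreal M" "S3 F' \<le> ennreal M" "S3 V' \<le> ennreal M" and M: "0 \<le> M"
 shows "ennreal (norm (LI k. cnj (V k - V' k) * (Qf F V k - Qf F' V' k)))
  \<le> ennreal (2 * (cI + M)) * (nsq (%k. V k - V' k) + nsq (xF (%k. F k - F' k)))"
proof -
 define d where "d k = V k - V' k" for k
 define e where "e k = F k - F' k" for k
 define s where "s k = V k + V' k" for k
 have [measurable]: "d \<in> bm" "e \<in> bm" "s \<in> bm"
  unfolding d_def[abs_def] e_def[abs_def] s_def[abs_def] by measurable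
 have fin: "nsq F < \<infinity>" "nsq (xF F) < \<infinity>" "nsq V < \<infinity>" "nsq (xF V) < \<infinity>" "nsq F' < \<infinity>" "nsq (xF F') < \<infinity>" "nsq V' < \<infinity>" "nsq (xF V') < \<infinity>"
  using S3_nsq[OF m(1) S(1)] S3_nsq[OF m(2) S(2)] S3_nsq[OF m(3) S(3)] S3_nsq[OF m(4) S(4)] by (auto intro: le_less_trans)
 have hd: "d (- k) = cnj (d k)" for k unfolding d_def by (simp add: hV)
 have dfin: "nsq d < \<infinity>" "nsq (xF d) < \<infinity>" "nsq (xF e) < \<infinity>"
  unfolding d_def[abs_def] e_def[abs_def] by (intro nsq_diff_finite nsq_xF_diff m fin)+
 let ?K = "ennreal ((cI + M) / 2)"
 have L: "(NN a. ennreal \<bar>\<bar>a\<bar> * norm (F a)\<bar>) \<le> ?K" "(NN a. ennreal \<bar>\<bar>a\<bar> * norm (F' a)\<bar>) \<le> ?K"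
  "(NN a. ennreal \<bar>\<bar>a\<bar> * norm (V a)\<bar>) \<le> ?K" "(NN a. ennreal \<bar>\<bar>a\<bar> * norm (V' a)\<bar>) \<le> ?K"
  "(NN a. ennreal (norm (V a))) \<le> ?K" "(NN a. ennreal (norm (V' a))) \<le> ?K"
  by (intro xF_L1 m S M)+
 have two: "?K + ?K = 2 * ?K" by (simp add: mult_2)
 have Ls: "(NN a. ennreal \<bar>\<bar>a\<bar> * norm (s a)\<bar>) \<le> 2 * ?K"
 proof -
  have "(NN a. ennreal \<bar>\<bar>a\<bar> * norm (s a)\<bar>) \<le> (NN a. ennreal \<bar>\<bar>a\<bar> * norm (V a)\<bar> + ennreal \<bar>\<bar>a\<bar> * norm (V' a)\<bar>)"
   unfolding s_def by (intro nn_integral_mono) (simp add: abs_mult distrib_left[symmetric] mult_left_mono norm_triangle_ineq flip: ennreal_plus)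
  also have "\<dots> \<le> ?K + ?K" using L by (simp add: nn_integral_add add_mono)
  finally show ?thesis unfolding two .
 qed
 have Ls0: "(NN a. ennreal \<bar>norm (s a)\<bar>) \<le> 2 * ?K"
 proof -
  have "(NN a. ennreal \<bar>norm (s a)\<bar>) \<le> (NN a. ennreal (norm (V a)) + ennreal (norm (V' a)))"
   unfolding s_def by (intro nn_integral_mono) (simp add: norm_triangle_ineq flip: ennreal_plus)
  also have "\<dots> \<le> ?K + ?K" using L by (simp add: nn_integral_add add_mono)
  finally show ?thesis unfolding two .
 qed
 have nd: "(NN x. ennreal ((norm (d x))\<^sup>2)) = nsq d" "(NN x. ennreal ((\<bar>x\<bar> * norm (d x))\<^sup>2)) = nsq (xF d)"
  "(NN x. ennreal ((\<bar>x\<bar> * norm (e x))\<^sup>2)) = nsq (xF e)"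
  by (simp_all add: nsq_def norm_mult)
 \<comment> \<open>Absolute convergence of this integral uses one derivative of d. That is
   legitimate as a qualitative fact, since both V and V' are in H^3, but it must not enter the
   bound.\<close>
 define \<Theta> where "\<Theta> k l = cnj (d k) * (cr (q1 k l) * (s (k - l) * d l))" for k l
 have g\<Theta>: "good2 \<Theta>"
  unfolding good2_def
 proof
  show "case_prod \<Theta> \<in> bm2" unfolding \<Theta>_def split_beta' by measurable
  have "2 * (NN k l. ennreal (norm (\<Theta> k l))) \<le> 2 * (NN k l. ennreal \<bar>norm (s (k - l)) * norm (d l) * (\<bar>k\<bar> * norm (d k))\<bar>)"
  proof (intro mult_left_mono nn_integral_mono ennreal_leI)
   fix k l
   have "norm (\<Theta> k l) = \<bar>q1 k l\<bar> * (norm (d k) * (norm (s (k - l)) * norm (d l)))" by (simp add: \<Theta>_def norm_mult)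
   also have "\<dots> \<le> \<bar>k\<bar> * (norm (d k) * (norm (s (k - l)) * norm (d l)))" by (intro mult_right_mono q1_le) auto
   finally show "norm (\<Theta> k l) \<le> \<bar>norm (s (k - l)) * norm (d l) * (\<bar>k\<bar> * norm (d k))\<bar>" by (simp add: ac_simps abs_mult)
  qed auto
  also have "\<dots> \<le> (NN a. ennreal \<bar>norm (s a)\<bar>) * (nsq d + nsq (xF d))"
   unfolding nd[symmetric] by (rule nn_tri_conv(1)) measurable
  also have "\<dots> < \<infinity>" using Ls0 dfin by (auto simp: ennreal_mult_less_top intro: le_less_trans)
  finally show "(NN k l. ennreal (norm (\<Theta> k l))) < \<infinity>" by (auto simp: ennreal_mult_less_top)
 qed
 have J1: "(LI k. cnj (d k) * Tq q1 s d k) = dbl \<Theta>" unfolding dbl_def \<Theta>_def Tq_def by simp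
 have i1: "intL (%k. cnj (d k) * Tq q1 s d k)"
  using good2_integrable[OF g\<Theta>] unfolding \<Theta>_def Tq_def by simp
 have "2 * dbl \<Theta> = dbl (%k l. \<Theta> k l + \<Theta> (- l) (- k))"
  using good2_add(2)[OF g\<Theta> good2_transform(1)[OF g\<Theta>]] good2_transform(3)[OF g\<Theta>] by simp
 then have "2 * ennreal (norm (dbl \<Theta>)) = ennreal (norm (dbl (%k l. \<Theta> k l + \<Theta> (- l) (- k))))"
  by (simp add: ennreal_2_times norm_mult flip: \<open>2 * dbl \<Theta> = _\<close>)
 also have "\<dots> \<le> (NN k l. ennreal \<bar>\<bar>k - l\<bar> * norm (s (k - l)) * norm (d l) * norm (d k)\<bar>)"
 proof (rule dbl_norm_le)
  fix k l
  have "\<Theta> k l + \<Theta> (- l) (- k) = cr (q1 k l + q1 (- l) (- k)) * (cnj (d k) * s (k - l) * d l)"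
   by (simp add: \<Theta>_def hd algebra_simps)
  also have "norm \<dots> = \<bar>q1 k l + q1 (- l) (- k)\<bar> * (norm (d k) * norm (s (k - l)) * norm (d l))" by (simp only: norm_mult norm_of_real complex_mod_cnj)
  also have "\<dots> \<le> \<bar>k - l\<bar> * (norm (d k) * norm (s (k - l)) * norm (d l))"
  proof (rule mult_right_mono)
   \<comment> \<open>For equal signs of k and l the sum is ||k| - |l|| in absolute value, for
     opposite signs |k| + |l|, and 0 never exceeds the bound. The derivative has moved to the factor
     s.\<close>
   show "\<bar>q1 k l + q1 (- l) (- k)\<bar> \<le> \<bar>k - l\<bar>"
    unfolding q1_def by (cases k "0::real" rule: linorder_cases; cases l "0::real" rule: linorder_cases; cases k l rule: linorder_cases) (auto simp: sgn_if)
  qed simp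
  finally show "norm (\<Theta> k l + \<Theta> (- l) (- k)) \<le> \<bar>\<bar>k - l\<bar> * norm (s (k - l)) * norm (d l) * norm (d k)\<bar>"
   by (simp add: ac_simps abs_mult)
 qed
 finally have "2 * (2 * ennreal (norm (dbl \<Theta>))) \<le> 2 * (NN k l. ennreal \<bar>\<bar>k - l\<bar> * norm (s (k - l)) * norm (d l) * norm (d k)\<bar>)"
  by (intro mult_left_mono) auto
 also have "\<dots> \<le> (NN a. ennreal \<bar>\<bar>a\<bar> * norm (s a)\<bar>) * (nsq d + nsq d)"
  unfolding nd[symmetric] by (rule nn_tri_conv(1)) measurable
 also have "\<dots> \<le> (2 * ?K) * (2 * nsq d)" using Ls by (intro mult_mono) (auto simp: mult_2)
 also have "\<dots> = 2 * (2 * (?K * nsq d))" by (simp add: ac_simps)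
 finally have J1le: "ennreal (norm (dbl \<Theta>)) \<le> ?K * nsq d" by (simp add: ennreal_mult_le_mult_iff)
 \<comment> \<open>The part from \<open>q2\<close> needs no symmetrisation: \<open>q2_le2\<close>
   places one derivative on each factor and none on d, and the \<open>lam\<close> part of the norm
   controls one derivative of e.\<close>
 define Y where "Y k = cnj (d k) * (Tq q2 e F k + Tq q2 F' e k)" for k
 have [measurable]: "Y \<in> bm" unfolding Y_def[abs_def]
  using Tq_measurable[OF q_measurable2(2)] by measurable
 have Yle: "(NN k. ennreal (norm (Y k))) \<le> 2 * ?K * (nsq d + nsq (xF e))"
 proof -
  have "(NN k. ennreal (norm (Y k))) \<le> (NN k. 2 * (NN l. ennreal \<bar>(\<bar>k - l\<bar> * norm (e (k - l))) * (\<bar>l\<bar> * norm (F l)) * norm (d k)\<bar>)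
   + 2 * (NN l. ennreal \<bar>(\<bar>k - l\<bar> * norm (F' (k - l))) * (\<bar>l\<bar> * norm (e l)) * norm (d k)\<bar>))"
  proof (rule nn_integral_mono)
   fix k
   have T: "ennreal (norm (d k) * norm (Tq q2 U W k)) \<le> 2 * (NN l. ennreal \<bar>(\<bar>k - l\<bar> * norm (U (k - l))) * (\<bar>l\<bar> * norm (W l)) * norm (d k)\<bar>)"
    if [measurable]: "U \<in> bm" "W \<in> bm" for U W
   proof -
    have "ennreal (norm (d k) * norm (Tq q2 U W k)) = ennreal (norm (d k)) * ennreal (norm (Tq q2 U W k))" by (rule ennreal_mult) auto
    also have "\<dots> \<le> ennreal (norm (d k)) * (NN l. ennreal (\<bar>q2 k l\<bar> * (norm (U (k - l)) * norm (W l))))" by (intro mult_left_mono Tq_norm) simp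
    also have "\<dots> = (NN l. ennreal (norm (d k)) * ennreal (\<bar>q2 k l\<bar> * (norm (U (k - l)) * norm (W l))))"
     by (rule nn_integral_cmult[symmetric]) measurable
    also have "\<dots> \<le> (NN l. 2 * ennreal \<bar>(\<bar>k - l\<bar> * norm (U (k - l))) * (\<bar>l\<bar> * norm (W l)) * norm (d k)\<bar>)"
    proof (rule nn_integral_mono)
     fix l
     have "\<bar>q2 k l\<bar> * (norm (d k) * (norm (U (k - l)) * norm (W l))) \<le> (2 * \<bar>k - l\<bar> * \<bar>l\<bar>) * (norm (d k) * (norm (U (k - l)) * norm (W l)))"
      by (intro mult_right_mono q2_le2) auto
     then have "norm (d k) * (\<bar>q2 k l\<bar> * (norm (U (k - l)) * norm (W l))) \<le> 2 * \<bar>(\<bar>k - l\<bar> * norm (U (k - l))) * (\<bar>l\<bar> * norm (W l)) * norm (d k)\<bar>"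
      by (simp add: abs_mult ac_simps)
     then have "ennreal (norm (d k) * (\<bar>q2 k l\<bar> * (norm (U (k - l)) * norm (W l)))) \<le> ennreal (2 * \<bar>(\<bar>k - l\<bar> * norm (U (k - l))) * (\<bar>l\<bar> * norm (W l)) * norm (d k)\<bar>)"
      by (rule ennreal_leI)
     then show "ennreal (norm (d k)) * ennreal (\<bar>q2 k l\<bar> * (norm (U (k - l)) * norm (W l))) \<le> 2 * ennreal \<bar>(\<bar>k - l\<bar> * norm (U (k - l))) * (\<bar>l\<bar> * norm (W l)) * norm (d k)\<bar>"
      by (simp only: ennreal_2_times ennreal_mult'[symmetric] norm_ge_zero)
    qed
    also have "\<dots> = 2 * (NN l. ennreal \<bar>(\<bar>k - l\<bar> * norm (U (k - l))) * (\<bar>l\<bar> * norm (W l)) * norm (d k)\<bar>)"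
     by (rule nn_integral_cmult) measurable
    finally show ?thesis .
   qed
   have "norm (Y k) \<le> norm (d k) * norm (Tq q2 e F k) + norm (d k) * norm (Tq q2 F' e k)"
    unfolding Y_def norm_mult complex_mod_cnj distrib_left[symmetric] by (intro mult_left_mono norm_triangle_ineq) auto
   then have "ennreal (norm (Y k)) \<le> ennreal (norm (d k) * norm (Tq q2 e F k)) + ennreal (norm (d k) * norm (Tq q2 F' e k))"
    by (simp add: ennreal_leI flip: ennreal_plus)
   also have "\<dots> \<le> 2 * (NN l. ennreal \<bar>(\<bar>k - l\<bar> * norm (e (k - l))) * (\<bar>l\<bar> * norm (F l)) * norm (d k)\<bar>)
    + 2 * (NN l. ennreal \<bar>(\<bar>k - l\<bar> * norm (F' (k - l))) * (\<bar>l\<bar> * norm (e l)) * norm (d k)\<bar>)"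
    by (intro add_mono T) measurable
   finally show "ennreal (norm (Y k)) \<le> \<dots>" .
  qed
  also have "\<dots> = 2 * (NN k l. ennreal \<bar>(\<bar>k - l\<bar> * norm (e (k - l))) * (\<bar>l\<bar> * norm (F l)) * norm (d k)\<bar>)
   + 2 * (NN k l. ennreal \<bar>(\<bar>k - l\<bar> * norm (F' (k - l))) * (\<bar>l\<bar> * norm (e l)) * norm (d k)\<bar>)"
   by (subst nn_integral_add) (simp_all add: nn_integral_cmult)
  also have "\<dots> \<le> (NN a. ennreal \<bar>\<bar>a\<bar> * norm (F a)\<bar>) * (nsq (xF e) + nsq d) + (NN a. ennreal \<bar>\<bar>a\<bar> * norm (F' a)\<bar>) * (nsq (xF e) + nsq d)"
   unfolding nd[symmetric] by (intro add_mono nn_tri_conv) measurable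
  also have "\<dots> \<le> ?K * (nsq (xF e) + nsq d) + ?K * (nsq (xF e) + nsq d)" by (intro add_mono mult_right_mono L) auto
  also have "\<dots> = 2 * ?K * (nsq d + nsq (xF e))" unfolding mult.assoc mult_2[symmetric] by (simp add: add.commute)
  finally show ?thesis .
 qed
 have i2: "intL Y"
  using Yle dfin by (intro integrableI_bounded) (auto simp: ennreal_mult_less_top intro: le_less_trans)
 have eq: "cnj (d k) * (Qf F V k - Qf F' V' k) = c\<^sub>F * (cnj (d k) * Tq q1 s d k + Y k)" for k
 proof -
  have "Qf F V k - Qf F' V' k = c\<^sub>F * ((Tq q1 V V k - Tq q1 V' V' k) + (Tq q2 F F k - Tq q2 F' F' k))"
   unfolding Qf_eq[OF m(1,2) fin(3,1,2)] Qf_eq[OF m(3,4) fin(7,5,6)] by (simp add: algebra_simps)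
  also have "\<dots> = c\<^sub>F * (Tq q1 s d k + (Tq q2 e F k + Tq q2 F' e k))"
   unfolding Tq_q1_diff[OF m(2,4) fin(3,7)] Tq_q2_diff[OF m(1,3) fin(1,5,2,6)] d_def[abs_def] e_def[abs_def] s_def[abs_def] ..
  finally show ?thesis unfolding Y_def by (simp add: algebra_simps)
 qed
 have kk: "2 * ?K + 2 * ?K = ennreal (2 * (cI + M))"
  by (subst ennreal_2_sum) (use cI(1) M in simp_all)
 have "(LI k. cnj (d k) * (Qf F V k - Qf F' V' k)) = c\<^sub>F * (dbl \<Theta> + (LI k. Y k))"
  unfolding eq J1[symmetric] using i1 i2 by (subst integral_mult_right_zero, subst LI_add) auto
 then have "norm (LI k. cnj (d k) * (Qf F V k - Qf F' V' k)) = norm c\<^sub>F * norm (dbl \<Theta> + (LI k. Y k))" by (simp only: norm_mult)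
 also have "\<dots> \<le> 1 * norm (dbl \<Theta> + (LI k. Y k))" by (intro mult_right_mono norm_cF) auto
 also have "\<dots> \<le> norm (dbl \<Theta>) + norm (LI k. Y k)" using norm_triangle_ineq by auto
 finally have "ennreal (norm (LI k. cnj (d k) * (Qf F V k - Qf F' V' k))) \<le> ennreal (norm (dbl \<Theta>)) + ennreal (norm (LI k. Y k))"
  by (simp add: ennreal_leI flip: ennreal_plus)
 also have "\<dots> \<le> ?K * nsq d + 2 * ?K * (nsq d + nsq (xF e))"
  using norm_integral_le_nn[of lborel Y] Yle by (intro add_mono J1le) (auto intro: order_trans)
 also have "\<dots> \<le> 2 * ?K * (nsq d + nsq (xF e)) + 2 * ?K * (nsq d + nsq (xF e))"
 proof (rule add_right_mono)
  have "?K * nsq d \<le> ?K * (nsq d + nsq (xF e)) + ?K * (nsq d + nsq (xF e))" by (rule add_increasing2) (auto intro!: mult_left_mono)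
  then show "?K * nsq d \<le> 2 * ?K * (nsq d + nsq (xF e))" by (simp add: mult_2 distrib_right)
 qed
 also have "\<dots> = ennreal (2 * (cI + M)) * (nsq d + nsq (xF e))"
  unfolding kk[symmetric] by (simp only: distrib_right)
 finally show ?thesis unfolding d_def e_def .
qed

lemma ennreal_3_times: "0 \<le> x ==> ennreal x + ennreal x + ennreal x = ennreal (3 * x)"
 by (simp flip: ennreal_plus)

text \<open>For vanishing sum the seventh power sum is 7 e3 e2^2 in the elementary symmetric
  polynomials, and e2^2 equals the last bracket. The exponent is 6 from the weight plus 1 from the
  kernel.\<close>

lemma sum7_identity:
 fixes a b c :: real
 assumes "a + b + c = 0"
 shows "a ^ 7 + b ^ 7 + c ^ 7 = 7 * (a * b * c) * (a\<^sup>2 * b\<^sup>2 + b\<^sup>2 * c\<^sup>2 + c\<^sup>2 * a\<^sup>2)"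
proof -
 have c: "c = - a - b" using assms by simp
 show ?thesis unfolding c by (simp add: eval_nat_numeral algebra_simps)
qed

text \<open>Factoring out sgn a sgn b sgn c replaces |c| sgn a sgn b by c, and likewise for the
  other terms. What remains is the sum of the \<open>wt x * x\<close>: its linear part is the
  vanishing sum of the frequencies, its other part is the seventh power sum.\<close>

lemma symmetrised_kernel_bound:
 fixes a b c :: real
 assumes s: "a + b + c = 0"
 shows "\<bar>wt c * \<bar>c\<bar> * (sgn a * sgn b) + wt a * \<bar>a\<bar> * (sgn b * sgn c) + wt b * \<bar>b\<bar> * (sgn c * sgn a)\<bar>
  \<le> 7 * (\<bar>a\<bar> * \<bar>b\<bar> ^ 3 * \<bar>c\<bar> ^ 3 + \<bar>b\<bar> * \<bar>a\<bar> ^ 3 * \<bar>c\<bar> ^ 3 + \<bar>c\<bar> * \<bar>a\<bar> ^ 3 * \<bar>b\<bar> ^ 3)" (is "\<bar>?L\<bar> \<le> 7 * ?R")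
proof (cases "a = 0 \<or> b = 0 \<or> c = 0")
 case True
 have R: "0 \<le> ?R" by simp
 have "?L = 0" using True s
  by (elim disjE) (auto simp: sgn_if abs_if wt_def add_eq_0_iff)
 then show ?thesis using R by simp
next
 case False
 have "?L = sgn a * sgn b * sgn c * (wt c * c + wt a * a + wt b * b)"
  using False by (auto simp: sgn_if abs_if algebra_simps)
 also have "wt c * c + wt a * a + wt b * b = (a + b + c) + (a ^ 7 + b ^ 7 + c ^ 7)"
  by (simp add: wt_def eval_nat_numeral algebra_simps)
 also have "\<dots> = 7 * (a * b * c) * (a\<^sup>2 * b\<^sup>2 + b\<^sup>2 * c\<^sup>2 + c\<^sup>2 * a\<^sup>2)" using s sum7_identity[OF s] by simp
 finally have "\<bar>?L\<bar> = \<bar>7 * (a * b * c) * (a\<^sup>2 * b\<^sup>2 + b\<^sup>2 * c\<^sup>2 + c\<^sup>2 * a\<^sup>2)\<bar>"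
  using False by (simp add: abs_mult abs_sgn_eq)
 also have "\<dots> = 7 * (\<bar>a\<bar> * \<bar>b\<bar> * \<bar>c\<bar>) * (\<bar>a\<bar>\<^sup>2 * \<bar>b\<bar>\<^sup>2 + \<bar>b\<bar>\<^sup>2 * \<bar>c\<bar>\<^sup>2 + \<bar>c\<bar>\<^sup>2 * \<bar>a\<bar>\<^sup>2)"
  by (simp add: abs_mult)
 also have "\<dots> = 7 * ?R" by (simp add: power2_eq_square power3_eq_cube algebra_simps)
 finally show ?thesis by simp
qed

lemma hi_facts:
 assumes h: "hi \<beta> M F V" and b: "\<beta> > 0" and M: "0 \<le> M"
 shows "F \<in> bm" "V \<in> bm"
  "!!k. F (- k) = cnj (F k)" "!!k. V (- k) = cnj (V k)"
  "S3 F \<le> ennreal (8 * M)" "S3 V \<le> ennreal (8 * M)"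
  "nsq F \<le> ennreal (8 * M)" "nsq V \<le> ennreal (8 * M)"
  "nsq (xF F) \<le> ennreal (8 * M)" "nsq (xF V) \<le> ennreal (8 * M)"
proof -
 show m: "F \<in> bm" "V \<in> bm"
  "!!k. F (- k) = cnj (F k)" "!!k. V (- k) = cnj (V k)" using h by (auto simp: hi_def)
 show S: "S3 F \<le> ennreal (8 * M)" using hi_S3(2)[OF h b] .
 have "S3 V \<le> ennreal (4 * M)" using hi_S3(1)[OF h b] .
 also have "\<dots> \<le> ennreal (8 * M)" using M by (intro ennreal_leI) auto
 finally show S': "S3 V \<le> ennreal (8 * M)" .
 show "nsq F \<le> ennreal (8 * M)" "nsq V \<le> ennreal (8 * M)"
  "nsq (xF F) \<le> ennreal (8 * M)" "nsq (xF V) \<le> ennreal (8 * M)"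
  using S3_nsq[OF m(1) S] S3_nsq[OF m(2) S'] by auto
qed

text \<open>A full derivative of F is controlled by \<open>lam\<close> at all frequencies, as k^2
  \<le> |k| + |k|^3.\<close>

lemma square_le_lam: "\<beta> > 0 ==> k\<^sup>2 \<le> (1 + 1 / \<beta>) * lam \<beta> k"
proof -
 assume b: "\<beta> > 0"
 have "k\<^sup>2 \<le> \<bar>k\<bar> + \<bar>k\<bar> ^ 3"
 proof -
  have "0 \<le> \<bar>k\<bar> * (\<bar>k\<bar> - 1)\<^sup>2" by simp
  also have "\<dots> = \<bar>k\<bar> ^ 3 - 2 * \<bar>k\<bar>\<^sup>2 + \<bar>k\<bar>" by (simp add: power2_eq_square power3_eq_cube algebra_simps)
  finally have "2 * k\<^sup>2 \<le> \<bar>k\<bar> ^ 3 + \<bar>k\<bar>" by simp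
  then show ?thesis using zero_le_power2[of k] by linarith
 qed
 also have "\<dots> \<le> (1 + 1 / \<beta>) * lam \<beta> k"
 proof -
  have "(1 + 1 / \<beta>) * lam \<beta> k = \<bar>k\<bar> + \<bar>k\<bar> ^ 3 + \<bar>k\<bar> / \<beta> + \<beta> * \<bar>k\<bar> ^ 3"
   using b by (simp add: lam_def field_simps)
  then show ?thesis using b by simp
 qed
 finally show ?thesis .
qed

text \<open>On the support of \<open>q2\<close> the weight at k is at most the geometric mean of the
  weights at k - l and k. Half of it goes to F at k - l, together with one derivative, and this
  combination is still below the energy density; the other half stays with V.\<close>

lemma high_energy_Q2:
 assumes h: "hi \<beta> M F V" and b: "\<beta> > 0" and M: "0 \<le> M"
 shows "(NN k. ennreal (wt k * (norm (V k) * norm (Tq q2 F F k)))) \<le> ennreal ((cI + 8 * M) / 2 * ((2 + 1 / \<beta>) * M))"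
proof -
 note hf = hi_facts[OF h b M]
 have [measurable]: "F \<in> bm" "V \<in> bm" by (rule hf)+
 let ?p = "%l. \<bar>l\<bar> * norm (F l)" and ?q = "%a. sqrt (wt a) * (\<bar>a\<bar> * norm (F a))" and ?r = "%k. sqrt (wt k) * norm (V k)"
 have [measurable]: "?q \<in> bm" "?r \<in> bm" by measurable
 have "(NN k. ennreal (wt k * (norm (V k) * norm (Tq q2 F F k))))
  \<le> (NN k. 2 * (NN l. ennreal \<bar>?q (k - l) * ?p l * ?r k\<bar>))"
 proof (rule nn_integral_mono)
  fix k
  have "ennreal (wt k * (norm (V k) * norm (Tq q2 F F k))) = ennreal (wt k * norm (V k)) * ennreal (norm (Tq q2 F F k))"
   by (subst ennreal_mult[symmetric]) (auto simp: mult.assoc)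
  also have "\<dots> \<le> ennreal (wt k * norm (V k)) * (NN l. ennreal (\<bar>q2 k l\<bar> * (norm (F (k - l)) * norm (F l))))" by (intro mult_left_mono Tq_norm) simp
  also have "\<dots> = (NN l. ennreal (wt k * norm (V k)) * ennreal (\<bar>q2 k l\<bar> * (norm (F (k - l)) * norm (F l))))"
   by (rule nn_integral_cmult[symmetric]) measurable
  also have "\<dots> \<le> (NN l. 2 * ennreal \<bar>?q (k - l) * ?p l * ?r k\<bar>)"
  proof (rule nn_integral_mono)
   fix l
   have "wt k * \<bar>q2 k l\<bar> \<le> 2 * (sqrt (wt (k - l)) * \<bar>k - l\<bar> * \<bar>l\<bar> * sqrt (wt k))"
   proof (cases "q2 k l = 0")
    case True
    then show ?thesis by simp
   next
    case False
    have "\<bar>k\<bar> ^ 6 \<le> \<bar>k - l\<bar> ^ 6" using q2_support[OF False] by (intro power_mono) auto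
    then have "wt k \<le> wt (k - l)" by (simp add: wt_def)
    then have "sqrt (wt k) * sqrt (wt k) \<le> sqrt (wt (k - l)) * sqrt (wt k)" by (intro mult_right_mono) auto
    then have "wt k \<le> sqrt (wt (k - l)) * sqrt (wt k)" by simp
    then have "wt k * \<bar>q2 k l\<bar> \<le> (sqrt (wt (k - l)) * sqrt (wt k)) * (2 * \<bar>k - l\<bar> * \<bar>l\<bar>)"
     by (intro mult_mono q2_le2) auto
    then show ?thesis by (simp add: ac_simps)
   qed
   then have "wt k * \<bar>q2 k l\<bar> * (norm (V k) * (norm (F (k - l)) * norm (F l))) \<le> 2 * (sqrt (wt (k - l)) * \<bar>k - l\<bar> * \<bar>l\<bar> * sqrt (wt k)) * (norm (V k) * (norm (F (k - l)) * norm (F l)))"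
    by (intro mult_right_mono) auto
   then have "ennreal ((wt k * norm (V k)) * (\<bar>q2 k l\<bar> * (norm (F (k - l)) * norm (F l)))) \<le> ennreal (2 * \<bar>?q (k - l) * ?p l * ?r k\<bar>)"
    by (intro ennreal_leI) (simp add: abs_mult ac_simps)
   then show "ennreal (wt k * norm (V k)) * ennreal (\<bar>q2 k l\<bar> * (norm (F (k - l)) * norm (F l))) \<le> 2 * ennreal \<bar>?q (k - l) * ?p l * ?r k\<bar>"
    by (subst ennreal_mult[symmetric]) (auto simp only: ennreal_2_times intro!: mult_nonneg_nonneg wt_nonneg norm_ge_zero abs_ge_zero)
  qed
  also have "\<dots> = 2 * (NN l. ennreal \<bar>?q (k - l) * ?p l * ?r k\<bar>)" by (rule nn_integral_cmult) measurable
  finally show "ennreal (wt k * (norm (V k) * norm (Tq q2 F F k))) \<le> \<dots>" .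
 qed
 also have "\<dots> = 2 * (NN k l. ennreal \<bar>?q (k - l) * ?p l * ?r k\<bar>)" by (rule nn_integral_cmult) measurable
 also have "\<dots> \<le> (NN x. ennreal \<bar>?p x\<bar>) * ((NN x. ennreal ((?q x)\<^sup>2)) + (NN x. ennreal ((?r x)\<^sup>2)))"
  by (rule nn_tri_conv(2)) measurable
 also have "\<dots> \<le> ennreal ((cI + 8 * M) / 2) * (ennreal ((1 + 1 / \<beta>) * M) + ennreal (1 * M))"
 proof (intro mult_mono add_mono)
  show "(NN x. ennreal \<bar>?p x\<bar>) \<le> ennreal ((cI + 8 * M) / 2)" using xF_L1(1)[OF hf(1) hf(5)] M by simp
  have "(NN x. ennreal ((?q x)\<^sup>2)) = wint (%k. wt k * k\<^sup>2) F" by (simp add: power_mult_distrib mult.assoc)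
  also have "\<dots> \<le> ennreal ((1 + 1 / \<beta>) * M)"
  proof (rule hi_weightF[OF h b])
   fix k
   have "wt k * k\<^sup>2 \<le> wt k * ((1 + 1 / \<beta>) * lam \<beta> k)" by (intro mult_left_mono square_le_lam b) auto
   also have "\<dots> \<le> (1 + 1 / \<beta>) * (wt k * lam \<beta> k + 1)" using b by (simp add: field_simps)
   finally show "wt k * k\<^sup>2 \<le> (1 + 1 / \<beta>) * (wt k * lam \<beta> k + 1)" .
  qed (use b in auto)
  finally show "(NN x. ennreal ((?q x)\<^sup>2)) \<le> ennreal ((1 + 1 / \<beta>) * M)" .
  have "(NN x. ennreal ((?r x)\<^sup>2)) = wint wt V" by (simp add: power_mult_distrib)
  also have "\<dots> \<le> ennreal (1 * M)" by (rule hi_weightV[OF h b]) auto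
  finally show "(NN x. ennreal ((?r x)\<^sup>2)) \<le> ennreal (1 * M)" .
 qed auto
 also have "\<dots> = ennreal ((cI + 8 * M) / 2) * ennreal ((1 + 1 / \<beta>) * M + 1 * M)"
  by (subst ennreal_plus) (use b M in auto)
 also have "\<dots> = ennreal ((cI + 8 * M) / 2 * ((1 + 1 / \<beta>) * M + 1 * M))"
  by (rule ennreal_mult'[symmetric]) (use cI(1) M in auto)
 also have "(1 + 1 / \<beta>) * M + 1 * M = (2 + 1 / \<beta>) * M" by (simp add: algebra_simps)
 finally show ?thesis .
qed

text \<open>Symmetrising over the three frequencies \<open>k - l\<close>, \<open>l\<close>, \<open>- k\<close>, whose sum is zero, turns the kernel
 into the power sum of \<open>sum7_identity\<close>, in which every term carries one derivative on
 one factor and three on each of the other two.\<close>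

lemma high_energy_Q1:
 assumes h: "hi \<beta> M F V" and b: "\<beta> > 0" and M: "0 \<le> M" and N: "!!k. \<bar>k\<bar> > N ==> V k = 0"
 shows "good2 (%k l. cr (wt k) * (cnj (V k) * (cr (q1 k l) * (V (k - l) * V l))))" (is "good2 ?\<Phi>")
  and "ennreal (norm (dbl (%k l. cr (wt k) * (cnj (V k) * (cr (q1 k l) * (V (k - l) * V l)))))) \<le> ennreal (7 * (cI + 8 * M) * M)"
proof -
 note hf = hi_facts[OF h b M]
 have [measurable]: "V \<in> bm" by (rule hf)
 have hV: "V (- k) = cnj (V k)" for k by (rule hf)
 have nV: "norm (V (- k)) = norm (V k)" for k by (simp add: hV)
 define A where "A = \<bar>N\<bar>"
 have A: "\<bar>k\<bar> > A ==> V k = 0" for k using N[of k] by (simp add: A_def)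
 let ?P = "ennreal ((cI + 8 * M) / 2)"
 have P1: "(NN x. ennreal \<bar>\<bar>x\<bar> * norm (V x)\<bar>) \<le> ?P" "(NN x. ennreal \<bar>norm (V x)\<bar>) \<le> ?P"
  using xF_L1[OF hf(2) hf(6)] M by auto
 \<comment> \<open>The frequency cutoff is used here only, to bound the weight and the kernel by
   constants. The estimate that follows does not involve N.\<close>
 show g: "good2 ?\<Phi>"
  unfolding good2_def
 proof
  show "case_prod ?\<Phi> \<in> bm2" unfolding split_beta' by measurable
  have "2 * (NN k l. ennreal (norm (?\<Phi> k l))) \<le> 2 * (NN k l. ennreal (wt A * A) * ennreal \<bar>norm (V (k - l)) * norm (V l) * norm (V k)\<bar>)"
  proof (intro mult_left_mono nn_integral_mono)
   fix k l
   have "norm (?\<Phi> k l) = (wt k * \<bar>q1 k l\<bar>) * (norm (V (k - l)) * norm (V l) * norm (V k))" by (simp add: norm_mult)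
   also have "\<dots> \<le> (wt A * A) * (norm (V (k - l)) * norm (V l) * norm (V k))"
   proof (cases "\<bar>k\<bar> > A")
    case True then show ?thesis by (simp add: A)
   next
    case False
    have "\<bar>k\<bar> ^ 6 \<le> A ^ 6" using False by (intro power_mono) auto
    then have "wt k \<le> wt A" by (simp add: wt_def)
    moreover have "\<bar>q1 k l\<bar> \<le> A" using q1_le[of k l] False by linarith
    ultimately show ?thesis by (intro mult_right_mono mult_mono) (auto simp: A_def)
   qed
   finally have "ennreal (norm (?\<Phi> k l)) \<le> ennreal ((wt A * A) * (norm (V (k - l)) * norm (V l) * norm (V k)))" by (rule ennreal_leI)
   then show "ennreal (norm (?\<Phi> k l)) \<le> ennreal (wt A * A) * ennreal \<bar>norm (V (k - l)) * norm (V l) * norm (V k)\<bar>"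
    by (simp add: ennreal_mult'' abs_mult)
  qed auto
  also have "\<dots> = ennreal (wt A * A) * (2 * (NN k l. ennreal \<bar>norm (V (k - l)) * norm (V l) * norm (V k)\<bar>))"
   by (simp add: nn_integral_cmult mult.left_commute)
  also have "\<dots> \<le> ennreal (wt A * A) * ((NN x. ennreal \<bar>norm (V x)\<bar>) * ((NN x. ennreal ((norm (V x))\<^sup>2)) + (NN x. ennreal ((norm (V x))\<^sup>2))))"
   by (intro mult_left_mono nn_tri_conv(1)) auto
  also have "\<dots> < \<infinity>"
   using P1(2) hf(8) by (auto simp: ennreal_mult_less_top nsq_def[symmetric] intro: le_less_trans)
  finally show "(NN k l. ennreal (norm (?\<Phi> k l))) < \<infinity>" by (auto simp: ennreal_mult_less_top)
 qed
 define \<Phi> where "\<Phi> = ?\<Phi>"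
 have g: "good2 \<Phi>" using g unfolding \<Phi>_def .
 note t1 = good2_transform(2,4)[OF g]
 note t2 = good2_transform(2,4)[OF t1(1)]
 \<comment> \<open>The sum of the kernel over the three cyclic rotations; each rotation leaves the
   integral unchanged.\<close>
 have "3 * dbl \<Phi> = dbl (%k l. \<Phi> k l + \<Phi> (l - k) (- k) + \<Phi> (- k - (l - k)) (- (l - k)))"
  using good2_add(2)[OF good2_add(1)[OF g t1(1)] t2(1)] good2_add(2)[OF g t1(1)] t1(2) t2(2) by simp
 then have "ennreal (norm (3 * dbl \<Phi>)) = ennreal (norm (dbl (%k l. \<Phi> k l + \<Phi> (l - k) (- k) + \<Phi> (- k - (l - k)) (- (l - k)))))" by simp
 also have "\<dots> \<le> (NN k l. ennreal (7 * (\<bar>(\<bar>k - l\<bar> * norm (V (k - l))) * (\<bar>l\<bar> ^ 3 * norm (V l)) * (\<bar>k\<bar> ^ 3 * norm (V k))\<bar>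
   + \<bar>(\<bar>k - l\<bar> ^ 3 * norm (V (k - l))) * (\<bar>l\<bar> * norm (V l)) * (\<bar>k\<bar> ^ 3 * norm (V k))\<bar>
   + \<bar>(\<bar>k - l\<bar> ^ 3 * norm (V (k - l))) * (\<bar>l\<bar> ^ 3 * norm (V l)) * (\<bar>k\<bar> * norm (V k))\<bar>)))"
 proof (rule dbl_norm_le)
  fix k l
  have c: "cnj (V (l - k)) = V (k - l)" using hV[of "l - k"] by simp
  have "\<Phi> k l + \<Phi> (l - k) (- k) + \<Phi> (- k - (l - k)) (- (l - k))
   = cr (wt k * q1 k l + wt (l - k) * q1 (l - k) (- k) + wt l * q1 (- l) (k - l)) * (cnj (V k) * V (k - l) * V l)"
   by (simp add: \<Phi>_def hV c algebra_simps)
  also have "norm \<dots> = \<bar>wt k * q1 k l + wt (l - k) * q1 (l - k) (- k) + wt l * q1 (- l) (k - l)\<bar> * (norm (V k) * norm (V (k - l)) * norm (V l))"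
   by (simp only: norm_mult norm_of_real complex_mod_cnj)
  also have "wt k * q1 k l + wt (l - k) * q1 (l - k) (- k) + wt l * q1 (- l) (k - l)
   = wt (- k) * \<bar>- k\<bar> * (sgn (k - l) * sgn l) + wt (k - l) * \<bar>k - l\<bar> * (sgn l * sgn (- k)) + wt l * \<bar>l\<bar> * (sgn (- k) * sgn (k - l))"
   using wt_minus[of "k - l"] by (simp add: q1_def abs_minus_commute)
  also have "\<bar>\<dots>\<bar> * (norm (V k) * norm (V (k - l)) * norm (V l)) \<le> 7 * (\<bar>k - l\<bar> * \<bar>l\<bar> ^ 3 * \<bar>- k\<bar> ^ 3 + \<bar>l\<bar> * \<bar>k - l\<bar> ^ 3 * \<bar>- k\<bar> ^ 3 + \<bar>- k\<bar> * \<bar>k - l\<bar> ^ 3 * \<bar>l\<bar> ^ 3) * (norm (V k) * norm (V (k - l)) * norm (V l))"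
   by (intro mult_right_mono symmetrised_kernel_bound) auto
  also have "\<dots> = 7 * (\<bar>(\<bar>k - l\<bar> * norm (V (k - l))) * (\<bar>l\<bar> ^ 3 * norm (V l)) * (\<bar>k\<bar> ^ 3 * norm (V k))\<bar>
   + \<bar>(\<bar>k - l\<bar> ^ 3 * norm (V (k - l))) * (\<bar>l\<bar> * norm (V l)) * (\<bar>k\<bar> ^ 3 * norm (V k))\<bar>
   + \<bar>(\<bar>k - l\<bar> ^ 3 * norm (V (k - l))) * (\<bar>l\<bar> ^ 3 * norm (V l)) * (\<bar>k\<bar> * norm (V k))\<bar>)"
   by (simp add: abs_mult algebra_simps)
  finally show "norm (\<Phi> k l + \<Phi> (l - k) (- k) + \<Phi> (- k - (l - k)) (- (l - k))) \<le> \<dots>" .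
 qed
 also have "\<dots> = 7 * ((NN k l. ennreal \<bar>(\<bar>k - l\<bar> * norm (V (k - l))) * (\<bar>l\<bar> ^ 3 * norm (V l)) * (\<bar>k\<bar> ^ 3 * norm (V k))\<bar>)
   + (NN k l. ennreal \<bar>(\<bar>k - l\<bar> ^ 3 * norm (V (k - l))) * (\<bar>l\<bar> * norm (V l)) * (\<bar>k\<bar> ^ 3 * norm (V k))\<bar>)
   + (NN k l. ennreal \<bar>(\<bar>k - l\<bar> ^ 3 * norm (V (k - l))) * (\<bar>l\<bar> ^ 3 * norm (V l)) * (\<bar>k\<bar> * norm (V k))\<bar>))" (is "_ = 7 * (?I1 + ?I2 + ?I3)")
  by (simp add: ennreal_mult' nn_integral_cmult nn_integral_add)
 \<comment> \<open>In the third integral the factor with a single derivative, the only one put in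
   L^1, stands at the output frequency. A rotation moves it to an inner one, as
   \<open>nn_tri_conv\<close> requires.\<close>
 also have "?I3 = ?I1"
 proof -
  let ?f = "%k l. ennreal \<bar>(\<bar>k - l\<bar> ^ 3 * norm (V (k - l))) * (\<bar>l\<bar> ^ 3 * norm (V l)) * (\<bar>k\<bar> * norm (V k))\<bar>"
  have feq: "?f (l - k) (- k) = ennreal \<bar>(\<bar>k - l\<bar> * norm (V (k - l))) * (\<bar>l\<bar> ^ 3 * norm (V l)) * (\<bar>k\<bar> ^ 3 * norm (V k))\<bar>" for k l
  proof -
   have "norm (V (l - k)) = norm (V (k - l))" using nV[of "k - l"] by simp
   then show ?thesis by (simp add: nV abs_minus_commute[of l k] ac_simps)
  qed
  have "?I3 = (NN k l. ?f (l - k) (- k))"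
   by (rule nn_reflect2(2)[symmetric]) (unfold split_beta', measurable)
  also have "\<dots> = ?I1" by (simp only: feq)
  finally show ?thesis .
 qed
 finally have le: "ennreal (norm (3 * dbl \<Phi>)) \<le> 7 * (?I1 + ?I2 + ?I1)" .
 let ?Q = "NN x. ennreal ((\<bar>x\<bar> ^ 3 * norm (V x))\<^sup>2)"
 have Q: "?Q \<le> ennreal M"
 proof -
  have "?Q = wint (%k. k ^ 6) V" by (simp add: power_mult_distrib flip: power_mult)
  also have "\<dots> \<le> ennreal (1 * M)" by (rule hi_weightV[OF h b]) (auto simp: wt_def)
  finally show ?thesis by simp
 qed
 have I: "2 * ?I1 \<le> ?P * (ennreal M + ennreal M)" "2 * ?I2 \<le> ?P * (ennreal M + ennreal M)"
 proof -
  have "(NN x. ennreal \<bar>\<bar>x\<bar> * norm (V x)\<bar>) * (?Q + ?Q) \<le> ?P * (ennreal M + ennreal M)" by (intro mult_mono add_mono P1 Q) auto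
  moreover have "2 * ?I1 \<le> (NN x. ennreal \<bar>\<bar>x\<bar> * norm (V x)\<bar>) * (?Q + ?Q)" by (rule nn_tri_conv(1)) measurable
  moreover have "2 * ?I2 \<le> (NN x. ennreal \<bar>\<bar>x\<bar> * norm (V x)\<bar>) * (?Q + ?Q)" by (rule nn_tri_conv(2)) measurable
  ultimately show "2 * ?I1 \<le> ?P * (ennreal M + ennreal M)" "2 * ?I2 \<le> ?P * (ennreal M + ennreal M)" by auto
 qed
 have PM: "?P * (ennreal M + ennreal M) = 2 * ennreal ((cI + 8 * M) / 2 * M)"
 proof -
  have "?P * ennreal M = ennreal ((cI + 8 * M) / 2 * M)" using M by (rule ennreal_mult''[symmetric])
  then show ?thesis unfolding mult_2[symmetric] by (simp only: mult.left_commute[of ?P])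
 qed
 have I': "?I1 \<le> ennreal ((cI + 8 * M) / 2 * M)" "?I2 \<le> ennreal ((cI + 8 * M) / 2 * M)"
  using I unfolding PM by (auto simp: ennreal_mult_le_mult_iff)
 have "ennreal (3 * norm (dbl \<Phi>)) = ennreal (norm (3 * dbl \<Phi>))" by (simp add: norm_mult)
 also have "\<dots> \<le> 7 * (ennreal ((cI + 8 * M) / 2 * M) + ennreal ((cI + 8 * M) / 2 * M) + ennreal ((cI + 8 * M) / 2 * M))"
  using le by (rule order_trans) (intro mult_left_mono add_mono I', auto)
 also have "\<dots> = 7 * ennreal (3 * ((cI + 8 * M) / 2 * M))"
  using M cI(1) by (subst ennreal_3_times) auto
 also have "\<dots> = ennreal 7 * ennreal (3 * ((cI + 8 * M) / 2 * M))" by simp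
 also have "\<dots> = ennreal (7 * (3 * ((cI + 8 * M) / 2 * M)))" by (rule ennreal_mult'[symmetric]) simp
 finally have "3 * norm (dbl \<Phi>) \<le> 7 * (3 * ((cI + 8 * M) / 2 * M))"
  using M cI(1) by (subst (asm) ennreal_le_iff) auto
 then have "norm (dbl \<Phi>) \<le> 7 * (cI + 8 * M) * M"
 proof -
  assume "3 * norm (dbl \<Phi>) \<le> 7 * (3 * ((cI + 8 * M) / 2 * M))"
  moreover have "7 * (3 * ((cI + 8 * M) / 2 * M)) = 3 * (7 * ((cI + 8 * M) * M) / 2)" by simp
  ultimately have "norm (dbl \<Phi>) \<le> 7 * ((cI + 8 * M) * M) / 2" by linarith
  moreover have "0 \<le> (cI + 8 * M) * M" using M cI(1) by simp
  moreover have "7 * (cI + 8 * M) * M = 7 * ((cI + 8 * M) * M)" by (rule mult.assoc)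
  ultimately show ?thesis by linarith
 qed
 then show "ennreal (norm (dbl ?\<Phi>)) \<le> ennreal (7 * (cI + 8 * M) * M)"
  unfolding \<Phi>_def by (rule ennreal_leI)
qed

definition KQ :: "real \<Rightarrow> real \<Rightarrow> real"
 where "KQ \<beta> M = 7 * (cI + 8 * M) * M + (cI + 8 * M) / 2 * ((2 + 1 / \<beta>) * M)"

lemma KQ_nonneg: "\<beta> > 0 ==> 0 \<le> M ==> 0 \<le> KQ \<beta> M"
 using cI(1) by (simp add: KQ_def)

lemma high_energy_estimate:
 assumes h: "hi \<beta> M F V" and b: "\<beta> > 0" and M: "0 \<le> M" and N: "!!k. \<bar>k\<bar> > N ==> V k = 0"
 shows "intL (%k. cr (wt k) * (cnj (V k) * Qf F V k))"
  and "norm (LI k. cr (wt k) * (cnj (V k) * Qf F V k)) \<le> KQ \<beta> M"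
proof -
 note hf = hi_facts[OF h b M]
 have [measurable]: "F \<in> bm" "V \<in> bm" by (rule hf)+
 have fin: "nsq V < \<infinity>" "nsq F < \<infinity>" "nsq (xF F) < \<infinity>" using hf by (auto intro: le_less_trans)
 note Q1 = high_energy_Q1[OF h b M N]
 let ?X = "%k. cr (wt k) * (cnj (V k) * Tq q1 V V k)"
 let ?Y = "%k. cr (wt k) * (cnj (V k) * Tq q2 F F k)"
 have X: "?X k = (LI l. cr (wt k) * (cnj (V k) * (cr (q1 k l) * (V (k - l) * V l))))" for k
  unfolding Tq_def by simp
 have iX: "intL ?X" unfolding X by (rule good2_integrable[OF Q1(1)])
 have nX: "norm (LI k. ?X k) \<le> 7 * (cI + 8 * M) * M"
  using Q1(2) M cI(1) unfolding X dbl_def by (subst (asm) ennreal_le_iff) auto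
 have [measurable]: "Tq q2 F F \<in> bm" by (rule Tq_measurable[OF q_measurable2(2)]) auto
 have yb: "(NN k. ennreal (norm (?Y k))) \<le> ennreal ((cI + 8 * M) / 2 * ((2 + 1 / \<beta>) * M))"
  using high_energy_Q2[OF h b M] by (simp add: norm_mult)
 have iY: "intL ?Y" using yb by (intro integrableI_bounded) (auto intro: le_less_trans)
 have "ennreal (norm (LI k. ?Y k)) \<le> ennreal ((cI + 8 * M) / 2 * ((2 + 1 / \<beta>) * M))"
  using norm_integral_le_nn[of lborel ?Y] yb by (rule order_trans)
 then have nY: "norm (LI k. ?Y k) \<le> (cI + 8 * M) / 2 * ((2 + 1 / \<beta>) * M)"
  using b M cI(1) by (subst (asm) ennreal_le_iff) auto
 have eq: "cr (wt k) * (cnj (V k) * Qf F V k) = c\<^sub>F * (?X k + ?Y k)" for k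
  unfolding Qf_eq[OF hf(1,2) fin] by (simp add: algebra_simps)
 show "intL (%k. cr (wt k) * (cnj (V k) * Qf F V k))"
  unfolding eq using iX iY by (intro integrable_mult_right LI_int_add)
 have "norm (LI k. cr (wt k) * (cnj (V k) * Qf F V k)) = norm (c\<^sub>F * ((LI k. ?X k) + (LI k. ?Y k)))"
  unfolding eq using iX iY by (subst integral_mult_right_zero, subst LI_add) auto
 also have "\<dots> \<le> 1 * norm ((LI k. ?X k) + (LI k. ?Y k))"
  unfolding norm_mult by (intro mult_right_mono norm_cF) auto
 also have "\<dots> \<le> norm (LI k. ?X k) + norm (LI k. ?Y k)" using norm_triangle_ineq by auto
 also have "\<dots> \<le> KQ \<beta> M" unfolding KQ_def using nX nY by (rule add_mono)
 finally show "norm (LI k. cr (wt k) * (cnj (V k) * Qf F V k)) \<le> KQ \<beta> M" .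
qed

section \<open>Integrals in time, the energy identity and Gronwall's inequality\<close>

abbreviation tint :: "real \<Rightarrow> (real \<Rightarrow> 'a) \<Rightarrow> 'a::{banach, second_countable_topology}"
 where "tint t g \<equiv> (LINT s:{0..t}|lborel. g s)"

abbreviation jm :: "(real \<Rightarrow> real \<Rightarrow> 'a::topological_space) \<Rightarrow> bool"
 where "jm u \<equiv> case_prod u \<in> bm2"

lemma tint_0: "tint 0 g = 0"
 unfolding set_lebesgue_integral_def
proof (rule integral_eq_zero_AE)
 show "AEL s. indicat_real {0..0} s *\<^sub>R g s = 0"
  using AE_lborel_singleton[of "0::real"] by eventually_elim auto
qed

lemma jm_tint:
 fixes G :: "real \<Rightarrow> real \<Rightarrow> 'a::{banach, second_countable_topology}"
 assumes "jm G"
 shows "jm (%t k. tint t (%s. G s k))"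
proof -
 note [measurable (raw)] = measurable_section2[OF assms]
 have "tint t (%s. G s k) = (LI s. (if 0 \<le> s \<and> s \<le> t then G s k else 0))" for t k
  unfolding set_lebesgue_integral_def by (intro LI_cong) (auto split: split_indicator)
 then show ?thesis unfolding split_beta' by simp
qed

text \<open>With g merely integrable, no derivative is taken. The double integral of cnj (h r) h s
  over the square [0,t]^2 is split along the diagonal into two triangles that are conjugate to each
  other.\<close>

lemma norm_square_absolutely_continuous:
 fixes g :: cfun
 assumes g: "set_integrable lborel {0..t} g"
 shows "set_integrable lborel {0..t} (%s. Re (cnj (b0 + tint s g) * g s))"
  and "(norm (b0 + tint t g))\<^sup>2 = (norm b0)\<^sup>2 + 2 * tint t (%s. Re (cnj (b0 + tint s g) * g s))"
proof -
 define h where "h s = indicator {0..t} s *\<^sub>R g s" for s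
 have h: "intL h" using g unfolding set_integrable_def h_def .
 have [measurable]: "h \<in> bm" using h by auto
 define \<Theta> where "\<Theta> s r = (if r \<le> s then cnj (h r) * h s else 0)" for s r
 have [measurable]: "Measurable.pred (borel \<Otimes>\<^sub>M borel) (%x::real \<times> real. snd x \<le> fst x)"
  "Measurable.pred (borel \<Otimes>\<^sub>M borel) (%x::real \<times> real. snd x < fst x)" by measurable
 have fin: "(NN s r. ennreal (norm (h s) * norm (h r))) < \<infinity>"
 proof -
  have "(NN s r. ennreal (norm (h s) * norm (h r))) = (NN r. ennreal (norm (h r))) * (NN r. ennreal (norm (h r)))"
   by (simp add: ennreal_mult nn_integral_cmult nn_integral_multc)
  also have "\<dots> < \<infinity>" using h by (simp add: integrable_iff_bounded ennreal_mult_less_top)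
  finally show ?thesis .
 qed
 have g1: "good2 \<Theta>"
  unfolding good2_def
 proof
  show "case_prod \<Theta> \<in> bm2" unfolding \<Theta>_def split_beta' by measurable
  have "(NN s r. ennreal (norm (\<Theta> s r))) \<le> (NN s r. ennreal (norm (h s) * norm (h r)))"
   by (intro nn_integral_mono ennreal_leI) (auto simp: \<Theta>_def norm_mult)
  then show "(NN s r. ennreal (norm (\<Theta> s r))) < \<infinity>" using fin by (rule le_less_trans)
 qed
 \<comment> \<open>Strict inequality here and weak inequality in \<open>\<Theta>\<close>: with the
   variables of this one exchanged the two cover the square exactly once, while the conjugation
   identity fails only on the diagonal.\<close>
 define \<Theta>' where "\<Theta>' s r = (if r < s then cnj (h s) * h r else 0)" for s r
 have g2: "good2 \<Theta>'"
  unfolding good2_def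
 proof
  show "case_prod \<Theta>' \<in> bm2" unfolding \<Theta>'_def split_beta' by measurable
  have "(NN s r. ennreal (norm (\<Theta>' s r))) \<le> (NN s r. ennreal (norm (h s) * norm (h r)))"
   by (intro nn_integral_mono ennreal_leI) (auto simp: \<Theta>'_def norm_mult)
  then show "(NN s r. ennreal (norm (\<Theta>' s r))) < \<infinity>" using fin by (rule le_less_trans)
 qed
 have d2: "dbl \<Theta>' = cnj (dbl \<Theta>)"
 proof -
  have "(LI r. \<Theta>' s r) = cnj (LI r. \<Theta> s r)" for s
  proof -
   have "(LI r. \<Theta>' s r) = (LI r. cnj (\<Theta> s r))"
   proof (rule integral_cong_AE)
    show "AEL r. \<Theta>' s r = cnj (\<Theta> s r)" using AE_lborel_singleton[of s] by eventually_elim (auto simp: \<Theta>_def \<Theta>'_def)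
   qed (simp_all add: \<Theta>_def[abs_def] \<Theta>'_def[abs_def])
   then show ?thesis by (simp only: LI_cnj)
  qed
  then show ?thesis unfolding dbl_def by (simp only: LI_cnj)
 qed
 have swap: "dbl \<Theta>' = (LI s r. \<Theta>' r s)"
  unfolding dbl_def by (rule Fubini_bochner) (use g2 in \<open>auto simp: good2_def\<close>)
 have "dbl \<Theta> + dbl \<Theta>' = (LI s. (LI r. \<Theta> s r) + (LI r. \<Theta>' r s))"
 proof -
  have "intL (%s. LI r. \<Theta>' r s)"
   by (rule lborel_pair.integrable_snd[OF good2_product[OF g2]])
  then show ?thesis unfolding swap unfolding dbl_def using good2_integrable[OF g1] by simp
 qed
 also have "\<dots> = (LI s r. cnj (h r) * h s)"
 proof (rule LI_cong[OF refl])
  fix s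
  have i: "intL (%r. cnj (h r) * h s)" using h by simp
  have i1: "intL (%r. \<Theta> s r)" "intL (%r. \<Theta>' r s)"
   by (rule LI_int_bound[OF i], auto simp: \<Theta>_def[abs_def] \<Theta>'_def[abs_def])+
  have "(LI r. \<Theta> s r) + (LI r. \<Theta>' r s) = (LI r. \<Theta> s r + \<Theta>' r s)" using i1 by simp
  also have "\<dots> = (LI r. cnj (h r) * h s)" by (intro LI_cong) (auto simp: \<Theta>_def \<Theta>'_def)
  finally show "(LI r. \<Theta> s r) + (LI r. \<Theta>' r s) = (LI r. cnj (h r) * h s)" .
 qed
 also have "\<dots> = cnj (LI r. h r) * (LI r. h r)" by (simp add: LI_cnj)
 finally have sum: "dbl \<Theta> + cnj (dbl \<Theta>) = cnj (LI r. h r) * (LI r. h r)" unfolding d2 .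
 have H: "tint t g = (LI r. h r)" by (simp add: set_lebesgue_integral_def h_def)
 have G: "tint s g = (LI r. (if r \<le> s then h r else 0))" if "s \<in> {0..t}" for s
  unfolding set_lebesgue_integral_def by (intro LI_cong) (use that in \<open>auto simp: h_def split: split_indicator\<close>)
 have inner: "(LI r. \<Theta> s r) = cnj (tint s g) * h s" for s
 proof (cases "s \<in> {0..t}")
  case True
  have "(LI r. \<Theta> s r) = (LI r. cnj (if r \<le> s then h r else 0) * h s)"
   by (intro LI_cong) (auto simp: \<Theta>_def)
  also have "\<dots> = cnj (tint s g) * h s" unfolding G[OF True] by (simp only: integral_mult_left_zero LI_cnj)
  finally show ?thesis .
 next
  case False
  then have "h s = 0" by (simp add: h_def)
  then show ?thesis by (simp add: \<Theta>_def cong: if_cong)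
 qed
 have int: "intL (%s. cnj (tint s g) * h s)" using good2_integrable[OF g1] unfolding inner .
 have dbl: "dbl \<Theta> = (LI s. cnj (tint s g) * h s)" unfolding dbl_def inner ..
 have eq: "indicator {0..t} s *\<^sub>R Re (cnj (b0 + tint s g) * g s) = Re (cnj b0 * h s + cnj (tint s g) * h s)" for s
  by (simp add: h_def algebra_simps split: split_indicator)
 have i2: "intL (%s. cnj b0 * h s + cnj (tint s g) * h s)" using int h by simp
 show "set_integrable lborel {0..t} (%s. Re (cnj (b0 + tint s g) * g s))"
  unfolding set_integrable_def eq by (rule integrable_Re[OF i2])
 have "tint t (%s. Re (cnj (b0 + tint s g) * g s)) = Re (LI s. cnj b0 * h s + cnj (tint s g) * h s)"
  by (subst set_lebesgue_integral_def, unfold eq) (rule integral_Re[OF i2])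
 also have "(LI s. cnj b0 * h s + cnj (tint s g) * h s) = cnj b0 * tint t g + dbl \<Theta>"
  unfolding H dbl using int h by simp
 finally have R: "tint t (%s. Re (cnj (b0 + tint s g) * g s)) = Re (cnj b0 * tint t g) + Re (dbl \<Theta>)" by simp
 have "2 * Re (dbl \<Theta>) = Re (cnj (tint t g) * tint t g)" unfolding H sum[symmetric] by simp
 also have "\<dots> = (norm (tint t g))\<^sup>2" unfolding cmod_power2 by (simp add: power2_eq_square)
 finally have "2 * Re (dbl \<Theta>) = (norm (tint t g))\<^sup>2" .
 moreover have "(norm (b0 + tint t g))\<^sup>2 = (norm b0)\<^sup>2 + 2 * Re (cnj b0 * tint t g) + (norm (tint t g))\<^sup>2"
  unfolding cmod_power2 by (simp add: power2_eq_square algebra_simps)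
 ultimately show "(norm (b0 + tint t g))\<^sup>2 = (norm b0)\<^sup>2 + 2 * tint t (%s. Re (cnj (b0 + tint s g) * g s))"
  unfolding R by simp
qed

lemma nn_time_bound:
 assumes "!!s. s \<in> {0..T} ==> f s \<le> C" and T: "0 \<le> T"
 shows "(NN s. f s * indicator {0..T} s) \<le> C * ennreal T"
proof -
 have "(NN s. f s * indicator {0..T} s) \<le> (NN s. C * indicator {0..T} s)"
  by (intro nn_integral_mono) (auto split: split_indicator simp: assms)
 also have "\<dots> = C * ennreal T" using T by (simp add: nn_integral_cmult)
 finally show ?thesis .
qed

text \<open>Tonelli gives square integrability in time for almost every frequency, and on a bounded
  interval this implies integrability.\<close>

lemma AE_time_integrable:
 fixes G :: "real \<Rightarrow> real \<Rightarrow> complex"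
 assumes m: "jm G" and T: "0 \<le> T" and b: "!!s. s \<in> {0..T} ==> nsq (G s) \<le> ennreal C"
 shows "AEL k. set_integrable lborel {0..T} (%s. G s k)"
proof -
 note [measurable (raw)] = measurable_section2[OF m]
 have "(NN k s. ennreal ((norm (G s k))\<^sup>2) * indicator {0..T} s) = (NN s k. ennreal ((norm (G s k))\<^sup>2) * indicator {0..T} s)"
  by (rule Fubini_nn) (unfold split_beta', measurable)
 also have "\<dots> = (NN s. nsq (G s) * indicator {0..T} s)" by (simp add: nsq_def nn_integral_multc)
 also have "\<dots> \<le> ennreal C * ennreal T" using b T by (rule nn_time_bound)
 also have "\<dots> < \<infinity>" by (simp add: ennreal_mult_less_top)
 finally have fin: "(NN k s. ennreal ((norm (G s k))\<^sup>2) * indicator {0..T} s) < \<infinity>" .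
 have "AEL k. (NN s. ennreal ((norm (G s k))\<^sup>2) * indicator {0..T} s) \<noteq> \<infinity>"
  by (rule nn_integral_PInf_AE) (use fin in \<open>auto simp: less_top\<close>)
 then show ?thesis
 proof eventually_elim
  case (elim k)
  have "(NN s. ennreal (norm (indicator {0..T} s *\<^sub>R G s k))) \<le> (NN s. indicator {0..T} s + ennreal ((norm (G s k))\<^sup>2) * indicator {0..T} s)"
  proof (rule nn_integral_mono)
   fix s
   have "norm (G s k) \<le> 1 + (norm (G s k))\<^sup>2" using abs_pow_le[of 1 2 "norm (G s k)"] by simp
   then have "ennreal (norm (G s k)) \<le> 1 + ennreal ((norm (G s k))\<^sup>2)" by (simp flip: ennreal_plus ennreal_1)
   then show "ennreal (norm (indicator {0..T} s *\<^sub>R G s k)) \<le> indicator {0..T} s + ennreal ((norm (G s k))\<^sup>2) * indicator {0..T} s"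
    by (auto split: split_indicator)
  qed
  also have "\<dots> = ennreal T + (NN s. ennreal ((norm (G s k))\<^sup>2) * indicator {0..T} s)"
   using T by (subst nn_integral_add) auto
  also have "\<dots> < \<infinity>" using elim by (simp add: less_top)
  finally show ?case unfolding set_integrable_def by (intro integrableI_bounded) auto
 qed
qed

text \<open>The identity for the square of an absolutely continuous function holds for almost every
  frequency, and Fubini integrates it with the weight. The bound on G in the same weighted norm as B
  is what makes the double integral converge; this decides at which level the identity can be
  applied.\<close>

lemma energy_identity:
 fixes G :: "real \<Rightarrow> real \<Rightarrow> complex"
 assumes m: "jm G" "B0 \<in> bm" and w[measurable]: "w \<in> bm" and w1: "!!k. 1 \<le> w k"
  and B: "!!s k. s \<in> {0..T} ==> B s k = B0 k + tint s (%s. G s k)"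
  and bB: "!!s. s \<in> {0..T} ==> wint w (B s) \<le> ennreal C" and bG: "!!s. s \<in> {0..T} ==> wint w (G s) \<le> ennreal C"
  and t: "t \<in> {0..T}"
 shows "(LI k. w k * (norm (B t k))\<^sup>2) = (LI k. w k * (norm (B 0 k))\<^sup>2)
   + tint t (%s. 2 * (LI k. w k * Re (cnj (B s k) * G s k)))" (is ?thesis1)
  and "set_integrable lborel {0..t} (%s. LI k. w k * Re (cnj (B s k) * G s k))"
  and "!!s. s \<in> {0..T} ==> intL (%k. w k * Re (cnj (B s k) * G s k))"
  and "!!s. s \<in> {0..T} ==> intL (%k. w k * (norm (B s k))\<^sup>2)"
proof -
 \<comment> \<open>B is prescribed only for times in [0, T]. The formula for all s gives a jointly
   measurable function that agrees with it there.\<close>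
 define H where "H s k = B0 k + tint s (%s. G s k)" for s k
 have w0: "0 \<le> w k" for k using w1[of k] by linarith
 have jmH: "jm H"
 proof -
  note [measurable (raw)] = measurable_section2[OF jm_tint[OF m(1)]]
  note [measurable] = m(2)
  show ?thesis unfolding H_def split_beta' by measurable
 qed
 note [measurable (raw)] = measurable_section2[OF m(1)] measurable_section2[OF jmH]
 have BH: "B s = H s" if "s \<in> {0..T}" for s using B[OF that] by (simp add: H_def fun_eq_iff)
 have T: "0 \<le> T" using t by auto
 define \<Psi> where "\<Psi> s k = w k * Re (cnj (H s k) * G s k)" for s k
 have jm\<Psi>: "jm \<Psi>" unfolding \<Psi>_def split_beta' by measurable
 note [measurable (raw)] = measurable_section2[OF jm\<Psi>]
 have nG: "nsq (G s) \<le> ennreal C" if "s \<in> {0..T}" for s using nsq_le_wint[OF w1] bG[OF that] by (rule order_trans)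
 have ae: "AEL k. set_integrable lborel {0..t} (%s. G s k)"
  by (rule AE_time_integrable[OF m(1), where C=C]) (use t nG in auto)
 have \<Psi>b: "(NN k. ennreal (norm (\<Psi> s k))) \<le> 2 * ennreal C" if s: "s \<in> {0..T}" for s
 proof -
  have "(NN k. ennreal (norm (\<Psi> s k))) \<le> (NN k. ennreal (w k * (norm (B s k))\<^sup>2) + ennreal (w k * (norm (G s k))\<^sup>2))"
  proof (rule nn_integral_mono)
   fix k
   have "norm (\<Psi> s k) = w k * \<bar>Re (cnj (B s k) * G s k)\<bar>" using w0 by (simp add: \<Psi>_def BH[OF s] abs_mult)
   also have "\<dots> \<le> w k * (norm (B s k) * norm (G s k))"
    using abs_Re_le_cmod[of "cnj (B s k) * G s k"] w0 by (intro mult_left_mono) (auto simp: norm_mult)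
   also have "\<dots> \<le> w k * ((norm (B s k))\<^sup>2 + (norm (G s k))\<^sup>2)"
   proof (rule mult_left_mono[OF _ w0])
    have "2 * (norm (B s k) * norm (G s k)) \<le> (norm (B s k))\<^sup>2 + (norm (G s k))\<^sup>2" using sum_squares_bound[of "norm (B s k)" "norm (G s k)"] by simp
    then show "norm (B s k) * norm (G s k) \<le> (norm (B s k))\<^sup>2 + (norm (G s k))\<^sup>2"
     using mult_nonneg_nonneg[OF norm_ge_zero norm_ge_zero, of "B s k" "G s k"] by linarith
   qed
   finally show "ennreal (norm (\<Psi> s k)) \<le> ennreal (w k * (norm (B s k))\<^sup>2) + ennreal (w k * (norm (G s k))\<^sup>2)"
    using w0 by (simp add: ennreal_leI distrib_left flip: ennreal_plus)
  qed
  also have "\<dots> = wint w (B s) + wint w (G s)" unfolding BH[OF s] by (subst nn_integral_add) auto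
  also have "\<dots> \<le> ennreal C + ennreal C" by (intro add_mono bB bG s)
  finally show ?thesis by (simp add: mult_2)
 qed
 show i3: "intL (%k. w k * Re (cnj (B s k) * G s k))" if s: "s \<in> {0..T}" for s
 proof -
  have "intL (\<Psi> s)"
  proof (rule integrableI_bounded)
   show "(NN k. ennreal (norm (\<Psi> s k))) < \<infinity>" using \<Psi>b[OF s] by (rule le_less_trans) (simp add: ennreal_mult_less_top)
  qed measurable
  then show ?thesis unfolding \<Psi>_def[abs_def] BH[OF s] .
 qed
 show i4: "intL (%k. w k * (norm (B s k))\<^sup>2)" if s: "s \<in> {0..T}" for s
 proof (rule integrableI_bounded)
  show "(%k. w k * (norm (B s k))\<^sup>2) \<in> borel_measurable lborel" unfolding BH[OF s] by measurable
  show "(NN k. ennreal (norm (w k * (norm (B s k))\<^sup>2))) < \<infinity>"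
   using bB[OF s] w0 by (auto simp: abs_mult intro: le_less_trans)
 qed
 define \<Xi> where "\<Xi> s k = indicator {0..t} s *\<^sub>R \<Psi> s k" for s k
 have jm\<Xi>: "jm \<Xi>" unfolding \<Xi>_def split_beta' by measurable
 have "(NN s k. ennreal (norm (\<Xi> s k))) = (NN s. (NN k. ennreal (norm (\<Psi> s k))) * indicator {0..t} s)"
  by (intro nn_integral_cong) (auto simp: \<Xi>_def split: split_indicator)
 also have "\<dots> \<le> 2 * ennreal C * ennreal t" by (rule nn_time_bound) (use \<Psi>b t in auto)
 also have "\<dots> < \<infinity>" by (simp add: ennreal_mult_less_top)
 finally have fin: "(NN s k. ennreal (norm (\<Xi> s k))) < \<infinity>" .
 have pI: "integrable (lborel \<Otimes>\<^sub>M lborel) (case_prod \<Xi>)" by (rule integrable_pairI[OF jm\<Xi> fin])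
 have iXi: "intL (%s. LI k. \<Xi> s k)" "intL (%k. LI s. \<Xi> s k)"
  using lborel_pair.integrable_fst'[OF pI] lborel_pair.integrable_snd[OF pI] by auto
 have e1: "(LI k. \<Xi> s k) = indicator {0..t} s *\<^sub>R (LI k. w k * Re (cnj (B s k) * G s k))" for s
  using t by (cases "s \<in> {0..t}") (auto simp: \<Xi>_def \<Psi>_def BH)
 show "set_integrable lborel {0..t} (%s. LI k. w k * Re (cnj (B s k) * G s k))"
  using iXi(1) unfolding set_integrable_def e1 .
 have e2: "AEL k. w k * (norm (B t k))\<^sup>2 = w k * (norm (B 0 k))\<^sup>2 + 2 * (LI s. \<Xi> s k)"
  using ae
 proof eventually_elim
  case (elim k)
  have 0: "0 \<in> {0..T}" using t by auto
  have B0: "B 0 k = B0 k" unfolding B[OF 0] tint_0 by simp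
  have "w k * (norm (B t k))\<^sup>2 = w k * (norm (B0 k))\<^sup>2 + 2 * (w k * tint t (%s. Re (cnj (B0 k + tint s (%s. G s k)) * G s k)))"
   unfolding B[OF t] using norm_square_absolutely_continuous(2)[OF elim, of "B0 k"] by (simp add: distrib_left)
  also have "w k * tint t (%s. Re (cnj (B0 k + tint s (%s. G s k)) * G s k)) = (LI s. \<Xi> s k)"
   unfolding set_lebesgue_integral_def \<Xi>_def \<Psi>_def H_def
   by (subst integral_mult_right_zero[symmetric]) (simp add: ac_simps)
  finally show ?case unfolding B0 .
 qed
 have 0: "0 \<in> {0..T}" using t by auto
 have "(LI k. w k * (norm (B t k))\<^sup>2) = (LI k. w k * (norm (B 0 k))\<^sup>2 + 2 * (LI s. \<Xi> s k))"
  by (rule integral_cong_AE[OF _ _ e2]) (use i4[OF t] i4[OF 0] iXi in auto)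
 also have "\<dots> = (LI k. w k * (norm (B 0 k))\<^sup>2) + 2 * (LI k s. \<Xi> s k)"
  using i4[OF 0] iXi by simp
 also have "(LI k s. \<Xi> s k) = (LI s k. \<Xi> s k)"
  by (rule Fubini_bochner[symmetric, OF jm\<Xi> fin])
 also have "2 * (LI s k. \<Xi> s k) = tint t (%s. 2 * (LI k. w k * Re (cnj (B s k) * G s k)))"
  unfolding set_lebesgue_integral_def e1 by (subst integral_mult_right_zero[symmetric]) (simp add: ac_simps)
 finally show ?thesis1 .
qed

text \<open>Only boundedness and integrability of d are available, so the supremum S of exp(-2 K t)
  d(t) is used: with the doubled rate the integral contributes at most S / 2 and is
  absorbed.\<close>

lemma gronwall:
 fixes d :: "real \<Rightarrow> real"
 assumes K: "K > 0" and m: "set_integrable lborel {0..T} d" and b: "!!t. t \<in> {0..T} ==> 0 \<le> d t \<and> d t \<le> C"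
  and le: "!!t. t \<in> {0..T} ==> d t \<le> a + tint t (%s. K * d s)" and a: "0 \<le> a" and t: "t \<in> {0..T}"
 shows "d t \<le> 2 * exp (2 * K * T) * a"
proof -
 define S where "S = (SUP t\<in>{0..T}. exp (- 2 * K * t) * d t)"
 have bdd: "bdd_above ((%t. exp (- 2 * K * t) * d t) ` {0..T})"
 proof (rule bdd_aboveI2)
  fix s assume s: "s \<in> {0..T}"
  have "exp (- 2 * K * s) * d s \<le> 1 * C" using s b[OF s] K by (intro mult_mono) auto
  then show "exp (- 2 * K * s) * d s \<le> C" by simp
 qed
 have dS: "d s \<le> exp (2 * K * s) * S" if "s \<in> {0..T}" for s
 proof -
  have "exp (- 2 * K * s) * d s \<le> S" unfolding S_def by (rule cSUP_upper[OF that bdd])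
  then have "exp (2 * K * s) * (exp (- 2 * K * s) * d s) \<le> exp (2 * K * s) * S" by (intro mult_left_mono) auto
  then show ?thesis by (simp add: mult.assoc[symmetric] flip: exp_add)
 qed
 have S0: "0 \<le> S" using dS[OF t] b[OF t] by (smt (verit) exp_gt_zero zero_le_mult_iff)
 have *: "exp (- 2 * K * s) * d s \<le> a + S / 2" if s: "s \<in> {0..T}" for s
 proof -
  have c: "continuous_on {0..s} (%r. K * (exp (2 * K * r) * S))" by (intro continuous_intros)
  have i1: "set_integrable lborel {0..s} (%r. K * d r)"
   by (rule set_integrable_mult_right) (rule set_integrable_subset[OF m], use s in auto)
  have "tint s (%r. K * d r) \<le> tint s (%r. K * (exp (2 * K * r) * S))"
   by (rule set_integral_mono[OF i1 borel_integrable_atLeastAtMost'[OF c]]) (use s K dS in auto)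
  also have "\<dots> = exp (2 * K * s) * S / 2 - exp (2 * K * 0) * S / 2"
   unfolding set_lebesgue_integral_def
  proof (rule integral_FTC_Icc(1))
   show "((%r. exp (2 * K * r) * S / 2) has_vector_derivative K * (exp (2 * K * r) * S)) (at r within {0..s})" for r
    by (auto intro!: derivative_eq_intros simp flip: has_real_derivative_iff_has_vector_derivative)
  qed (use s c in auto)
  also have "\<dots> \<le> exp (2 * K * s) * S / 2" using S0 by simp
  finally have "d s \<le> a + exp (2 * K * s) * (S / 2)" using le[OF s] by simp
  then have "exp (- 2 * K * s) * d s \<le> exp (- 2 * K * s) * (a + exp (2 * K * s) * (S / 2))" by (intro mult_left_mono) auto
  also have "\<dots> = exp (- 2 * K * s) * a + S / 2" by (simp add: distrib_left mult.assoc[symmetric] flip: exp_add)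
  also have "\<dots> \<le> a + S / 2" using K s a by (simp add: mult_left_le_one_le)
  finally show ?thesis .
 qed
 have "S \<le> a + S / 2" unfolding S_def using t * by (intro cSUP_least) (auto simp: S_def)
 then have "S \<le> 2 * a" by simp
 have "d t \<le> exp (2 * K * t) * S" by (rule dS[OF t])
 also have "\<dots> \<le> exp (2 * K * T) * (2 * a)" using \<open>S \<le> 2 * a\<close> S0 K t by (intro mult_mono) auto
 finally show ?thesis by simp
qed

lemma wint_real:
 fixes f :: cfun
 assumes [measurable]: "w \<in> bm" "f \<in> bm" and w: "!!k. 0 \<le> w k" and fin: "wint w f < \<infinity>"
 shows "intL (%k. w k * (norm (f k))\<^sup>2)" "wint w f = ennreal (LI k. w k * (norm (f k))\<^sup>2)"
  "0 \<le> (LI k. w k * (norm (f k))\<^sup>2)"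
proof -
 show i: "intL (%k. w k * (norm (f k))\<^sup>2)" using fin w by (intro integrableI_bounded) (auto simp: abs_mult)
 show "wint w f = ennreal (LI k. w k * (norm (f k))\<^sup>2)" using w by (intro nn_integral_eq_integral i) auto
 show "0 \<le> (LI k. w k * (norm (f k))\<^sup>2)" using w by (intro LI_nonneg) auto
qed

lemma nsq_wint: "nsq f = wint (%_. 1) f" by (simp add: nsq_def)

lemma wint_add_le:
 fixes f g :: cfun
 assumes [measurable]: "w \<in> bm" "f \<in> bm" "g \<in> bm" and w: "!!k. 0 \<le> w k"
 shows "wint w (%k. f k + g k) \<le> 2 * wint w f + 2 * wint w g" "wint w (%k. f k - g k) \<le> 2 * wint w f + 2 * wint w g"
proof -
 have e: "wint w h = nsq (%k. cr (sqrt (w k)) * h k)" for h :: cfun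
  using w by (simp add: nsq_def norm_mult power_mult_distrib)
 show "wint w (%k. f k + g k) \<le> 2 * wint w f + 2 * wint w g"
  unfolding e distrib_left by (rule nsq_add_le) measurable
 show "wint w (%k. f k - g k) \<le> 2 * wint w f + 2 * wint w g"
  unfolding e right_diff_distrib by (rule nsq_diff_le) measurable
qed

lemma Qf_jm:
 assumes "jm F" "jm V"
 shows "jm (%s. Qf (F s) (V s))"
proof -
 note [measurable (raw)] = measurable_section2[OF assms(1)] measurable_section2[OF assms(2)]
 show ?thesis unfolding Qf_def conv_def split_beta' by measurable
qed

lemma Tq_square_bound:
 fixes U' W' :: cfun
 assumes [measurable]: "U' \<in> bm" "W' \<in> bm" and A: "0 \<le> A"
  and b: "!!l. \<bar>q k l\<bar> * (norm (U (k - l)) * norm (W l)) \<le> A * (norm (U' (k - l)) * norm (W' l))"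
 shows "ennreal ((norm (Tq q U W k))\<^sup>2) \<le> ennreal (A\<^sup>2) * (nsq U' * nsq W')"
proof -
 have "ennreal (norm (Tq q U W k)) \<le> (NN l. ennreal (\<bar>q k l\<bar> * (norm (U (k - l)) * norm (W l))))" by (rule Tq_norm)
 also have "\<dots> \<le> (NN l. ennreal A * ennreal \<bar>norm (U' (k - l)) * norm (W' l)\<bar>)"
  by (intro nn_integral_mono) (use A in \<open>simp add: ennreal_leI[OF b] abs_mult flip: ennreal_mult'\<close>)
 also have "\<dots> = ennreal A * (NN l. ennreal \<bar>norm (U' (k - l)) * norm (W' l)\<bar>)" by (rule nn_integral_cmult) measurable
 finally have "(ennreal (norm (Tq q U W k)))\<^sup>2 \<le> (ennreal A * (NN l. ennreal \<bar>norm (U' (k - l)) * norm (W' l)\<bar>))\<^sup>2"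
  by (rule power_mono) simp
 also have "\<dots> = ennreal (A\<^sup>2) * (NN l. ennreal \<bar>norm (U' (k - l)) * norm (W' l)\<bar>)\<^sup>2"
  using A by (simp add: power_mult_distrib ennreal_power)
 also have "\<dots> \<le> ennreal (A\<^sup>2) * (nsq U' * nsq W')"
  using nn_convolution_bound[of "%l. norm (U' l)" "%l. norm (W' l)" k] by (intro mult_left_mono) (auto simp: nsq_def)
 finally show ?thesis by (simp add: ennreal_power)
qed

lemma norm3_square_le: "(norm (x + (y + z)))\<^sup>2 \<le> 2 * (norm x)\<^sup>2 + 4 * (norm y)\<^sup>2 + 4 * (norm (z::complex))\<^sup>2"
proof -
 have "(norm (x + (y + z)))\<^sup>2 \<le> (norm x + norm (y + z))\<^sup>2" by (intro power_mono norm_triangle_ineq) auto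
 also have "\<dots> \<le> 2 * (norm x)\<^sup>2 + 2 * (norm (y + z))\<^sup>2" by (rule power2_sum_le)
 also have "(norm (y + z))\<^sup>2 \<le> (norm y + norm z)\<^sup>2" by (intro power_mono norm_triangle_ineq) auto
 also have "\<dots> \<le> 2 * (norm y)\<^sup>2 + 2 * (norm z)\<^sup>2" by (rule power2_sum_le)
 finally show ?thesis by simp
qed

text \<open>At a fixed frequency the quadratic term is Lipschitz in L^2 without any derivative on
  the difference: the loss is the explicit factor k^2. For this the derivative at l is charged to F
  in one term and moved to k - l, onto F', in the other.\<close>

lemma Qf_diff_pointwise:
 assumes m[measurable]: "F \<in> bm" "V \<in> bm" "F' \<in> bm" "V' \<in> bm"
  and n: "nsq F \<le> ennreal C" "nsq (xF F) \<le> ennreal C" "nsq V \<le> ennreal C" "nsq F' \<le> ennreal C" "nsq (xF F') \<le> ennreal C" "nsq V' \<le> ennreal C"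
  and C: "0 \<le> C"
 shows "ennreal ((norm (Qf F V k - Qf F' V' k))\<^sup>2) \<le> ennreal (32 * C * k\<^sup>2) * (nsq (%k. V k - V' k) + nsq (%k. F k - F' k))"
proof -
 have fin: "nsq F < \<infinity>" "nsq (xF F) < \<infinity>" "nsq V < \<infinity>" "nsq F' < \<infinity>" "nsq (xF F') < \<infinity>" "nsq V' < \<infinity>"
  using n by (auto intro: le_less_trans)
 let ?d = "%k. V k - V' k" and ?e = "%k. F k - F' k" and ?s = "%k. V k + V' k"
 have s: "nsq ?s \<le> ennreal (4 * C)"
 proof -
  have "nsq ?s \<le> 2 * nsq V + 2 * nsq V'" by (rule nsq_add_le) auto
  also have "\<dots> \<le> 2 * ennreal C + 2 * ennreal C" by (intro add_mono mult_left_mono n) auto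
  also have "\<dots> = ennreal (4 * C)" using C by (simp add: ennreal_2_sum)
  finally show ?thesis .
 qed
 have T1: "ennreal ((norm (Tq q1 ?s ?d k))\<^sup>2) \<le> ennreal (\<bar>k\<bar>\<^sup>2) * (nsq ?s * nsq ?d)"
  by (rule Tq_square_bound) (auto intro!: mult_right_mono q1_le)
 have T2: "ennreal ((norm (Tq q2 ?e F k))\<^sup>2) \<le> ennreal ((2 * \<bar>k\<bar>)\<^sup>2) * (nsq ?e * nsq (xF F))"
 proof (rule Tq_square_bound)
  fix l
  have "\<bar>q2 k l\<bar> * (norm (?e (k - l)) * norm (F l)) \<le> (2 * \<bar>k\<bar> * \<bar>l\<bar>) * (norm (?e (k - l)) * norm (F l))" by (intro mult_right_mono q2_le) auto
  then show "\<bar>q2 k l\<bar> * (norm (?e (k - l)) * norm (F l)) \<le> 2 * \<bar>k\<bar> * (norm (?e (k - l)) * norm (xF F l))" by (simp add: norm_mult ac_simps)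
 qed auto
 have T3: "ennreal ((norm (Tq q2 F' ?e k))\<^sup>2) \<le> ennreal ((2 * \<bar>k\<bar>)\<^sup>2) * (nsq (xF F') * nsq ?e)"
 proof (rule Tq_square_bound)
  fix l
  have "\<bar>q2 k l\<bar> * (norm (F' (k - l)) * norm (?e l)) \<le> (2 * \<bar>k\<bar> * \<bar>k - l\<bar>) * (norm (F' (k - l)) * norm (?e l))" by (intro mult_right_mono q2_le2) auto
  then show "\<bar>q2 k l\<bar> * (norm (F' (k - l)) * norm (?e l)) \<le> 2 * \<bar>k\<bar> * (norm (xF F' (k - l)) * norm (?e l))"
   by (simp only: norm_mult norm_of_real ac_simps)
 qed auto
 have "Qf F V k - Qf F' V' k = c\<^sub>F * ((Tq q1 V V k - Tq q1 V' V' k) + (Tq q2 F F k - Tq q2 F' F' k))"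
  unfolding Qf_eq[OF m(1,2) fin(3,1,2)] Qf_eq[OF m(3,4) fin(6,4,5)] by (simp add: algebra_simps)
 also have "\<dots> = c\<^sub>F * (Tq q1 ?s ?d k + (Tq q2 ?e F k + Tq q2 F' ?e k))"
  unfolding Tq_q1_diff[OF m(2,4) fin(3,6)] Tq_q2_diff[OF m(1,3) fin(1,4,2,5)] ..
 finally have "norm (Qf F V k - Qf F' V' k) \<le> 1 * norm (Tq q1 ?s ?d k + (Tq q2 ?e F k + Tq q2 F' ?e k))"
  by (simp only: norm_mult) (intro mult_right_mono norm_cF, auto)
 then have "(norm (Qf F V k - Qf F' V' k))\<^sup>2 \<le> (norm (Tq q1 ?s ?d k + (Tq q2 ?e F k + Tq q2 F' ?e k)))\<^sup>2" by (intro power_mono) auto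
 also have "\<dots> \<le> 2 * (norm (Tq q1 ?s ?d k))\<^sup>2 + 4 * (norm (Tq q2 ?e F k))\<^sup>2 + 4 * (norm (Tq q2 F' ?e k))\<^sup>2" by (rule norm3_square_le)
 finally have "ennreal ((norm (Qf F V k - Qf F' V' k))\<^sup>2) \<le> ennreal (2 * (norm (Tq q1 ?s ?d k))\<^sup>2 + 4 * (norm (Tq q2 ?e F k))\<^sup>2 + 4 * (norm (Tq q2 F' ?e k))\<^sup>2)"
  by (rule ennreal_leI)
 also have "\<dots> = ennreal 2 * ennreal ((norm (Tq q1 ?s ?d k))\<^sup>2) + ennreal 4 * ennreal ((norm (Tq q2 ?e F k))\<^sup>2) + ennreal 4 * ennreal ((norm (Tq q2 F' ?e k))\<^sup>2)"
  by (simp only: ennreal_plus ennreal_mult zero_le_power2 mult_nonneg_nonneg add_nonneg_nonneg zero_le_numeral)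
 also have "\<dots> \<le> ennreal 2 * (ennreal (\<bar>k\<bar>\<^sup>2) * (ennreal (4 * C) * nsq ?d)) + ennreal 4 * (ennreal ((2 * \<bar>k\<bar>)\<^sup>2) * (nsq ?e * ennreal C)) + ennreal 4 * (ennreal ((2 * \<bar>k\<bar>)\<^sup>2) * (ennreal C * nsq ?e))"
  by (intro add_mono mult_left_mono order_trans[OF T1] order_trans[OF T2] order_trans[OF T3] mult_right_mono s n) auto
 also have "\<dots> = ennreal (2 * \<bar>k\<bar>\<^sup>2 * (4 * C)) * nsq ?d + (ennreal (4 * (2 * \<bar>k\<bar>)\<^sup>2 * C) * nsq ?e + ennreal (4 * (2 * \<bar>k\<bar>)\<^sup>2 * C) * nsq ?e)"
  using C by (simp only: ennreal_mult zero_le_power2 mult_nonneg_nonneg zero_le_numeral) (simp only: ac_simps)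
 also have "\<dots> \<le> ennreal (32 * C * k\<^sup>2) * nsq ?d + ennreal (32 * C * k\<^sup>2) * nsq ?e"
 proof (rule add_mono)
  show "ennreal (2 * \<bar>k\<bar>\<^sup>2 * (4 * C)) * nsq ?d \<le> ennreal (32 * C * k\<^sup>2) * nsq ?d"
   using C by (intro mult_right_mono ennreal_leI) (auto simp: mult_right_mono ac_simps)
  have "ennreal (4 * (2 * \<bar>k\<bar>)\<^sup>2 * C) + ennreal (4 * (2 * \<bar>k\<bar>)\<^sup>2 * C) = ennreal (32 * C * k\<^sup>2)"
   using C by (subst ennreal_plus[symmetric]) (auto simp: power_mult_distrib ac_simps)
  then show "ennreal (4 * (2 * \<bar>k\<bar>)\<^sup>2 * C) * nsq ?e + ennreal (4 * (2 * \<bar>k\<bar>)\<^sup>2 * C) * nsq ?e \<le> ennreal (32 * C * k\<^sup>2) * nsq ?e"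
   unfolding distrib_right[symmetric] by simp
 qed
 finally show ?thesis by (simp add: distrib_left)
qed

section \<open>The right-hand side on bounded sets of the energy space\<close>

locale wave_params =
 fixes \<epsilon> \<alpha> \<beta> :: real
 assumes \<epsilon>: "\<epsilon> > 0" and \<beta>: "\<beta> > 0"
begin

abbreviation R where "R \<equiv> Rf \<epsilon> \<alpha> \<beta>"

lemma R_measurable[measurable]:
 assumes [measurable]: "F \<in> bm" "V \<in> bm"
 shows "R F V \<in> bm"
 unfolding Rf_def[abs_def] by measurable

lemma R_jm:
 assumes "jm F" "jm V"
 shows "jm (%s. R (F s) (V s))"
proof -
 note [measurable (raw)] = measurable_section2[OF assms(1)] measurable_section2[OF assms(2)] measurable_section2[OF Qf_jm[OF assms]]
 show ?thesis unfolding Rf_def split_beta' by measurable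
qed

text \<open>For large k the left side grows like |k|^8 and the energy weight of F like |k|^9. One
  factor \<open>lam\<close> is kept and the other is bounded by (1 + \<beta>) |k|^3.\<close>

lemma lam_square_le: "(1 + k\<^sup>2) * (lam \<beta> k)\<^sup>2 \<le> 2 * (1 + \<beta>)\<^sup>2 * (wt k * lam \<beta> k + 1)"
proof (cases "\<bar>k\<bar> \<le> 1")
 case True
 have k2: "k\<^sup>2 \<le> 1" using True by (simp add: abs_square_le_1)
 have "\<bar>k\<bar> ^ 3 \<le> 1" using True by (simp add: power_le_one)
 then have "lam \<beta> k \<le> 1 + \<beta>" unfolding lam_def using True \<beta> by (intro add_mono) (auto simp: mult_left_le)
 then have "(lam \<beta> k)\<^sup>2 \<le> (1 + \<beta>)\<^sup>2" using \<beta> by (intro power_mono) auto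
 then have "(1 + k\<^sup>2) * (lam \<beta> k)\<^sup>2 \<le> 2 * (1 + \<beta>)\<^sup>2" using k2 by (intro mult_mono) auto
 also have "\<dots> \<le> 2 * (1 + \<beta>)\<^sup>2 * (wt k * lam \<beta> k + 1)"
 proof -
  have "0 \<le> wt k * lam \<beta> k" using \<beta> by simp
  then have "1 \<le> wt k * lam \<beta> k + 1" by linarith
  from mult_left_mono[OF this, of "2 * (1 + \<beta>)\<^sup>2"] show ?thesis by simp
 qed
 finally show ?thesis .
next
 case False
 then have k: "1 \<le> \<bar>k\<bar>" by simp
 have "\<bar>k\<bar> ^ 1 \<le> \<bar>k\<bar> ^ 3" by (rule power_increasing) (use k in auto)
 then have l: "lam \<beta> k \<le> (1 + \<beta>) * \<bar>k\<bar> ^ 3" unfolding lam_def by (simp add: distrib_right)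
 have "1 \<le> k\<^sup>2" using k by (metis abs_le_square_iff abs_one one_power2)
 then have k2: "1 + k\<^sup>2 \<le> 2 * \<bar>k\<bar>\<^sup>2" by simp
 have "(1 + k\<^sup>2) * (lam \<beta> k)\<^sup>2 = lam \<beta> k * ((1 + k\<^sup>2) * lam \<beta> k)" by (simp add: power2_eq_square)
 also have "\<dots> \<le> lam \<beta> k * ((2 * \<bar>k\<bar>\<^sup>2) * ((1 + \<beta>) * \<bar>k\<bar> ^ 3))"
  using \<beta> by (intro mult_left_mono mult_mono l k2) auto
 also have "\<dots> = 2 * (1 + \<beta>) * (\<bar>k\<bar> ^ 5 * lam \<beta> k)" by (simp add: eval_nat_numeral ac_simps)
 also have "\<dots> \<le> 2 * (1 + \<beta>)\<^sup>2 * (wt k * lam \<beta> k + 1)"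
 proof (rule mult_mono)
  have "\<bar>k\<bar> ^ 5 \<le> wt k" using abs_pow_le[of 5 6 k] by (simp add: wt_def)
  then have "\<bar>k\<bar> ^ 5 * lam \<beta> k \<le> wt k * lam \<beta> k" using \<beta> by (intro mult_right_mono) auto
  then show "\<bar>k\<bar> ^ 5 * lam \<beta> k \<le> wt k * lam \<beta> k + 1" by simp
  show "2 * (1 + \<beta>) \<le> 2 * (1 + \<beta>)\<^sup>2" using \<beta> power_increasing[of 1 2 "1 + \<beta>"] by simp
 qed (use \<beta> in auto)
 finally show ?thesis .
qed

definition CR :: "real \<Rightarrow> real"
 where "CR M = 8 * (1 + \<beta>)\<^sup>2 * M + 8 * \<alpha>\<^sup>2 * M + 2 * \<epsilon>\<^sup>2 * (4 * (cI + 8 * M)\<^sup>2 * (8 * M))"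

lemma CR_nonneg: "0 \<le> M ==> 0 \<le> CR M"
 unfolding CR_def using cI(1) by (intro add_nonneg_nonneg mult_nonneg_nonneg) auto

lemma Qf_weight_hi:
 assumes h: "hi \<beta> M F V" and M: "0 \<le> M"
 shows "wint (%k. 1 + k\<^sup>2) (Qf F V) \<le> ennreal (4 * (cI + 8 * M)\<^sup>2 * (8 * M))"
 using hi_facts[OF h \<beta> M] M by (intro Qf_weight) auto

lemma Qf_nsq: "hi \<beta> M F V ==> 0 \<le> M ==> nsq (Qf F V) \<le> ennreal (4 * (cI + 8 * M)\<^sup>2 * (8 * M))"
 by (rule order_trans[OF nsq_le_wint Qf_weight_hi]) auto

text \<open>The term with \<alpha> fixes the level: (1 + k^2) times k^4 grows exactly like the
  weight k^6 of V. So V' lies in H^1, which makes it \<open>nice\<close>.\<close>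

lemma R_weight:
 assumes h: "hi \<beta> M F V" and M: "0 \<le> M"
 shows "wint (%k. 1 + k\<^sup>2) (R F V) \<le> ennreal (CR M)"
proof -
 note hf = hi_facts[OF h \<beta> M]
 have [measurable]: "F \<in> bm" "V \<in> bm" by (rule hf)+
 let ?w = "%k::real. 1 + k\<^sup>2"
 let ?a = "%k. - cr (lam \<beta> k) * F k" and ?b = "%k. \<i> * cr (\<alpha> * k * \<bar>k\<bar>) * V k" and ?c = "%k. cr \<epsilon> * Qf F V k"
 have a: "wint ?w ?a \<le> ennreal (2 * (1 + \<beta>)\<^sup>2 * M)"
 proof -
  have "wint ?w ?a = wint (%k. (1 + k\<^sup>2) * (lam \<beta> k)\<^sup>2) F" by (simp add: norm_mult power_mult_distrib mult.assoc)
  also have "\<dots> \<le> ennreal (2 * (1 + \<beta>)\<^sup>2 * M)" by (rule hi_weightF[OF h \<beta>]) (auto simp: lam_square_le)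
  finally show ?thesis .
 qed
 have b: "wint ?w ?b \<le> ennreal (2 * \<alpha>\<^sup>2 * M)"
 proof -
  have "wint ?w ?b = wint (%k. (1 + k\<^sup>2) * (\<alpha>\<^sup>2 * k ^ 4)) V"
   by (simp add: norm_mult power_mult_distrib mult.assoc abs_mult flip: power_add)
  also have "\<dots> \<le> ennreal (2 * \<alpha>\<^sup>2 * M)"
  proof (rule hi_weightV[OF h \<beta>])
   fix k
   have "k ^ 4 \<le> wt k" using abs_pow_le[of 4 6 k] by (simp add: wt_def)
   moreover have "k ^ 6 \<le> wt k" by (simp add: wt_def)
   ultimately have "k ^ 4 + k ^ 6 \<le> 2 * wt k" by linarith
   then have "\<alpha>\<^sup>2 * (k ^ 4 + k ^ 6) \<le> \<alpha>\<^sup>2 * (2 * wt k)" by (rule mult_left_mono) simp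
   then show "(1 + k\<^sup>2) * (\<alpha>\<^sup>2 * k ^ 4) \<le> 2 * \<alpha>\<^sup>2 * wt k" by (simp add: algebra_simps flip: power_add)
  qed auto
  finally show ?thesis .
 qed
 have c: "wint ?w ?c \<le> ennreal (\<epsilon>\<^sup>2 * (4 * (cI + 8 * M)\<^sup>2 * (8 * M)))"
 proof -
  have "wint ?w ?c = wint (%k. \<epsilon>\<^sup>2 * (1 + k\<^sup>2)) (Qf F V)" by (simp add: norm_mult power_mult_distrib ac_simps)
  also have "\<dots> = ennreal (\<epsilon>\<^sup>2) * wint ?w (Qf F V)" by (rule wint_cmult) auto
  also have "\<dots> \<le> ennreal (\<epsilon>\<^sup>2) * ennreal (4 * (cI + 8 * M)\<^sup>2 * (8 * M))" by (intro mult_left_mono Qf_weight_hi[OF h M]) auto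
  finally show ?thesis by (simp add: ennreal_mult')
 qed
 have nn: "0 \<le> 2 * (1 + \<beta>)\<^sup>2 * M" "0 \<le> 2 * \<alpha>\<^sup>2 * M" "0 \<le> \<epsilon>\<^sup>2 * (4 * (cI + 8 * M)\<^sup>2 * (8 * M))" using M by auto
 have "wint ?w (R F V) \<le> 2 * wint ?w (%k. ?a k + ?b k) + 2 * wint ?w ?c"
  unfolding Rf_def by (rule wint_add_le(1)) auto
 also have "\<dots> \<le> 2 * (2 * wint ?w ?a + 2 * wint ?w ?b) + 2 * wint ?w ?c"
  by (intro add_right_mono mult_left_mono wint_add_le(1)) auto
 also have "\<dots> \<le> 2 * (2 * ennreal (2 * (1 + \<beta>)\<^sup>2 * M) + 2 * ennreal (2 * \<alpha>\<^sup>2 * M)) + 2 * ennreal (\<epsilon>\<^sup>2 * (4 * (cI + 8 * M)\<^sup>2 * (8 * M)))"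
  by (intro add_mono mult_left_mono a b c) auto
 also have "\<dots> = 2 * ennreal (2 * (2 * (1 + \<beta>)\<^sup>2 * M) + 2 * (2 * \<alpha>\<^sup>2 * M)) + 2 * ennreal (\<epsilon>\<^sup>2 * (4 * (cI + 8 * M)\<^sup>2 * (8 * M)))"
  unfolding ennreal_2_sum[OF nn(1,2)] ..
 also have "\<dots> = ennreal (2 * (2 * (2 * (1 + \<beta>)\<^sup>2 * M) + 2 * (2 * \<alpha>\<^sup>2 * M)) + 2 * (\<epsilon>\<^sup>2 * (4 * (cI + 8 * M)\<^sup>2 * (8 * M))))"
  using nn by (intro ennreal_2_sum) auto
 also have "\<dots> = ennreal (CR M)" by (simp add: CR_def mult.assoc)
 finally show ?thesis .
qed

lemma R_nsq: "hi \<beta> M F V ==> 0 \<le> M ==> nsq (R F V) \<le> ennreal (CR M)"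
 using R_weight[of M F V] nsq_le_wint[of "%k. 1 + k\<^sup>2" "R F V"] by (auto intro: order_trans)

abbreviation lw :: "real \<Rightarrow> real" where "lw k \<equiv> lam \<beta> k + 1"

lemma lw_ge_1: "1 \<le> lw k" "0 \<le> lw k" using lam_nonneg[OF \<beta>, of k] by auto

lemma lw_le_wt: "lw k \<le> (2 + \<beta>) * wt k"
proof -
 have "\<bar>k\<bar> \<le> wt k" "\<bar>k\<bar> ^ 3 \<le> wt k" using abs_pow_le[of 1 6 k] abs_pow_le[of 3 6 k] by (auto simp: wt_def)
 then have "\<bar>k\<bar> \<le> wt k" "\<beta> * \<bar>k\<bar> ^ 3 \<le> \<beta> * wt k" using \<beta> by auto
 moreover have "1 \<le> wt k" by simp
 ultimately show ?thesis unfolding lam_def distrib_right by linarith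
qed

text \<open>At the lower level \<open>lw\<close> the derivative V of F is bounded in the same
  weighted norm as F, as \<open>energy_identity\<close> demands; V itself is measured there in L^2,
  where \<open>R_nsq\<close> bounds its derivative.\<close>

lemma hi_lw: "hi \<beta> M F V ==> 0 \<le> M ==> wint lw F \<le> ennreal M" "hi \<beta> M F V ==> 0 \<le> M ==> wint lw V \<le> ennreal ((2 + \<beta>) * M)"
proof -
 assume h: "hi \<beta> M F V" and M: "0 \<le> M"
 have "wint lw F \<le> ennreal (1 * M)"
 proof (rule hi_weightF[OF h \<beta>])
  show "lw k \<le> 1 * (wt k * lam \<beta> k + 1)" for k using mult_right_mono[OF wt_ge_1[of k] lam_nonneg[OF \<beta>, of k]] by simp
 qed (auto simp: lw_ge_1)
 then show "wint lw F \<le> ennreal M" by simp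
 show "wint lw V \<le> ennreal ((2 + \<beta>) * M)" by (rule hi_weightV[OF h \<beta>]) (use \<beta> lw_ge_1 lw_le_wt in auto)
qed

text \<open>Solutions of the integrated system up to residuals \<open>\<rho>\<close>, \<open>\<sigma>\<close> of size \<open>\<eta>\<close>.\<close>

definition apsol :: "real \<Rightarrow> real \<Rightarrow> real \<Rightarrow> (real \<Rightarrow> real \<Rightarrow> complex) \<Rightarrow> (real \<Rightarrow> real \<Rightarrow> complex) \<Rightarrow> (real \<Rightarrow> real \<Rightarrow> complex) \<Rightarrow> (real \<Rightarrow> real \<Rightarrow> complex) \<Rightarrow> bool"
 where "apsol T M \<eta> F V \<rho> \<sigma> \<longleftrightarrow> jm F \<and> jm V \<and> jm \<rho> \<and> jm \<sigma>
  \<and> (\<forall>t\<in>{0..T}. hi \<beta> M (F t) (V t) \<and> wint lw (\<rho> t) \<le> ennreal \<eta> \<and> nsq (\<sigma> t) \<le> ennreal \<eta>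
    \<and> (AEL k. F t k = F 0 k + tint t (%s. V s k + \<rho> s k)) \<and> (AEL k. V t k = V 0 k + tint t (%s. R (F s) (V s) k + \<sigma> s k)))"

definition KS :: "real \<Rightarrow> real" where "KS M = 2 + 4 * \<epsilon> * (cI + 8 * M) * (2 + 1 / \<beta>)"

lemma KS_pos: "0 \<le> M ==> 0 < KS M"
 unfolding KS_def using \<epsilon> \<beta> cI(1) by (intro add_pos_nonneg mult_nonneg_nonneg) auto

text \<open>The \<open>lam\<close> parts of the two pairings are opposite, and the \<alpha> part of
  the second is purely imaginary before the real part is taken. There remain one harmless product
  from the 1 in \<open>lw\<close>, the residuals, and the quadratic term covered by
  \<open>low_energy_estimate\<close>.\<close>

lemma energy_balance:
 assumes h: "hi \<beta> M F V" "hi \<beta> M F' V'" and M: "0 \<le> M" and [measurable]: "r \<in> bm" "r' \<in> bm"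
  and r: "wint lw r \<le> ennreal e" "nsq r' \<le> ennreal e" and e: "0 \<le> e"
  and i1: "intL (%k. lw k * Re (cnj (F k - F' k) * (V k - V' k + r k)))"
  and i2: "intL (%k. Re (cnj (V k - V' k) * (R F V k - R F' V' k + r' k)))"
 shows "2 * (LI k. lw k * Re (cnj (F k - F' k) * (V k - V' k + r k))) + 2 * (LI k. Re (cnj (V k - V' k) * (R F V k - R F' V' k + r' k)))
  \<le> KS M * ((LI k. lw k * (norm (F k - F' k))\<^sup>2) + (LI k. (norm (V k - V' k))\<^sup>2)) + 2 * e"
proof -
 note hf = hi_facts[OF h(1) \<beta> M] and hf' = hi_facts[OF h(2) \<beta> M]
 have [measurable]: "F \<in> bm" "V \<in> bm" "F' \<in> bm" "V' \<in> bm" by (rule hf hf')+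
 define d where "d k = V k - V' k" for k
 define a where "a k = F k - F' k" for k
 define q where "q k = Qf F V k - Qf F' V' k" for k
 have [measurable]: "d \<in> bm" "a \<in> bm" "q \<in> bm"
  unfolding d_def[abs_def] a_def[abs_def] q_def[abs_def] by measurable
 have da: "wint lw a < \<infinity>"
 proof -
  have "wint lw a \<le> 2 * wint lw F + 2 * wint lw F'" unfolding a_def by (rule wint_add_le(2)) (auto simp: lw_ge_1)
  also have "\<dots> < \<infinity>" using hi_lw(1)[OF h(1) M] hi_lw(1)[OF h(2) M] by (auto simp: ennreal_mult_less_top intro: le_less_trans)
  finally show ?thesis .
 qed
 have dd: "nsq d < \<infinity>" unfolding d_def[abs_def] using hf hf' by (intro nsq_diff_finite) (auto intro: le_less_trans)
 have qq: "nsq q < \<infinity>" unfolding q_def[abs_def]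
  using Qf_nsq[OF h(1) M] Qf_nsq[OF h(2) M] by (intro nsq_diff_finite) (auto intro: le_less_trans)
 note ra = wint_real[of lw a, OF _ _ _ da] and rr = wint_real[of lw r] and rd = wint_real[of "%_. 1" d] and rr' = wint_real[of "%_. 1" r']
 have fr: "wint lw r < \<infinity>" "nsq r' < \<infinity>" using r by (auto intro: le_less_trans)
 define A where "A = (LI k. lw k * (norm (a k))\<^sup>2)"
 define D where "D = (LI k. (norm (d k))\<^sup>2)"
 have iA: "intL (%k. lw k * (norm (a k))\<^sup>2)" and A: "wint lw a = ennreal A" "0 \<le> A"
  using ra lw_ge_1 by (auto simp: A_def)
 have iD: "intL (%k. (norm (d k))\<^sup>2)" and D: "nsq d = ennreal D" "0 \<le> D"
  using rd dd by (auto simp: D_def nsq_wint)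
 have iR: "intL (%k. lw k * (norm (r k))\<^sup>2)" and Rle: "(LI k. lw k * (norm (r k))\<^sup>2) \<le> e"
  using rr fr r(1) e lw_ge_1 by (auto simp: ennreal_le_iff)
 have iR': "intL (%k. (norm (r' k))\<^sup>2)" and Rle': "(LI k. (norm (r' k))\<^sup>2) \<le> e"
  using rr' fr r(2) e by (auto simp: nsq_wint ennreal_le_iff)
 have iq: "intL (%k. cnj (d k) * q k)"
  using dd qq by (intro integrable_L2_mult) (auto simp: nsq_def)
 have lwx: "(norm (a k))\<^sup>2 \<le> lw k * (norm (a k))\<^sup>2" for k
  using mult_right_mono[OF lw_ge_1(1)[of k], of "(norm (a k))\<^sup>2"] by simp
 have ia: "intL (%k. (norm (a k))\<^sup>2)"
 proof (rule LI_int_bound[OF iA])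
  show "AEL k. norm ((norm (a k))\<^sup>2) \<le> norm (lw k * (norm (a k))\<^sup>2)"
   using lwx lw_ge_1 by (intro AE_I2) (auto simp: abs_mult)
 qed measurable
 have ale: "(LI k. (norm (a k))\<^sup>2) \<le> A" unfolding A_def
  by (intro integral_mono ia iA lwx)
 have xa: "nsq (xF a) \<le> ennreal ((1 + 1 / \<beta>) * A)"
 proof -
  have "nsq (xF a) = wint (%k. k\<^sup>2) a" by (simp add: nsq_def norm_mult power_mult_distrib)
  also have "\<dots> \<le> wint (%k. (1 + 1 / \<beta>) * lw k) a"
  proof (rule wint_mono)
   fix k :: real
   have "k\<^sup>2 \<le> (1 + 1 / \<beta>) * lam \<beta> k" by (rule square_le_lam[OF \<beta>])
   then show "k\<^sup>2 \<le> (1 + 1 / \<beta>) * lw k" using \<beta> by (simp add: distrib_left add_increasing2)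
  qed auto
  also have "\<dots> = ennreal (1 + 1 / \<beta>) * wint lw a" using \<beta> by (intro wint_cmult) auto
  finally show ?thesis using \<beta> A by (simp add: ennreal_mult')
 qed
 have Q: "Re (LI k. cnj (d k) * q k) \<le> 2 * (cI + 8 * M) * (D + (1 + 1 / \<beta>) * A)"
 proof -
  have "ennreal (norm (LI k. cnj (d k) * q k)) \<le> ennreal (2 * (cI + 8 * M)) * (nsq d + nsq (xF a))"
   unfolding d_def[abs_def] q_def a_def[abs_def] by (rule low_energy_estimate) (use hf hf' M in auto)
  also have "\<dots> \<le> ennreal (2 * (cI + 8 * M)) * (ennreal D + ennreal ((1 + 1 / \<beta>) * A))"
   unfolding D by (intro mult_left_mono add_left_mono xa) simp
  also have "\<dots> = ennreal (2 * (cI + 8 * M) * (D + (1 + 1 / \<beta>) * A))"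
   using D A M cI(1) \<beta> by (subst ennreal_mult') (auto simp: ennreal_plus)
  finally have "norm (LI k. cnj (d k) * q k) \<le> 2 * (cI + 8 * M) * (D + (1 + 1 / \<beta>) * A)"
   using D A M cI(1) \<beta> by (subst (asm) ennreal_le_iff) auto
  then show ?thesis using complex_Re_le_cmod order_trans by blast
 qed
 define P where "P k = lw k * Re (cnj (a k) * (d k + r k))" for k
 define P' where "P' k = Re (cnj (d k) * (R F V k - R F' V' k + r' k))" for k
 define q' where "q' k = Re (cnj (d k) * q k)" for k
 have iP: "intL P" "intL P'" "intL q'"
  using i1 i2 integrable_Re[OF iq] unfolding P_def[abs_def] P'_def[abs_def] q'_def[abs_def] a_def d_def by auto
 \<comment> \<open>Pointwise in k nothing can be said about the last term; its sign and size are
   known only after integration, so it is carried along unchanged.\<close>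
 have pt: "2 * (lw k * Re (cnj (a k) * (d k + r k))) + 2 * Re (cnj (d k) * (R F V k - R F' V' k + r' k))
  \<le> (norm (a k))\<^sup>2 + 2 * (norm (d k))\<^sup>2 + lw k * (norm (a k))\<^sup>2 + lw k * (norm (r k))\<^sup>2 + (norm (r' k))\<^sup>2 + 2 * \<epsilon> * Re (cnj (d k) * q k)" for k
 proof -
  have two: "2 * Re (cnj x * y) \<le> (norm x)\<^sup>2 + (norm y)\<^sup>2" for x y :: complex
  proof -
   have "2 * Re (cnj x * y) \<le> 2 * (norm x * norm y)" using complex_Re_le_cmod[of "cnj x * y"] by (simp add: norm_mult)
   then show ?thesis using sum_squares_bound[of "norm x" "norm y"] by simp
  qed
  have RR: "R F V k - R F' V' k = - cr (lam \<beta> k) * a k + \<i> * cr (\<alpha> * k * \<bar>k\<bar>) * d k + cr \<epsilon> * q k"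
   by (simp add: Rf_def a_def d_def q_def algebra_simps)
  have "2 * (lw k * Re (cnj (a k) * (d k + r k))) + 2 * Re (cnj (d k) * (R F V k - R F' V' k + r' k))
   = 2 * Re (cnj (a k) * d k) + lw k * (2 * Re (cnj (a k) * r k)) + 2 * Re (cnj (d k) * r' k) + 2 * \<epsilon> * Re (cnj (d k) * q k)"
   unfolding RR by (simp add: algebra_simps)
  also have "\<dots> \<le> ((norm (a k))\<^sup>2 + (norm (d k))\<^sup>2) + lw k * ((norm (a k))\<^sup>2 + (norm (r k))\<^sup>2) + ((norm (d k))\<^sup>2 + (norm (r' k))\<^sup>2) + 2 * \<epsilon> * Re (cnj (d k) * q k)"
   by (intro add_mono mult_left_mono two order_refl lw_ge_1)
  finally show ?thesis by (simp add: algebra_simps)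
 qed
 have "2 * (LI k. P k) + 2 * (LI k. P' k) = (LI k. 2 * P k + 2 * P' k)" using iP by simp
 also have "\<dots> \<le> (LI k. (norm (a k))\<^sup>2 + 2 * (norm (d k))\<^sup>2 + lw k * (norm (a k))\<^sup>2 + lw k * (norm (r k))\<^sup>2 + (norm (r' k))\<^sup>2 + 2 * \<epsilon> * q' k)"
  by (intro integral_mono LI_int_add integrable_mult_right iP iA iD iR iR' ia) (use pt in \<open>simp add: P_def P'_def q'_def\<close>)
 also have "\<dots> = (LI k. (norm (a k))\<^sup>2) + 2 * D + A + (LI k. lw k * (norm (r k))\<^sup>2) + (LI k. (norm (r' k))\<^sup>2) + 2 * \<epsilon> * (LI k. q' k)"
  unfolding A_def D_def using iA iD iR iR' ia iP by simp
 also have "(LI k. q' k) = Re (LI k. cnj (d k) * q k)" unfolding q'_def by (rule integral_Re[OF iq])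
 also have "(LI k. (norm (a k))\<^sup>2) + 2 * D + A + (LI k. lw k * (norm (r k))\<^sup>2) + (LI k. (norm (r' k))\<^sup>2) + 2 * \<epsilon> * Re (LI k. cnj (d k) * q k)
  \<le> A + 2 * D + A + e + e + 2 * \<epsilon> * (2 * (cI + 8 * M) * (D + (1 + 1 / \<beta>) * A))"
  using \<epsilon> by (intro add_mono ale Rle Rle' mult_left_mono Q order_refl) auto
 also have "\<dots> \<le> KS M * (A + D) + 2 * e"
 proof -
  have c: "0 \<le> 4 * \<epsilon> * (cI + 8 * M)" using \<epsilon> cI(1) M by simp
  have "D + (1 + 1 / \<beta>) * A \<le> (2 + 1 / \<beta>) * (A + D)" using A D \<beta> 
  proof -
   have "0 \<le> D / \<beta>" using D \<beta> by simp
   then show ?thesis using A D by (simp add: algebra_simps add_divide_distrib)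
  qed
  from mult_left_mono[OF this c] show ?thesis by (simp add: KS_def algebra_simps)
 qed
 finally show ?thesis unfolding A_def D_def P_def P'_def a_def d_def .
qed

end

section \<open>Stability\<close>

lemma wint_diff_bound:
 fixes f g :: cfun
 assumes "w \<in> bm" "f \<in> bm" "g \<in> bm" "!!k. 0 \<le> w k"
  and "wint w f \<le> ennreal x" "wint w g \<le> ennreal y" "0 \<le> x" "0 \<le> y"
 shows "wint w (%k. f k - g k) \<le> ennreal (2 * x + 2 * y)" "wint w (%k. f k + g k) \<le> ennreal (2 * x + 2 * y)"
proof -
 have "2 * wint w f + 2 * wint w g \<le> 2 * ennreal x + 2 * ennreal y" by (intro add_mono mult_left_mono assms) auto
 then have le: "2 * wint w f + 2 * wint w g \<le> ennreal (2 * x + 2 * y)" unfolding ennreal_2_sum[OF assms(7,8)] .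
 show "wint w (%k. f k - g k) \<le> ennreal (2 * x + 2 * y)" by (rule order_trans[OF wint_add_le(2)[OF assms(1-4)] le])
 show "wint w (%k. f k + g k) \<le> ennreal (2 * x + 2 * y)" by (rule order_trans[OF wint_add_le(1)[OF assms(1-4)] le])
qed

lemma nsq_diff_bound:
 fixes f g :: cfun
 assumes "f \<in> bm" "g \<in> bm" "nsq f \<le> ennreal x" "nsq g \<le> ennreal y" "0 \<le> x" "0 \<le> y"
 shows "nsq (%k. f k - g k) \<le> ennreal (2 * x + 2 * y)" "nsq (%k. f k + g k) \<le> ennreal (2 * x + 2 * y)"
 using wint_diff_bound[of "%_. 1" f g x y] assms by (simp_all add: nsq_def)

lemma jm_section: "jm F ==> F t \<in> bm"
 by (rule measurable_section2[of F "%_. t" borel "%x. x"]) auto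

lemma jm_arith:
 fixes F G :: "real \<Rightarrow> real \<Rightarrow> complex"
 assumes "jm F" "jm G"
 shows "jm (%t k. F t k + G t k)" "jm (%t k. F t k - G t k)"
 using assms unfolding split_beta' by measurable

lemma wint_cong_AE: "(AEL k. f k = g k) ==> wint w f = wint w g"
 by (intro nn_integral_cong_AE) (auto elim!: eventually_mono)

text \<open>The exceptional set of frequencies is the same for all s, which is why the quantifier
  over s stands inside.\<close>

lemma tint_diff_AE:
 fixes X Y :: "real \<Rightarrow> real \<Rightarrow> complex"
 assumes "jm X" "jm Y" "0 \<le> T" "!!s. s \<in> {0..T} ==> nsq (X s) \<le> ennreal C" "!!s. s \<in> {0..T} ==> nsq (Y s) \<le> ennreal C'"
 shows "AEL k. \<forall>s\<in>{0..T}. tint s (%r. X r k - Y r k) = tint s (%r. X r k) - tint s (%r. Y r k)"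
proof -
 have "AEL k. set_integrable lborel {0..T} (%s. X s k)" by (rule AE_time_integrable[OF assms(1,3)]) (rule assms(4))
 moreover have "AEL k. set_integrable lborel {0..T} (%s. Y s k)" by (rule AE_time_integrable[OF assms(2,3)]) (rule assms(5))
 ultimately show ?thesis
proof eventually_elim
 case (elim k)
 then show ?case by (auto intro!: set_integral_diff(2) intro: set_integrable_subset)
qed
qed

context wave_params
begin

lemma apsolD:
 assumes "apsol T M \<eta> F V \<rho> \<sigma>"
 shows "jm F" "jm V" "jm \<rho>" "jm \<sigma>" "!!t. t \<in> {0..T} ==> hi \<beta> M (F t) (V t)"
  "!!t. t \<in> {0..T} ==> wint lw (\<rho> t) \<le> ennreal \<eta>" "!!t. t \<in> {0..T} ==> nsq (\<sigma> t) \<le> ennreal \<eta>"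
  "!!t. t \<in> {0..T} ==> AEL k. F t k = F 0 k + tint t (%s. V s k + \<rho> s k)"
  "!!t. t \<in> {0..T} ==> AEL k. V t k = V 0 k + tint t (%s. R (F s) (V s) k + \<sigma> s k)"
 using assms unfolding apsol_def by blast+

definition CS :: "real \<Rightarrow> real \<Rightarrow> real" where "CS T M = 2 * exp (2 * KS M * T) * (1 + 8 * T)"

text \<open>Energy identities for both differences, their sum bounded by
  \<open>energy_balance\<close>, and Gronwall. With residuals present it compares approximate
  solutions; without them it is uniqueness.\<close>

lemma stability:
 assumes a: "apsol T M \<eta> F V \<rho> \<sigma>" and a': "apsol T M \<eta> F' V' \<rho>' \<sigma>'" and M: "0 \<le> M" and \<eta>: "0 \<le> \<eta>" and t: "t \<in> {0..T}"
 shows "wint lw (%k. F t k - F' t k) + nsq (%k. V t k - V' t k)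
  \<le> ennreal (CS T M) * (wint lw (%k. F 0 k - F' 0 k) + nsq (%k. V 0 k - V' 0 k) + ennreal \<eta>)"
proof -
 have T: "0 \<le> T" and t0: "0 \<in> {0..T}" using t by auto
 note d = apsolD[OF a] and d' = apsolD[OF a']
 note j = d(1-4) d'(1-4) R_jm[OF d(1,2)] R_jm[OF d'(1,2)]
 note js[measurable] = j[THEN jm_section]
 have lwp: "!!k. 0 \<le> lw k" using lw_ge_1 by blast
 let ?C = "(2 + \<beta>) * M"
 have C0: "0 \<le> ?C" "0 \<le> CR M" using M \<beta> CR_nonneg by auto
 define GF where "GF s k = (V s k + \<rho> s k) - (V' s k + \<rho>' s k)" for s k
 define GV where "GV s k = (R (F s) (V s) k + \<sigma> s k) - (R (F' s) (V' s) k + \<sigma>' s k)" for s k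
 \<comment> \<open>The definition of \<open>apsol\<close> gives the integral equations almost
   everywhere for each time, while \<open>energy_identity\<close> needs them at every k. A and B are
   the differences redefined by the formula.\<close>
 define A where "A s k = (F 0 k - F' 0 k) + tint s (%r. GF r k)" for s k
 define B where "B s k = (V 0 k - V' 0 k) + tint s (%r. GV r k)" for s k
 have jX: "jm (%s k. V s k + \<rho> s k)" "jm (%s k. V' s k + \<rho>' s k)" "jm (%s k. R (F s) (V s) k + \<sigma> s k)" "jm (%s k. R (F' s) (V' s) k + \<sigma>' s k)"
  by (intro jm_arith j)+
 have jG: "jm GF" "jm GV" unfolding GF_def GV_def by (intro jm_arith j)+
 note jGs[measurable] = jG[THEN jm_section]
 have jAB: "jm A" "jm B"
 proof -
  note [measurable (raw)] = measurable_section2[OF jm_tint[OF jG(1)]] measurable_section2[OF jm_tint[OF jG(2)]]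
  show "jm A" "jm B" unfolding A_def B_def split_beta' by measurable
 qed
 note [measurable] = jAB[THEN jm_section]
 have wX: "wint lw (%k. V s k + \<rho> s k) \<le> ennreal (2 * ?C + 2 * \<eta>)" "wint lw (%k. V' s k + \<rho>' s k) \<le> ennreal (2 * ?C + 2 * \<eta>)" if s: "s \<in> {0..T}" for s
  by (rule wint_diff_bound(2), auto intro!: lwp hi_lw(2)[OF d(5)[OF s] M] hi_lw(2)[OF d'(5)[OF s] M] d(6)[OF s] d'(6)[OF s] C0 \<eta>)+
 have nX: "nsq (%k. R (F s) (V s) k + \<sigma> s k) \<le> ennreal (2 * CR M + 2 * \<eta>)" "nsq (%k. R (F' s) (V' s) k + \<sigma>' s k) \<le> ennreal (2 * CR M + 2 * \<eta>)" if s: "s \<in> {0..T}" for s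
  by (rule nsq_diff_bound(2), auto intro!: R_nsq[OF d(5)[OF s] M] R_nsq[OF d'(5)[OF s] M] d(7)[OF s] d'(7)[OF s] C0 \<eta>)+
 have wX1: "nsq (%k. V s k + \<rho> s k) \<le> ennreal (2 * ?C + 2 * \<eta>)" "nsq (%k. V' s k + \<rho>' s k) \<le> ennreal (2 * ?C + 2 * \<eta>)" if s: "s \<in> {0..T}" for s
  using wX[OF s] by (auto intro!: order_trans[OF nsq_le_wint[OF lw_ge_1(1)]])
 have tA: "AEL k. \<forall>s\<in>{0..T}. tint s (%r. (V r k + \<rho> r k) - (V' r k + \<rho>' r k)) = tint s (%r. V r k + \<rho> r k) - tint s (%r. V' r k + \<rho>' r k)"
  by (rule tint_diff_AE[OF jX(1,2) T]) (rule wX1, assumption)+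
 have tB: "AEL k. \<forall>s\<in>{0..T}. tint s (%r. (R (F r) (V r) k + \<sigma> r k) - (R (F' r) (V' r) k + \<sigma>' r k)) = tint s (%r. R (F r) (V r) k + \<sigma> r k) - tint s (%r. R (F' r) (V' r) k + \<sigma>' r k)"
  by (rule tint_diff_AE[OF jX(3,4) T]) (rule nX, assumption)+
 have AE: "AEL k. A s k = F s k - F' s k" "AEL k. B s k = V s k - V' s k" if s: "s \<in> {0..T}" for s
 proof -
  show "AEL k. A s k = F s k - F' s k"
   using tA d(8)[OF s] d'(8)[OF s] by eventually_elim (use s in \<open>simp add: A_def GF_def\<close>)
  show "AEL k. B s k = V s k - V' s k"
   using tB d(9)[OF s] d'(9)[OF s] by eventually_elim (use s in \<open>simp add: B_def GV_def\<close>)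
 qed
 \<comment> \<open>Crude common bounds: they only secure convergence and do not enter the final
   constant.\<close>
 let ?K1 = "4 * M + 8 * ?C + 8 * \<eta>" and ?K2 = "32 * M + 8 * CR M + 8 * \<eta>"
 have bA: "wint lw (A s) \<le> ennreal ?K1" "wint lw (GF s) \<le> ennreal ?K1" if s: "s \<in> {0..T}" for s
 proof -
  have "wint lw (A s) = wint lw (%k. F s k - F' s k)" by (rule wint_cong_AE[OF AE(1)[OF s]])
  also have "\<dots> \<le> ennreal (2 * M + 2 * M)" by (rule wint_diff_bound(1)) (auto intro!: lwp hi_lw(1)[OF d(5)[OF s] M] hi_lw(1)[OF d'(5)[OF s] M] M)
  also have "\<dots> \<le> ennreal ?K1" using C0 \<eta> by (intro ennreal_leI) auto
  finally show "wint lw (A s) \<le> ennreal ?K1" .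
  have "wint lw (GF s) \<le> ennreal (2 * (2 * ?C + 2 * \<eta>) + 2 * (2 * ?C + 2 * \<eta>))"
   unfolding GF_def[abs_def] by (rule wint_diff_bound(1)) (use wX[OF s] lwp C0 \<eta> in auto)
  also have "\<dots> \<le> ennreal ?K1" using M by (intro ennreal_leI) auto
  finally show "wint lw (GF s) \<le> ennreal ?K1" .
 qed
 have bB: "wint (%_. 1) (B s) \<le> ennreal ?K2" "wint (%_. 1) (GV s) \<le> ennreal ?K2" if s: "s \<in> {0..T}" for s
 proof -
  have "wint (%_. 1) (B s) = wint (%_. 1) (%k. V s k - V' s k)" by (rule wint_cong_AE[OF AE(2)[OF s]])
  also have "\<dots> \<le> ennreal (2 * (8 * M) + 2 * (8 * M))"
   by (rule wint_diff_bound(1)) (use hi_facts(8)[OF d(5)[OF s] \<beta> M] hi_facts(8)[OF d'(5)[OF s] \<beta> M] M in \<open>auto simp: nsq_def\<close>)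
  also have "\<dots> \<le> ennreal ?K2" using C0 \<eta> by (intro ennreal_leI) auto
  finally show "wint (%_. 1) (B s) \<le> ennreal ?K2" .
  have "wint (%_. 1) (GV s) \<le> ennreal (2 * (2 * CR M + 2 * \<eta>) + 2 * (2 * CR M + 2 * \<eta>))"
   unfolding GV_def[abs_def] by (rule wint_diff_bound(1)) (use nX[OF s] C0 \<eta> in \<open>auto simp: nsq_def\<close>)
  also have "\<dots> \<le> ennreal ?K2" using M by (intro ennreal_leI) auto
  finally show "wint (%_. 1) (GV s) \<le> ennreal ?K2" .
 qed
 have mI: "(%k. F 0 k - F' 0 k) \<in> bm" "(%k. V 0 k - V' 0 k) \<in> bm" by measurable
 have m1: "lw \<in> bm" "(%_. 1::real) \<in> bm" by measurable
 note EA = energy_identity[OF jG(1) mI(1) m1(1) lw_ge_1(1) A_def bA]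
 note EB = energy_identity[OF jG(2) mI(2) m1(2) order_refl B_def bB]
 define a where "a s = (LI k. lw k * (norm (A s k))\<^sup>2)" for s
 define b where "b s = (LI k. 1 * (norm (B s k))\<^sup>2)" for s
 define \<Phi>A where "\<Phi>A s = (LI k. lw k * Re (cnj (A s k) * GF s k))" for s
 define \<Phi>B where "\<Phi>B s = (LI k. 1 * Re (cnj (B s k) * GV s k))" for s
 have ea: "a s = a 0 + tint s (%r. 2 * \<Phi>A r)" "set_integrable lborel {0..s} \<Phi>A"
  and eb: "b s = b 0 + tint s (%r. 2 * \<Phi>B r)" "set_integrable lborel {0..s} \<Phi>B" if s: "s \<in> {0..T}" for s
  using EA(1,2)[OF _ _ s] EB(1,2)[OF _ _ s] unfolding a_def b_def \<Phi>A_def \<Phi>B_def by auto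
 have W: "wint lw (%k. F s k - F' s k) = ennreal (a s)" "nsq (%k. V s k - V' s k) = ennreal (b s)" "0 \<le> a s" "0 \<le> b s" if s: "s \<in> {0..T}" for s
 proof -
  have "wint lw (A s) < \<infinity>" "wint (%_. 1) (B s) < \<infinity>" using bA(1)[OF s] bB(1)[OF s] by (auto intro: le_less_trans)
  note fA = wint_real[OF _ _ lwp this(1)] and fB = wint_real[OF _ _ zero_le_one this(2)]
  show "wint lw (%k. F s k - F' s k) = ennreal (a s)" "0 \<le> a s"
   using fA wint_cong_AE[OF AE(1)[OF s], of lw] unfolding a_def by auto
  show "nsq (%k. V s k - V' s k) = ennreal (b s)" "0 \<le> b s"
   using fB wint_cong_AE[OF AE(2)[OF s], of "%_. 1"] unfolding b_def nsq_def by auto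
 qed
 \<comment> \<open>The difference of two residuals of size \<eta> has size 4 \<eta>, which
   \<open>energy_balance\<close> counts twice.\<close>
 have bal: "2 * \<Phi>A s + 2 * \<Phi>B s \<le> KS M * (a s + b s) + 8 * \<eta>" if s: "s \<in> {0..T}" for s
 proof -
  let ?r = "%k. \<rho> s k - \<rho>' s k" and ?r' = "%k. \<sigma> s k - \<sigma>' s k"
  let ?P = "%k. lw k * Re (cnj (F s k - F' s k) * (V s k - V' s k + ?r k))"
  let ?Q = "%k. Re (cnj (V s k - V' s k) * (R (F s) (V s) k - R (F' s) (V' s) k + ?r' k))"
  have GFe: "GF s k = V s k - V' s k + ?r k" "GV s k = R (F s) (V s) k - R (F' s) (V' s) k + ?r' k" for k by (simp_all add: GF_def GV_def)
  have aeP: "AEL k. lw k * Re (cnj (A s k) * GF s k) = ?P k" using AE(1)[OF s] by eventually_elim (simp only: GFe)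
  have aeQ: "AEL k. 1 * Re (cnj (B s k) * GV s k) = ?Q k" using AE(2)[OF s] by eventually_elim (simp only: GFe mult_1)
  have mPQ: "?P \<in> bm" "?Q \<in> bm" by measurable
  have iP: "intL ?P" "\<Phi>A s = (LI k. ?P k)"
   using EA(3)[OF _ _ t s] mPQ aeP unfolding \<Phi>A_def by (auto intro!: integral_cong_AE elim: integrable_cong_AE_imp)
  have iQ: "intL ?Q" "\<Phi>B s = (LI k. ?Q k)"
   using EB(3)[OF _ _ t s] mPQ aeQ unfolding \<Phi>B_def by (auto intro!: integral_cong_AE elim: integrable_cong_AE_imp)
  have eA: "a s = (LI k. lw k * (norm (F s k - F' s k))\<^sup>2)" unfolding a_def
   by (intro integral_cong_AE) (use AE(1)[OF s] in \<open>auto elim!: eventually_mono\<close>)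
  have eB: "b s = (LI k. (norm (V s k - V' s k))\<^sup>2)" unfolding b_def
   by (intro integral_cong_AE) (use AE(2)[OF s] in \<open>auto elim!: eventually_mono\<close>)
  have "wint lw ?r \<le> ennreal (2 * \<eta> + 2 * \<eta>)" by (rule wint_diff_bound(1)) (use d(6)[OF s] d'(6)[OF s] lwp \<eta> in auto)
  moreover have "nsq ?r' \<le> ennreal (2 * \<eta> + 2 * \<eta>)"
   by (rule nsq_diff_bound(1)) (use d(7)[OF s] d'(7)[OF s] \<eta> in auto)
  ultimately show ?thesis unfolding iP(2) iQ(2) eA eB
   using energy_balance[OF d(5)[OF s] d'(5)[OF s] M _ _ _ _ _ iP(1) iQ(1), of "4 * \<eta>"] \<eta> by simp
 qed
 have ms: "(%s. a s + b s) \<in> bm"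
 proof -
  note [measurable (raw)] = measurable_section2[OF jAB(1)] measurable_section2[OF jAB(2)]
  show ?thesis unfolding a_def b_def by measurable
 qed
 have up: "a s + b s \<le> ?K1 + ?K2" if s: "s \<in> {0..T}" for s
 proof -
  have "ennreal (a s) \<le> ennreal ?K1" "ennreal (b s) \<le> ennreal ?K2"
   using W[OF s] bA(1)[OF s] bB(1)[OF s] wint_cong_AE[OF AE(1)[OF s], of lw] wint_cong_AE[OF AE(2)[OF s], of "%_. 1"] by (auto simp: nsq_def)
  moreover have k: "0 \<le> ?K1" "0 \<le> ?K2" using M C0 \<eta> by auto
  ultimately show ?thesis unfolding ennreal_le_iff[OF k(1)] ennreal_le_iff[OF k(2)] by linarith
 qed
 have sd: "set_integrable lborel {0..T} (%s. a s + b s)"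
  unfolding set_integrable_def
 proof (rule LI_int_bound[of lborel "%s. indicator {0..T} s * (?K1 + ?K2)"])
  show "intL (%s. indicator {0..T} s * (?K1 + ?K2))" using T by (intro integrable_mult_left integrable_real_indicator) auto
  show "AEL s. norm (indicator {0..T} s *\<^sub>R (a s + b s)) \<le> norm (indicator {0..T} s * (?K1 + ?K2))"
   using up W(3,4) M C0 \<eta> by (intro AE_I2) (auto split: split_indicator)
 qed (use ms in auto)
 have main: "a s + b s \<le> (a 0 + b 0 + 8 * \<eta> * T) + tint s (%r. KS M * (a r + b r))" if s: "s \<in> {0..T}" for s
 proof -
  have si: "set_integrable lborel {0..s} (%r. a r + b r)" by (rule set_integrable_subset[OF sd]) (use s in auto)
  have c: "set_integrable lborel {0..s} (%r. 8 * \<eta>)" by (rule borel_integrable_atLeastAtMost') simp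
  have "a s + b s = a 0 + b 0 + tint s (%r. 2 * \<Phi>A r + 2 * \<Phi>B r)"
   using ea[OF s] eb[OF s] by (subst set_integral_add(2)) auto
  also have "tint s (%r. 2 * \<Phi>A r + 2 * \<Phi>B r) \<le> tint s (%r. KS M * (a r + b r) + 8 * \<eta>)"
   by (rule set_integral_mono) (use ea[OF s] eb[OF s] si c bal s in \<open>auto intro!: set_integral_add(1)\<close>)
  also have "\<dots> = tint s (%r. KS M * (a r + b r)) + tint s (%r. 8 * \<eta>)"
   using si c by (intro set_integral_add(2)) auto
  also have "tint s (%r. 8 * \<eta>) = s * (8 * \<eta>)" using s by (simp add: set_lebesgue_integral_def)
  also have "s * (8 * \<eta>) \<le> T * (8 * \<eta>)" by (rule mult_right_mono) (use s \<eta> in auto)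
  finally show ?thesis by (simp add: mult.commute mult.left_commute)
 qed
 have "a t + b t \<le> 2 * exp (2 * KS M * T) * (a 0 + b 0 + 8 * \<eta> * T)"
  by (rule gronwall[OF KS_pos[OF M] sd _ main _ t]) (use up W[OF t0] W(3,4) \<eta> T in auto)
 also have "\<dots> \<le> CS T M * (a 0 + b 0 + \<eta>)"
 proof -
  have "8 * \<eta> * T + 0 \<le> 8 * T * (a 0 + b 0 + \<eta>) + \<eta>" using W[OF t0] \<eta> T by (intro add_mono) (auto simp: ac_simps intro!: mult_left_mono)
  then have "a 0 + b 0 + 8 * \<eta> * T \<le> (1 + 8 * T) * (a 0 + b 0 + \<eta>)" by (simp add: algebra_simps)
  then show ?thesis unfolding CS_def mult.assoc by (intro mult_left_mono) auto
 qed
 finally have "ennreal (a t + b t) \<le> ennreal (CS T M * (a 0 + b 0 + \<eta>))" by (rule ennreal_leI)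
 moreover have "0 \<le> CS T M" using T by (simp add: CS_def)
 ultimately show ?thesis using W[OF t] W[OF t0] \<eta> by (simp add: ennreal_plus ennreal_mult')
qed

end

section \<open>Approximate solutions\<close>

text \<open>The integrand is frozen at the left grid point, and its integral is the polygon with
  vertices x j. This makes an Euler polygon an exact solution of an integrated equation with delayed
  arguments.\<close>

lemma piecewise_linear_tint:
 fixes x y :: "nat \<Rightarrow> complex"
 assumes h: "0 < h" and step: "!!j. x (Suc j) = x j + cr h * y j"
 shows "real j * h \<le> t ==> t \<le> real (Suc j) * h ==>
  set_integrable lborel {0..t} (%s. y (nat \<lfloor>s / h\<rfloor>)) \<and> tint t (%s. y (nat \<lfloor>s / h\<rfloor>)) = x j - x 0 + cr (t - real j * h) * y j"
proof (induction j arbitrary: t)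
 have fl: "nat \<lfloor>s / h\<rfloor> = j" if "real j * h \<le> s" "s < real (Suc j) * h" for j s
 proof -
  have "\<lfloor>s / h\<rfloor> = int j" by (rule floor_unique) (use that h in \<open>auto simp: field_simps\<close>)
  then show ?thesis by simp
 qed
 have piece: "set_integrable lborel {real j * h<..t} (%s. y (nat \<lfloor>s / h\<rfloor>)) \<and>
   (LINT s:{real j * h<..t}|lborel. y (nat \<lfloor>s / h\<rfloor>)) = cr (t - real j * h) * y j"
  if t: "real j * h \<le> t" "t \<le> real (Suc j) * h" for j t
 proof -
  \<comment> \<open>At the right end of the cell the floor has already jumped to j + 1; this is a
    single point.\<close>
  have ae: "AEL s. indicator {real j * h<..t} s *\<^sub>R y (nat \<lfloor>s / h\<rfloor>) = indicator {real j * h<..t} s *\<^sub>R y j"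
   using AE_lborel_singleton[of "real (Suc j) * h"] by eventually_elim (use fl[of j] t in \<open>auto split: split_indicator simp del: of_nat_Suc\<close>)
  have i: "intL (%s. indicator {real j * h<..t} s *\<^sub>R y j)"
   using t by (intro integrable_scaleR_left integrable_real_indicator) auto
  have m: "(%s. indicator {real j * h<..t} s *\<^sub>R y (nat \<lfloor>s / h\<rfloor>)) \<in> borel_measurable lborel" by measurable
  have "intL (%s. indicator {real j * h<..t} s *\<^sub>R y (nat \<lfloor>s / h\<rfloor>))"
   using integrable_cong_AE[OF m _ ae] i by auto
  moreover have "(LI s. indicator {real j * h<..t} s *\<^sub>R y (nat \<lfloor>s / h\<rfloor>)) = (LI s. indicator {real j * h<..t} s *\<^sub>R y j)"
   using i by (intro integral_cong_AE[OF m _ ae]) auto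
  ultimately show ?thesis using t by (simp add: set_integrable_def set_lebesgue_integral_def scaleR_conv_of_real)
 qed
 have glue: "set_integrable lborel {0..t} f \<and> tint t f = tint a f + (LINT s:{a<..t}|lborel. f s)"
  if "0 \<le> a" "a \<le> t" "set_integrable lborel {0..a} f" "set_integrable lborel {a<..t} f" for a t and f :: cfun
 proof -
  have e: "{0..t} = {0..a} \<union> {a<..t}" using that by auto
  show ?thesis unfolding e using that by (auto intro!: set_integrable_Un set_integral_Un)
 qed
 {
  case 0
  have "set_integrable lborel {0..0} (%s. y (nat \<lfloor>s / h\<rfloor>))"
   unfolding set_integrable_def
  proof (rule integrable_cong_AE_imp[of _ "%_. 0"])
   show "AEL s. (0::complex) = indicator {0..0} s *\<^sub>R y (nat \<lfloor>s / h\<rfloor>)"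
    using AE_lborel_singleton[of "0::real"] by eventually_elim auto
  qed auto
  moreover have "tint 0 (%s. y (nat \<lfloor>s / h\<rfloor>)) = 0" by (rule tint_0)
  ultimately show ?case using glue[of 0 t "%s. y (nat \<lfloor>s / h\<rfloor>)"] piece[of 0 t] 0 by (simp del: atLeastAtMost_singleton)
 next
  case (Suc j)
  have a: "real j * h \<le> real (Suc j) * h" "0 \<le> real (Suc j) * h" using h by auto
  note IH = Suc.IH[OF a(1) order_refl]
  show ?case using glue[OF a(2) Suc.prems(1)] IH piece[OF Suc.prems] by (simp add: step algebra_simps)
 }
qed

abbreviation cut :: "real \<Rightarrow> cfun \<Rightarrow> real \<Rightarrow> complex" where "cut N G \<equiv> (%k. if \<bar>k\<bar> \<le> N then G k else 0)"

lemma cut_measurable: "G \<in> bm ==> cut N G \<in> bm"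
proof -
 assume [measurable]: "G \<in> bm"
 show ?thesis by measurable
qed

lemma wint_cut_le:
 assumes "!!k. 0 \<le> w k" "!!k. \<bar>k\<bar> \<le> N ==> w k \<le> c * w' k" "0 \<le> c" "G \<in> bm" "w' \<in> bm" "!!k. 0 \<le> w' k"
 shows "wint w (cut N G) \<le> ennreal c * wint w' G"
proof -
 have "wint w (cut N G) \<le> wint (%k. c * w' k) G"
  by (intro nn_integral_mono ennreal_leI) (use assms in \<open>auto intro!: mult_right_mono\<close>)
 also have "\<dots> = ennreal c * wint w' G" using assms by (intro wint_cmult) auto
 finally show ?thesis .
qed

lemma lam_mono: "\<beta> > 0 ==> \<bar>k\<bar> \<le> N ==> lam \<beta> k \<le> lam \<beta> N"
 unfolding lam_def by (intro add_mono mult_left_mono power_mono) auto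

lemma wt_mono: "\<bar>k\<bar> \<le> N ==> wt k \<le> wt N"
 unfolding wt_def using power_mono[of "\<bar>k\<bar>" N 6] by simp

lemma R_cong_hermitian:
 assumes "!!k. F (- k) = cnj (F k)" "!!k. V (- k) = cnj (V k)"
 shows "Rf \<epsilon> \<alpha> \<beta> F V (- k) = cnj (Rf \<epsilon> \<alpha> \<beta> F V k)"
proof -
 have "Qf F V (- k) = cnj (Qf F V k)" by (rule Qf_hermitian) (rule assms)+
 then show ?thesis using assms by (simp add: Rf_def)
qed

section \<open>Euler polygons of the truncated system\<close>

context wave_params
begin

text \<open>The growth rate of the energy: twice the bound for the linear term of an Euler step,
  plus 1 to pay for the term quadratic in the step length. The constant \<open>CN\<close> bounds the
  energy of the increment (V, R) cut to frequencies up to N.\<close>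

definition K1 :: "real \<Rightarrow> real" where "K1 M = 2 * (\<epsilon> * KQ \<beta> M + 8 * M) + 1"
definition CN :: "real \<Rightarrow> real \<Rightarrow> real" where "CN N M = wt N * CR M + (wt N * lam \<beta> N + 1) * (8 * M)"

lemma K1_pos: "0 \<le> M ==> 1 \<le> K1 M"
 unfolding K1_def using KQ_nonneg[OF \<beta>] \<epsilon> by simp

lemma edens_integral:
 assumes "hi \<beta> M F V" "0 \<le> M"
 shows "intL (edens \<beta> F V)" "(NN k. ennreal (edens \<beta> F V k)) = ennreal (LI k. edens \<beta> F V k)"
proof -
 have m: "edens \<beta> F V \<in> bm" using assms by (auto simp: hi_def intro: edens_measurable)
 show i: "intL (edens \<beta> F V)"
  using m assms edens_nonneg[OF \<beta>, of F V] by (intro integrableI_bounded) (auto simp: hi_def intro: le_less_trans)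
 show "(NN k. ennreal (edens \<beta> F V k)) = ennreal (LI k. edens \<beta> F V k)"
  by (rule nn_integral_eq_integral[OF i]) (auto intro: edens_nonneg[OF \<beta>])
qed

text \<open>The density is a quadratic form, so after a step of length \<tau> it is exactly the old
  one plus 2 \<tau> b + \<tau>^2 c. In b all unbounded contributions cancel or are covered by
  \<open>high_energy_estimate\<close>; c grows with N, but \<tau> \<open>CN\<close> \<le> 1 reduces
  it to \<tau>.\<close>

lemma euler_step_energy:
 assumes h: "hi \<beta> M F V" and M: "0 \<le> M" and N: "0 \<le> N" and sF: "!!k. \<bar>k\<bar> > N ==> F k = 0" and sV: "!!k. \<bar>k\<bar> > N ==> V k = 0"
  and E: "(NN k. ennreal (edens \<beta> F V k)) \<le> ennreal E" "0 \<le> E" and \<tau>: "0 \<le> \<tau>" "\<tau> * CN N M \<le> 1"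
 shows "(NN k. ennreal (edens \<beta> (%k. F k + cr \<tau> * V k) (%k. V k + cr \<tau> * cut N (R F V) k) k))
  \<le> ennreal (E + \<tau> * K1 M)"
proof -
 note hf = hi_facts[OF h \<beta> M]
 have [measurable]: "F \<in> bm" "V \<in> bm" by (rule hf)+
 let ?R = "cut N (R F V)"
 have [measurable]: "?R \<in> bm" by measurable
 \<comment> \<open>What is left of the linear term: the products with weight wt lam cancel and the
   \<alpha> term is imaginary. The last summand comes from the extra |F|^2 in the energy.\<close>
 define b where "b k = \<epsilon> * Re (cr (wt k) * (cnj (V k) * Qf F V k)) + Re (cnj (F k) * V k)" for k
 note high = high_energy_estimate[OF h \<beta> M sV]
 have iFV: "intL (%k. cnj (F k) * V k)" by (intro integrable_L2_mult) (use hf in \<open>auto simp: nsq_def intro: le_less_trans\<close>)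
 have i1: "intL (%k. cr (wt k) * (cnj (V k) * Qf F V k))" by (rule high(1))
 have ib: "intL b" unfolding b_def[abs_def]
  by (intro LI_int_add integrable_mult_right integrable_Re high(1) iFV)
 have "(LI k. b k) = \<epsilon> * Re (LI k. cr (wt k) * (cnj (V k) * Qf F V k)) + Re (LI k. cnj (F k) * V k)"
 proof -
  have 1: "intL (%k. \<epsilon> * Re (cr (wt k) * (cnj (V k) * Qf F V k)))" "intL (%k. Re (cnj (F k) * V k))"
   by (intro integrable_mult_right integrable_Re i1, rule integrable_Re[OF iFV])
  show ?thesis unfolding b_def LI_add[OF 1] integral_mult_right_zero integral_Re[OF i1] integral_Re[OF iFV] ..
 qed
 also have "\<dots> \<le> \<epsilon> * KQ \<beta> M + 8 * M"
 proof (intro add_mono mult_left_mono)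
  show "Re (LI k. cr (wt k) * (cnj (V k) * Qf F V k)) \<le> KQ \<beta> M"
   using high(2) complex_Re_le_cmod order_trans by blast
  have "(ennreal (norm (LI k. cnj (F k) * V k)))\<^sup>2 \<le> (NN k. ennreal (norm (cnj (F k) * V k)))\<^sup>2"
   by (intro power_mono norm_integral_le_nn) auto
  also have "\<dots> \<le> nsq (%k. cnj (F k)) * nsq V" by (rule nsq_pair) auto
  also have "\<dots> \<le> ennreal (8 * M) * ennreal (8 * M)" using hf(7,8) by (intro mult_mono) (auto simp: nsq_def)
  also have "\<dots> = ennreal ((8 * M)\<^sup>2)" unfolding power2_eq_square by (rule ennreal_mult[symmetric]) (use M in auto)
  finally have "(norm (LI k. cnj (F k) * V k))\<^sup>2 \<le> (8 * M)\<^sup>2"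
   using M by (simp add: ennreal_power ennreal_le_iff)
  then have "norm (LI k. cnj (F k) * V k) \<le> 8 * M" by (rule power2_le_imp_le) (use M in simp)
  then show "Re (LI k. cnj (F k) * V k) \<le> 8 * M" using complex_Re_le_cmod order_trans by blast
 qed (use \<epsilon> in auto)
 finally have bb: "(LI k. b k) \<le> \<epsilon> * KQ \<beta> M + 8 * M" .
 \<comment> \<open>The same density evaluated at the increment, with V in the place of F.\<close>
 define c where "c k = edens \<beta> V ?R k" for k
 have c0: "0 \<le> c k" for k unfolding c_def by (rule edens_nonneg[OF \<beta>])
 have cle: "(NN k. ennreal (c k)) \<le> ennreal (CN N M)"
 proof -
  have "(NN k. ennreal (c k)) \<le> (NN k. ennreal (wt N) * ennreal ((norm (R F V k))\<^sup>2) + ennreal (wt N * lam \<beta> N + 1) * ennreal ((norm (V k))\<^sup>2))"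
  proof (rule nn_integral_mono)
   fix k
   have "c k \<le> wt N * (norm (R F V k))\<^sup>2 + (wt N * lam \<beta> N + 1) * (norm (V k))\<^sup>2"
   proof (cases "\<bar>k\<bar> \<le> N")
    case True
    have "wt k * lam \<beta> k \<le> wt N * lam \<beta> N" using True wt_mono lam_mono[OF \<beta>] \<beta> by (intro mult_mono) auto
    moreover have "c k = wt k * (norm (R F V k))\<^sup>2 + (wt k * lam \<beta> k + 1) * (norm (V k))\<^sup>2" using True by (simp add: c_def edens_def algebra_simps)
    ultimately show ?thesis using True wt_mono by (auto intro!: add_mono mult_right_mono)
   next
    case False
    then show ?thesis using sV \<beta> by (simp add: c_def edens_def)
   qed
   then show "ennreal (c k) \<le> ennreal (wt N) * ennreal ((norm (R F V k))\<^sup>2) + ennreal (wt N * lam \<beta> N + 1) * ennreal ((norm (V k))\<^sup>2)"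
    using \<beta> by (subst ennreal_lin2) (rule ennreal_leI | simp)+
  qed
  also have "\<dots> = ennreal (wt N) * nsq (R F V) + ennreal (wt N * lam \<beta> N + 1) * nsq V" by (simp add: nsq_def nn_integral_add nn_integral_cmult)
  also have "\<dots> \<le> ennreal (wt N) * ennreal (CR M) + ennreal (wt N * lam \<beta> N + 1) * ennreal (8 * M)"
   by (intro add_mono mult_left_mono R_nsq[OF h M] hf) auto
  also have "\<dots> = ennreal (CN N M)" using \<beta> M CR_nonneg[OF M] by (subst ennreal_lin2) (auto simp: CN_def)
  finally show ?thesis .
 qed
 have [measurable]: "c \<in> bm" unfolding c_def[abs_def] by measurable
 have ic: "intL c" using cle c0 by (intro integrableI_bounded) (auto intro: le_less_trans)
 have CN0: "0 \<le> CN N M" unfolding CN_def using \<beta> M CR_nonneg[OF M] by auto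
 have ccle: "(LI k. c k) \<le> CN N M"
  using cle nn_integral_eq_integral[OF ic] c0 CN0 by (simp add: ennreal_le_iff)
 note ie = edens_integral[OF h M]
 have eE: "(LI k. edens \<beta> F V k) \<le> E" using E unfolding ie(2) by (simp add: ennreal_le_iff)
 have pt: "edens \<beta> (%k. F k + cr \<tau> * V k) (%k. V k + cr \<tau> * ?R k) k = edens \<beta> F V k + 2 * \<tau> * b k + \<tau>\<^sup>2 * c k" for k
 proof (cases "\<bar>k\<bar> \<le> N")
  case True
  have n2: "(norm (x + cr \<tau> * y))\<^sup>2 = (norm x)\<^sup>2 + 2 * \<tau> * Re (cnj x * y) + \<tau>\<^sup>2 * (norm y)\<^sup>2" for x y
   unfolding cmod_power2 by (simp add: power2_eq_square algebra_simps)
  have RR: "Re (cnj (V k) * R F V k) = - lam \<beta> k * Re (cnj (F k) * V k) + \<epsilon> * Re (cnj (V k) * Qf F V k)"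
   unfolding Rf_def by (simp add: algebra_simps)
  show ?thesis using True
   by (simp add: edens_def c_def b_def n2 RR algebra_simps del: times_complex.sel complex_cnj) (simp add: algebra_simps)
 next
  case False
  then show ?thesis using sF sV by (simp add: edens_def c_def b_def)
 qed
 have "(NN k. ennreal (edens \<beta> (%k. F k + cr \<tau> * V k) (%k. V k + cr \<tau> * ?R k) k))
  = ennreal (LI k. edens \<beta> F V k + 2 * \<tau> * b k + \<tau>\<^sup>2 * c k)"
 proof -
  have "0 \<le> edens \<beta> F V k + 2 * \<tau> * b k + \<tau>\<^sup>2 * c k" for k unfolding pt[symmetric] by (rule edens_nonneg[OF \<beta>])
  then show ?thesis unfolding pt by (intro nn_integral_eq_integral) (use ie ib ic in auto)
 qed
 also have "(LI k. edens \<beta> F V k + 2 * \<tau> * b k + \<tau>\<^sup>2 * c k) = (LI k. edens \<beta> F V k) + 2 * \<tau> * (LI k. b k) + \<tau>\<^sup>2 * (LI k. c k)"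
  using ie ib ic by simp
 also have "\<dots> \<le> E + 2 * \<tau> * (\<epsilon> * KQ \<beta> M + 8 * M) + \<tau>\<^sup>2 * CN N M"
  using \<tau> by (intro add_mono mult_left_mono eE bb ccle) auto
 also have "\<tau>\<^sup>2 * CN N M \<le> \<tau>" using mult_left_mono[OF \<tau>(2) \<tau>(1)] by (simp add: power2_eq_square mult.assoc)
 finally show ?thesis by (auto simp: K1_def algebra_simps intro: ennreal_leI)
qed

text \<open>Euler steps of length \<open>h\<close> for the system truncated to \<open>|k| \<le> N\<close>. The term quadratic in the step length, of size
 \<open>CN N M\<close>, is absorbed by choosing \<open>h\<close> small depending on \<open>N\<close>; the linear one is independent of \<open>N\<close>.\<close>

primrec eul :: "real \<Rightarrow> real \<Rightarrow> cfun \<Rightarrow> cfun \<Rightarrow> nat \<Rightarrow> cfun \<times> cfun"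
 where "eul N h F0 V0 0 = (cut N F0, cut N V0)"
 | "eul N h F0 V0 (Suc j) = (let (F, V) = eul N h F0 V0 j in
   (%k. F k + cr h * V k, %k. V k + cr h * cut N (R F V) k))"

lemma edens_cut_le: "edens \<beta> (cut N F) (cut N V) k \<le> edens \<beta> F V k"
 using edens_nonneg[OF \<beta>, of F V k] by (auto simp: edens_def)

text \<open>The time T is what an energy growing at rate K1 takes to rise from M0 by 1. The rate is
  the one valid up to M0 + 1, so the bound and the estimate that proves it support each
  other.\<close>

context
 fixes N h M0 T :: real and F0 V0 :: cfun
 assumes m0: "F0 \<in> bm" "V0 \<in> bm"
  and h0: "!!k. F0 (- k) = cnj (F0 k)" "!!k. V0 (- k) = cnj (V0 k)"
  and E0: "(NN k. ennreal (edens \<beta> F0 V0 k)) \<le> ennreal M0" and M0: "0 \<le> M0"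
  and N: "1 \<le> N" and h: "0 < h" "h * CN N (M0 + 1) \<le> 1" and T: "T = 1 / K1 (M0 + 1)"
begin

abbreviation "U \<equiv> eul N h F0 V0"
abbreviation "Fe j \<equiv> fst (U j)"
abbreviation "Ve j \<equiv> snd (U j)"

lemma eul_basic: "Fe j \<in> bm" "Ve j \<in> bm" "Fe j (- k) = cnj (Fe j k)" "Ve j (- k) = cnj (Ve j k)"
 "\<bar>k\<bar> > N ==> Fe j k = 0" "\<bar>k\<bar> > N ==> Ve j k = 0"
proof -
 have "Fe j \<in> bm \<and> Ve j \<in> bm \<and> (\<forall>k. Fe j (- k) = cnj (Fe j k)) \<and> (\<forall>k. Ve j (- k) = cnj (Ve j k))
  \<and> (\<forall>k. \<bar>k\<bar> > N \<longrightarrow> Fe j k = 0 \<and> Ve j k = 0)"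
 proof (induction j)
  case 0 then show ?case using m0 h0 by auto
 next
  case (Suc j)
  then have [measurable]: "Fe j \<in> bm" "Ve j \<in> bm"
   and s: "!!k. Fe j (- k) = cnj (Fe j k)" "!!k. Ve j (- k) = cnj (Ve j k)" by auto
  have "R (Fe j) (Ve j) (- k) = cnj (R (Fe j) (Ve j) k)" for k by (rule R_cong_hermitian) (rule s)+
  then show ?case using Suc s by (auto simp: Let_def split_beta)
 qed
 then show "Fe j \<in> bm" "Ve j \<in> bm" "Fe j (- k) = cnj (Fe j k)" "Ve j (- k) = cnj (Ve j k)"
  "\<bar>k\<bar> > N ==> Fe j k = 0" "\<bar>k\<bar> > N ==> Ve j k = 0" by auto
qed

abbreviation "Re_e j \<equiv> cut N (R (Fe j) (Ve j))"
definition "idx s = nat \<lfloor>s / h\<rfloor>"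
text \<open>Linear interpolation between grid points. An intermediate value is itself an Euler step
  of shorter length from the left grid point, so \<open>euler_step_energy\<close> covers it as
  well.\<close>

definition "Fi t k = Fe (idx t) k + cr (t - real (idx t) * h) * Ve (idx t) k"
definition "Vi t k = Ve (idx t) k + cr (t - real (idx t) * h) * Re_e (idx t) k"

lemma M1: "0 \<le> M0 + 1" using M0 by simp
lemma TK: "0 < T" "T * K1 (M0 + 1) = 1" using K1_pos[OF M1] by (auto simp: T)

lemma idx_bounds: "0 \<le> t ==> real (idx t) * h \<le> t \<and> t \<le> real (Suc (idx t)) * h"
proof -
 assume t: "0 \<le> t"
 have f: "0 \<le> \<lfloor>t / h\<rfloor>" using t h by simp
 have "of_int \<lfloor>t / h\<rfloor> \<le> t / h" "t / h \<le> of_int \<lfloor>t / h\<rfloor> + 1" by linarith+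
 then have "of_int \<lfloor>t / h\<rfloor> * h \<le> t" "t \<le> (of_int \<lfloor>t / h\<rfloor> + 1) * h" unfolding pos_le_divide_eq[OF h(1)] pos_divide_le_eq[OF h(1)] by auto
 then show ?thesis using f by (simp add: idx_def add.commute)
qed

text \<open>Before time T the bound of the previous step is at most M0 + 1, hence the constants for
  M0 + 1 apply to the next one.\<close>

lemma eul_energy: "real j * h \<le> T ==> (NN k. ennreal (edens \<beta> (Fe j) (Ve j) k)) \<le> ennreal (M0 + real j * h * K1 (M0 + 1))"
proof (induction j)
 case 0
 have "(NN k. ennreal (edens \<beta> (Fe 0) (Ve 0) k)) \<le> (NN k. ennreal (edens \<beta> F0 V0 k))"
  using edens_cut_le[of N F0 V0] by (auto intro!: nn_integral_mono ennreal_leI)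
 then show ?case using E0 by auto
next
 case (Suc j)
 let ?E = "M0 + real j * h * K1 (M0 + 1)"
 have j: "real j * h \<le> T" using Suc.prems h by (simp add: distrib_right)
 have "real j * h * K1 (M0 + 1) \<le> T * K1 (M0 + 1)" using j K1_pos[OF M1] by (intro mult_right_mono) auto
 then have E: "?E \<le> M0 + 1" "0 \<le> ?E" using TK K1_pos[OF M1] M0 h by auto
 have hi: "hi \<beta> (M0 + 1) (Fe j) (Ve j)" unfolding hi_def using eul_basic order_trans[OF Suc.IH[OF j] ennreal_leI[OF E(1)]] by auto
 have "(NN k. ennreal (edens \<beta> (Fe (Suc j)) (Ve (Suc j)) k)) \<le> ennreal (?E + h * K1 (M0 + 1))"
  using euler_step_energy[OF hi M1 _ _ _ Suc.IH[OF j] E(2) _ h(2)] N h eul_basic by (simp add: Let_def split_beta)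
 then show ?case by (simp add: algebra_simps)
qed

lemma eul_hi: "real j * h \<le> T ==> hi \<beta> (M0 + 1) (Fe j) (Ve j)"
proof -
 assume j: "real j * h \<le> T"
 have "real j * h * K1 (M0 + 1) \<le> T * K1 (M0 + 1)" using j K1_pos[OF M1] by (intro mult_right_mono) auto
 then have "M0 + real j * h * K1 (M0 + 1) \<le> M0 + 1" using TK by simp
 then show ?thesis unfolding hi_def using eul_basic order_trans[OF eul_energy[OF j] ennreal_leI] by auto
qed

lemma eul_herm: "Fi t (- k) = cnj (Fi t k)" "Vi t (- k) = cnj (Vi t k)"
proof -
 have "R (Fe (idx t)) (Ve (idx t)) (- k) = cnj (R (Fe (idx t)) (Ve (idx t)) k)" by (rule R_cong_hermitian) (rule eul_basic)+
 then show "Fi t (- k) = cnj (Fi t k)" "Vi t (- k) = cnj (Vi t k)" by (auto simp: Fi_def Vi_def eul_basic)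
qed

lemma eul_hi_t:
 assumes t: "t \<in> {0..T}"
 shows "hi \<beta> (M0 + 1) (Fi t) (Vi t)"
proof -
 let ?j = "idx t" and ?\<tau> = "t - real (idx t) * h"
 have b: "real ?j * h \<le> t" "t \<le> real (Suc ?j) * h" using idx_bounds[of t] t by auto
 have \<tau>: "0 \<le> ?\<tau>" "?\<tau> \<le> h" using b by (auto simp: distrib_right)
 have j: "real ?j * h \<le> T" using b t by auto
 have CN0: "0 \<le> CN N (M0 + 1)" unfolding CN_def using \<beta> M1 CR_nonneg[OF M1] by (intro add_nonneg_nonneg mult_nonneg_nonneg) (use M0 in auto)
 have "?\<tau> * CN N (M0 + 1) \<le> h * CN N (M0 + 1)" using \<tau> CN0 by (intro mult_right_mono)
 then have \<tau>2: "?\<tau> * CN N (M0 + 1) \<le> 1" using h by linarith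
 have E: "0 \<le> M0 + real ?j * h * K1 (M0 + 1)" using M0 h K1_pos[OF M1] by simp
 have "(NN k. ennreal (edens \<beta> (Fi t) (Vi t) k)) \<le> ennreal (M0 + real ?j * h * K1 (M0 + 1) + ?\<tau> * K1 (M0 + 1))"
  unfolding Fi_def[abs_def] Vi_def[abs_def]
  by (rule euler_step_energy[OF eul_hi[OF j] M1 _ _ _ eul_energy[OF j] E \<tau>(1) \<tau>2]) (use N eul_basic in auto)
 also have "M0 + real ?j * h * K1 (M0 + 1) + ?\<tau> * K1 (M0 + 1) = M0 + t * K1 (M0 + 1)" by (simp add: algebra_simps)
 also have "ennreal \<dots> \<le> ennreal (M0 + 1)"
 proof (rule ennreal_leI)
  have "t * K1 (M0 + 1) \<le> T * K1 (M0 + 1)" using t K1_pos[OF M1] by (intro mult_right_mono) auto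
  then show "M0 + t * K1 (M0 + 1) \<le> M0 + 1" using TK by simp
 qed
 finally have "(NN k. ennreal (edens \<beta> (Fi t) (Vi t) k)) \<le> ennreal (M0 + 1)" .
 moreover have m[measurable]: "Fe ?j \<in> bm" "Ve ?j \<in> bm" by (rule eul_basic)+
 have "Fi t \<in> bm" "Vi t \<in> bm" unfolding Fi_def[abs_def] Vi_def[abs_def] by measurable
 ultimately show ?thesis unfolding hi_def using eul_herm by auto
qed

text \<open>The polygon solves the integrated system with arguments frozen at the last grid point;
  the difference between frozen and current arguments becomes the residual of
  \<open>apsol\<close>.\<close>

lemma eul_tint: "0 \<le> t ==> Fi t k = Fi 0 k + tint t (%s. Ve (idx s) k)" "0 \<le> t ==> Vi t k = Vi 0 k + tint t (%s. Re_e (idx s) k)"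
proof -
 assume t: "0 \<le> t"
 have i0: "idx 0 = 0" by (simp add: idx_def)
 note b = idx_bounds[OF t]
 have 1: "tint t (%s. Ve (idx s) k) = Fe (idx t) k - Fe 0 k + cr (t - real (idx t) * h) * Ve (idx t) k"
  using piecewise_linear_tint[OF h(1), of "%j. Fe j k" "%j. Ve j k" "idx t" t] b unfolding idx_def by (simp add: Let_def split_beta)
 have 2: "tint t (%s. Re_e (idx s) k) = Ve (idx t) k - Ve 0 k + cr (t - real (idx t) * h) * Re_e (idx t) k"
  using piecewise_linear_tint[OF h(1), of "%j. Ve j k" "%j. Re_e j k" "idx t" t] b unfolding idx_def by (simp add: Let_def split_beta)
 show "Fi t k = Fi 0 k + tint t (%s. Ve (idx s) k)" unfolding 1 by (simp add: Fi_def i0)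
 show "Vi t k = Vi 0 k + tint t (%s. Re_e (idx s) k)" unfolding 2 by (simp add: Vi_def i0)
qed

lemma eul_jm: "jm Fi" "jm Vi" "jm (%s. Ve (idx s))" "jm (%s. Re_e (idx s))"
proof -
 have [measurable]: "idx \<in> borel \<rightarrow>\<^sub>M count_space UNIV" unfolding idx_def[abs_def] by measurable
 have c: "jm (%t. X (idx t))" if [measurable]: "!!j. X j \<in> bm" for X :: "nat \<Rightarrow> real \<Rightarrow> complex"
 proof -
  have "(%p. X (idx (fst p)) (snd p)) \<in> bm2"
   by (rule measurable_compose_countable[of "%j p. X j (snd p)" _ _ "%p. idx (fst p)"]) measurable
  then show ?thesis by (simp add: split_beta')
 qed
 have mR: "Re_e j \<in> bm" for j
  by (intro cut_measurable R_measurable eul_basic)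
 note j = c[OF eul_basic(1)] c[OF eul_basic(2)] c[of Re_e, OF mR]
 show "jm (%s. Ve (idx s))" "jm (%s. Re_e (idx s))" by (rule j)+
 note [measurable] = j
 have [measurable]: "(%t. cr (t - real (idx t) * h)) \<in> bm" by measurable
 show "jm Fi" "jm Vi" unfolding Fi_def[abs_def] Vi_def[abs_def] using j unfolding split_beta' by measurable
qed

end

end

lemma wint_real_mult_le:
 fixes f :: cfun
 assumes [measurable]: "f \<in> bm" "w \<in> bm" and "\<bar>\<tau>\<bar> \<le> h" "!!k. 0 \<le> w k"
 shows "wint w (%k. cr \<tau> * f k) \<le> ennreal (h\<^sup>2) * wint w f"
proof -
 have "wint w (%k. cr \<tau> * f k) \<le> wint (%k. h\<^sup>2 * w k) f"
 proof (intro nn_integral_mono ennreal_leI)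
  fix k
  have "\<tau>\<^sup>2 \<le> h\<^sup>2" using assms(3) by (rule abs_le_square_iff[THEN iffD1, OF order_trans[OF _ abs_ge_self]])
  then have "\<tau>\<^sup>2 * (w k * (norm (f k))\<^sup>2) \<le> h\<^sup>2 * (w k * (norm (f k))\<^sup>2)" using assms by (intro mult_right_mono) auto
  then show "w k * (norm (cr \<tau> * f k))\<^sup>2 \<le> h\<^sup>2 * w k * (norm (f k))\<^sup>2"
   by (simp add: norm_mult power_mult_distrib mult_ac)
 qed
 also have "\<dots> = ennreal (h\<^sup>2) * wint w f" by (rule wint_cmult) auto
 finally show ?thesis .
qed

lemma nsq_cut_const: "0 \<le> c ==> 0 \<le> N ==> (!!k. \<bar>k\<bar> \<le> N ==> ennreal ((norm (G k))\<^sup>2) \<le> ennreal c) ==> nsq (cut N G) \<le> ennreal (2 * N * c)"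
proof -
 assume a: "0 \<le> c" "0 \<le> N" "!!k. \<bar>k\<bar> \<le> N ==> ennreal ((norm (G k))\<^sup>2) \<le> ennreal c"
 have "nsq (cut N G) \<le> (NN k. ennreal c * indicator {-N..N} k)"
  unfolding nsq_def by (intro nn_integral_mono) (use a(3) in \<open>auto split: split_indicator\<close>)
 also have "\<dots> = ennreal (2 * N * c)" using a by (simp add: nn_integral_cmult ennreal_mult[symmetric] mult.commute)
 finally show ?thesis .
qed

context wave_params
begin

text \<open>Beyond N the energy density exceeds the low-level one by a factor of order
  \<open>wt k\<close> \<ge> N, since \<open>lam k\<close> \<ge> 1 there. Cutting the data thus costs
  O(1/N) in the norm of \<open>stability\<close>.\<close>

lemma cut_tail:
 assumes [measurable]: "F0 \<in> bm" "V0 \<in> bm" and N: "1 \<le> N"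
 shows "wint lw (%k. cut N F0 k - F0 k) + nsq (%k. cut N V0 k - V0 k) \<le> ennreal (2 / N) * (NN k. ennreal (edens \<beta> F0 V0 k))"
proof -
 have "wint lw (%k. cut N F0 k - F0 k) + nsq (%k. cut N V0 k - V0 k)
  = (NN k. ennreal (lw k * (norm (cut N F0 k - F0 k))\<^sup>2 + (norm (cut N V0 k - V0 k))\<^sup>2))"
  unfolding nsq_def using lw_ge_1 by (subst nn_integral_add[symmetric]) (auto intro!: nn_integral_cong simp: ennreal_plus[symmetric] simp del: ennreal_plus)
 also have "\<dots> \<le> (NN k. ennreal (2 / N * edens \<beta> F0 V0 k))"
 proof (intro nn_integral_mono ennreal_leI)
  fix k
  show "lw k * (norm (cut N F0 k - F0 k))\<^sup>2 + (norm (cut N V0 k - V0 k))\<^sup>2 \<le> 2 / N * edens \<beta> F0 V0 k"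
  proof (cases "\<bar>k\<bar> \<le> N")
   case True then show ?thesis using N edens_nonneg[OF \<beta>, of F0 V0 k] by simp
  next
   case False
   have "N \<le> \<bar>k\<bar>" "1 \<le> \<bar>k\<bar>" using False N by auto
   moreover have "\<bar>k\<bar> ^ 1 \<le> \<bar>k\<bar> ^ 6" using \<open>1 \<le> \<bar>k\<bar>\<close> by (intro power_increasing) auto
   ultimately have w: "N \<le> wt k" by (simp add: wt_def)
   have l: "1 \<le> lam \<beta> k" unfolding lam_def using \<open>1 \<le> \<bar>k\<bar>\<close> \<beta> by (simp add: add_increasing2)
   have "N * lw k \<le> N * (2 * lam \<beta> k)" using l N by (intro mult_left_mono) auto
   also have "\<dots> \<le> 2 * (wt k * lam \<beta> k)" using mult_right_mono[OF w, of "lam \<beta> k"] l by simp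
   finally have a: "N * lw k \<le> 2 * (wt k * lam \<beta> k)" .
   have "N * lw k * (norm (F0 k))\<^sup>2 + N * (norm (V0 k))\<^sup>2 \<le> 2 * (wt k * lam \<beta> k) * (norm (F0 k))\<^sup>2 + (2 * wt k) * (norm (V0 k))\<^sup>2"
    using a w N by (intro add_mono mult_right_mono) auto
   also have "\<dots> \<le> 2 * edens \<beta> F0 V0 k" by (simp add: edens_def algebra_simps)
   finally show ?thesis using False N by (simp add: pos_le_divide_eq algebra_simps)
  qed
 qed
 also have "\<dots> = ennreal (2 / N) * (NN k. ennreal (edens \<beta> F0 V0 k))"
  using N by (subst nn_integral_cmult[symmetric]) (auto simp: ennreal_mult'[symmetric] intro!: edens_measurable)
 finally show ?thesis .
qed

definition CQ :: "real \<Rightarrow> real" where "CQ M = 4 * (cI + 8 * M)\<^sup>2 * (8 * M)"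
definition CD :: "real \<Rightarrow> real \<Rightarrow> real"
 where "CD N M = 4 * ((lam \<beta> N)\<^sup>2 + (\<alpha> * N\<^sup>2)\<^sup>2) + 2 * (2 * N * (\<epsilon>\<^sup>2 * (32 * (8 * M) * N\<^sup>2 * 2)))"

text \<open>On bounded frequencies all multipliers are bounded and the quadratic term is Lipschitz,
  with a constant depending on N. This serves for the Euler residual and again for the passage to
  the limit.\<close>

lemma R_cut_diff:
 assumes hj: "hi \<beta> M F V" and hs: "hi \<beta> M F' V'" and M: "0 \<le> M" and N: "0 \<le> N" and x: "0 \<le> x"
  and d: "nsq (%k. F k - F' k) \<le> ennreal x" "nsq (%k. V k - V' k) \<le> ennreal x"
 shows "nsq (cut N (%k. R F V k - R F' V' k)) \<le> ennreal (CD N M * x)"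
proof -
 note f = hi_facts[OF hj \<beta> M] and f' = hi_facts[OF hs \<beta> M]
 have m[measurable]: "F \<in> bm" "V \<in> bm" "F' \<in> bm" "V' \<in> bm" by (rule f f')+
 have [measurable]: "Qf F V \<in> bm" "Qf F' V' \<in> bm" by (auto intro: Qf_measurable m)
 have M8: "0 \<le> 8 * M" using M by simp
 let ?x = "cut N (%k. cr (lam \<beta> k) * (F' k - F k))" and ?y = "cut N (%k. \<i> * cr (\<alpha> * k * \<bar>k\<bar>) * (V k - V' k))"
 have c: "nsq (cut N (%k. m k * G k)) \<le> ennreal (b\<^sup>2 * x)" if b: "!!k. \<bar>k\<bar> \<le> N ==> norm (m k) \<le> b" and G: "nsq G \<le> ennreal x" and [measurable]: "G \<in> bm" for m b and G :: cfun
 proof -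
  have "nsq (cut N (%k. m k * G k)) = wint (%k. (norm (m k))\<^sup>2) (cut N G)"
   unfolding nsq_def by (intro nn_integral_cong) (simp add: norm_mult power_mult_distrib)
  also have "\<dots> \<le> ennreal (b\<^sup>2) * wint (%_. 1) G" using b by (intro wint_cut_le) (auto intro: power_mono)
  also have "\<dots> \<le> ennreal (b\<^sup>2) * ennreal x" using G by (intro mult_left_mono) (auto simp: nsq_wint)
  finally show ?thesis by (simp add: ennreal_mult')
 qed
 have x1: "nsq ?x \<le> ennreal ((lam \<beta> N)\<^sup>2 * x)"
  by (rule c) (use d(1) lam_mono[OF \<beta>, of _ N] \<beta> nsq_minus_commute[of F F'] in auto)
 have y1: "nsq ?y \<le> ennreal ((\<bar>\<alpha>\<bar> * N\<^sup>2)\<^sup>2 * x)"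
 proof (rule c)
  fix k :: real assume k: "\<bar>k\<bar> \<le> N"
  have "\<bar>k\<bar> * \<bar>k\<bar> \<le> N * N" using k N by (intro mult_mono) auto
  from mult_left_mono[OF this, of "\<bar>\<alpha>\<bar>"] show "norm (\<i> * cr (\<alpha> * k * \<bar>k\<bar>)) \<le> \<bar>\<alpha>\<bar> * N\<^sup>2"
   by (simp add: norm_mult abs_mult power2_eq_square mult_ac)
 qed (use d in auto)
 let ?b = "cut N (%k. cr \<epsilon> * (Qf F V k - Qf F' V' k))"
 have b1: "nsq ?b \<le> ennreal (2 * N * (\<epsilon>\<^sup>2 * (32 * (8 * M) * N\<^sup>2 * (x + x))))"
 proof (rule nsq_cut_const)
  fix k :: real assume k: "\<bar>k\<bar> \<le> N"
  have "ennreal ((norm (Qf F V k - Qf F' V' k))\<^sup>2) \<le> ennreal (32 * (8 * M) * k\<^sup>2) * (nsq (%k. V k - V' k) + nsq (%k. F k - F' k))"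
   by (rule Qf_diff_pointwise) (rule m f f' M8)+
  also have "\<dots> \<le> ennreal (32 * (8 * M) * N\<^sup>2) * (ennreal x + ennreal x)"
   using k M8 power_mono[of "\<bar>k\<bar>" N 2] by (intro mult_mono add_mono d ennreal_leI mult_left_mono) auto
  also have "\<dots> = ennreal (32 * (8 * M) * N\<^sup>2 * (x + x))"
   using M8 x by (subst ennreal_plus[symmetric], simp, simp, subst ennreal_mult[symmetric]) auto
  finally have "(norm (Qf F V k - Qf F' V' k))\<^sup>2 \<le> 32 * (8 * M) * N\<^sup>2 * (x + x)"
   using M8 x by (subst (asm) ennreal_le_iff) auto
  from mult_left_mono[OF this, of "\<epsilon>\<^sup>2"] show "ennreal ((norm (cr \<epsilon> * (Qf F V k - Qf F' V' k)))\<^sup>2) \<le> ennreal (\<epsilon>\<^sup>2 * (32 * (8 * M) * N\<^sup>2 * (x + x)))"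
   by (intro ennreal_leI) (simp add: norm_mult power_mult_distrib)
 qed (use M8 N x in auto)
 have "cut N (%k. R F V k - R F' V' k) = (%k. (?x k + ?y k) + ?b k)" by (auto simp: fun_eq_iff Rf_def algebra_simps)
 moreover have "nsq (%k. (?x k + ?y k) + ?b k) \<le> ennreal (2 * (2 * ((lam \<beta> N)\<^sup>2 * x) + 2 * ((\<bar>\<alpha>\<bar> * N\<^sup>2)\<^sup>2 * x)) + 2 * (2 * N * (\<epsilon>\<^sup>2 * (32 * (8 * M) * N\<^sup>2 * (x + x)))))"
  by (intro nsq_diff_bound(2) x1 y1 b1) (use x M8 N in auto)
 moreover have "2 * (2 * ((lam \<beta> N)\<^sup>2 * x) + 2 * ((\<bar>\<alpha>\<bar> * N\<^sup>2)\<^sup>2 * x)) + 2 * (2 * N * (\<epsilon>\<^sup>2 * (32 * (8 * M) * N\<^sup>2 * (x + x)))) = CD N M * x"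
  by (simp add: CD_def power_mult_distrib algebra_simps)
 ultimately show ?thesis by simp
qed

lemma euler_residual:
 assumes hj: "hi \<beta> M F V" and hs: "hi \<beta> M F' V'" and M: "0 \<le> M" and N: "1 \<le> N" and \<tau>: "0 \<le> \<tau>" "\<tau> \<le> h"
  and F': "!!k. F' k = F k + cr \<tau> * V k" and V': "!!k. V' k = V k + cr \<tau> * cut N (R F V) k"
  and s: "!!k. \<bar>k\<bar> > N ==> F k = 0" "!!k. \<bar>k\<bar> > N ==> V k = 0"
 shows "wint lw (%k. V k - V' k) \<le> ennreal (h\<^sup>2 * (lw N * CR M))"
  and "nsq (%k. cut N (R F V) k - R F' V' k) \<le> ennreal (h\<^sup>2 * (2 * CD N M * (CR M + 8 * M)) + 2 * \<epsilon>\<^sup>2 * CQ M / N\<^sup>2)"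
proof -
 note f = hi_facts[OF hj \<beta> M] and f' = hi_facts[OF hs \<beta> M]
 have m[measurable]: "F \<in> bm" "V \<in> bm" "F' \<in> bm" "V' \<in> bm" by (rule f f')+
 have mR[measurable]: "R F V \<in> bm" "Qf F V \<in> bm" "Qf F' V' \<in> bm" by (auto intro: R_measurable Qf_measurable m)
 have cm[measurable]: "cut N (R F V) \<in> bm" by measurable
 have \<tau>': "\<bar>- \<tau>\<bar> \<le> h" "\<bar>\<tau>\<bar> \<le> h" using \<tau> by auto
 have M8: "0 \<le> 8 * M" "0 \<le> CR M" using M CR_nonneg[OF M] by auto
 have rn: "nsq (cut N (R F V)) \<le> ennreal (CR M)"
  by (rule order_trans[OF nsq_mono_AE R_nsq[OF hj M]]) auto
 have "wint lw (%k. V k - V' k) = wint lw (%k. cr (- \<tau>) * cut N (R F V) k)" by (simp add: V')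
 also have "\<dots> \<le> ennreal (h\<^sup>2) * wint lw (cut N (R F V))" by (rule wint_real_mult_le) (use \<tau>' lw_ge_1 in auto)
 also have "wint lw (cut N (R F V)) \<le> ennreal (lw N) * wint (%_. 1) (R F V)"
  using lam_mono[OF \<beta>, of _ N] lw_ge_1 by (intro wint_cut_le) auto
 also have "\<dots> \<le> ennreal (lw N) * ennreal (CR M)" using R_nsq[OF hj M] by (intro mult_left_mono) (auto simp: nsq_wint)
 also have "ennreal (h\<^sup>2) * \<dots> = ennreal (h\<^sup>2 * (lw N * CR M))" using lw_ge_1 M8 by (simp add: ennreal_mult[symmetric] del: ennreal_plus)
 finally show "wint lw (%k. V k - V' k) \<le> ennreal (h\<^sup>2 * (lw N * CR M))" by (meson mult_left_mono zero_le)
 define C where "C = (%k. if \<bar>k\<bar> \<le> N then 0 else - cr \<epsilon> * Qf F' V' k)"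
 have e: "cut N (R F V) k - R F' V' k = cut N (%k. R F V k - R F' V' k) k + C k" for k
  by (cases "\<bar>k\<bar> \<le> N") (auto simp: C_def F' V' Rf_def s algebra_simps)
 have [measurable]: "C \<in> bm" unfolding C_def by measurable
 have B: "nsq (cut N (%k. R F V k - R F' V' k)) \<le> ennreal (CD N M * (h\<^sup>2 * (CR M + 8 * M)))"
 proof (rule R_cut_diff[OF hj hs M])
  have "nsq (%k. V k - V' k) = wint (%_. 1) (%k. cr (- \<tau>) * cut N (R F V) k)" by (simp add: V' nsq_wint)
  also have "\<dots> \<le> ennreal (h\<^sup>2) * nsq (cut N (R F V))" unfolding nsq_wint by (rule wint_real_mult_le) (use \<tau>' in auto)
  also have "\<dots> \<le> ennreal (h\<^sup>2) * ennreal (CR M + 8 * M)" using M8 by (intro mult_left_mono order_trans[OF rn] ennreal_leI) auto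
  finally show "nsq (%k. V k - V' k) \<le> ennreal (h\<^sup>2 * (CR M + 8 * M))" by (simp add: ennreal_mult')
  have "nsq (%k. F k - F' k) = wint (%_. 1) (%k. cr (- \<tau>) * V k)" by (simp add: F' nsq_wint)
  also have "\<dots> \<le> ennreal (h\<^sup>2) * nsq V" unfolding nsq_wint by (rule wint_real_mult_le) (use \<tau>' in auto)
  also have "\<dots> \<le> ennreal (h\<^sup>2) * ennreal (CR M + 8 * M)" using M8 by (intro mult_left_mono order_trans[OF f(8)] ennreal_leI) auto
  finally show "nsq (%k. F k - F' k) \<le> ennreal (h\<^sup>2 * (CR M + 8 * M))" by (simp add: ennreal_mult')
 qed (use N M8 in auto)
 have C: "nsq C \<le> ennreal (\<epsilon>\<^sup>2 / N\<^sup>2 * CQ M)"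
 proof -
  have "nsq C \<le> wint (%k. \<epsilon>\<^sup>2 / N\<^sup>2 * (1 + k\<^sup>2)) (Qf F' V')"
   unfolding nsq_def
  proof (intro nn_integral_mono ennreal_leI)
   fix k :: real
   show "(norm (C k))\<^sup>2 \<le> \<epsilon>\<^sup>2 / N\<^sup>2 * (1 + k\<^sup>2) * (norm (Qf F' V' k))\<^sup>2"
   proof (cases "\<bar>k\<bar> \<le> N")
    case False
    have "N\<^sup>2 \<le> 1 + k\<^sup>2" using power_mono[of N "\<bar>k\<bar>" 2] False N by simp
    then have "1 \<le> 1 / N\<^sup>2 * (1 + k\<^sup>2)" using N by (simp add: pos_le_divide_eq)
    from mult_left_mono[OF this, of "\<epsilon>\<^sup>2 * (norm (Qf F' V' k))\<^sup>2"] show ?thesis using False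
     by (simp add: C_def norm_mult power_mult_distrib mult_ac)
   qed (simp add: C_def)
  qed
  also have "\<dots> = ennreal (\<epsilon>\<^sup>2 / N\<^sup>2) * wint (%k. 1 + k\<^sup>2) (Qf F' V')" by (rule wint_cmult) auto
  also have "\<dots> \<le> ennreal (\<epsilon>\<^sup>2 / N\<^sup>2) * ennreal (CQ M)" unfolding CQ_def by (intro mult_left_mono Qf_weight_hi[OF hs M]) auto
  finally show ?thesis by (simp add: ennreal_mult'[symmetric])
 qed
 have nn: "0 \<le> CD N M" "0 \<le> CQ M" unfolding CD_def CQ_def using M8 N cI(1)
  by (intro add_nonneg_nonneg mult_nonneg_nonneg; simp)+
 have "nsq (%k. cut N (R F V) k - R F' V' k) \<le> ennreal (2 * (CD N M * (h\<^sup>2 * (CR M + 8 * M))) + 2 * (\<epsilon>\<^sup>2 / N\<^sup>2 * CQ M))"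
  unfolding e by (rule nsq_diff_bound(2)[OF _ _ B C]) (use nn M8 in auto)
 then show "nsq (%k. cut N (R F V) k - R F' V' k) \<le> ennreal (h\<^sup>2 * (2 * CD N M * (CR M + 8 * M)) + 2 * \<epsilon>\<^sup>2 * CQ M / N\<^sup>2)"
  by (rule order_trans) (use nn in \<open>auto intro!: ennreal_leI simp: algebra_simps\<close>)
qed

text \<open>The cutoff N is chosen first, for the initial error and the spectral tail. The step h is
  chosen afterwards, since its admissible size depends on N.\<close>

lemma approximate_solution:
 assumes m0: "F0 \<in> bm" "V0 \<in> bm"
  and h0: "!!k. F0 (- k) = cnj (F0 k)" "!!k. V0 (- k) = cnj (V0 k)"
  and E0: "(NN k. ennreal (edens \<beta> F0 V0 k)) \<le> ennreal M0" and M0: "0 \<le> M0" and T: "T = 1 / K1 (M0 + 1)" and \<eta>: "0 < \<eta>"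
 obtains F V \<rho> \<sigma> where "apsol T (M0 + 1) \<eta> F V \<rho> \<sigma>" "!!t k. F t (- k) = cnj (F t k)" "!!t k. V t (- k) = cnj (V t k)"
  "wint lw (%k. F 0 k - F0 k) + nsq (%k. V 0 k - V0 k) \<le> ennreal \<eta>"
proof -
 let ?M = "M0 + 1"
 have M: "0 \<le> ?M" using M0 by simp
 have Q0: "0 \<le> CQ ?M" unfolding CQ_def using M0 cI(1) by (intro mult_nonneg_nonneg; simp)
 \<comment> \<open>The second summand makes the initial error 2 M0 / N at most \<eta>, the third
   makes the tail of the quadratic term at most \<eta> / 2.\<close>
 define N where "N = 1 + 2 * M0 / \<eta> + 4 * \<epsilon>\<^sup>2 * CQ ?M / \<eta>"
 have N: "1 \<le> N" "2 * M0 / \<eta> \<le> N" "4 * \<epsilon>\<^sup>2 * CQ ?M / \<eta> \<le> N" unfolding N_def using \<eta> M0 Q0 by auto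
 define D where "D = 2 * CD N ?M * (CR ?M + 8 * ?M)"
 \<comment> \<open>The reciprocal of the step: the summands ensure in turn h \<le> 1, the step
   condition of \<open>euler_step_energy\<close>, a residual at most \<eta> in the first equation
   and a contribution at most \<eta> / 2 from inside the band in the second.\<close>
 define c where "c = 1 + \<bar>CN N ?M\<bar> + \<bar>lw N * CR ?M\<bar> / \<eta> + 2 * \<bar>D\<bar> / \<eta>"
 define h where "h = 1 / c"
 have c: "1 \<le> c" "CN N ?M \<le> c" "lw N * CR ?M / \<eta> \<le> c" "2 * D / \<eta> \<le> c"
 proof -
  have "0 \<le> \<bar>lw N * CR ?M\<bar> / \<eta>" "0 \<le> 2 * \<bar>D\<bar> / \<eta>" "lw N * CR ?M / \<eta> \<le> \<bar>lw N * CR ?M\<bar> / \<eta>"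
   "2 * D / \<eta> \<le> 2 * \<bar>D\<bar> / \<eta>" using \<eta> by (auto intro!: divide_right_mono mult_left_mono simp del: distrib_left_numeral)
  then show "1 \<le> c" "CN N ?M \<le> c" "lw N * CR ?M / \<eta> \<le> c" "2 * D / \<eta> \<le> c" unfolding c_def using abs_ge_self[of "CN N ?M"] abs_ge_zero[of "CN N ?M"] by linarith+
 qed
 have h: "0 < h" "h \<le> 1" "h * c = 1" using c(1) by (auto simp: h_def)
 have hCN: "h * CN N ?M \<le> 1" using mult_left_mono[OF c(2), of h] h by simp
 have h2: "h\<^sup>2 * x \<le> \<eta> * y" if "x / \<eta> \<le> y * c" "0 \<le> y" for x y
 proof -
  have "x \<le> \<eta> * y * c" using that \<eta> by (simp add: pos_divide_le_eq mult_ac)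
  then have "h\<^sup>2 * x \<le> h\<^sup>2 * (\<eta> * y * c)" by (rule mult_left_mono) simp
  also have "\<dots> = h * (\<eta> * y)" using h(3) by (simp add: power2_eq_square mult_ac)
  also have "\<dots> \<le> 1 * (\<eta> * y)" using h \<eta> that by (intro mult_right_mono) auto
  finally show ?thesis by simp
 qed
 note ctx = m0 h0 E0 M0 N(1) h(1) hCN T
 let ?F = "Fi N h F0 V0" and ?V = "Vi N h F0 V0" and ?j = "idx h"
 let ?U = "%s. fst (eul N h F0 V0 (?j s))" and ?W = "%s. snd (eul N h F0 V0 (?j s))"
 have res: "wint lw (%k. ?W t k - ?V t k) \<le> ennreal \<eta> \<and> nsq (%k. cut N (R (?U t) (?W t)) k - R (?F t) (?V t) k) \<le> ennreal \<eta>" if t: "t \<in> {0..T}" for t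
 proof -
  have b: "real (?j t) * h \<le> t" "t \<le> real (Suc (?j t)) * h" using idx_bounds[OF ctx, of t] t by auto
  have \<tau>: "0 \<le> t - real (?j t) * h" "t - real (?j t) * h \<le> h" using b by (auto simp: distrib_right)
  have hj: "hi \<beta> ?M (?U t) (?W t)" using eul_hi[OF ctx, of "?j t"] b t by auto
  note r = euler_residual[OF hj eul_hi_t[OF ctx t] M N(1) \<tau> Fi_def[OF ctx] Vi_def[OF ctx] eul_basic(5,6)[OF ctx], folded D_def]
  have 1: "h\<^sup>2 * (lw N * CR ?M) \<le> \<eta>" using h2[of "lw N * CR ?M" 1] c by simp
  have "h\<^sup>2 * D \<le> \<eta> * (1/2)" using h2[of "D" "1/2"] c by (simp add: mult.commute)
  moreover have "2 * \<epsilon>\<^sup>2 * CQ ?M / N\<^sup>2 \<le> \<eta> / 2"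
  proof -
   have "4 * \<epsilon>\<^sup>2 * CQ ?M \<le> N * \<eta>" using N(3) \<eta> by (simp add: pos_divide_le_eq)
   also have "\<dots> \<le> N\<^sup>2 * \<eta>" using N(1) \<eta> by (intro mult_right_mono) (auto simp: self_le_power)
   finally show ?thesis using N(1) by (simp add: pos_divide_le_eq mult_ac)
  qed
  ultimately have 2: "h\<^sup>2 * D + 2 * \<epsilon>\<^sup>2 * CQ ?M / N\<^sup>2 \<le> \<eta>" by linarith
  show ?thesis using order_trans[OF r(1) ennreal_leI[OF 1]] order_trans[OF r(2) ennreal_leI[OF 2]] by blast
 qed
 have "apsol T ?M \<eta> ?F ?V (%s k. ?W s k - ?V s k) (%s k. cut N (R (?U s) (?W s)) k - R (?F s) (?V s) k)"
  unfolding apsol_def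
 proof (intro conjI ballI AE_I2)
  note j = eul_jm[OF ctx]
  show "jm ?F" "jm ?V" by (rule j)+
  show "jm (%s k. ?W s k - ?V s k)" by (rule jm_arith(2)[OF j(3,2)])
  show "jm (%s k. cut N (R (?U s) (?W s)) k - R (?F s) (?V s) k)" by (rule jm_arith(2)[OF j(4) R_jm[OF j(1,2)]])
  fix t k assume t: "t \<in> {0..T}"
  show "hi \<beta> ?M (?F t) (?V t)" by (rule eul_hi_t[OF ctx t])
  show "wint lw (%k. ?W t k - ?V t k) \<le> ennreal \<eta>" "nsq (%k. cut N (R (?U t) (?W t)) k - R (?F t) (?V t) k) \<le> ennreal \<eta>" using res[OF t] by auto
  show "?F t k = ?F 0 k + tint t (%s. ?V s k + (?W s k - ?V s k))" "?V t k = ?V 0 k + tint t (%s. R (?F s) (?V s) k + (cut N (R (?U s) (?W s)) k - R (?F s) (?V s) k))"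
   using eul_tint[OF ctx, of t k] t by auto
 qed
 moreover have "wint lw (%k. ?F 0 k - F0 k) + nsq (%k. ?V 0 k - V0 k) \<le> ennreal \<eta>"
 proof -
  have "?F 0 k = cut N F0 k" "?V 0 k = cut N V0 k" for k by (auto simp: Fi_def[OF ctx] Vi_def[OF ctx] idx_def[OF ctx])
  then have "wint lw (%k. ?F 0 k - F0 k) + nsq (%k. ?V 0 k - V0 k) \<le> ennreal (2 / N) * (NN k. ennreal (edens \<beta> F0 V0 k))"
   using cut_tail[OF m0 N(1)] by simp
  also have "\<dots> \<le> ennreal (2 / N) * ennreal M0" by (intro mult_left_mono E0) auto
  also have "\<dots> = ennreal (2 / N * M0)" using M0 N by (intro ennreal_mult[symmetric]) auto
  also have "\<dots> \<le> ennreal \<eta>" using N \<eta> by (intro ennreal_leI) (simp add: pos_divide_le_eq mult_ac)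
  finally show ?thesis .
 qed
 ultimately show ?thesis by (intro that[of ?F ?V]) (auto simp: eul_herm[OF ctx])
qed

end

section \<open>Passage to the limit in the integrated system\<close>

lemma ennreal_add_leD: "(a::ennreal) + b \<le> c ==> a \<le> c" "(a::ennreal) + b \<le> c ==> b \<le> c"
 using order_trans[of a "a + b" c] order_trans[of b "a + b" c] by (simp_all add: add_increasing)

text \<open>Cauchy-Schwarz in time yields one factor T, the integration of the uniform bound the
  other.\<close>

lemma nsq_set_integral_le:
 fixes G :: "real \<Rightarrow> real \<Rightarrow> complex"
 assumes m: "jm G" and [measurable]: "A \<in> sets borel" and A: "emeasure lborel A = ennreal T"
  and b: "!!s. s \<in> A ==> nsq (G s) \<le> ennreal C" and C: "0 \<le> C" and T: "0 \<le> T"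
 shows "nsq (%k. LINT s:A|lborel. G s k) \<le> ennreal (T\<^sup>2 * C)"
proof -
 note [measurable (raw)] = measurable_section2[OF m]
 have pt: "ennreal ((norm (LINT s:A|lborel. G s k))\<^sup>2) \<le> ennreal T * (NN s. ennreal ((norm (G s k))\<^sup>2) * indicator A s)" for k
 proof -
  have "ennreal (norm (LINT s:A|lborel. G s k)) \<le> (NN s. ennreal \<bar>indicator A s * (indicator A s * norm (G s k))\<bar>)"
   unfolding set_lebesgue_integral_def by (rule order_trans[OF norm_integral_le_nn]) (auto intro!: nn_integral_mono ennreal_leI split: split_indicator)
  then have "(ennreal (norm (LINT s:A|lborel. G s k)))\<^sup>2 \<le> (NN s. ennreal \<bar>indicator A s * (indicator A s * norm (G s k))\<bar>)\<^sup>2"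
   by (rule power_mono) simp
  also have "\<dots> \<le> (NN s. ennreal ((indicator A s)\<^sup>2)) * (NN s. ennreal ((indicator A s * norm (G s k))\<^sup>2))"
   by (rule nn_cauchy_schwarz) measurable
  also have "(NN s. ennreal ((indicator A s)\<^sup>2)) = (NN s. indicator A s)"
   by (intro nn_integral_cong) (auto split: split_indicator)
  also have "\<dots> = ennreal T" using A by simp
  also have "(NN s. ennreal ((indicator A s * norm (G s k))\<^sup>2)) = (NN s. ennreal ((norm (G s k))\<^sup>2) * indicator A s)"
   by (intro nn_integral_cong) (auto split: split_indicator)
  finally show ?thesis by (simp add: ennreal_power)
 qed
 have "nsq (%k. LINT s:A|lborel. G s k) \<le> (NN k. ennreal T * (NN s. ennreal ((norm (G s k))\<^sup>2) * indicator A s))"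
  unfolding nsq_def by (rule nn_integral_mono) (rule pt)
 also have "\<dots> = ennreal T * (NN k s. ennreal ((norm (G s k))\<^sup>2) * indicator A s)"
  by (rule nn_integral_cmult) measurable
 also have "(NN k s. ennreal ((norm (G s k))\<^sup>2) * indicator A s) = (NN s k. ennreal ((norm (G s k))\<^sup>2) * indicator A s)"
  by (rule Fubini_nn) (unfold split_beta', measurable)
 also have "\<dots> = (NN s. nsq (G s) * indicator A s)" by (simp add: nsq_def nn_integral_multc)
 also have "\<dots> \<le> (NN s. ennreal C * indicator A s)"
  by (intro nn_integral_mono) (use b in \<open>auto split: split_indicator\<close>)
 also have "\<dots> = ennreal C * ennreal T" by (simp add: nn_integral_cmult A)
 also have "ennreal T * (ennreal C * ennreal T) = ennreal (T\<^sup>2 * C)" using T C by (simp add: ennreal_mult[symmetric] power2_eq_square mult_ac)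
 finally show ?thesis by (meson mult_left_mono zero_le)
qed

lemma nsq_tint_le:
 fixes G :: "real \<Rightarrow> real \<Rightarrow> complex"
 assumes m: "jm G" and t: "t \<in> {0..T}" and b: "!!s. s \<in> {0..T} ==> nsq (G s) \<le> ennreal C" and C: "0 \<le> C"
 shows "nsq (%k. tint t (%s. G s k)) \<le> ennreal (T\<^sup>2 * C)"
proof -
 have "nsq (%k. tint t (%s. G s k)) \<le> ennreal (t\<^sup>2 * C)" by (rule nsq_set_integral_le[OF m]) (use t b C in auto)
 also have "\<dots> \<le> ennreal (T\<^sup>2 * C)" using t C by (intro ennreal_leI mult_right_mono power_mono) auto
 finally show ?thesis .
qed

lemma nsq_geometric_0:
 assumes "!!n. nsq f \<le> ennreal (K * (1/4) ^ n)"
 shows "nsq f = 0"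
proof -
 have "(%n. K * (1/4) ^ n) \<longlonglongrightarrow> K * 0" by (intro tendsto_mult tendsto_const LIMSEQ_power_zero) simp
 then have "(%n. ennreal (K * (1/4) ^ n)) \<longlonglongrightarrow> ennreal (K * 0)" by (rule tendsto_ennrealI)
 then have "nsq f \<le> ennreal (K * 0)" by (rule LIMSEQ_le_const) (use assms in auto)
 then show ?thesis by simp
qed

text \<open>The right-hand sides converge in L^2 only on bounded frequency bands, with constants C N
  that grow with the band. Since the limit equation is pointwise in k, it suffices to prove it on
  every band and to unite countably many null sets.\<close>

lemma tint_limit:
 fixes G :: "nat \<Rightarrow> real \<Rightarrow> real \<Rightarrow> complex" and X A :: "nat \<Rightarrow> real \<Rightarrow> complex"
 assumes j: "!!n. jm (G n)" "jm G'" and t: "t \<in> {0..T}"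
  and bd: "!!n s. s \<in> {0..T} ==> nsq (G n s) \<le> ennreal B" "!!s. s \<in> {0..T} ==> nsq (G' s) \<le> ennreal B"
  and eq: "!!n. AEL k. X n k = A n k + tint t (%s. G n s k)"
  and m[measurable]: "!!n. X n \<in> bm" "!!n. A n \<in> bm" "X' \<in> bm" "A' \<in> bm"
  and XA: "!!n. nsq (%k. X n k - X' k) \<le> ennreal (c * (1/4) ^ n)" "!!n. nsq (%k. A n k - A' k) \<le> ennreal (c * (1/4) ^ n)" "0 \<le> c"
  and G: "!!N. 0 \<le> C N" "!!N n s. s \<in> {0..T} ==> nsq (cut (real N) (%k. G n s k - G' s k)) \<le> ennreal (C N * (1/4) ^ n)"
 shows "AEL k. X' k = A' k + tint t (%s. G' s k)"
proof -
 note [measurable (raw)] = measurable_section2[OF j(2)] measurable_section2[OF j(1)]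
 have T: "0 \<le> T" using t by auto
 have mt[measurable]: "(%k. tint t (%s. G' s k)) \<in> bm" by (rule jm_section[OF jm_tint[OF j(2)]])
 let ?D = "%k. X' k - A' k - tint t (%s. G' s k)"
 have "AEL k. cut (real N) ?D k = 0" for N
 proof (rule nsq_0_AE)
  show "cut (real N) ?D \<in> bm" by measurable
  show "nsq (cut (real N) ?D) = 0"
  proof (rule nsq_geometric_0)
   fix n
   let ?q = "(1/4::real) ^ n"
   let ?E = "%k. (A n k - A' k) - (X n k - X' k)" and ?H = "%s. cut (real N) (%k. G n s k - G' s k)"
   have jH: "jm ?H" unfolding split_beta' by measurable
   have mH: "(%k. tint t (%s. ?H s k)) \<in> bm" by (rule jm_section[OF jm_tint[OF jH]])
   have ae: "AEL k. \<forall>s\<in>{0..T}. tint s (%r. G n r k - G' r k) = tint s (%r. G n r k) - tint s (%r. G' r k)"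
    by (rule tint_diff_AE[OF j(1) j(2) T bd])
   have "nsq (cut (real N) ?D) = nsq (%k. cut (real N) ?E k + tint t (%s. ?H s k))"
   proof (rule nsq_cong_AE)
    show "AEL k. norm (cut (real N) ?D k) = norm (cut (real N) ?E k + tint t (%s. ?H s k))"
     using ae eq[of n]
    proof eventually_elim
     case (elim k)
     note e = bspec[OF elim(1) t]
     have "?D k = ?E k + tint t (%s. G n s k - G' s k)" unfolding e elim(2) by simp
     then show ?case by (cases "\<bar>k\<bar> \<le> real N") (simp only: if_True, simp)
    qed
   qed
   also have "\<dots> \<le> ennreal (2 * (2 * (c * ?q) + 2 * (c * ?q)) + 2 * (T\<^sup>2 * (C N * ?q)))"
   proof (rule nsq_diff_bound(2))
    show "nsq (cut (real N) ?E) \<le> ennreal (2 * (c * ?q) + 2 * (c * ?q))"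
    proof (rule order_trans)
     show "nsq (cut (real N) ?E) \<le> nsq ?E" by (rule nsq_mono_AE) auto
     show "nsq ?E \<le> ennreal (2 * (c * ?q) + 2 * (c * ?q))" by (rule nsq_diff_bound(1)) (use XA in auto)
    qed
    show "nsq (%k. tint t (%s. ?H s k)) \<le> ennreal (T\<^sup>2 * (C N * ?q))" by (rule nsq_tint_le[OF jH t G(2)]) (use G in auto)
   qed (use mH XA(3) G(1) in auto)
   also have "2 * (2 * (c * ?q) + 2 * (c * ?q)) + 2 * (T\<^sup>2 * (C N * ?q)) = (8 * c + 2 * T\<^sup>2 * C N) * ?q" by (simp add: algebra_simps)
   finally show "nsq (cut (real N) ?D) \<le> ennreal ((8 * c + 2 * T\<^sup>2 * C N) * ?q)" .
  qed
 qed
 then have "AEL k. \<forall>N. cut (real N) ?D k = 0" by (subst AE_all_countable) blast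
 then show ?thesis
 proof eventually_elim
  case (elim k)
  obtain N where "\<bar>k\<bar> \<le> real N" using real_arch_simple by blast
  then show ?case using elim[rule_format, of N] by (simp add: algebra_simps)
 qed
qed

text \<open>Convergence is known only at the lower level. Fatou's lemma makes the energy lower
  semicontinuous along convergence almost everywhere and so carries the high bound to the
  limit.\<close>

lemma hi_limit:
 assumes h: "!!n. hi \<beta> M (F n) (V n)" and b: "\<beta> > 0" and [measurable]: "F' \<in> bm" "V' \<in> bm"
  and s: "!!k. F' (- k) = cnj (F' k)" "!!k. V' (- k) = cnj (V' k)"
  and l: "AEL k. (%n. F n k) \<longlonglongrightarrow> F' k" "AEL k. (%n. V n k) \<longlonglongrightarrow> V' k"
 shows "hi \<beta> M F' V'"
proof -
 have "(NN k. ennreal (edens \<beta> F' V' k)) = (NN k. liminf (%n. ennreal (edens \<beta> (F n) (V n) k)))"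
 proof (rule nn_integral_cong_AE)
  show "AEL k. ennreal (edens \<beta> F' V' k) = liminf (%n. ennreal (edens \<beta> (F n) (V n) k))"
   using l
  proof eventually_elim
   case (elim k)
   have "(%n. ennreal (edens \<beta> (F n) (V n) k)) \<longlonglongrightarrow> ennreal (edens \<beta> F' V' k)"
    unfolding edens_def by (intro tendsto_ennrealI tendsto_intros elim)
   then show ?case by (simp add: lim_imp_Liminf)
  qed
 qed
 also have "\<dots> \<le> liminf (%n. NN k. ennreal (edens \<beta> (F n) (V n) k))"
 proof (rule nn_integral_liminf)
  fix n
  have [measurable]: "F n \<in> bm" "V n \<in> bm" using h[of n] by (auto simp: hi_def)
  show "(%k. ennreal (edens \<beta> (F n) (V n) k)) \<in> borel_measurable lborel" by measurable
 qed
 also have "\<dots> \<le> liminf (%n. ennreal M)" by (rule Liminf_mono) (use h in \<open>auto simp: hi_def\<close>)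
 also have "\<dots> = ennreal M" by (simp add: Liminf_const)
 finally show ?thesis using s by (simp add: hi_def)
qed

context wave_params
begin

lemma apsol_mono: "apsol T M \<eta> F V \<rho> \<sigma> ==> \<eta> \<le> \<eta>' ==> apsol T M \<eta>' F V \<rho> \<sigma>"
 unfolding apsol_def by (meson ennreal_leI order_trans)

text \<open>Approximate solutions with error 4^-n are compared by \<open>stability\<close>;
  consecutive ones then differ by a multiple of 4^-n at every time, which is the rate
  \<open>L2_limit_joint\<close> asks for.\<close>

lemma fourier_solution:
 assumes m0: "F0 \<in> bm" "V0 \<in> bm"
  and h0: "!!k. F0 (- k) = cnj (F0 k)" "!!k. V0 (- k) = cnj (V0 k)"
  and E0: "(NN k. ennreal (edens \<beta> F0 V0 k)) \<le> ennreal M0" and M0: "0 \<le> M0" and T: "T = 1 / K1 (M0 + 1)"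
 obtains F V where "jm F" "jm V" "!!t. t \<in> {0..T} ==> hi \<beta> (M0 + 1) (F t) (V t)"
  "!!t k. F t (- k) = cnj (F t k)" "!!t k. V t (- k) = cnj (V t k)"
  "!!t. t \<in> {0..T} ==> AEL k. F t k = F0 k + tint t (%s. V s k)"
  "!!t. t \<in> {0..T} ==> AEL k. V t k = V0 k + tint t (%s. R (F s) (V s) k)"
proof -
 let ?M = "M0 + 1"
 have M: "0 \<le> ?M" using M0 by simp
 have T0: "0 \<le> T" using K1_pos[OF M] T by simp
 let ?q = "%n. (1/4::real) ^ n"
 define P where "P n x \<longleftrightarrow> (case x of (F, V, \<rho>, \<sigma>) \<Rightarrow> apsol T ?M (?q n) F V \<rho> \<sigma> \<and> (\<forall>t k. F t (- k) = cnj (F t k)) \<and> (\<forall>t k. V t (- k) = cnj (V t k)) \<and>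
  wint lw (%k. F 0 k - F0 k) + nsq (%k. V 0 k - V0 k) \<le> ennreal (?q n))" for n x
 have "\<exists>x. P n x" for n
 proof -
  obtain F V \<rho> \<sigma> where "apsol T ?M (?q n) F V \<rho> \<sigma>" "!!t k. F t (- k) = cnj (F t k)" "!!t k. V t (- k) = cnj (V t k)"
   "wint lw (%k. F 0 k - F0 k) + nsq (%k. V 0 k - V0 k) \<le> ennreal (?q n)"
   by (rule approximate_solution[OF m0 h0 E0 M0 T, of "?q n"]) auto
  then show ?thesis unfolding P_def by (intro exI[of _ "(F, V, \<rho>, \<sigma>)"]) auto
 qed
 then obtain x where x: "!!n. P n (x n)" by metis
 define F V \<rho> \<sigma> where "F n = fst (x n)" and "V n = fst (snd (x n))" and "\<rho> n = fst (snd (snd (x n)))" and "\<sigma> n = snd (snd (snd (x n)))" for n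
 have a: "apsol T ?M (?q n) (F n) (V n) (\<rho> n) (\<sigma> n)" and herm: "F n t (- k) = cnj (F n t k)" "V n t (- k) = cnj (V n t k)"
  and ini: "wint lw (%k. F n 0 k - F0 k) + nsq (%k. V n 0 k - V0 k) \<le> ennreal (?q n)" for n t k
  using x[of n] unfolding P_def by (auto simp: F_def V_def \<rho>_def \<sigma>_def split_beta)
 note d = apsolD[OF a]
 have lw1: "!!k. 1 \<le> lw k" "!!k. 0 \<le> lw k" using lw_ge_1 by auto
 have q0: "0 \<le> ?q n" "?q (Suc n) \<le> ?q n" "?q n \<le> 1" for n by (auto intro: power_le_one)
 have iF: "wint lw (%k. F n 0 k - F0 k) \<le> ennreal (?q n)" and iV: "nsq (%k. V n 0 k - V0 k) \<le> ennreal (?q n)" for n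
  by (rule ennreal_add_leD[OF ini])+
 have mF[measurable]: "F n t \<in> bm" "V n t \<in> bm" "\<rho> n t \<in> bm" "\<sigma> n t \<in> bm" for n t
  by (rule jm_section d)+
 note [measurable] = m0
 \<comment> \<open>The factor 9 is 4 + 4 + 1: two differences of initial values, each at most (2 +
   2) 4^-n, and the residual.\<close>
 define C where "C = \<bar>CS T ?M\<bar> * 9"
 have C0: "0 \<le> C" by (simp add: C_def)
 have lin: "ennreal c * (ennreal a + ennreal a + ennreal b) = ennreal (c * (a + a + b))" if "0 \<le> a" "0 \<le> b" "0 \<le> c" for a b c
  using that by (simp only: ennreal_plus ennreal_mult add_nonneg_nonneg)
 have step: "wint lw (%k. F (Suc n) t k - F n t k) + nsq (%k. V (Suc n) t k - V n t k) \<le> ennreal (C * ?q n)" if t: "t \<in> {0..T}" for n t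
 proof -
  have 1: "wint lw (%k. (F (Suc n) 0 k - F0 k) - (F n 0 k - F0 k)) \<le> ennreal (2 * ?q (Suc n) + 2 * ?q n)"
   by (rule wint_diff_bound(1)) (rule iF lw1 | simp)+
  have 2: "nsq (%k. (V (Suc n) 0 k - V0 k) - (V n 0 k - V0 k)) \<le> ennreal (2 * ?q (Suc n) + 2 * ?q n)"
   by (rule nsq_diff_bound(1)) (rule iV | simp)+
  have "wint lw (%k. F (Suc n) t k - F n t k) + nsq (%k. V (Suc n) t k - V n t k)
    \<le> ennreal (CS T ?M) * (wint lw (%k. F (Suc n) 0 k - F n 0 k) + nsq (%k. V (Suc n) 0 k - V n 0 k) + ennreal (?q n))"
   by (rule stability[OF apsol_mono[OF a q0(2)] a M _ t]) simp
  also have "\<dots> \<le> ennreal \<bar>CS T ?M\<bar> * (ennreal (2 * ?q (Suc n) + 2 * ?q n) + ennreal (2 * ?q (Suc n) + 2 * ?q n) + ennreal (?q n))"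
   using 1 2 by (intro mult_mono add_mono ennreal_leI) auto
  also have "\<dots> = ennreal (\<bar>CS T ?M\<bar> * ((2 * ?q (Suc n) + 2 * ?q n) + (2 * ?q (Suc n) + 2 * ?q n) + ?q n))"
   by (rule lin) auto
  also have "\<dots> \<le> ennreal (C * ?q n)" unfolding C_def mult.assoc using q0[of n] by (intro ennreal_leI mult_left_mono) auto
  finally show ?thesis .
 qed
 have sF: "nsq (%k. F (Suc n) t k - F n t k) \<le> ennreal (C * ?q n)" and sV: "nsq (%k. V (Suc n) t k - V n t k) \<le> ennreal (C * ?q n)" if t: "t \<in> {0..T}" for n t
 proof -
  have "nsq (%k. F (Suc n) t k - F n t k) + nsq (%k. V (Suc n) t k - V n t k) \<le> ennreal (C * ?q n)"
   by (rule order_trans[OF add_right_mono[OF nsq_le_wint[OF lw1(1)]] step[OF t]])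
  then show "nsq (%k. F (Suc n) t k - F n t k) \<le> ennreal (C * ?q n)" "nsq (%k. V (Suc n) t k - V n t k) \<le> ennreal (C * ?q n)"
   by (rule ennreal_add_leD)+
 qed
 obtain F' where F': "jm F'" "!!n t. t \<in> {0..T} ==> nsq (%k. F n t k - F' t k) \<le> ennreal (4 * C * ?q n)"
  "!!t. t \<in> {0..T} ==> AEL k. (%n. F n t k) \<longlonglongrightarrow> F' t k" "!!t k. F' t (- k) = cnj (F' t k)"
  by (rule L2_limit_joint[of F C "{0..T}"]) (use d(1) C0 sF herm(1) in auto)
 obtain V' where V': "jm V'" "!!n t. t \<in> {0..T} ==> nsq (%k. V n t k - V' t k) \<le> ennreal (4 * C * ?q n)"
  "!!t. t \<in> {0..T} ==> AEL k. (%n. V n t k) \<longlonglongrightarrow> V' t k" "!!t k. V' t (- k) = cnj (V' t k)"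
  by (rule L2_limit_joint[of V C "{0..T}"]) (use d(2) C0 sV herm(2) in auto)
 have mF'[measurable]: "F' t \<in> bm" "V' t \<in> bm" for t by (rule jm_section F' V')+
 have hi': "hi \<beta> ?M (F' t) (V' t)" if t: "t \<in> {0..T}" for t
  by (rule hi_limit[OF d(5)[OF t] \<beta> mF' F'(4) V'(4) F'(3)[OF t] V'(3)[OF t]])
 have \<rho>: "nsq (\<rho> n t) \<le> ennreal (?q n)" if "t \<in> {0..T}" for n t
  using order_trans[OF nsq_le_wint[OF lw1(1)] d(6)[OF that]] .
 define c where "c = 4 * C + 1"
 have c: "0 \<le> c" "4 * C \<le> c" "1 \<le> c" using C0 by (auto simp: c_def)
 have le: "X \<le> ennreal (c * ?q n)" if "X \<le> ennreal (4 * C * ?q n) \<or> X \<le> ennreal (?q n)" for X n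
  using that by (auto elim!: order_trans intro!: ennreal_leI mult_right_mono c simp: mult_le_cancel_right1 c)
 \<comment> \<open>A single bound for both integrated equations, large enough for V, for R and for
   their residuals.\<close>
 define B where "B = 2 * (8 * ?M) + 2 * CR ?M + 2"
 note B0 = CR_nonneg[OF M]
 have "AEL k. F' t k = F0 k + tint t (%s. V' s k)" if t: "t \<in> {0..T}" for t
 proof (rule tint_limit[where G = "%n s k. V n s k + \<rho> n s k" and X = "%n. F n t" and A = "%n. F n 0" and B = B and c = c and C = "%_. 8 * C + 2"])
  show "jm (%s k. V n s k + \<rho> n s k)" for n by (rule jm_arith d)+
  show "nsq (%k. V n s k + \<rho> n s k) \<le> ennreal B" if s: "s \<in> {0..T}" for n s
  proof -
   have "nsq (%k. V n s k + \<rho> n s k) \<le> ennreal (2 * (8 * ?M) + 2 * ?q n)"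
    by (rule nsq_diff_bound(2)) (use hi_facts[OF d(5)[OF s] \<beta> M] \<rho>[OF s] M in auto)
   also have "\<dots> \<le> ennreal B" using q0[of n] B0 by (intro ennreal_leI) (simp add: B_def)
   finally show ?thesis .
  qed
  show "nsq (V' s) \<le> ennreal B" if s: "s \<in> {0..T}" for s
   by (rule order_trans[OF hi_facts(8)[OF hi'[OF s] \<beta> M]]) (use B0 M in \<open>auto intro!: ennreal_leI simp: B_def\<close>)
  show "nsq (cut (real N) (%k. V n s k + \<rho> n s k - V' s k)) \<le> ennreal ((8 * C + 2) * ?q n)" if s: "s \<in> {0..T}" for n s N
  proof -
   have "nsq (cut (real N) (%k. V n s k + \<rho> n s k - V' s k)) \<le> nsq (%k. (V n s k - V' s k) + \<rho> n s k)"
    by (rule nsq_mono_AE) (auto simp: algebra_simps)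
   also have "\<dots> \<le> ennreal (2 * (4 * C * ?q n) + 2 * ?q n)" by (rule nsq_diff_bound(2)) (use V'(2)[OF s] \<rho>[OF s] C0 in auto)
   also have "2 * (4 * C * ?q n) + 2 * ?q n = (8 * C + 2) * ?q n" by (simp add: algebra_simps)
   finally show ?thesis .
  qed
  show "nsq (%k. F n t k - F' t k) \<le> ennreal (c * ?q n)" "nsq (%k. F n 0 k - F0 k) \<le> ennreal (c * ?q n)" for n
   by (rule le, rule disjI1, rule F'(2)[OF t]) (rule le, rule disjI2, rule order_trans[OF nsq_le_wint[OF lw1(1)] iF])
  show "AEL k. F n t k = F n 0 k + tint t (%s. V n s k + \<rho> n s k)" for n by (rule d(8)[OF t])
 qed (use V' t C0 c in auto)
 moreover have "AEL k. V' t k = V0 k + tint t (%s. R (F' s) (V' s) k)" if t: "t \<in> {0..T}" for t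
 proof (rule tint_limit[where G = "%n s k. R (F n s) (V n s) k + \<sigma> n s k" and X = "%n. V n t" and A = "%n. V n 0" and B = B and c = c
    and C = "%N. 2 * (CD (real N) ?M * (4 * C)) + 2"])
  have CD0: "0 \<le> CD (real N) ?M" for N unfolding CD_def using M0 by (intro add_nonneg_nonneg mult_nonneg_nonneg) auto
  show "jm (%s k. R (F n s) (V n s) k + \<sigma> n s k)" "jm (%s. R (F' s) (V' s))" for n by (rule jm_arith R_jm d F' V')+
  show "nsq (%k. R (F n s) (V n s) k + \<sigma> n s k) \<le> ennreal B" if s: "s \<in> {0..T}" for n s
  proof -
   have "nsq (%k. R (F n s) (V n s) k + \<sigma> n s k) \<le> ennreal (2 * CR ?M + 2 * ?q n)"
    by (rule nsq_diff_bound(2)) (use R_nsq[OF d(5)[OF s] M] d(7)[OF s] M B0 in auto)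
   also have "\<dots> \<le> ennreal B" using q0[of n] M by (intro ennreal_leI) (simp add: B_def)
   finally show ?thesis .
  qed
  show "nsq (R (F' s) (V' s)) \<le> ennreal B" if s: "s \<in> {0..T}" for s
   by (rule order_trans[OF R_nsq[OF hi'[OF s] M]]) (use B0 M in \<open>auto intro!: ennreal_leI simp: B_def\<close>)
  show "nsq (cut (real N) (%k. R (F n s) (V n s) k + \<sigma> n s k - R (F' s) (V' s) k)) \<le> ennreal ((2 * (CD (real N) ?M * (4 * C)) + 2) * ?q n)" if s: "s \<in> {0..T}" for n s N
  proof -
   have "nsq (cut (real N) (%k. R (F n s) (V n s) k + \<sigma> n s k - R (F' s) (V' s) k)) \<le> nsq (%k. cut (real N) (%k. R (F n s) (V n s) k - R (F' s) (V' s) k) k + cut (real N) (\<sigma> n s) k)"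
    by (rule nsq_mono_AE) (auto simp: algebra_simps)
   also have "\<dots> \<le> ennreal (2 * (CD (real N) ?M * (4 * C * ?q n)) + 2 * ?q n)"
   proof (rule nsq_diff_bound(2))
    show "nsq (cut (real N) (%k. R (F n s) (V n s) k - R (F' s) (V' s) k)) \<le> ennreal (CD (real N) ?M * (4 * C * ?q n))"
     by (rule R_cut_diff[OF d(5)[OF s] hi'[OF s] M]) (use F'(2)[OF s] V'(2)[OF s] C0 in auto)
    show "nsq (cut (real N) (\<sigma> n s)) \<le> ennreal (?q n)" by (rule order_trans[OF nsq_mono_AE d(7)[OF s]]) auto
   qed (use C0 CD0 in auto)
   also have "2 * (CD (real N) ?M * (4 * C * ?q n)) + 2 * ?q n = (2 * (CD (real N) ?M * (4 * C)) + 2) * ?q n" by (simp add: algebra_simps)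
   finally show ?thesis .
  qed
  show "nsq (%k. V n t k - V' t k) \<le> ennreal (c * ?q n)" "nsq (%k. V n 0 k - V0 k) \<le> ennreal (c * ?q n)" for n
   by (rule le, rule disjI1, rule V'(2)[OF t]) (rule le, rule disjI2, rule iV)
  show "0 \<le> 2 * (CD (real N) ?M * (4 * C)) + 2" for N using CD0 C0 by simp
  show "AEL k. V n t k = V n 0 k + tint t (%s. R (F n s) (V n s) k + \<sigma> n s k)" for n by (rule d(9)[OF t])
 qed (use t c in auto)
 ultimately show ?thesis using F' V' hi' by (intro that[of F' V']) auto
qed

end

section \<open>Weak time derivatives\<close>

lemma continuous_on_tint:
 fixes q :: "real \<Rightarrow> 'a::euclidean_space"
 assumes "set_integrable lborel {0..T} q"
 shows "continuous_on {0..T} (%t. tint t q)"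
proof -
 have "q integrable_on {0..T}" using set_borel_integral_eq_integral(1)[OF assms] .
 then have "continuous_on {0..T} (%t. integral {0..t} q)" by (rule indefinite_integral_continuous_1)
 moreover have "integral {0..t} q = tint t q" if "t \<in> {0..T}" for t
  by (rule set_borel_integral_eq_integral(2)[symmetric], rule set_integrable_subset[OF assms]) (use that in auto)
 ultimately show ?thesis by (simp cong: continuous_on_cong_simp)
qed

text \<open>The primitive of an integrable q is not differentiable in general, so Fubini over the
  triangle s \<le> t takes the place of integration by parts.\<close>

lemma test_by_parts:
 fixes q :: "real \<Rightarrow> 'a::{banach, second_countable_topology}"
 assumes \<phi>: "test_function_on {0<..<T} \<phi>" and q: "set_integrable lborel {0..T} q" and T: "0 < T"
 shows "(LINT t:{0<..<T}|lborel. deriv \<phi> t *\<^sub>R (c + tint t q)) = - (LINT t:{0<..<T}|lborel. \<phi> t *\<^sub>R q t)"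
  and "set_integrable lborel {0<..<T} (%t. deriv \<phi> t *\<^sub>R (c + tint t q))"
proof -
 note f = test_function_facts[OF \<phi>]
 have z: "\<phi> t = 0" if "t \<notin> {0<..<T}" for t using \<phi> that unfolding test_function_on_def by blast
 have [measurable]: "deriv \<phi> \<in> bm" using f(3) by (rule borel_measurable_continuous_onI)
 define h where "h s = indicator {0..T} s *\<^sub>R q s" for s
 have h: "intL h" using q unfolding h_def[abs_def] set_integrable_def .
 then have [measurable]: "h \<in> bm" by auto
 obtain B where B: "!!t. t \<in> {0..T} ==> norm (deriv \<phi> t) \<le> B"
 proof -
  have "bounded (deriv \<phi> ` {0..T})" by (intro compact_imp_bounded compact_continuous_image continuous_on_subset[OF f(3)]) auto
  then obtain B where "\<forall>x\<in>deriv \<phi> ` {0..T}. norm x \<le> B" unfolding bounded_iff ..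
  then show ?thesis by (intro that[of B]) simp
 qed
 have B0: "0 \<le> B" using B[of 0] T by (auto intro: order_trans[OF norm_ge_zero])
 define H where "H t s = (if 0 \<le> t \<and> t \<le> T \<and> s \<le> t then deriv \<phi> t *\<^sub>R h s else 0)" for t s
 have mH: "case_prod H \<in> bm2" unfolding H_def split_beta' by measurable
 have bH: "(NN t s. ennreal (norm (H t s))) < \<infinity>"
 proof -
  have "(NN t s. ennreal (norm (H t s))) \<le> (NN t. ennreal B * (NN s. ennreal (norm (h s))) * indicator {0..T} t)"
  proof (rule nn_integral_mono)
   fix t
   have "(NN s. ennreal (norm (H t s))) \<le> (NN s. ennreal B * ennreal (norm (h s)) * indicator {0..T} t)"
    using B[of t] B0 by (intro nn_integral_mono) (auto simp: H_def ennreal_mult[symmetric] intro!: ennreal_leI mult_right_mono split: split_indicator)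
   also have "\<dots> = ennreal B * (NN s. ennreal (norm (h s))) * indicator {0..T} t" by (simp add: nn_integral_cmult nn_integral_multc)
   finally show "(NN s. ennreal (norm (H t s))) \<le> \<dots>" .
  qed
  also have "\<dots> < \<infinity>" using h T by (simp add: nn_integral_cmult integrable_iff_bounded ennreal_mult_less_top)
  finally show ?thesis .
 qed
 have inn: "(LI s. H t s) = indicator {0..T} t *\<^sub>R (deriv \<phi> t *\<^sub>R tint t q)" for t
 proof (cases "t \<in> {0..T}")
  case True
  have "(LI s. H t s) = (LI s. deriv \<phi> t *\<^sub>R (indicator {0..t} s *\<^sub>R q s))"
   by (intro LI_cong) (use True in \<open>auto simp: H_def h_def split: split_indicator\<close>)
  also have "\<dots> = deriv \<phi> t *\<^sub>R tint t q" unfolding set_lebesgue_integral_def by (rule integral_scaleR_right)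
  finally show ?thesis using True by simp
 qed (auto simp: H_def)
 obtain K where K: "compact K" "K \<subseteq> {0<..<T}" "!!x. x \<notin> K ==> \<phi> x = 0" using \<phi> unfolding test_function_on_def by blast
 have z': "deriv \<phi> t = 0" if "t \<notin> {0<..<T}" for t
 proof -
  have "((%_. 0) has_field_derivative 0) (at t)" by simp
  then have "(\<phi> has_field_derivative 0) (at t)"
   by (rule has_field_derivative_transform_within_open[of _ _ _ "- K"]) (use that K in \<open>auto intro: open_Compl compact_imp_closed\<close>)
  then show ?thesis by (rule DERIV_imp_deriv)
 qed
 \<comment> \<open>The derivative of the test function vanishes at 0 and T, so closed and open
   intervals are interchangeable even pointwise.\<close>
 have ae: "indicator {0..T} t *\<^sub>R (deriv \<phi> t *\<^sub>R x) = indicator {0<..<T} t *\<^sub>R (deriv \<phi> t *\<^sub>R x)" for t and x :: "'b::real_vector"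
  using z'[of t] by (auto split: split_indicator)
 have i1: "intL (%t. indicator {0..T} t *\<^sub>R (deriv \<phi> t *\<^sub>R tint t q))"
  using lborel_pair.integrable_fst'[OF integrable_pairI[OF mH bH]] by (simp add: inn)
 have i1': "set_integrable lborel {0<..<T} (%t. deriv \<phi> t *\<^sub>R tint t q)"
  using i1 unfolding set_integrable_def ae .
 have i2: "set_integrable lborel {0<..<T} (%t. deriv \<phi> t *\<^sub>R c)"
  by (rule set_integrable_subset[OF borel_integrable_atLeastAtMost'[of 0 T]]) (auto intro!: continuous_intros continuous_on_subset[OF f(3)])
 have ftc: "(LI t. indicator {s..T} t *\<^sub>R deriv \<phi> t) = \<phi> T - \<phi> s" if "s \<le> T" for s
  by (rule integral_FTC_Icc[OF that has_field_derivative_at_within[OF f(1), unfolded has_real_derivative_iff_has_vector_derivative] continuous_on_subset[OF f(3) subset_UNIV]])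
 have e2: "(LINT t:{0<..<T}|lborel. deriv \<phi> t *\<^sub>R c) = 0"
 proof -
  have "(LINT t:{0<..<T}|lborel. deriv \<phi> t *\<^sub>R c) = (LI t. (indicator {0..T} t *\<^sub>R deriv \<phi> t) *\<^sub>R c)"
   unfolding set_lebesgue_integral_def ae[symmetric] by simp
  also have "\<dots> = (LI t. indicator {0..T} t *\<^sub>R deriv \<phi> t) *\<^sub>R c"
   using borel_integrable_atLeastAtMost'[OF continuous_on_subset[OF f(3)], of 0 T] unfolding set_integrable_def by (intro integral_scaleR_left) auto
  finally show ?thesis using ftc[of 0] T by (simp add: z)
 qed
 have "(LINT t:{0<..<T}|lborel. deriv \<phi> t *\<^sub>R tint t q) = (LI t s. H t s)"
  unfolding inn ae by (simp add: set_lebesgue_integral_def)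
 also have "\<dots> = (LI s t. H t s)" by (rule Fubini_bochner[OF mH bH])
 also have "\<dots> = (LI s. - (indicator {0<..<T} s *\<^sub>R (\<phi> s *\<^sub>R q s)))"
 proof (rule LI_cong[OF refl])
  fix s
  show "(LI t. H t s) = - (indicator {0<..<T} s *\<^sub>R (\<phi> s *\<^sub>R q s))"
  proof (cases "s \<in> {0..T}")
   case True
   have "(LI t. H t s) = (LI t. (indicator {s..T} t *\<^sub>R deriv \<phi> t) *\<^sub>R q s)"
    by (intro LI_cong) (use True in \<open>auto simp: H_def h_def split: split_indicator\<close>)
   also have "\<dots> = (\<phi> T - \<phi> s) *\<^sub>R q s"
    using borel_integrable_atLeastAtMost'[OF continuous_on_subset[OF f(3)], of s T] True ftc[of s] unfolding set_integrable_def by (subst integral_scaleR_left) auto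
   finally show ?thesis using z[of s] z[of T] by (auto split: split_indicator)
  next
   case False
   then have "H t s = 0" for t by (auto simp: H_def h_def)
   then show ?thesis using False by (auto split: split_indicator)
  qed
 qed
 also have "\<dots> = - (LINT t:{0<..<T}|lborel. \<phi> t *\<^sub>R q t)" unfolding set_lebesgue_integral_def by simp
 finally have e1: "(LINT t:{0<..<T}|lborel. deriv \<phi> t *\<^sub>R tint t q) = - (LINT t:{0<..<T}|lborel. \<phi> t *\<^sub>R q t)" .
 show "set_integrable lborel {0<..<T} (%t. deriv \<phi> t *\<^sub>R (c + tint t q))" using set_integral_add(1)[OF i2 i1'] by (simp add: scaleR_add_right)
 show "(LINT t:{0<..<T}|lborel. deriv \<phi> t *\<^sub>R (c + tint t q)) = - (LINT t:{0<..<T}|lborel. \<phi> t *\<^sub>R q t)"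
  using set_integral_add(2)[OF i2 i1'] e1 e2 by (simp add: scaleR_add_right)
qed

text \<open>A bump and its translate have the same integral. The primitive of their difference
  therefore returns to zero and is a test function; its derivative compares averages near a and near
  b.\<close>

lemma test_primitive:
 assumes a: "0 < a" "a \<le> b" "b + \<delta> < T" "0 < \<delta>"
 obtains \<phi> where "test_function_on {0<..<T} \<phi>" "!!t. deriv \<phi> t = bump 1 a (a + \<delta>) t - bump 1 b (b + \<delta>) t"
proof -
 define \<psi> where "\<psi> t = bump 1 a (a + \<delta>) t + (- 1) * bump 1 b (b + \<delta>) t" for t
 have s: "smooth_fun \<psi>" unfolding \<psi>_def[abs_def] by (intro smooth_fun.add smooth_fun.mult smooth_fun.const smooth_bump)
 have c: "continuous_on A \<psi>" for A
  using smooth_fun_deriv(2)[OF s] by (auto intro!: DERIV_isCont continuous_at_imp_continuous_on)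
 have z: "\<psi> t = 0" if "t \<notin> {a<..<b + \<delta>}" for t using that bump_zero[of 1 t] a by (auto simp: \<psi>_def)
 define \<phi> where "\<phi> t = integral {0..t} \<psi>" for t
 have za: "\<phi> t = 0" if "t \<le> a" for t
  unfolding \<phi>_def by (rule integral_unique, rule has_integral_is_0) (use that z in auto)
 have d: "(\<phi> has_field_derivative \<psi> x) (at x)" for x
 proof (cases "x < a")
  case True
  have "((%_. 0) has_field_derivative 0) (at x)" by simp
  then show ?thesis using True z[of x] za by (auto intro: has_field_derivative_transform_within_open[of "%_. 0" _ _ "{..<a}"])
 next
  case False
  have "((%x. integral {0..x} \<psi>) has_real_derivative \<psi> x) (at x within {0..x + 1})"
   by (rule integral_has_real_derivative[OF c]) (use False a in auto)
  then show ?thesis using False a at_within_Icc_at[of 0 x "x + 1"] unfolding \<phi>_def[abs_def] by simp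
 qed
 have dd: "deriv \<phi> = \<psi>" using d by (auto intro: DERIV_imp_deriv)
 have i: "intL (bump 1 a (a + \<delta>))" "intL (bump 1 b (b + \<delta>))"
  by (auto intro!: test_function_integrable(1)[where S = UNIV] test_bump)
 have "(LI t. bump 1 b (b + \<delta>) t) = (LI t. bump 1 b (b + \<delta>) ((b - a) + 1 * t))"
  by (subst lborel_integral_real_affine[where c = 1 and t = "b - a"]) auto
 also have "\<dots> = (LI t. bump 1 a (a + \<delta>) t)" by (simp add: bump_def algebra_simps)
 finally have tot: "(LI t. \<psi> t) = 0" using i by (simp add: \<psi>_def)
 have zb: "\<phi> t = 0" if "b + \<delta> \<le> t" for t
 proof -
  have "\<phi> t = (LINT x:{0..t}|lborel. \<psi> x)" unfolding \<phi>_def by (rule set_borel_integral_eq_integral(2)[symmetric]) (rule borel_integrable_atLeastAtMost'[OF c])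
  also have "\<dots> = (LI x. \<psi> x)" unfolding set_lebesgue_integral_def
   by (intro LI_cong) (use z that a in \<open>auto split: split_indicator\<close>)
  finally show ?thesis using tot by simp
 qed
 have "((deriv ^^ n) \<phi>) field_differentiable (at x)" for n x
  using d[of x] smooth_fun_differentiable[OF s] by (cases n) (auto simp: funpow_Suc_right dd field_differentiable_def simp del: funpow.simps(2))
 then have "test_function_on {0<..<T} \<phi>" unfolding test_function_on_def
  using za zb a by (auto intro!: exI[of _ "{a..b + \<delta>}"])
 then show ?thesis by (rule that) (simp add: dd \<psi>_def)
qed

text \<open>Subtracting the primitive of q leaves a continuous function with vanishing weak
  derivative. Tested with \<open>test_primitive\<close>, its averages over short intervals at a and
  b agree, and continuity shrinks the averages to values.\<close>

lemma du_bois_reymond: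
 fixes p q :: "real \<Rightarrow> 'a::euclidean_space"
 assumes p: "continuous_on {0..T} p" and q: "set_integrable lborel {0..T} q" and T: "0 < T"
  and w: "!!\<phi>. test_function_on {0<..<T} \<phi> ==> (LINT t:{0<..<T}|lborel. deriv \<phi> t *\<^sub>R p t) = - (LINT t:{0<..<T}|lborel. \<phi> t *\<^sub>R q t)"
  and t: "t \<in> {0..T}"
 shows "p t = p 0 + tint t q"
proof -
 define r where "r t = p t - tint t q" for t
 have cr: "continuous_on {0..T} r" unfolding r_def[abs_def] by (intro continuous_intros p continuous_on_tint q)
 have r0: "(LINT t:{0<..<T}|lborel. deriv \<phi> t *\<^sub>R r t) = 0" if \<phi>: "test_function_on {0<..<T} \<phi>" for \<phi>
 proof -
  note b = test_by_parts[OF \<phi> q T, of 0]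
  have i: "set_integrable lborel {0<..<T} (%t. deriv \<phi> t *\<^sub>R p t)"
   by (rule set_integrable_subset[OF borel_integrable_atLeastAtMost'[of 0 T]])
    (auto intro!: continuous_intros p continuous_on_subset[OF test_function_facts(3)[OF \<phi>]])
  show ?thesis using set_integral_diff(2)[OF i b(2)] w[OF \<phi>] b(1) by (simp add: r_def scaleR_diff_right)
 qed
 have eq: "r a = r b" if ab: "0 < a" "a \<le> b" "b < T" for a b
 proof -
  have le: "norm (r a - r b) \<le> 2 * e" if e: "0 < e" for e
  proof -
   have "\<exists>d>0. \<forall>x\<in>{0..T}. dist x c < d \<longrightarrow> dist (r x) (r c) < e" if "c \<in> {0..T}" for c
    using cr that e unfolding continuous_on_iff by blast
   from this[of a] this[of b] obtain d1 d2 where d: "0 < d1" "0 < d2" "!!x. x \<in> {0..T} ==> dist x a < d1 ==> dist (r x) (r a) < e"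
    "!!x. x \<in> {0..T} ==> dist x b < d2 ==> dist (r x) (r b) < e" using ab by auto
   \<comment> \<open>Bumps of width \<delta> stay where r is e-close to its value at a or b, and the
     right one still ends before T.\<close>
   define \<delta> where "\<delta> = min (min d1 d2) (T - b) / 2"
   have \<delta>: "0 < \<delta>" "\<delta> < d1" "\<delta> < d2" "b + \<delta> < T" using d ab by (auto simp: \<delta>_def min_def field_simps)
   define I where "I c = (LI t. bump 1 c (c + \<delta>) t)" for c
   have ib: "intL (bump 1 c (c + \<delta>))" for c by (auto intro!: test_function_integrable(1)[where S = UNIV] test_bump)
   have cb: "continuous_on A (bump 1 c (c + \<delta>))" for A c
    using test_function_facts(2)[OF test_bump[of 1 c "c + \<delta>" UNIV]] continuous_on_subset by auto
   have Ieq: "I b = I a"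
   proof -
    have "I b = (LI t. bump 1 b (b + \<delta>) ((b - a) + 1 * t))" unfolding I_def
     by (subst lborel_integral_real_affine[where c = 1 and t = "b - a"]) auto
    then show ?thesis by (simp add: I_def bump_def algebra_simps)
   qed
   have Ipos: "0 < I a"
   proof -
    have "I a \<noteq> 0"
    proof
     assume "I a = 0"
     then have "AEL t. bump 1 a (a + \<delta>) t = 0" unfolding I_def using integral_nonneg_eq_0_iff_AE[OF ib] bump_bounds by auto
     then have "AEL t. t \<notin> {a<..<a + \<delta>}" by eventually_elim (use bump_pos[of 1] in force)
     then have "emeasure lborel {a<..<a + \<delta>} = 0" using AE_iff_measurable[of "{a<..<a + \<delta>}" lborel "%t. t \<notin> {a<..<a + \<delta>}"] by (auto simp: set_eq_iff)
     then show False using \<delta> by simp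
    qed
    moreover have "0 \<le> I a" unfolding I_def using bump_bounds by (intro LI_nonneg) auto
    ultimately show ?thesis by simp
   qed
   have near: "intL (%t. indicator {0<..<T} t *\<^sub>R (bump 1 c (c + \<delta>) t *\<^sub>R r t))"
    "norm ((LI t. indicator {0<..<T} t *\<^sub>R (bump 1 c (c + \<delta>) t *\<^sub>R r t)) - I c *\<^sub>R r c) \<le> e * I c"
    if c: "0 < c" "c + \<delta> < T" and rc: "!!x. x \<in> {0..T} ==> dist x c \<le> \<delta> ==> norm (r x - r c) \<le> e" for c
   proof -
    have e1: "indicator {0<..<T} t *\<^sub>R (bump 1 c (c + \<delta>) t *\<^sub>R r t) = indicator {c..c + \<delta>} t *\<^sub>R (bump 1 c (c + \<delta>) t *\<^sub>R r t)" for t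
     using bump_zero[of 1 t c "c + \<delta>"] c by (auto split: split_indicator)
    have "set_integrable lborel {c..c + \<delta>} (%t. bump 1 c (c + \<delta>) t *\<^sub>R r t)"
     by (rule borel_integrable_atLeastAtMost') (intro continuous_intros cb continuous_on_subset[OF cr], use c in auto)
    then show i: "intL (%t. indicator {0<..<T} t *\<^sub>R (bump 1 c (c + \<delta>) t *\<^sub>R r t))" unfolding e1 set_integrable_def .
    have D: "(LI t. indicator {0<..<T} t *\<^sub>R (bump 1 c (c + \<delta>) t *\<^sub>R r t)) - I c *\<^sub>R r c
     = (LI t. indicator {0<..<T} t *\<^sub>R (bump 1 c (c + \<delta>) t *\<^sub>R r t) - bump 1 c (c + \<delta>) t *\<^sub>R r c)"
     unfolding I_def using i ib by (subst LI_diff) auto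
    have "norm (LI t. indicator {0<..<T} t *\<^sub>R (bump 1 c (c + \<delta>) t *\<^sub>R r t) - bump 1 c (c + \<delta>) t *\<^sub>R r c) \<le> (LI t. e * bump 1 c (c + \<delta>) t)"
    proof (rule order_trans[OF integral_norm_bound integral_mono])
     fix t
     show "norm (indicator {0<..<T} t *\<^sub>R (bump 1 c (c + \<delta>) t *\<^sub>R r t) - bump 1 c (c + \<delta>) t *\<^sub>R r c) \<le> e * bump 1 c (c + \<delta>) t"
     proof (cases "t \<in> {c<..<c + \<delta>}")
      case True
      then have "norm (r t - r c) \<le> e" using rc[of t] c by (auto simp: dist_real_def)
      then have "bump 1 c (c + \<delta>) t * norm (r t - r c) \<le> bump 1 c (c + \<delta>) t * e" by (rule mult_left_mono) (rule bump_bounds)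
      moreover have "indicator {0<..<T} t *\<^sub>R (bump 1 c (c + \<delta>) t *\<^sub>R r t) - bump 1 c (c + \<delta>) t *\<^sub>R r c = bump 1 c (c + \<delta>) t *\<^sub>R (r t - r c)"
       using True c by (simp add: scaleR_diff_right)
      ultimately show ?thesis using bump_bounds(1)[of 1 c "c + \<delta>" t] by (simp add: mult.commute)
     next
      case False then show ?thesis using bump_zero[of 1 t c "c + \<delta>"] by auto
     qed
    qed (intro integrable_norm LI_int_diff i integrable_scaleR_left integrable_mult_right ib)+
    also have "\<dots> = e * I c" unfolding I_def by (rule integral_mult_right_zero)
    finally show "norm ((LI t. indicator {0<..<T} t *\<^sub>R (bump 1 c (c + \<delta>) t *\<^sub>R r t)) - I c *\<^sub>R r c) \<le> e * I c" unfolding D .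
   qed
   have na: "norm (r x - r a) \<le> e" if "x \<in> {0..T}" "dist x a \<le> \<delta>" for x using d(3)[OF that(1)] that(2) \<delta> by (auto simp: dist_norm)
   have nb: "norm (r x - r b) \<le> e" if "x \<in> {0..T}" "dist x b \<le> \<delta>" for x using d(4)[OF that(1)] that(2) \<delta> by (auto simp: dist_norm)
   have aT: "a + \<delta> < T" "0 < b" using \<delta> ab by auto
   note A = near[OF ab(1) aT(1) na] and Bn = near[OF aT(2) \<delta>(4) nb]
   obtain \<phi> where \<phi>: "test_function_on {0<..<T} \<phi>" "!!t. deriv \<phi> t = bump 1 a (a + \<delta>) t - bump 1 b (b + \<delta>) t"
    by (rule test_primitive[OF ab(1,2) \<delta>(4,1)]) auto
   have eqi: "(LI t. indicator {0<..<T} t *\<^sub>R (bump 1 a (a + \<delta>) t *\<^sub>R r t)) = (LI t. indicator {0<..<T} t *\<^sub>R (bump 1 b (b + \<delta>) t *\<^sub>R r t))"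
    using r0[OF \<phi>(1)] LI_diff[OF A(1) Bn(1)] unfolding set_lebesgue_integral_def \<phi>(2) by (simp add: scaleR_diff_left scaleR_diff_right)
   have "norm (I a *\<^sub>R r b - I a *\<^sub>R r a) \<le> e * I a + e * I a"
    using norm_triangle_le_diff[OF add_mono[OF A(2) Bn(2)]] unfolding eqi Ieq by (simp add: norm_minus_commute)
   moreover have "norm (I a *\<^sub>R r b - I a *\<^sub>R r a) = I a * norm (r a - r b)"
    using Ipos by (metis abs_of_pos norm_minus_commute norm_scaleR scaleR_diff_right)
   ultimately have "I a * norm (r a - r b) \<le> I a * (2 * e)" by (simp add: algebra_simps)
   then show ?thesis using Ipos by simp
  qed
  have "norm (r a - r b) \<le> 0 + e" if "0 < e" for e using that le[of "e / 2"] by simp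
  then have "norm (r a - r b) \<le> 0" by (rule field_le_epsilon)
  then show ?thesis by simp
 qed
 have cl: "closure {0<..<T} = {0..T}" using T by simp
 have half: "r x = r (T / 2)" if "x \<in> {0<..<T}" for x
  using eq[of x "T/2"] eq[of "T/2" x] that T by (cases "x \<le> T / 2") auto
 \<comment> \<open>Test functions see the open interval only; continuity of p up to the ends carries
   the constant value to 0 and T.\<close>
 have "r x = r (T / 2)" if "x \<in> {0..T}" for x
  by (rule continuous_constant_on_closure[of "{0<..<T}" r]) (simp_all only: cl cr half that)
 from this[of t] this[of 0] t T have "r t = r 0" by simp
 then show ?thesis unfolding r_def tint_0 by (simp add: algebra_simps)
qed

section \<open>Transforms of time-dependent functions\<close>

lemma jointly_measurable_extend:
 assumes v: "jointly_measurable T v"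
 shows "jm (%t x. if t \<in> {0..T} then v t x else 0)"
proof -
 have "(%p. if fst p \<in> {0..T} then v (fst p) (snd p) else 0) \<in> bm2"
 proof (subst measurable_If_restrict_space_iff)
  show "{p \<in> space (borel \<Otimes>\<^sub>M borel). fst p \<in> {0..T}} \<in> sets (borel \<Otimes>\<^sub>M (borel::real measure))" by measurable
  have "(%p. (fst p, snd p)) \<in> restrict_space (borel \<Otimes>\<^sub>M borel) {p. fst p \<in> {0..T}} \<rightarrow>\<^sub>M restrict_space borel {0..T} \<Otimes>\<^sub>M (borel::real measure)"
   by (intro measurable_Pair measurable_restrict_space2 measurable_restrict_space1) (auto simp: space_restrict_space)
  from measurable_compose[OF this v[unfolded jointly_measurable_def]]
  show "(%p. v (fst p) (snd p)) \<in> borel_measurable (restrict_space (borel \<Otimes>\<^sub>M borel) {p. fst p \<in> {0..T}}) \<and> (%p. 0) \<in> borel_measurable (restrict_space (borel \<Otimes>\<^sub>M borel) {p. fst p \<notin> {0..T}})"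
   by (simp add: split_beta')
 qed
 then show ?thesis by (simp add: split_beta')
qed

text \<open>The transforms of the truncations of \<open>v t\<close> are jointly measurable, but their rate of convergence depends on \<open>t\<close>.
 Choosing, for every \<open>t\<close>, the least index that guarantees a prescribed accuracy makes the rate uniform
 and keeps measurability.\<close>

lemma joint_fourier:
 assumes v: "jointly_measurable T v"
 obtains G where "jm G" "!!t k. G t (- k) = cnj (G t k)"
  "!!t. t \<in> {0..T} ==> square_integrable (v t) ==> AEL k. fourier (v t) k = G t k"
proof -
 define w where "w t x = (if t \<in> {0..T} then v t x else 0)" for t x
 have jw: "jm w" unfolding w_def by (rule jointly_measurable_extend[OF v])
 define g where "g n t = ft (trunc_fun (w t) (real n))" for n t
 have jg: "jm (g n)" for n
 proof -
  note [measurable (raw)] = measurable_section2[OF jw]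
  show ?thesis unfolding g_def ft_def trunc_fun_def split_beta' by measurable
 qed
 note [measurable (raw)] = measurable_section2[OF jg]
 have gm[measurable]: "g n t \<in> bm" for n t by (rule jm_section[OF jg])
 have herm: "g n t (- k) = cnj (g n t k)" for n t k
  unfolding g_def cnj_ft by (simp add: trunc_fun_def[abs_def])
 let ?q = "%j. (1/4::real) ^ j"
 \<comment> \<open>A Cauchy condition on the truncated transforms instead of their distance to
   \<open>fourier (v t)\<close>: the latter is a choice for every t separately and has no known
   measurability in t, the former is measurable.\<close>
 define Q where "Q j t N \<longleftrightarrow> (\<forall>m\<ge>N. \<forall>m'\<ge>N. nsq (%k. g m t k - g m' t k) \<le> ennreal (?q j))" for j t N
 define \<nu> where "\<nu> j t = (LEAST N. Q j t N)" for j t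
 define u where "u j t = g (\<nu> j t) t" for j t
 have [measurable]: "(%t. nsq (%k. g m t k - g m' t k)) \<in> bm" for m m' unfolding nsq_def by measurable
 have [measurable]: "\<nu> j \<in> borel \<rightarrow>\<^sub>M count_space UNIV" for j unfolding \<nu>_def[abs_def] Q_def by measurable
 have ju: "jm (u j)" for j
 proof -
  have "(%p. g (\<nu> j (fst p)) (fst p) (snd p)) \<in> bm2"
   by (rule measurable_compose_countable[of "%n p. g n (fst p) (snd p)" _ _ "%p. \<nu> j (fst p)"]) measurable
  then show ?thesis by (simp add: u_def split_beta')
 qed
 define S where "S = {t \<in> {0..T}. square_integrable (v t)}"
 have lim: "\<exists>N. \<forall>m\<ge>N. nsq (%k. fourier (v t) k - g m t k) \<le> ennreal e" if t: "t \<in> S" and e: "0 < e" for t e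
 proof -
  have "((%r. nsq (%k. fourier (v t) k - ft (trunc_fun (v t) r) k)) \<longlongrightarrow> 0) at_top"
   by (rule has_fourier_limit[OF has_fourier_fourier]) (use t in \<open>simp add: S_def\<close>)
  then have "((%m. nsq (%k. fourier (v t) k - ft (trunc_fun (v t) (real m)) k)) \<longlongrightarrow> 0) sequentially"
   by (rule filterlim_compose) (rule filterlim_real_sequentially)
  moreover have "w t = v t" using t by (auto simp: w_def S_def)
  ultimately have "eventually (%m. nsq (%k. fourier (v t) k - g m t k) < ennreal e) sequentially"
   unfolding g_def using e by (intro order_tendstoD(2)) auto
  then show ?thesis unfolding eventually_sequentially by (meson less_imp_le)
 qed
 have mf[measurable]: "fourier (v t) \<in> bm" if "t \<in> S" for t
  using has_fourier_L2[OF has_fourier_fourier] that by (auto simp: S_def)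
 have Q\<nu>: "Q j t (\<nu> j t)" if t: "t \<in> S" for j t
 proof -
  obtain N where N: "!!m. m \<ge> N ==> nsq (%k. fourier (v t) k - g m t k) \<le> ennreal (?q j / 4)" using lim[OF t, of "?q j / 4"] by auto
  have "nsq (%k. g m t k - g m' t k) \<le> ennreal (?q j)" if "m \<ge> N" "m' \<ge> N" for m m'
  proof -
   note [measurable] = mf[OF t]
   have "nsq (%k. (fourier (v t) k - g m' t k) - (fourier (v t) k - g m t k)) \<le> ennreal (2 * (?q j / 4) + 2 * (?q j / 4))"
    by (rule nsq_diff_bound(1)) (use N that in auto)
   then show ?thesis by simp
  qed
  then have "Q j t N" by (auto simp: Q_def)
  then show ?thesis unfolding \<nu>_def by (rule LeastI)
 qed
 \<comment> \<open>A higher accuracy implies the lower one, so the least indices increase with j and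
   both fall under condition \<open>Q\<close> for j.\<close>
 have step: "nsq (%k. u (Suc j) t k - u j t k) \<le> ennreal (1 * ?q j)" if t: "t \<in> S" for j t
 proof -
  have "?q (Suc j) \<le> ?q j" by simp
  then have "Q j t (\<nu> (Suc j) t)" using Q\<nu>[OF t, of "Suc j"] unfolding Q_def by (meson ennreal_leI order_trans)
  then have "\<nu> j t \<le> \<nu> (Suc j) t" unfolding \<nu>_def[of j] by (rule Least_le)
  then show ?thesis using Q\<nu>[OF t, of j] by (simp add: Q_def u_def)
 qed
 obtain U where U: "jm U" "!!j t. t \<in> S ==> nsq (%k. u j t k - U t k) \<le> ennreal (4 * 1 * ?q j)" "!!t k. U t (- k) = cnj (U t k)"
  by (rule L2_limit_joint[of u 1 S]) (use ju step herm in \<open>auto simp: u_def\<close>)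
 have [measurable]: "U t \<in> bm" "u j t \<in> bm" for j t by (rule jm_section U ju)+
 have "AEL k. fourier (v t) k = U t k" if t: "t \<in> S" for t
 proof -
  note [measurable] = mf[OF t]
  have "nsq (%k. fourier (v t) k - U t k) = 0"
  proof (rule nsq_geometric_0)
   fix j
   obtain N where N: "!!m. m \<ge> N ==> nsq (%k. fourier (v t) k - g m t k) \<le> ennreal (?q j)" using lim[OF t, of "?q j"] by auto
   let ?m = "max N (\<nu> j t)"
   have 1: "nsq (%k. g ?m t k - u j t k) \<le> ennreal (?q j)" using Q\<nu>[OF t, of j] by (simp add: Q_def u_def)
   have "nsq (%k. (fourier (v t) k - g ?m t k) + (g ?m t k - u j t k)) \<le> ennreal (2 * ?q j + 2 * ?q j)"
    by (rule nsq_diff_bound(2)) (use N[of ?m] 1 in auto)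
   then have 2: "nsq (%k. fourier (v t) k - u j t k) \<le> ennreal (2 * ?q j + 2 * ?q j)" by simp
   have "nsq (%k. (fourier (v t) k - u j t k) + (u j t k - U t k)) \<le> ennreal (2 * (2 * ?q j + 2 * ?q j) + 2 * (4 * 1 * ?q j))"
    by (rule nsq_diff_bound(2)) (rule 2 U(2)[OF t] | simp)+
   then show "nsq (%k. fourier (v t) k - U t k) \<le> ennreal (16 * ?q j)" by simp
  qed
  then have "AEL k. fourier (v t) k - U t k = 0" by (intro nsq_0_AE) auto
  then show ?thesis by simp
 qed
 then show ?thesis using U by (intro that[of U]) (auto simp: S_def)
qed

lemma L2_norm_nsq: "square_integrable f ==> nsq f = ennreal ((L2_norm f)\<^sup>2)" "0 \<le> L2_norm f"
proof -
 assume f: "square_integrable f"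
 have "nsq f = ennreal (LINT x|lborel. (f x)\<^sup>2)"
  unfolding nsq_def by (simp, rule nn_integral_eq_integral) (use f in \<open>auto simp: square_integrable_def\<close>)
 then show "nsq f = ennreal ((L2_norm f)\<^sup>2)" by (simp add: L2_norm_def)
qed (simp add: L2_norm_def)

lemma L2_norm_le: "square_integrable f ==> nsq f \<le> ennreal (c\<^sup>2) ==> 0 \<le> c ==> L2_norm f \<le> c"
 using L2_norm_nsq[of f] by (simp add: power2_le_iff_abs_le ennreal_le_iff)

lemma jointly_measurableI: "jm u ==> jointly_measurable T u" for u :: "real \<Rightarrow> real \<Rightarrow> real"
proof -
 assume j: "jm u"
 have "fst \<in> restrict_space borel {0..T} \<Otimes>\<^sub>M borel \<rightarrow>\<^sub>M (borel :: real measure)"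
  using measurable_compose[OF measurable_fst measurable_restrict_space1[OF measurable_ident]] by simp
 then show ?thesis unfolding jointly_measurable_def split_beta' by (rule measurable_section2[OF j]) measurable
qed

lemma jm_ir:
 assumes "jm U"
 shows "jm (%t. ir (U t))"
proof -
 note [measurable (raw)] = measurable_section2[OF assms]
 show ?thesis unfolding ir_def ft_def split_beta' by measurable
qed

lemma norm_ft_bound:
 assumes "nice Z" "wint (%k. 1 + k\<^sup>2) Z \<le> ennreal C" "0 \<le> C"
 shows "(NN k. ennreal (norm (Z k))) \<le> ennreal (cI + C)" "norm (ft Z x) \<le> cI + C"
proof -
 have "(NN k. ennreal (norm (Z k))) \<le> 2 * (NN k. ennreal (1 * norm (Z k)))"
  by (simp add: mult_2 add_increasing)
 also have "\<dots> \<le> ennreal cI + wint (%k. (1 + k\<^sup>2) * 1\<^sup>2) Z" by (rule L1_of_weight) (use nice_measurable[OF assms(1)] in auto)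
 also have "\<dots> \<le> ennreal cI + ennreal C" using assms(2) by (intro add_left_mono) simp
 finally show 1: "(NN k. ennreal (norm (Z k))) \<le> ennreal (cI + C)" using assms(3) cI(1) by simp
 have i: "intL Z" using assms(1) by (simp add: nice_def)
 have "ennreal (LI k. norm (Z k)) \<le> ennreal (cI + C)" using 1 nn_integral_eq_integral[OF integrable_norm[OF i]] by simp
 then have "(LI k. norm (Z k)) \<le> cI + C" by (rule ennreal_le_iff[THEN iffD1, rotated]) (use assms(3) cI(1) in simp)
 then show "norm (ft Z x) \<le> cI + C" using norm_ft_le[OF i, of x] by linarith
qed

text \<open>Translates an integrated equation between transforms into the notions of the statement.
  The difference of two values is an integral of Z, so the solution is Lipschitz in time with values
  in L^2; integrable transforms turn the equation into one for every single x, to which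
  \<open>test_by_parts\<close> applies.\<close>

lemma evolution_solution:
 assumes j: "jm U" "jm Z" and T: "0 < T" and C: "0 \<le> C"
  and n: "!!t. t \<in> {0..T} ==> nice (U t)" "!!t. t \<in> {0..T} ==> nice (Z t)"
  and b: "!!t. t \<in> {0..T} ==> wint (%k. 1 + k\<^sup>2) (U t) \<le> ennreal C" "!!t. t \<in> {0..T} ==> wint (%k. 1 + k\<^sup>2) (Z t) \<le> ennreal C"
  and eq: "!!t. t \<in> {0..T} ==> AEL k. U t k = U0 k + tint t (%s. Z s k)"
 shows "(%t. ir (U t)) \<in> C_L2 T" "has_weak_time_deriv T (%t. ir (U t)) (%t. ir (Z t))"
proof -
 note [measurable (raw)] = measurable_section2[OF j(1)] measurable_section2[OF j(2)]
 note jI = jm_ir[OF j(1)] jm_ir[OF j(2)]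
 have nU: "nsq (U t) \<le> ennreal C" "nsq (Z t) \<le> ennreal C" if "t \<in> {0..T}" for t
  using b[OF that] nsq_le_wint[of "%k. 1 + k\<^sup>2"] by (auto intro: order_trans)
 have si: "AEL k. set_integrable lborel {0..T} (%s. Z s k)" by (rule AE_time_integrable[OF j(2) _ nU(2)]) (use T in auto)
 have L1: "(%t. ir (X t)) \<in> L1_L2 T" if jX: "jm X" and nX: "!!t. t \<in> {0..T} ==> nice (X t)" and bX: "!!t. t \<in> {0..T} ==> nsq (X t) \<le> ennreal C" for X
 proof -
  have "(\<integral>\<^sup>+t\<in>{0<..<T}. ennreal (L2_norm (ir (X t))) \<partial>lborel) \<le> (NN t. ennreal (sqrt C) * indicator {0<..<T} t)"
  proof (rule nn_integral_mono)
   fix t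
   have "L2_norm (ir (X t)) \<le> sqrt C" if t: "t \<in> {0<..<T}"
    by (rule L2_norm_le[OF square_integrable_ir]) (use nX[of t] bX[of t] nsq_ir_le[OF nX[of t]] t C in \<open>auto intro: order_trans\<close>)
   then show "ennreal (L2_norm (ir (X t))) * indicator {0<..<T} t \<le> ennreal (sqrt C) * indicator {0<..<T} t"
    by (auto split: split_indicator intro: ennreal_leI)
  qed
  also have "\<dots> < \<infinity>" using T by (simp add: nn_integral_cmult ennreal_mult_less_top)
  finally show ?thesis unfolding L1_L2_def using jointly_measurableI[OF jm_ir[OF jX]] nX by (auto intro!: AE_I2 square_integrable_ir)
 qed
 have lip: "L2_norm (%x. ir (U s) x - ir (U t) x) \<le> sqrt C * \<bar>s - t\<bar>" if st: "s \<in> {0..T}" "t \<in> {0..T}" "t \<le> s" for s t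
 proof -
  have r: "rep (%x. ir (U s) x - ir (U t) x) (%k. U s k - U t k)" by (intro rep_diff rep_ir n st)
  have "nsq (%x. ir (U s) x - ir (U t) x) \<le> nsq (%k. U s k - U t k)" by (rule nsq_rep[OF r])
  also have "\<dots> = nsq (%k. LINT r:{t<..s}|lborel. Z r k)"
  proof (rule nsq_cong_AE)
   show "AEL k. norm (U s k - U t k) = norm (LINT r:{t<..s}|lborel. Z r k)"
    using eq[OF st(1)] eq[OF st(2)] si
   proof eventually_elim
    case (elim k)
    have e: "{0..s} = {0..t} \<union> {t<..s}" using st by auto
    have "tint s (%r. Z r k) = tint t (%r. Z r k) + (LINT r:{t<..s}|lborel. Z r k)"
     unfolding e by (rule set_integral_Un) (use st in \<open>auto intro: set_integrable_subset[OF elim(3)]\<close>)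
    then show ?case by (simp add: elim(1,2))
   qed
  qed
  also have "\<dots> \<le> ennreal ((s - t)\<^sup>2 * C)"
   by (rule nsq_set_integral_le[OF j(2)]) (use nU(2) st C in auto)
  also have "(s - t)\<^sup>2 * C = (sqrt C * \<bar>s - t\<bar>)\<^sup>2" using C by (simp add: power_mult_distrib)
  finally show ?thesis by (intro L2_norm_le rep_square_integrable[OF r]) (use C in auto)
 qed
 have lip2: "L2_norm (%x. ir (U s) x - ir (U t) x) \<le> sqrt C * \<bar>s - t\<bar>" if st: "s \<in> {0..T}" "t \<in> {0..T}" for s t
  using lip[of s t] lip[of t s] st by (cases "t \<le> s") (auto simp: L2_norm_def power2_commute abs_minus_commute)
 show "(%t. ir (U t)) \<in> C_L2 T"
  unfolding C_L2_def
 proof (intro CollectI conjI ballI)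
  fix t assume t: "t \<in> {0..T}"
  show "square_integrable (ir (U t))" by (rule square_integrable_ir[OF n(1)[OF t]])
  have "((%s. sqrt C * \<bar>s - t\<bar>) \<longlongrightarrow> sqrt C * \<bar>t - t\<bar>) (at t within {0..T})" by (intro tendsto_intros)
  then have l: "((%s. sqrt C * \<bar>s - t\<bar>) \<longlongrightarrow> 0) (at t within {0..T})" by simp
  show "((%s. L2_norm (%x. ir (U s) x - ir (U t) x)) \<longlongrightarrow> 0) (at t within {0..T})"
   by (rule tendsto_sandwich[OF _ _ tendsto_const l])
    (auto simp: eventually_at_filter L2_norm_nsq(2) intro!: always_eventually lip2 t)
 qed
 have fub: "ft (%k. tint t (%s. Z s k)) y = tint t (%s. ft (Z s) y)" if t: "t \<in> {0..T}" for t y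
 proof -
  define H where "H s k = indicator {0..t} s *\<^sub>R (Z s k * exp (- \<i> * cr (y * k)))" for s k
  have mH: "case_prod H \<in> bm2" unfolding H_def split_beta' by measurable
  have bH: "(NN s k. ennreal (norm (H s k))) < \<infinity>"
  proof -
   have "(NN s k. ennreal (norm (H s k))) \<le> (NN s. ennreal (cI + C) * indicator {0..t} s)"
    using norm_ft_bound(1)[OF n(2) b(2) C] t by (intro nn_integral_mono) (auto simp: H_def norm_mult split: split_indicator)
   also have "\<dots> < \<infinity>" using t by (simp add: nn_integral_cmult ennreal_mult_less_top)
   finally show ?thesis .
  qed
  have "ft (%k. tint t (%s. Z s k)) y = c\<^sub>F * (LI k s. H s k)"
   unfolding ft_def H_def set_lebesgue_integral_def by (simp only: scaleR_conv_of_real mult.assoc[symmetric] integral_mult_left_zero)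
  also have "(LI k s. H s k) = (LI s k. H s k)" by (rule Fubini_bochner[OF mH bH, symmetric])
  also have "c\<^sub>F * \<dots> = tint t (%s. ft (Z s) y)"
   unfolding set_lebesgue_integral_def integral_mult_right_zero[symmetric]
   by (intro LI_cong) (auto simp: ft_def H_def split: split_indicator)
  finally show ?thesis .
 qed
 \<comment> \<open>Valid for every x and not only almost everywhere, because the integral defining
   \<open>ft\<close> ignores null sets of frequencies.\<close>
 have rep0: "ir (U t) x = ir (U 0) x + tint t (%s. ir (Z s) x)" if t: "t \<in> {0..T}" for t x
 proof -
  have t0: "0 \<in> {0..T}" using T by simp
  have "cr (ir (U t) x - ir (U 0) x) = ft (U t) (- x) - ft (U 0) (- x)"
   using of_real_ir[OF n(1)[OF t]] of_real_ir[OF n(1)[OF t0]] by simp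
  also have "\<dots> = ft (%k. U t k - U 0 k) (- x)" using n(1)[OF t] n(1)[OF t0] by (subst ft_diff) (auto simp: nice_def)
  also have "\<dots> = ft (%k. tint t (%s. Z s k)) (- x)"
  proof (subst ft_cong_AE[of _ "%k. tint t (%s. Z s k)"])
   show "AEL k. U t k - U 0 k = tint t (%s. Z s k)" using eq[OF t] eq[OF t0]
   proof eventually_elim
    case (elim k) then show ?case using tint_0[of "%s. Z s k"] by simp
   qed
  qed (use jm_section[OF jm_tint[OF j(2)]] jm_section[OF j(1)] in auto)
  also have "\<dots> = tint t (%s. cr (ir (Z s) x))"
   unfolding fub[OF t] by (rule set_lebesgue_integral_cong) (use t of_real_ir[OF n(2)] in auto)
  also have "\<dots> = cr (tint t (%s. ir (Z s) x))"
   unfolding set_lebesgue_integral_def by (subst integral_complex_of_real[symmetric]) (simp add: scaleR_conv_of_real)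
  finally show ?thesis unfolding of_real_eq_iff by simp
 qed
 have zi: "set_integrable lborel {0..T} (%s. ir (Z s) x)" for x
  unfolding set_integrable_def
 proof (rule LI_int_bound[of lborel "%s. indicator {0..T} s * (cI + C)"])
  show "intL (%s. indicator {0..T} s * (cI + C))" using T by (intro integrable_mult_left integrable_real_indicator) auto
  show "(%s. indicator {0..T} s *\<^sub>R ir (Z s) x) \<in> borel_measurable lborel" using measurable_section2[OF jI(2)] by measurable
  show "AEL s. norm (indicator {0..T} s *\<^sub>R ir (Z s) x) \<le> norm (indicator {0..T} s * (cI + C))"
  proof (intro AE_I2)
   fix s
   have "\<bar>ir (Z s) x\<bar> \<le> cI + C" if "s \<in> {0..T}"
    using norm_ft_bound(2)[OF n(2)[OF that] b(2)[OF that] C, of "- x"] abs_Re_le_cmod[of "ft (Z s) (- x)"] by (simp add: ir_def)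
   then show "norm (indicator {0..T} s *\<^sub>R ir (Z s) x) \<le> norm (indicator {0..T} s * (cI + C))" by (auto split: split_indicator)
  qed
 qed
 show "has_weak_time_deriv T (%t. ir (U t)) (%t. ir (Z t))"
  unfolding has_weak_time_deriv_def
 proof (intro conjI allI impI AE_I2)
  show "(%t. ir (U t)) \<in> L1_L2 T" "(%t. ir (Z t)) \<in> L1_L2 T" using L1 j n nU by auto
  fix \<phi> x assume \<phi>: "test_function_on {0<..<T} \<phi>"
  have "(LINT t:{0<..<T}|lborel. deriv \<phi> t * ir (U t) x) = (LINT t:{0<..<T}|lborel. deriv \<phi> t *\<^sub>R (ir (U 0) x + tint t (%s. ir (Z s) x)))"
   by (rule set_lebesgue_integral_cong) (auto simp: rep0[symmetric])
  then show "(LINT t:{0<..<T}|lborel. deriv \<phi> t * ir (U t) x) = - (LINT t:{0<..<T}|lborel. \<phi> t * ir (Z t) x)"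
   using test_by_parts(1)[OF \<phi> zi T] by simp
 qed
qed

section \<open>Existence\<close>

lemma Hs_wint:
 assumes F: "AEL k. fourier u k = F k" and [measurable]: "F \<in> bm" "w \<in> bm"
  and w: "!!k. \<bar>k\<bar> powr (2 * s) = w k" and u: "square_integrable u"
 shows "u \<in> Hs s ==> wint (%k. 1 + w k) F = ennreal ((Hs_norm s u)\<^sup>2)"
  and "wint (%k. 1 + w k) F \<le> ennreal C ==> 0 \<le> C ==> u \<in> Hs s \<and> Hs_norm s u \<le> sqrt C"
proof -
 have [measurable]: "fourier u \<in> bm" using has_fourier_L2[OF has_fourier_fourier[OF u]] by simp
 have w0: "0 \<le> 1 + w k" for k using w[of k] by (metis add_nonneg_nonneg powr_ge_zero zero_le_one)
 have e: "wint (%k. 1 + w k) F = wint (%k. 1 + w k) (fourier u)" by (rule wint_cong_AE) (use F in \<open>auto elim: eventually_mono\<close>)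
 have n2: "(Hs_norm s u)\<^sup>2 = (LINT k|lborel. (1 + w k) * (norm (fourier u k))\<^sup>2)" unfolding Hs_norm_def w
  using w0 by (intro real_sqrt_pow2 LI_nonneg) auto
 show "wint (%k. 1 + w k) F = ennreal ((Hs_norm s u)\<^sup>2)" if "u \<in> Hs s"
  unfolding e n2 by (rule nn_integral_eq_integral) (use that w0 in \<open>auto simp: Hs_def w\<close>)
 assume b: "wint (%k. 1 + w k) F \<le> ennreal C" and C: "0 \<le> C"
 have fin: "wint (%k. 1 + w k) (fourier u) < \<infinity>" using b unfolding e by (auto intro: le_less_trans)
 note r = wint_real[OF _ _ w0 fin]
 have "u \<in> Hs s" using r(1) u by (simp add: Hs_def w)
 moreover have "(LINT k|lborel. (1 + w k) * (norm (fourier u k))\<^sup>2) \<le> C" using b C r(2) unfolding e by (simp add: ennreal_le_iff)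
 then have "Hs_norm s u \<le> sqrt C" unfolding Hs_norm_def w by (rule real_sqrt_le_mono)
 ultimately show "u \<in> Hs s \<and> Hs_norm s u \<le> sqrt C" ..
qed

lemma powr_9: "\<bar>k\<bar> powr (2 * (9 / 2)) = \<bar>k\<bar> ^ 9" and powr_6: "\<bar>k\<bar> powr (2 * 3) = k ^ 6" for k :: real
 by (cases "k = 0"; simp add: powr_numeral)+

context wave_params
begin

text \<open>The energy weight of F is comparable from both sides with 1 + |k|^9 once 1 is added:
  boundedness of the energy is the same as boundedness in H^4.5 and H^3.\<close>

lemma wt_lam_9: "\<bar>k\<bar> ^ 9 \<le> (1 / \<beta>) * (wt k * lam \<beta> k)" "wt k * lam \<beta> k \<le> (2 + 2 * \<beta>) * (1 + \<bar>k\<bar> ^ 9)"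
proof -
 show "\<bar>k\<bar> ^ 9 \<le> (1 / \<beta>) * (wt k * lam \<beta> k)" using wt_lam_ge(2)[OF \<beta>, of k] \<beta> by (simp add: pos_le_divide_eq mult.commute)
 have p: "\<bar>k\<bar> \<le> 1 + \<bar>k\<bar> ^ 9" "\<bar>k\<bar> ^ 3 \<le> 1 + \<bar>k\<bar> ^ 9" "\<bar>k\<bar> ^ 7 \<le> 1 + \<bar>k\<bar> ^ 9" "\<bar>k\<bar> ^ 9 \<le> 1 + \<bar>k\<bar> ^ 9"
  using abs_pow_le[of 1 9 k] abs_pow_le[of 3 9 k] abs_pow_le[of 7 9 k] by auto
 have "(1 + x ^ 6) * (x + \<beta> * x ^ 3) = x + x ^ 7 + \<beta> * (x ^ 3 + x ^ 9)" for x by algebra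
 from this[of "\<bar>k\<bar>"] have "wt k * lam \<beta> k = \<bar>k\<bar> + \<bar>k\<bar> ^ 7 + \<beta> * (\<bar>k\<bar> ^ 3 + \<bar>k\<bar> ^ 9)"
  by (simp add: wt_def lam_def)
 also have "\<dots> \<le> 2 * (1 + \<bar>k\<bar> ^ 9) + \<beta> * (2 * (1 + \<bar>k\<bar> ^ 9))"
  using p \<beta> by (intro add_mono mult_left_mono) auto
 finally show "wt k * lam \<beta> k \<le> (2 + 2 * \<beta>) * (1 + \<bar>k\<bar> ^ 9)" by (simp add: algebra_simps)
qed

lemma hi_weight9:
 assumes h: "hi \<beta> M F V"
 shows "wint (%k. 1 + \<bar>k\<bar> ^ 9) F \<le> ennreal ((1 + 1 / \<beta>) * M)"
proof (rule hi_weightF[OF h \<beta>])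
 fix k
 have "0 \<le> wt k * lam \<beta> k" using \<beta> by simp
 moreover have "0 < 1 / \<beta>" using \<beta> by simp
 moreover have "(1 + 1 / \<beta>) * (wt k * lam \<beta> k + 1) = wt k * lam \<beta> k + 1 + (1 / \<beta>) * (wt k * lam \<beta> k) + 1 / \<beta>" by (simp add: algebra_simps)
 ultimately show "1 + \<bar>k\<bar> ^ 9 \<le> (1 + 1 / \<beta>) * (wt k * lam \<beta> k + 1)" using wt_lam_9(1)[of k] by linarith
qed (use \<beta> in auto)

lemma hi_nice:
 assumes h: "hi \<beta> M F V" and M: "0 \<le> M"
 shows "nice F" "nice V" "nice (R F V)" "wint (%k. 1 + k\<^sup>2) F \<le> ennreal (8 * M)" "wint (%k. 1 + k\<^sup>2) V \<le> ennreal (8 * M)"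
proof -
 note f = hi_facts[OF h \<beta> M]
 have le: "1 + k\<^sup>2 \<le> (1 + k\<^sup>2) ^ 3" for k :: real using power_increasing[of 1 3 "1 + k\<^sup>2"] by simp
 show w: "wint (%k. 1 + k\<^sup>2) F \<le> ennreal (8 * M)" "wint (%k. 1 + k\<^sup>2) V \<le> ennreal (8 * M)"
  using S3_weight[OF f(1) _ f(5) _ le] S3_weight[OF f(2) _ f(6) _ le] by auto
 show "nice F" "nice V" using w f(1-4) by (auto intro!: niceI le_less_trans[OF w(1)] le_less_trans[OF w(2)])
 show "nice (R F V)"
 proof (rule niceI)
  show "R F V (- k) = cnj (R F V k)" for k by (rule R_cong_hermitian) (rule f)+
  show "wint (%k. 1 + k\<^sup>2) (R F V) < \<infinity>" using R_weight[OF h M] by (auto intro: le_less_trans)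
 qed (rule R_measurable f)+
qed

text \<open>The weights |k|^9 for F and (1 + k^2)^3 for V leave room for 1 + k^2 after each
  multiplier of the equation, so every intermediate transform is \<open>nice\<close>.\<close>

lemma rep_wave_hi:
 assumes h: "hi \<beta> M F V" and M: "0 \<le> M" and u: "rep u F" and v: "rep v V"
 shows "rep (wave_rhs \<epsilon> \<alpha> \<beta> u v) (R F V)"
proof (rule rep_wave_rhs[OF u v])
 note f = hi_facts[OF h \<beta> M]
 have F9: "wint (%k. 1 + \<bar>k\<bar> ^ 9) F < \<infinity>" using hi_weight9[OF h] by (auto intro: le_less_trans)
 have V3: "wint (%k. (1 + k\<^sup>2) ^ 3) V < \<infinity>" using f(6) unfolding S3_def by (auto intro: le_less_trans)
 have a: "\<bar>k\<bar> ^ m \<le> 1 + \<bar>k\<bar> ^ 9" if "m \<le> 9" for m and k :: real using abs_pow_le[OF that] .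
 have e: "k\<^sup>2 = \<bar>k\<bar> ^ 2" for k :: real by simp
 show "nice (%k. cr \<bar>k\<bar> * F k)"
 proof (rule niceI_weight[OF f(1) _ f(3) _ F9, where C = 2])
  fix k :: real
  have "(1 + k\<^sup>2) * (norm (cr \<bar>k\<bar>))\<^sup>2 = \<bar>k\<bar> ^ 2 + \<bar>k\<bar> ^ 4" by (simp add: algebra_simps flip: power_add)
  also have "\<dots> \<le> 2 * (1 + \<bar>k\<bar> ^ 9)" using a[of 2 k] a[of 4 k] by simp
  finally show "(1 + k\<^sup>2) * (norm (cr \<bar>k\<bar>))\<^sup>2 \<le> 2 * (1 + \<bar>k\<bar> ^ 9)" .
 qed auto
 show "nice (%k. cr (\<bar>k\<bar> ^ 3) * F k)"
 proof (rule niceI_weight[OF f(1) _ f(3) _ F9, where C = 2])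
  fix k :: real
  have "(1 + k\<^sup>2) * (norm (cr (\<bar>k\<bar> ^ 3)))\<^sup>2 = \<bar>k\<bar> ^ 6 + \<bar>k\<bar> ^ 8"
   by (simp add: norm_power algebra_simps flip: power_mult power_add)
  also have "\<dots> \<le> 2 * (1 + \<bar>k\<bar> ^ 9)" using a[of 6 k] a[of 8 k] by simp
  finally show "(1 + k\<^sup>2) * (norm (cr (\<bar>k\<bar> ^ 3)))\<^sup>2 \<le> 2 * (1 + \<bar>k\<bar> ^ 9)" .
 qed auto
 have c: "(1 + k\<^sup>2) * (k\<^sup>2) ^ n \<le> 1 * (1 + k\<^sup>2) ^ 3" if "n \<le> 2" for n and k :: real
 proof -
  have "(k\<^sup>2) ^ n \<le> (1 + k\<^sup>2) ^ n" by (rule power_mono) auto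
  also have "\<dots> \<le> (1 + k\<^sup>2) ^ 2" by (rule power_increasing) (use that in auto)
  finally have "(1 + k\<^sup>2) * (k\<^sup>2) ^ n \<le> (1 + k\<^sup>2) * (1 + k\<^sup>2) ^ 2" by (rule mult_left_mono) simp
  then show ?thesis by (simp add: power3_eq_cube power2_eq_square)
 qed
 show "nice (%k. \<i> * cr k * V k)"
  by (rule niceI_weight[OF f(2) _ f(4) _ V3, where C = 1]) (use c[of 1] in \<open>auto simp: norm_mult\<close>)
 have "nice (%k. (cr \<bar>k\<bar> * (\<i> * cr k)) * V k)"
  by (rule niceI_weight[OF f(2) _ f(4) _ V3, where C = 1]) (use c[of 2] in \<open>auto simp: norm_mult power_mult_distrib power2_eq_square\<close>)
 then show "nice (%k. cr \<bar>k\<bar> * (\<i> * cr k * V k))" by (simp add: mult.assoc)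
 show "nice (Qf F V)"
 proof (rule niceI)
  show "Qf F V (- k) = cnj (Qf F V k)" for k by (rule Qf_hermitian) (rule f)+
  show "wint (%k. 1 + k\<^sup>2) (Qf F V) < \<infinity>" using Qf_weight_hi[OF h M] by (auto intro: le_less_trans)
 qed (rule Qf_measurable f)+
qed

lemma hi_Hs:
 assumes h: "hi \<beta> M F V" and M: "0 \<le> M" and u: "rep u F" and v: "rep v V"
 shows "u \<in> Hs (9/2) \<and> Hs_norm (9/2) u \<le> sqrt ((1 + 1 / \<beta>) * M)" "v \<in> Hs 3 \<and> Hs_norm 3 v \<le> sqrt M"
proof -
 note f = hi_facts[OF h \<beta> M]
 show "u \<in> Hs (9/2) \<and> Hs_norm (9/2) u \<le> sqrt ((1 + 1 / \<beta>) * M)"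
  by (rule Hs_wint(2)[OF rep_fourier[OF u] f(1) _ powr_9 rep_square_integrable[OF u] hi_weight9[OF h]]) (use M \<beta> in auto)
 have "wint (%k. 1 + k ^ 6) V \<le> ennreal (1 * M)" by (rule hi_weightV[OF h \<beta>]) (auto simp: wt_def)
 then show "v \<in> Hs 3 \<and> Hs_norm 3 v \<le> sqrt M"
  using M by (intro Hs_wint(2)[OF rep_fourier[OF v] f(2) _ powr_6 rep_square_integrable[OF v]]) auto
qed

definition CH :: "real \<Rightarrow> real" where "CH C = (4 + 2 * \<beta>) * C\<^sup>2"

lemma Hs_hi:
 assumes u: "u \<in> Hs (9/2)" "Hs_norm (9/2) u \<le> C" and v: "v \<in> Hs 3" "Hs_norm 3 v \<le> C"
  and F: "AEL k. fourier u k = F k" "F \<in> bm" "!!k. F (- k) = cnj (F k)"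
  and V: "AEL k. fourier v k = V k" "V \<in> bm" "!!k. V (- k) = cnj (V k)"
 shows "hi \<beta> (CH C) F V"
proof -
 note [measurable] = F(2) V(2)
 have sq: "square_integrable u" "square_integrable v" using u v by (auto simp: Hs_def)
 have n0: "0 \<le> Hs_norm (9/2) u" "0 \<le> Hs_norm 3 v" by (simp_all add: Hs_norm_def)
 have a: "wint (%k. 1 + \<bar>k\<bar> ^ 9) F \<le> ennreal (C\<^sup>2)"
  unfolding Hs_wint(1)[OF F(1,2) _ powr_9 sq(1) u(1), simplified] using u(2) n0 by (intro ennreal_leI power_mono)
 have b: "wint (%k. 1 + k ^ 6) V \<le> ennreal (C\<^sup>2)"
  unfolding Hs_wint(1)[OF V(1,2) _ powr_6 sq(2) v(1), simplified] using v(2) n0 by (intro ennreal_leI power_mono)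
 have "(NN k. ennreal (edens \<beta> F V k)) \<le> (NN k. ennreal ((1 + k ^ 6) * (norm (V k))\<^sup>2) + ennreal ((3 + 2 * \<beta>) * (1 + \<bar>k\<bar> ^ 9) * (norm (F k))\<^sup>2))"
 proof (rule nn_integral_mono)
  fix k
  have "wt k * lam \<beta> k + 1 \<le> (3 + 2 * \<beta>) * (1 + \<bar>k\<bar> ^ 9)" using wt_lam_9(2)[of k] zero_le_power[OF abs_ge_zero, of k 9] unfolding distrib_left distrib_right by linarith
  then have "(wt k * lam \<beta> k + 1) * (norm (F k))\<^sup>2 \<le> (3 + 2 * \<beta>) * (1 + \<bar>k\<bar> ^ 9) * (norm (F k))\<^sup>2" by (rule mult_right_mono) simp
  then have "edens \<beta> F V k \<le> (1 + k ^ 6) * (norm (V k))\<^sup>2 + (3 + 2 * \<beta>) * (1 + \<bar>k\<bar> ^ 9) * (norm (F k))\<^sup>2"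
   by (simp add: edens_def wt_def algebra_simps)
  then have "ennreal (edens \<beta> F V k) \<le> ennreal ((1 + k ^ 6) * (norm (V k))\<^sup>2 + (3 + 2 * \<beta>) * (1 + \<bar>k\<bar> ^ 9) * (norm (F k))\<^sup>2)" by (rule ennreal_leI)
  also have "\<dots> = ennreal ((1 + k ^ 6) * (norm (V k))\<^sup>2) + ennreal ((3 + 2 * \<beta>) * (1 + \<bar>k\<bar> ^ 9) * (norm (F k))\<^sup>2)"
   by (rule ennreal_plus) (use \<beta> in auto)
  finally show "ennreal (edens \<beta> F V k) \<le> \<dots>" .
 qed
 also have "\<dots> = wint (%k. 1 + k ^ 6) V + wint (%k. (3 + 2 * \<beta>) * (1 + \<bar>k\<bar> ^ 9)) F" by (rule nn_integral_add) measurable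
 also have "wint (%k. (3 + 2 * \<beta>) * (1 + \<bar>k\<bar> ^ 9)) F = ennreal (3 + 2 * \<beta>) * wint (%k. 1 + \<bar>k\<bar> ^ 9) F" by (rule wint_cmult) (use \<beta> in auto)
 also have "wint (%k. 1 + k ^ 6) V + \<dots> \<le> ennreal (C\<^sup>2) + ennreal (3 + 2 * \<beta>) * ennreal (C\<^sup>2)"
  by (intro add_mono mult_left_mono a b) auto
 also have "\<dots> = ennreal (C\<^sup>2 + (3 + 2 * \<beta>) * C\<^sup>2)" using \<beta> by (subst ennreal_mult[symmetric]) (auto simp del: distrib_right_numeral)
 also have "C\<^sup>2 + (3 + 2 * \<beta>) * C\<^sup>2 = CH C" by (simp add: CH_def algebra_simps)
 finally show ?thesis using F V by (simp add: hi_def)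
qed

text \<open>The transform \<open>fourier f0\<close> is hermitian only almost everywhere. A
  representative that is hermitian at every k comes from \<open>joint_fourier\<close>, applied to
  the data as functions constant in time.\<close>

lemma initial_data:
 assumes f: "f0 \<in> Hs (9/2)" "f1 \<in> Hs 3"
 obtains F0 V0 M where "hi \<beta> M F0 V0" "0 \<le> M" "rep f0 F0" "rep f1 V0"
proof -
 have sq: "square_integrable f0" "square_integrable f1" using f by (auto simp: Hs_def)
 have "jm (%t. f0)" "jm (%t. f1)" using sq by (auto simp: square_integrable_def split_beta')
 note jm = this[THEN jointly_measurableI]
 obtain G where G: "jm G" "!!t k. G t (- k) = cnj (G t k)" "!!t. t \<in> {0..0} ==> square_integrable f0 ==> AEL k. fourier f0 k = G t k"
  by (rule joint_fourier[OF jm(1)]) blast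
 obtain H where H: "jm H" "!!t k. H t (- k) = cnj (H t k)" "!!t. t \<in> {0..0} ==> square_integrable f1 ==> AEL k. fourier f1 k = H t k"
  by (rule joint_fourier[OF jm(2)]) blast
 define C where "C = max (Hs_norm (9/2) f0) (Hs_norm 3 f1)"
 have ae: "AEL k. fourier f0 k = G 0 k" "AEL k. fourier f1 k = H 0 k" using G(3)[of 0] H(3)[of 0] sq by auto
 have h: "hi \<beta> (CH C) (G 0) (H 0)"
  by (rule Hs_hi[OF f(1) _ f(2) _ ae(1) jm_section[OF G(1)] G(2) ae(2) jm_section[OF H(1)] H(2)]) (auto simp: C_def)
 have "0 \<le> CH C" using \<beta> by (simp add: CH_def)
 note n = hi_nice[OF h this]
 show ?thesis by (rule that[OF h \<open>0 \<le> CH C\<close> repI[OF sq(1) n(1) ae(1)] repI[OF sq(2) n(2) ae(2)]])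
qed

text \<open>The solution, its derivative and its second derivative are the inverse transforms of F,
  V and R(F, V). The first equation is used at the H^1 level for F and V, the second one for V and
  R, each through \<open>evolution_solution\<close>.\<close>

lemma existence:
 assumes h0: "hi \<beta> M0 F0 V0" and M0: "0 \<le> M0" and r0: "rep f0 F0" "rep f1 V0" and T: "T = 1 / K1 (M0 + 1)"
 shows "\<exists>f ft. ivp_solution \<epsilon> \<alpha> \<beta> f0 f1 T f ft \<and> f \<in> Linf_Hs T (9/2) \<and> ft \<in> Linf_Hs T 3"
proof -
 let ?M = "M0 + 1"
 have M: "0 \<le> ?M" using M0 by simp
 have T0: "0 < T" "0 \<in> {0..T}" using K1_pos[OF M] T by auto
 obtain F V where FV: "jm F" "jm V" "!!t. t \<in> {0..T} ==> hi \<beta> ?M (F t) (V t)"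
  "!!t k. F t (- k) = cnj (F t k)" "!!t k. V t (- k) = cnj (V t k)"
  "!!t. t \<in> {0..T} ==> AEL k. F t k = F0 k + tint t (%s. V s k)"
  "!!t. t \<in> {0..T} ==> AEL k. V t k = V0 k + tint t (%s. R (F s) (V s) k)"
  by (rule fourier_solution[of F0 V0 M0 T]) (use h0 M0 T in \<open>auto simp: hi_def\<close>)
 note n = hi_nice[OF FV(3) M] and w = R_weight[OF FV(3) M]
 let ?C = "8 * ?M + CR ?M"
 have C: "0 \<le> ?C" "ennreal (8 * ?M) \<le> ennreal ?C" "ennreal (CR ?M) \<le> ennreal ?C" using M CR_nonneg[OF M] by (auto intro!: ennreal_leI)
 note jR = R_jm[OF FV(1,2)]
 have e1: "(%t. ir (F t)) \<in> C_L2 T" "has_weak_time_deriv T (%t. ir (F t)) (%t. ir (V t))"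
  by (rule evolution_solution[OF FV(1,2) T0(1) C(1) n(1) n(2) order_trans[OF n(4) C(2)] order_trans[OF n(5) C(2)] FV(6)], assumption+)+
 have e2: "(%t. ir (V t)) \<in> C_L2 T" "has_weak_time_deriv T (%t. ir (V t)) (%t. ir (R (F t) (V t)))"
  by (rule evolution_solution[OF FV(2) jR T0(1) C(1) n(2) n(3) order_trans[OF n(5) C(2)] order_trans[OF w C(3)] FV(7)], assumption+)+
 have r: "rep (ir (F t)) (F t)" "rep (ir (V t)) (V t)" if "t \<in> {0..T}" for t using n[OF that] by (auto intro: rep_ir)
 have wave: "AEL x. ir (R (F t) (V t)) x = wave_rhs \<epsilon> \<alpha> \<beta> (ir (F t)) (ir (V t)) x" if t: "t \<in> {0..T}" for t
  by (rule rep_AE_eq[OF rep_ir[OF n(3)[OF t]] rep_wave_hi[OF FV(3)[OF t] M r[OF t]]])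
 have "AEL k. F 0 k = F0 k" using FV(6)[OF T0(2)]
 proof eventually_elim
  case (elim k) then show ?case using tint_0[of "%s. V s k"] by simp
 qed
 then have i0: "AEL x. ir (F 0) x = f0 x" by (intro rep_AE_eq[OF rep_cong[OF r(1)[OF T0(2)] _ rep_nice[OF r0(1)]] r0(1)])
 have "AEL k. V 0 k = V0 k" using FV(7)[OF T0(2)]
 proof eventually_elim
  case (elim k) then show ?case using tint_0[of "%s. R (F s) (V s) k"] by simp
 qed
 then have i1: "AEL x. ir (V 0) x = f1 x" by (intro rep_AE_eq[OF rep_cong[OF r(2)[OF T0(2)] _ rep_nice[OF r0(2)]] r0(2)])
 have "ivp_solution \<epsilon> \<alpha> \<beta> f0 f1 T (%t. ir (F t)) (%t. ir (V t))"
  unfolding ivp_solution_def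
 proof (intro conjI exI[of _ "%t. ir (R (F t) (V t))"])
  show "AEL t. t \<in> {0<..<T} \<longrightarrow> (AEL x. ir (R (F t) (V t)) x = wave_rhs \<epsilon> \<alpha> \<beta> (ir (F t)) (ir (V t)) x)"
   by (rule AE_I2) (use wave in simp)
 qed (rule e1 e2 i0 i1)+
 moreover have "(%t. ir (F t)) \<in> Linf_Hs T (9/2)" "(%t. ir (V t)) \<in> Linf_Hs T 3"
  unfolding Linf_Hs_def using hi_Hs[OF FV(3) M r]
  by (intro CollectI conjI jointly_measurableI jm_ir FV(1) exI[of _ "sqrt ((1 + 1 / \<beta>) * ?M)"] AE_I2, simp)
   (use hi_Hs[OF FV(3) M r] in \<open>intro CollectI conjI jointly_measurableI jm_ir FV(2) exI[of _ "sqrt ?M"] AE_I2, simp\<close>)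
 ultimately show ?thesis by blast
qed

end

section \<open>Uniqueness\<close>

lemma L2_pair:
 fixes h :: cfun
 assumes f: "square_integrable f" and [measurable]: "h \<in> bm" and c: "nsq h = ennreal (c\<^sup>2)" "0 \<le> c"
 shows "intL (%x. cr (f x) * h x)"
  "(NN x. ennreal (norm (cr (f x) * h x))) \<le> ennreal (L2_norm f * c)"
  "norm (LI x. cr (f x) * h x) \<le> L2_norm f * c"
proof -
 have [measurable]: "f \<in> bm" using f by (simp add: square_integrable_def)
 have n: "nsq (%x. cr (f x)) = ennreal ((L2_norm f)\<^sup>2)" using L2_norm_nsq(1)[OF f] by (simp add: nsq_def)
 show i: "intL (%x. cr (f x) * h x)" by (rule integrable_L2_mult) (use n c in auto)
 let ?I = "LI x. norm (cr (f x) * h x)"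
 have e: "(NN x. ennreal (norm (cr (f x) * h x))) = ennreal ?I" by (rule nn_integral_eq_integral) (use i in auto)
 have "(ennreal ?I)\<^sup>2 \<le> ennreal ((L2_norm f)\<^sup>2) * ennreal (c\<^sup>2)" using nsq_pair[of "%x. cr (f x)" h] unfolding e n c by simp
 then have "ennreal (?I\<^sup>2) \<le> ennreal ((L2_norm f * c)\<^sup>2)" by (simp add: ennreal_power ennreal_mult power_mult_distrib)
 then have "?I\<^sup>2 \<le> (L2_norm f * c)\<^sup>2" by (simp add: ennreal_le_iff)
 then have I: "?I \<le> L2_norm f * c" by (rule power2_le_imp_le) (use c L2_norm_nsq(2) in auto)
 then show "(NN x. ennreal (norm (cr (f x) * h x))) \<le> ennreal (L2_norm f * c)" unfolding e by (rule ennreal_leI)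
 show "norm (LI x. cr (f x) * h x) \<le> L2_norm f * c" by (rule order_trans[OF integral_norm_bound I])
qed

text \<open>The weak time derivative is stated through integrals in t for almost every x. Pairing
  with a fixed h in L^2 and exchanging the integrals reduces it to a scalar function of t.\<close>

lemma weak_pair:
 fixes h :: cfun
 assumes u: "u \<in> L1_L2 T" and \<psi>: "continuous_on UNIV \<psi>" and h[measurable]: "h \<in> bm" and c: "nsq h = ennreal (c\<^sup>2)" "0 \<le> c"
 shows "(LINT t:{0<..<T}|lborel. \<psi> t *\<^sub>R (LI x. cr (u t x) * h x))
  = (LI x. cr (LINT t:{0<..<T}|lborel. \<psi> t * u t x) * h x)"
proof -
 define w where "w t x = (if t \<in> {0..T} then u t x else 0)" for t x
 have "jm w" unfolding w_def by (rule jointly_measurable_extend) (use u in \<open>simp add: L1_L2_def\<close>)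
 note [measurable (raw)] = measurable_section2[OF this]
 have [measurable]: "\<psi> \<in> bm" using \<psi> by (rule borel_measurable_continuous_onI)
 have wu: "w t = u t" if "t \<in> {0<..<T}" for t using that by (auto simp: w_def)
 obtain B where B: "!!t. t \<in> {0<..<T} ==> \<bar>\<psi> t\<bar> \<le> B" "0 \<le> B"
 proof -
  have "bounded (\<psi> ` {0..T})" by (intro compact_imp_bounded compact_continuous_image continuous_on_subset[OF \<psi>]) auto
  then obtain B where "\<forall>x\<in>\<psi> ` {0..T}. norm x \<le> B" unfolding bounded_iff ..
  then have "\<bar>\<psi> t\<bar> \<le> max B 0" if "t \<in> {0<..<T}" for t
   using that by (intro max.coboundedI1) simp
  then show ?thesis by (intro that[of "max B 0"]) auto
 qed
 define H where "H t x = indicator {0<..<T} t *\<^sub>R (\<psi> t *\<^sub>R (cr (w t x) * h x))" for t x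
 have mH: "case_prod H \<in> bm2" unfolding H_def split_beta' by measurable
 have bH: "(NN t x. ennreal (norm (H t x))) < \<infinity>"
 proof -
  have sq: "AEL t. t \<in> {0<..<T} \<longrightarrow> square_integrable (u t)" using u by (simp add: L1_L2_def)
  have "(NN t x. ennreal (norm (H t x))) \<le> (NN t. ennreal (B * c) * (ennreal (L2_norm (w t)) * indicator {0<..<T} t))"
  proof (rule nn_integral_mono_AE)
   show "AEL t. (NN x. ennreal (norm (H t x))) \<le> ennreal (B * c) * (ennreal (L2_norm (w t)) * indicator {0<..<T} t)"
    using sq
   proof eventually_elim
    case (elim t)
    show ?case
    proof (cases "t \<in> {0<..<T}")
     case True
     have "(NN x. ennreal (norm (H t x))) \<le> (NN x. ennreal B * ennreal (norm (cr (w t x) * h x)))"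
      using B(1)[OF True] B(2) True by (intro nn_integral_mono) (auto simp: H_def ennreal_mult[symmetric] norm_mult intro!: ennreal_leI mult_right_mono)
     also have "\<dots> = ennreal B * (NN x. ennreal (norm (cr (w t x) * h x)))" by (rule nn_integral_cmult) measurable
     also have "\<dots> \<le> ennreal B * ennreal (L2_norm (w t) * c)" using L2_pair(2)[OF _ h c, of "u t"] elim True by (intro mult_left_mono) (auto simp: wu)
     also have "\<dots> = ennreal (B * c) * (ennreal (L2_norm (w t)) * indicator {0<..<T} t)"
      using True B(2) c(2) L2_norm_nsq(2)[of "w t"] by (simp add: ennreal_mult[symmetric] mult_ac)
     finally show ?thesis .
    qed (simp add: H_def)
   qed
  qed
  also have "\<dots> = ennreal (B * c) * (\<integral>\<^sup>+t\<in>{0<..<T}. ennreal (L2_norm (w t)) \<partial>lborel)"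
   unfolding L2_norm_def by (rule nn_integral_cmult) measurable
  also have "(\<integral>\<^sup>+t\<in>{0<..<T}. ennreal (L2_norm (w t)) \<partial>lborel) = (\<integral>\<^sup>+t\<in>{0<..<T}. ennreal (L2_norm (u t)) \<partial>lborel)"
   by (intro nn_integral_cong) (auto simp: wu split: split_indicator)
  also have "ennreal (B * c) * \<dots> < \<infinity>" using u by (simp add: L1_L2_def ennreal_mult_less_top)
  finally show ?thesis .
 qed
 have "(LINT t:{0<..<T}|lborel. \<psi> t *\<^sub>R (LI x. cr (u t x) * h x)) = (LI t x. H t x)"
  unfolding set_lebesgue_integral_def H_def by (intro LI_cong) (auto simp: wu split: split_indicator)
 also have "\<dots> = (LI x t. H t x)" by (rule Fubini_bochner[OF mH bH])
 also have "\<dots> = (LI x. cr (LINT t:{0<..<T}|lborel. \<psi> t * u t x) * h x)"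
 proof (rule LI_cong[OF refl])
  fix x
  have "(LI t. H t x) = (LI t. cr (indicator {0<..<T} t *\<^sub>R (\<psi> t * u t x)) * h x)"
   by (intro LI_cong) (auto simp: H_def wu scaleR_conv_of_real split: split_indicator)
  also have "\<dots> = cr (LINT t:{0<..<T}|lborel. \<psi> t * u t x) * h x"
   unfolding set_lebesgue_integral_def integral_mult_left_zero integral_complex_of_real ..
  finally show "(LI t. H t x) = cr (LINT t:{0<..<T}|lborel. \<psi> t * u t x) * h x" .
 qed
 finally show ?thesis .
qed

lemma AE_closed_interval:
 fixes T :: real
 assumes "AEL s. s \<in> {0<..<T} \<longrightarrow> Q s"
 shows "AEL s. s \<in> {0..T} \<longrightarrow> Q s"
 using assms AE_lborel_singleton[of "0::real"] AE_lborel_singleton[of T] by eventually_elim auto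

text \<open>Pairing u with the transform of an interval indicator gives the integral of its
  transform over that interval. These scalar functions satisfy the hypotheses of
  \<open>du_bois_reymond\<close>, and the intervals determine the transform.\<close>

lemma time_deriv_fourier:
 assumes u: "u \<in> C_L2 T" and w: "has_weak_time_deriv T u v" and T: "0 < T"
  and G: "jm G" "!!t. t \<in> {0..T} ==> nsq (G t) \<le> ennreal C" and C: "0 \<le> C"
  and ae: "AEL t. t \<in> {0<..<T} \<longrightarrow> (AEL k. fourier (v t) k = G t k)"
  and t: "t \<in> {0..T}"
 shows "AEL k. fourier (u t) k = fourier (u 0) k + tint t (%s. G s k)"
proof (rule AE_eq_of_interval_integrals)
 note [measurable (raw)] = measurable_section2[OF G(1)]
 have t0: "0 \<in> {0..T}" using T by simp
 have sq: "square_integrable (u t)" if "t \<in> {0..T}" for t using u that by (simp add: C_L2_def)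
 have f: "fourier (u s) \<in> bm" "nsq (fourier (u s)) < \<infinity>" if "s \<in> {0..T}" for s
  using has_fourier_L2[OF has_fourier_fourier[OF sq[OF that]]] by auto
 note [measurable] = f(1)[OF t] f(1)[OF t0]
 show "fourier (u t) \<in> bm" "nsq (fourier (u t)) < \<infinity>" by (rule f[OF t])+
 have nt: "nsq (%k. tint t (%s. G s k)) < \<infinity>" using nsq_tint_le[OF G(1) t G(2) C] by (auto intro: le_less_trans)
 have mt[measurable]: "(%k. tint t (%s. G s k)) \<in> bm" by (rule jm_section[OF jm_tint[OF G(1)]])
 show "(%k. fourier (u 0) k + tint t (%s. G s k)) \<in> bm" by measurable
 show "nsq (%k. fourier (u 0) k + tint t (%s. G s k)) < \<infinity>"
  by (rule le_less_trans[OF nsq_add_le]) (use f(2)[OF t0] nt in \<open>auto simp: ennreal_mult_less_top\<close>)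
 fix a b
 let ?I = "interval_fun a b"
 define h where "h = ft ?I"
 have [measurable]: "h \<in> bm" unfolding h_def by measurable
 obtain c where c: "nsq h = ennreal (c\<^sup>2)" "0 \<le> c"
 proof -
  have "nsq h = ennreal ((sqrt (enn2real (nsq h)))\<^sup>2)" using nsq_ft_interval_fun[of a b] by (simp add: h_def less_top)
  then show ?thesis by (rule that) simp
 qed
 \<comment> \<open>p is continuous because u is continuous into L^2; its weak derivative will be q,
   which is bounded on [0, T].\<close>
 define p where "p s = (LI x. cr (u s x) * h x)" for s
 define q where "q s = (LI k. G s k * ?I k)" for s
 have dual: "(LI k. fourier (y s) k * ?I k) = (LI x. cr (y s x) * h x)" if "square_integrable (y s)" for y :: "real \<Rightarrow> real \<Rightarrow> real" and s
  unfolding h_def by (rule has_fourier_dual_pair[OF that has_fourier_fourier[OF that]])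
 have iI: "intL (%k. X k * ?I k)" if "X \<in> bm" "nsq X < \<infinity>" for X
  by (rule integrable_L2_mult) (use that nsq_interval_fun in auto)
 have cp: "continuous_on {0..T} p"
  unfolding continuous_on_def
 proof
  fix s assume s: "s \<in> {0..T}"
  have "((%r. L2_norm (%x. u r x - u s x) * c) \<longlongrightarrow> 0 * c) (at s within {0..T})"
   using u s by (intro tendsto_intros) (simp add: C_L2_def)
  then have l: "((%r. L2_norm (%x. u r x - u s x) * c) \<longlongrightarrow> 0) (at s within {0..T})" by simp
  have "eventually (%r. norm (p r - p s) \<le> L2_norm (%x. u r x - u s x) * c) (at s within {0..T})"
   unfolding eventually_at_filter
  proof (intro always_eventually allI impI)
   fix r assume r: "r \<in> {0..T}"
   have m: "u r \<in> bm" "u s \<in> bm" using sq r s by (auto simp: square_integrable_def)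
   have "square_integrable (%x. u r x - u s x)"
    unfolding square_integrable_iff_nsq
    using nsq_diff_le[OF m] sq[OF r] sq[OF s] m by (auto simp: square_integrable_iff_nsq ennreal_mult_less_top intro: le_less_trans)
   note L = L2_pair(3)[OF this _ c]
   have "p r - p s = (LI x. cr (u r x - u s x) * h x)"
    unfolding p_def by (subst LI_diff[symmetric]) (auto intro!: L2_pair(1)[OF _ _ c] sq r s simp: left_diff_distrib)
   then show "norm (p r - p s) \<le> L2_norm (%x. u r x - u s x) * c" using L by simp
  qed
  then have "((%r. p r - p s) \<longlongrightarrow> 0) (at s within {0..T})" by (rule Lim_null_comparison[OF _ l])
  then show "(p \<longlongrightarrow> p s) (at s within {0..T})" by (rule LIM_zero_cancel)
 qed
 define H where "H s k = indicator {0..t} s *\<^sub>R (G s k * ?I k)" for s k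
 have mH: "case_prod H \<in> bm2" unfolding H_def split_beta' by measurable
 have bG: "(NN k. ennreal (norm (G s k * ?I k))) \<le> ennreal (C + \<bar>b - a\<bar>)" if s: "s \<in> {0..T}" for s
 proof -
  have "(NN k. ennreal (norm (G s k * ?I k))) \<le> (NN k. ennreal ((norm (G s k))\<^sup>2) + indicator {a..b} k)"
  proof (rule nn_integral_mono)
   fix k
   have "norm (G s k) \<le> 1 + (norm (G s k))\<^sup>2" using abs_pow_le[of 1 2 "norm (G s k)"] by simp
   then have "ennreal (norm (G s k)) \<le> 1 + ennreal ((norm (G s k))\<^sup>2)" by (simp flip: ennreal_plus ennreal_1)
   then show "ennreal (norm (G s k * ?I k)) \<le> ennreal ((norm (G s k))\<^sup>2) + indicator {a..b} k" by (auto simp: add.commute split: split_indicator)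
  qed
  also have "\<dots> = nsq (G s) + emeasure lborel {a..b}" by (simp add: nn_integral_add nsq_def)
  also have "\<dots> \<le> ennreal C + ennreal \<bar>b - a\<bar>" by (intro add_mono G(2) s) (auto simp: emeasure_lborel_Icc_eq)
  finally show ?thesis using C by simp
 qed
 have bH: "(NN s k. ennreal (norm (H s k))) < \<infinity>"
 proof -
  have "(NN s k. ennreal (norm (H s k))) \<le> (NN s. ennreal (C + \<bar>b - a\<bar>) * indicator {0..t} s)"
   using bG t by (intro nn_integral_mono) (auto simp: H_def split: split_indicator)
  also have "\<dots> < \<infinity>" using t by (simp add: nn_integral_cmult ennreal_mult_less_top)
  finally show ?thesis .
 qed
 have qi: "set_integrable lborel {0..T} q"
  unfolding set_integrable_def
 proof (rule LI_int_bound[of lborel "%s. indicator {0..T} s * (C + \<bar>b - a\<bar>)"])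
  show "intL (%s. indicator {0..T} s * (C + \<bar>b - a\<bar>))" using T by (intro integrable_mult_left integrable_real_indicator) auto
  show "(%s. indicator {0..T} s *\<^sub>R q s) \<in> borel_measurable lborel" unfolding q_def by measurable
  show "AEL s. norm (indicator {0..T} s *\<^sub>R q s) \<le> norm (indicator {0..T} s * (C + \<bar>b - a\<bar>))"
  proof (intro AE_I2)
   fix s
   have "norm (q s) \<le> C + \<bar>b - a\<bar>" if "s \<in> {0..T}"
    using order_trans[OF norm_integral_le_nn bG[OF that]] C unfolding q_def by (subst (asm) ennreal_le_iff) auto
   then show "norm (indicator {0..T} s *\<^sub>R q s) \<le> norm (indicator {0..T} s * (C + \<bar>b - a\<bar>))" using C by (auto split: split_indicator)
  qed
 qed
 have weak: "(LINT t:{0<..<T}|lborel. deriv \<phi> t *\<^sub>R p t) = - (LINT t:{0<..<T}|lborel. \<phi> t *\<^sub>R q t)" if \<phi>: "test_function_on {0<..<T} \<phi>" for \<phi>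
 proof -
  note fc = test_function_facts(2,3)[OF \<phi>]
  have L: "u \<in> L1_L2 T" "v \<in> L1_L2 T" and wk: "AEL x. (LINT t:{0<..<T}|lborel. deriv \<phi> t * u t x) = - (LINT t:{0<..<T}|lborel. \<phi> t * v t x)"
   using w \<phi> by (auto simp: has_weak_time_deriv_def)
  have "(LINT t:{0<..<T}|lborel. deriv \<phi> t *\<^sub>R p t) = (LI x. cr (LINT t:{0<..<T}|lborel. deriv \<phi> t * u t x) * h x)"
   unfolding p_def by (rule weak_pair[OF L(1) fc(2) _ c]) simp
  also have "\<dots> = (LI x. - (cr (LINT t:{0<..<T}|lborel. \<phi> t * v t x) * h x))"
  proof (rule integral_cong_AE)
   have m: "(%x. LINT t:{0<..<T}|lborel. \<psi> t * y t x) \<in> bm" if y: "y \<in> L1_L2 T" and "continuous_on UNIV \<psi>" for y :: "real \<Rightarrow> real \<Rightarrow> real" and \<psi> :: "real \<Rightarrow> real"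
   proof -
    have [measurable]: "\<psi> \<in> bm" using that(2) by (rule borel_measurable_continuous_onI)
    note [measurable (raw)] = measurable_section2[OF jointly_measurable_extend[of T y]]
    have "(LINT t:{0<..<T}|lborel. \<psi> t * y t x) = (LI t. indicator {0<..<T} t *\<^sub>R (\<psi> t * (if t \<in> {0..T} then y t x else 0)))" for x
     unfolding set_lebesgue_integral_def by (intro LI_cong) (auto split: split_indicator)
    moreover have "jointly_measurable T y" using y by (simp add: L1_L2_def)
    then have "(%x. LI t. indicator {0<..<T} t *\<^sub>R (\<psi> t * (if t \<in> {0..T} then y t x else 0))) \<in> bm" by measurable
    ultimately show ?thesis by simp
   qed
   note [measurable] = m[OF L(1) fc(2)] m[OF L(2) fc(1)]
   show "(%x. cr (LINT t:{0<..<T}|lborel. deriv \<phi> t * u t x) * h x) \<in> borel_measurable lborel"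
    "(%x. - (cr (LINT t:{0<..<T}|lborel. \<phi> t * v t x) * h x)) \<in> borel_measurable lborel" by measurable
  qed (use wk in \<open>auto elim: eventually_mono\<close>)
  also have "\<dots> = - (LINT t:{0<..<T}|lborel. \<phi> t *\<^sub>R (LI x. cr (v t x) * h x))"
   by (subst weak_pair[OF L(2) fc(1) _ c]) simp_all
  also have "(LINT t:{0<..<T}|lborel. \<phi> t *\<^sub>R (LI x. cr (v t x) * h x)) = (LINT t:{0<..<T}|lborel. \<phi> t *\<^sub>R q t)"
  proof -
   define y where "y t x = (if t \<in> {0..T} then v t x else 0)" for t x
   have "jm y" unfolding y_def by (rule jointly_measurable_extend) (use L in \<open>simp add: L1_L2_def\<close>)
   note [measurable (raw)] = measurable_section2[OF this]
   have [measurable]: "\<phi> \<in> bm" using fc(1) by (rule borel_measurable_continuous_onI)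
   have e: "indicator {0<..<T} t *\<^sub>R (\<phi> t *\<^sub>R (LI x. cr (v t x) * h x)) = indicator {0<..<T} t *\<^sub>R (\<phi> t *\<^sub>R (LI x. cr (y t x) * h x))" for t
    by (auto simp: y_def split: split_indicator)
   have sv: "AEL t. t \<in> {0<..<T} \<longrightarrow> square_integrable (v t)" using L by (simp add: L1_L2_def)
   show ?thesis unfolding set_lebesgue_integral_def e
   proof (rule integral_cong_AE)
    show "AEL t. indicator {0<..<T} t *\<^sub>R (\<phi> t *\<^sub>R (LI x. cr (y t x) * h x)) = indicator {0<..<T} t *\<^sub>R (\<phi> t *\<^sub>R q t)"
     using sv ae
    proof eventually_elim
     case (elim s)
     show ?case
     proof (cases "s \<in> {0<..<T}")
      case True
      then have sq': "square_integrable (v s)" and fe: "AEL k. fourier (v s) k = G s k" using elim by auto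
      have [measurable]: "fourier (v s) \<in> bm" using has_fourier_L2[OF has_fourier_fourier[OF sq']] by simp
      have "(LI x. cr (y s x) * h x) = (LI k. fourier (v s) k * ?I k)" using True dual[of v s, OF sq'] by (simp add: y_def)
      also have "\<dots> = q s" unfolding q_def by (rule integral_cong_AE) (use fe in \<open>auto elim: eventually_mono\<close>)
      finally show ?thesis by simp
     qed simp
    qed
    show "(%t. indicator {0<..<T} t *\<^sub>R (\<phi> t *\<^sub>R (LI x. cr (y t x) * h x))) \<in> borel_measurable lborel"
     "(%t. indicator {0<..<T} t *\<^sub>R (\<phi> t *\<^sub>R q t)) \<in> borel_measurable lborel" unfolding q_def by measurable
   qed
  qed
  finally show ?thesis .
 qed
 have "(LI k. fourier (u t) k * ?I k) = p 0 + tint t q"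
  using du_bois_reymond[OF cp qi T weak t] dual[of u t, OF sq[OF t]] by (simp add: p_def)
 also have "p 0 = (LI k. fourier (u 0) k * ?I k)" using dual[of u 0, OF sq[OF t0]] by (simp add: p_def)
 also have "tint t q = (LI s k. H s k)"
  unfolding set_lebesgue_integral_def q_def H_def by simp
 also have "\<dots> = (LI k s. H s k)" by (rule Fubini_bochner[OF mH bH])
 also have "\<dots> = (LI k. tint t (%s. G s k) * ?I k)"
  unfolding set_lebesgue_integral_def H_def integral_mult_left_zero[symmetric] by simp
 also have "(LI k. fourier (u 0) k * ?I k) + \<dots> = (LI k. (fourier (u 0) k + tint t (%s. G s k)) * ?I k)"
  unfolding distrib_right by (rule LI_add[symmetric]) (rule iI f[OF t0] mt nt)+
 finally show "(LI k. fourier (u t) k * ?I k) = (LI k. (fourier (u 0) k + tint t (%s. G s k)) * ?I k)" .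
qed

context wave_params
begin

text \<open>The hypotheses bound a solution at almost every time, whereas \<open>apsol\<close> wants
  bounds at every time and functions measurable in (t, k). Jointly measurable transforms are set to
  zero at bad times, and F and V are then defined as the integrals of the right-hand sides.\<close>

lemma solution_apsol:
 assumes sol: "ivp_solution \<epsilon> \<alpha> \<beta> f0 f1 T f fd" and Lf: "f \<in> Linf_Hs T (9/2)" and Lv: "fd \<in> Linf_Hs T 3" and T: "0 < T"
  and r0: "rep f0 F0" "rep f1 V0"
 obtains M F V where "0 \<le> M" "!!M'. M \<le> M' ==> apsol T M' 0 F V (%_ _. 0) (%_ _. 0)" "F 0 = F0" "V 0 = V0"
  "!!t. t \<in> {0..T} ==> AEL k. fourier (f t) k = F t k"
proof -
 obtain fdd where C2: "f \<in> C_L2 T" "fd \<in> C_L2 T" and wd: "has_weak_time_deriv T f fd" "has_weak_time_deriv T fd fdd"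
  and wave: "AEL t. t \<in> {0<..<T} \<longrightarrow> (AEL x. fdd t x = wave_rhs \<epsilon> \<alpha> \<beta> (f t) (fd t) x)"
  and ini: "AEL x. f 0 x = f0 x" "AEL x. fd 0 x = f1 x"
  using sol unfolding ivp_solution_def by blast
 have sq: "square_integrable (f t)" "square_integrable (fd t)" if "t \<in> {0..T}" for t using C2 that by (auto simp: C_L2_def)
 have sqtt: "AEL t. t \<in> {0<..<T} \<longrightarrow> square_integrable (fdd t)" using wd(2) by (simp add: has_weak_time_deriv_def L1_L2_def)
 have Tin: "t \<in> {0..T}" if "t \<in> {0<..<T}" for t using that by auto
 have t0: "0 \<in> {0..T}" using T by simp
 obtain A where A: "jm A" "!!t k. A t (- k) = cnj (A t k)" "!!t. t \<in> {0..T} ==> square_integrable (f t) ==> AEL k. fourier (f t) k = A t k"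
  by (rule joint_fourier[of T f]) (use Lf in \<open>auto simp: Linf_Hs_def\<close>)
 obtain B where B: "jm B" "!!t k. B t (- k) = cnj (B t k)" "!!t. t \<in> {0..T} ==> square_integrable (fd t) ==> AEL k. fourier (fd t) k = B t k"
  by (rule joint_fourier[of T fd]) (use Lv in \<open>auto simp: Linf_Hs_def\<close>)
 note fA = A(3)[OF _ sq(1)] and fB = B(3)[OF _ sq(2)]
 obtain c1 c2 where b: "AEL t. t \<in> {0<..<T} \<longrightarrow> f t \<in> Hs (9/2) \<and> Hs_norm (9/2) (f t) \<le> c1"
  "AEL t. t \<in> {0<..<T} \<longrightarrow> fd t \<in> Hs 3 \<and> Hs_norm 3 (fd t) \<le> c2"
  using Lf Lv unfolding Linf_Hs_def by blast
 define M where "M = CH (max c1 c2)"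
 have M: "0 \<le> M" using \<beta> by (simp add: M_def CH_def)
 \<comment> \<open>The good times. Unlike the Sobolev bounds on f and fd themselves, this condition
   on the joint transforms is measurable in t.\<close>
 define P where "P t \<longleftrightarrow> (NN k. ennreal (edens \<beta> (A t) (B t) k)) \<le> ennreal M" for t
 have hiAB: "hi \<beta> M (A t) (B t)" if "P t" for t using that A B unfolding hi_def P_def by (auto intro: jm_section)
 have good: "AEL t. t \<in> {0<..<T} \<longrightarrow> P t" using b
 proof eventually_elim
  case (elim t)
  show ?case
  proof
   assume t: "t \<in> {0<..<T}"
   have "hi \<beta> M (A t) (B t)" unfolding M_def
    by (rule Hs_hi[of "f t" _ "fd t"]) (use elim t in \<open>auto intro!: fA fB A(2) B(2) jm_section A(1) B(1)\<close>)
   then show "P t" by (simp add: hi_def P_def)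
  qed
 qed
 \<comment> \<open>Zero satisfies every bound, so after this change the energy bound holds at all
   times while almost no time is affected.\<close>
 define A' B' where "A' t k = (if P t then A t k else 0)" and "B' t k = (if P t then B t k else 0)" for t k
 have jAB: "jm A'" "jm B'"
 proof -
  note [measurable (raw)] = measurable_section2[OF A(1)] measurable_section2[OF B(1)]
  have [measurable]: "Measurable.pred borel P" unfolding P_def[abs_def] edens_def by measurable
  show "jm A'" "jm B'" unfolding A'_def B'_def split_beta' by measurable
 qed
 have hi': "hi \<beta> M (A' t) (B' t)" for t
 proof (cases "P t")
  case True
  then have "A' t = A t" "B' t = B t" by (auto simp: A'_def B'_def)
  then show ?thesis using hiAB[OF True] by simp
 next
  case False
  then have "A' t = (%_. 0)" "B' t = (%_. 0)" by (auto simp: A'_def B'_def)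
  then show ?thesis by (simp add: hi_def edens_def)
 qed
 have eqP: "A' t = A t" "B' t = B t" if "P t" for t using that by (auto simp: A'_def B'_def)
 note hf = hi_facts[OF hi' \<beta> M]
 have repAB: "rep (f t) (A t)" "rep (fd t) (B t)" if "P t" "t \<in> {0..T}" for t
  using hi_nice[OF hiAB[OF that(1)] M] that by (auto intro!: repI sq fA fB)
 define F V where "F t k = F0 k + tint t (%s. B' s k)" and "V t k = V0 k + tint t (%s. R (A' s) (B' s) k)" for t k
 note jR = R_jm[OF jAB]
 have m0: "F0 \<in> bm" "V0 \<in> bm" and h0: "F0 (- k) = cnj (F0 k)" "V0 (- k) = cnj (V0 k)" for k
  using rep_nice[OF r0(1)] rep_nice[OF r0(2)] by (auto simp: nice_def)
 have jFV: "jm F" "jm V"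
 proof -
  note [measurable (raw)] = measurable_section2[OF jm_tint[OF jAB(2)]] measurable_section2[OF jm_tint[OF jR]] and [measurable] = m0
  show "jm F" "jm V" unfolding F_def V_def split_beta' by measurable
 qed
 have fi: "AEL k. fourier (f 0) k = F0 k" "AEL k. fourier (fd 0) k = V0 k"
  using rep_fourier[OF r0(1)] rep_fourier[OF r0(2)] fourier_cong_AE[OF _ _ ini(1)] fourier_cong_AE[OF _ _ ini(2)] sq[OF t0] r0
  by (auto simp: square_integrable_def rep_def)
 have fF: "AEL k. fourier (f t) k = F t k" if t: "t \<in> {0..T}" for t
 proof -
  have "AEL t. t \<in> {0<..<T} \<longrightarrow> (AEL k. fourier (fd t) k = B' t k)"
   using good by eventually_elim (use fB eqP(2) in auto)
  from time_deriv_fourier[OF C2(1) wd(1) T jAB(2) hf(8) _ this t] M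
  have "AEL k. fourier (f t) k = fourier (f 0) k + tint t (%s. B' s k)" by simp
  with fi(1) show ?thesis by eventually_elim (simp add: F_def)
 qed
 have fV: "AEL k. fourier (fd t) k = V t k" if t: "t \<in> {0..T}" for t
 proof -
  have "AEL t. t \<in> {0<..<T} \<longrightarrow> (AEL k. fourier (fdd t) k = R (A' t) (B' t) k)"
   using good wave sqtt
  proof eventually_elim
   case (elim s)
   show ?case
   proof
    assume s: "s \<in> {0<..<T}"
    then have P: "P s" and sT: "s \<in> {0..T}" and m: "fdd s \<in> bm" and w: "AEL x. fdd s x = wave_rhs \<epsilon> \<alpha> \<beta> (f s) (fd s) x"
     using elim by (auto simp: square_integrable_def)
    show "AEL k. fourier (fdd s) k = R (A' s) (B' s) k" unfolding eqP[OF P]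
     by (rule rep_fourier[OF rep_cong_fun[OF rep_wave_hi[OF hiAB[OF P] M repAB[OF P sT]] w m]])
   qed
  qed
  from time_deriv_fourier[OF C2(2) wd(2) T jR R_nsq[OF hi' M] CR_nonneg[OF M] this t]
  have "AEL k. fourier (fd t) k = fourier (fd 0) k + tint t (%s. R (A' s) (B' s) k)" .
  with fi(2) show ?thesis by eventually_elim (simp add: V_def)
 qed
 have herm: "F t (- k) = cnj (F t k)" "V t (- k) = cnj (V t k)" for t k
 proof -
  have c: "tint t (%s. cnj (g s)) = cnj (tint t g)" for g :: cfun
   unfolding set_lebesgue_integral_def by (subst LI_cnj[symmetric]) simp
  have "R (A' s) (B' s) (- k) = cnj (R (A' s) (B' s) k)" for s by (rule R_cong_hermitian) (rule hf)+
  then show "F t (- k) = cnj (F t k)" "V t (- k) = cnj (V t k)" by (simp_all add: F_def V_def c hf(4) h0)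
 qed
 have AE_FV: "AEL k. A t k = F t k" "AEL k. B t k = V t k" if t: "t \<in> {0..T}" for t
 proof -
  show "AEL k. A t k = F t k" using fA[OF t t] fF[OF t] by eventually_elim simp
  show "AEL k. B t k = V t k" using fB[OF t t] fV[OF t] by eventually_elim simp
 qed
 have hiFV0: "hi \<beta> M (F t) (V t)" if P: "P t" and t: "t \<in> {0..T}" for t
 proof -
  have "(NN k. ennreal (edens \<beta> (F t) (V t) k)) = (NN k. ennreal (edens \<beta> (A t) (B t) k))"
  proof (rule nn_integral_cong_AE)
   show "AEL k. ennreal (edens \<beta> (F t) (V t) k) = ennreal (edens \<beta> (A t) (B t) k)"
    using AE_FV[OF t] by eventually_elim (simp add: edens_def)
  qed
  then show ?thesis using P herm jm_section[OF jFV(1)] jm_section[OF jFV(2)] by (simp add: hi_def P_def)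
 qed
 \<comment> \<open>Good times are dense, being of full measure. F and V are continuous in time for
   almost every frequency, so the bound at good times tending to t passes to t by
   \<open>hi_limit\<close>.\<close>
 have hiFV: "hi \<beta> M (F t) (V t)" if t: "t \<in> {0..T}" for t
 proof -
  have "\<exists>s. s \<in> {0<..<T} \<and> P s \<and> \<bar>s - t\<bar> < e" if e: "0 < e" for e
  proof (rule ccontr)
   assume no: "\<nexists>s. s \<in> {0<..<T} \<and> P s \<and> \<bar>s - t\<bar> < e"
   let ?J = "{max 0 (t - e)<..<min T (t + e)}"
   have "AEL s. s \<notin> ?J" using good
   proof eventually_elim
    case (elim s)
    show ?case
    proof
     assume "s \<in> ?J"
     then have "s \<in> {0<..<T}" "\<bar>s - t\<bar> < e" by (auto simp: abs_less_iff)
     then show False using no elim by blast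
    qed
   qed
   then have z: "emeasure lborel ?J = 0" using AE_iff_measurable[of ?J lborel "%s. s \<notin> ?J"] by (auto simp: set_eq_iff)
   have lt: "max 0 (t - e) < min T (t + e)" using t T e by (auto simp: max_def min_def)
   have "ennreal (min T (t + e) - max 0 (t - e)) = 0" using z unfolding emeasure_lborel_Ioo[OF less_imp_le[OF lt]] .
   then have "min T (t + e) - max 0 (t - e) \<le> 0" unfolding ennreal_eq_0_iff .
   with lt show False by linarith
  qed
  then have "\<exists>s. s \<in> {0<..<T} \<and> P s \<and> \<bar>s - t\<bar> < 1 / real (Suc n)" for n by (simp del: of_nat_Suc)
  then obtain s where s: "!!n. s n \<in> {0<..<T}" "!!n. P (s n)" "!!n. \<bar>s n - t\<bar> < 1 / real (Suc n)" by metis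
  have "(%n. s n - t) \<longlonglongrightarrow> 0"
   by (rule Lim_null_comparison[OF _ LIMSEQ_inverse_real_of_nat]) (use s(3) in \<open>auto simp: inverse_eq_divide less_imp_le simp del: of_nat_Suc\<close>)
  then have l: "s \<longlonglongrightarrow> t" by (rule LIM_zero_cancel)
  have lim: "AEL k. (%n. x k + tint (s n) (%r. G r k)) \<longlonglongrightarrow> x k + tint t (%r. G r k)"
   if "jm G" "!!r. r \<in> {0..T} ==> nsq (G r) \<le> ennreal c" for G c and x :: cfun
  proof -
   have "AEL k. set_integrable lborel {0..T} (%r. G r k)" by (rule AE_time_integrable[OF that(1) _ that(2)]) (use T in auto)
   then show ?thesis
   proof eventually_elim
    case (elim k)
    have "(%n. tint (s n) (%r. G r k)) \<longlonglongrightarrow> tint t (%r. G r k)"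
     by (rule continuous_on_tendsto_compose[OF continuous_on_tint[OF elim] l t]) (use s(1) in \<open>auto intro!: always_eventually less_imp_le\<close>)
    then show ?case by (intro tendsto_intros)
   qed
  qed
  show ?thesis
  proof (rule hi_limit[of _ _ "%n. F (s n)" "%n. V (s n)"])
   show "AEL k. (%n. F (s n) k) \<longlonglongrightarrow> F t k" unfolding F_def by (rule lim[OF jAB(2) hf(8)])
   show "AEL k. (%n. V (s n) k) \<longlonglongrightarrow> V t k" unfolding V_def by (rule lim[OF jR R_nsq[OF hi' M]])
   show "hi \<beta> M (F (s n)) (V (s n))" for n by (rule hiFV0[OF s(2) Tin[OF s(1)]])
  qed (rule \<beta> herm jm_section[OF jFV(1)] jm_section[OF jFV(2)])+
 qed
 \<comment> \<open>Turns equality for almost every k at almost every time into equality for almost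
   every time at almost every k; the null set of frequencies then serves all t at once.\<close>
 have swap: "AEL k. \<forall>t\<in>{0..T}. tint t (%s. X s k) = tint t (%s. Y s k)"
  if j: "jm X" "jm Y" and e: "AEL s. s \<in> {0<..<T} \<longrightarrow> (AEL k. X s k = Y s k)" for X Y :: "real \<Rightarrow> real \<Rightarrow> complex"
 proof -
  note [measurable (raw)] = measurable_section2[OF j(1)] measurable_section2[OF j(2)]
  have "AEL s. AEL k. s \<in> {0..T} \<longrightarrow> X s k = Y s k"
   using AE_closed_interval[OF e] by eventually_elim auto
  moreover have "{p \<in> space (lborel \<Otimes>\<^sub>M lborel). fst p \<in> {0..T} \<longrightarrow> X (fst p) (snd p) = Y (fst p) (snd p)} \<in> sets (lborel \<Otimes>\<^sub>M lborel)" by measurable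
  ultimately have "AEL k. AEL s. s \<in> {0..T} \<longrightarrow> X s k = Y s k" by (subst (asm) lborel_pair.AE_commute) auto
  then show ?thesis
  proof eventually_elim
   case (elim k)
   show ?case
   proof
    fix t assume t: "t \<in> {0..T}"
    show "tint t (%s. X s k) = tint t (%s. Y s k)"
     by (rule set_lebesgue_integral_cong_AE) (use elim t in \<open>auto elim!: eventually_mono\<close>)
   qed
  qed
 qed
 have good_s: "AEL s. s \<in> {0<..<T} \<longrightarrow> (AEL k. B' s k = V s k)"
  using good by eventually_elim (use AE_FV(2) eqP(2) in auto)
 \<comment> \<open>Instead of following the change on a null set through the convolutions, both
   sides are recognised as transforms of the same function \<open>wave_rhs\<close> of f and fd at
   time s.\<close>
 have good_R: "AEL s. s \<in> {0<..<T} \<longrightarrow> (AEL k. R (A' s) (B' s) k = R (F s) (V s) k)"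
  using good
 proof eventually_elim
  case (elim s)
  show ?case
  proof
   assume s: "s \<in> {0<..<T}"
   then have P: "P s" and sT: "s \<in> {0..T}" using elim by auto
   note n = hi_nice[OF hiFV[OF sT] M]
   have 1: "AEL k. fourier (wave_rhs \<epsilon> \<alpha> \<beta> (f s) (fd s)) k = R (A s) (B s) k"
    by (rule rep_fourier[OF rep_wave_hi[OF hiAB[OF P] M repAB[OF P sT]]])
   have 2: "AEL k. fourier (wave_rhs \<epsilon> \<alpha> \<beta> (f s) (fd s)) k = R (F s) (V s) k"
    by (rule rep_fourier[OF rep_wave_hi[OF hiFV[OF sT] M repI[OF sq(1)[OF sT] n(1) fF[OF sT]] repI[OF sq(2)[OF sT] n(2) fV[OF sT]]]])
   show "AEL k. R (A' s) (B' s) k = R (F s) (V s) k" unfolding eqP[OF P] using 1 2 by eventually_elim simp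
  qed
 qed
 have F00: "F 0 = F0" "V 0 = V0" unfolding F_def V_def by (simp_all only: tint_0 add_0_right)
 have "apsol T M' 0 F V (%_ _. 0) (%_ _. 0)" if "M \<le> M'" for M'
  unfolding apsol_def
 proof (intro conjI ballI)
  show "jm F" "jm V" by (rule jFV)+
  fix t assume t: "t \<in> {0..T}"
  show "hi \<beta> M' (F t) (V t)" by (rule hi_mono[OF hiFV[OF t] that])
  show "AEL k. F t k = F 0 k + tint t (%s. V s k + 0)" using swap[OF jAB(2) jFV(2) good_s]
   by eventually_elim (use t in \<open>simp only: F00, simp add: F_def\<close>)
  show "AEL k. V t k = V 0 k + tint t (%s. R (F s) (V s) k + 0)" using swap[OF jR R_jm[OF jFV] good_R]
   by eventually_elim (use t in \<open>simp only: F00, simp add: V_def\<close>)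
 qed (auto simp: nsq_def)
 from that[OF M this F00 fF] show ?thesis .
qed

text \<open>Both solutions become exact solutions of the integrated system with the same initial
  transforms and a common energy bound, so \<open>stability\<close> with \<eta> = 0 makes the
  difference vanish.\<close>

lemma uniqueness:
 assumes f: "ivp_solution \<epsilon> \<alpha> \<beta> f0 f1 T f fd" "f \<in> Linf_Hs T (9/2)" "fd \<in> Linf_Hs T 3"
  and g: "ivp_solution \<epsilon> \<alpha> \<beta> f0 f1 T g gt" "g \<in> Linf_Hs T (9/2)" "gt \<in> Linf_Hs T 3"
  and T: "0 < T" and r0: "rep f0 F0" "rep f1 V0" and t: "t \<in> {0..T}"
 shows "AEL x. f t x = g t x"
proof -
 obtain M F V where F: "0 \<le> M" "!!M'. M \<le> M' ==> apsol T M' 0 F V (%_ _. 0) (%_ _. 0)" "F 0 = F0" "V 0 = V0"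
  "!!t. t \<in> {0..T} ==> AEL k. fourier (f t) k = F t k"
  by (rule solution_apsol[OF f T r0]) blast
 obtain M' F' V' where G: "0 \<le> M'" "!!M. M' \<le> M ==> apsol T M 0 F' V' (%_ _. 0) (%_ _. 0)" "F' 0 = F0" "V' 0 = V0"
  "!!t. t \<in> {0..T} ==> AEL k. fourier (g t) k = F' t k"
  by (rule solution_apsol[OF g T r0]) blast
 note a = F(2)[OF max.cobounded1[of M M']] and a' = G(2)[OF max.cobounded2[of M' M]]
 have m: "F t \<in> bm" "F' t \<in> bm" using apsolD(1)[OF a] apsolD(1)[OF a'] by (auto intro: jm_section)
 have "wint lw (%k. F t k - F' t k) + nsq (%k. V t k - V' t k) \<le> ennreal (CS T (max M M')) * (wint lw (%k. F 0 k - F' 0 k) + nsq (%k. V 0 k - V' 0 k) + ennreal 0)"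
  by (rule stability[OF a a' _ _ t]) (use F(1) in auto)
 then have "wint lw (%k. F t k - F' t k) \<le> 0" by (simp add: F(3,4) G(3,4) nsq_def)
 then have "nsq (%k. F t k - F' t k) = 0" using nsq_le_wint[of lw "%k. F t k - F' t k"] lw_ge_1 by auto
 then have "AEL k. F t k - F' t k = 0" by (intro nsq_0_AE) (use m in auto)
 then have "AEL k. fourier (f t) k = fourier (g t) k" using F(5)[OF t] G(5)[OF t] by eventually_elim simp
 then show ?thesis using f(1) g(1) t by (intro AE_eq_of_fourier_eq) (auto simp: ivp_solution_def C_L2_def)
qed

end

theorem theorem2:
  fixes \<epsilon> \<alpha>\<^sub>o \<beta> :: real and f\<^sub>0 f\<^sub>1 :: "real \<Rightarrow> real"
  assumes "\<epsilon> > 0" and "\<alpha>\<^sub>o \<ge> 0" and "\<beta> > 0"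
    and "f\<^sub>0 \<in> Hs (9/2)" and "f\<^sub>1 \<in> Hs 3"
  shows "\<exists>T>0.
    (\<exists>f f\<^sub>t. ivp_solution \<epsilon> \<alpha>\<^sub>o \<beta> f\<^sub>0 f\<^sub>1 T f f\<^sub>t \<and> f \<in> Linf_Hs T (9/2) \<and> f\<^sub>t \<in> Linf_Hs T 3) \<and>
    (\<forall>f f\<^sub>t g g\<^sub>t.
      ivp_solution \<epsilon> \<alpha>\<^sub>o \<beta> f\<^sub>0 f\<^sub>1 T f f\<^sub>t \<and> f \<in> Linf_Hs T (9/2) \<and> f\<^sub>t \<in> Linf_Hs T 3 \<and>
      ivp_solution \<epsilon> \<alpha>\<^sub>o \<beta> f\<^sub>0 f\<^sub>1 T g g\<^sub>t \<and> g \<in> Linf_Hs T (9/2) \<and> g\<^sub>t \<in> Linf_Hs T 3 \<longrightarrow>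
      (\<forall>t\<in>{0..T}. AE x in lborel. f t x = g t x))"
proof -
  interpret wave_params \<epsilon> \<alpha>\<^sub>o \<beta> by standard (fact assms)+
  obtain F0 V0 M where h: "hi \<beta> M F0 V0" and M: "0 \<le> M" and r: "rep f\<^sub>0 F0" "rep f\<^sub>1 V0"
    by (rule initial_data[OF assms(4,5)])
  \<comment> \<open>The lifespan depends on the data only through their energy bound M and on the
    parameters; uniqueness is then applied on this same interval.\<close>
  define T where "T = 1 / K1 (M + 1)"
  have T: "0 < T" using K1_pos[of "M + 1"] M by (simp add: T_def)
  have "\<exists>f f\<^sub>t. ivp_solution \<epsilon> \<alpha>\<^sub>o \<beta> f\<^sub>0 f\<^sub>1 T f f\<^sub>t \<and> f \<in> Linf_Hs T (9/2) \<and> f\<^sub>t \<in> Linf_Hs T 3"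
    by (rule existence[OF h M r T_def])
  with T show ?thesis using uniqueness[OF _ _ _ _ _ _ T r] by blast
qed

end
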